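(* There are universal constants $C_0,C_1>0$ such that the following holds. Let $\mathbf A\in\mathbb{F}^{d^n\times d^n}$ be positive semidefinite (psd), fix a target rank $r\ge1$ and an oversampling parameter $\gamma>2$, and consider the rMPS Nyström++ estimator $\widehat{\operatorname{Tr}}_{\mathrm N++}$ with $k$ matrix–vector products for low-rank approximation and $\ell$ matrix–vector products for residual trace estimation, where $k,\ell\ge C_0r$. If the bond dimension is $\chi=\gamma n$, then with probability at least $0.98$, $$\left|\widehat{\operatorname{Tr}}_{\mathrm N++}-\operatorname{Tr}(\mathbf A)\right|^2\le C_1\left[\frac1r\|\mathbf A-[\![\mathbf A]\!]_r\|_{\rm F}^2+\left(\frac1{r^2}+\frac1{\gamma r}\right)\|\mathbf A-[\![\mathbf A]\!]_r\|_*^2\right].$$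
   Context: $\mathbb{F}\in\{\mathbb{R},\mathbb{C}\}$. $\|\cdot\|_{\rm F}$, $\|\cdot\|_*$: Frobenius and nuclear norms. $[\![\mathbf A]\!]_r$: a best rank-$r$ approximation of $\mathbf A$ (Eckart–Young–Mirsky). rMPS: Let $d,\chi\ge1$, $n\ge2$ be integers. An rMPS (random matrix product state) over $\mathbb{F}$ of order $n$, physical dimension $d$, bond dimension $\chi$ is the random vector in $\mathbb{F}^{d^n}$ with entries $\boldsymbol\omega(i_1,\dots,i_n)=\sum_{\alpha_1,\dots,\alpha_{n-1}=1}^{\chi}G_1(i_1,\alpha_1)G_2(\alpha_1,i_2,\alpha_2)\cdots G_{n-1}(\alpha_{n-2},i_{n-1},\alpha_{n-1})G_n(\alpha_{n-1},i_n)$, $(i_1,\dots,i_n)\in\{1,\dots,d\}^n$, where $G_1\in\mathbb{F}^{d\times\chi}$, $G_n\in\mathbb{F}^{\chi\times d}$, $G_p\in\mathbb{F}^{\chi\times d\times\chi}$ ($1<p<n$) have independent entries, those of $G_p$ with law $\mathcal N_{\mathbb F}(0,\sigma_p^2)$, $\sigma_p^2=1/\chi$ for $1<p<n$ and $\sigma_p^2=1/\sqrt\chi$ for $p\in\{1,n\}$. ($\mathcal N_{\mathbb C}(0,\sigma^2)$ is the law of $g_1+\mathrm{i}g_2$ with $g_1,g_2$ independent $\mathcal N_{\mathbb R}(0,\sigma^2/2)$.) Nyström++ estimator: let $\boldsymbol\omega_1,\dots,\boldsymbol\omega_k,\boldsymbol\psi_1,\dots,\boldsymbol\psi_\ell$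 be iid rMPS vectors of bond dimension $\chi$, let $\mathbf\Omega=k^{-1/2}[\boldsymbol\omega_1,\dots,\boldsymbol\omega_k]$, and let $\mathbf A\langle\mathbf\Omega\rangle=\mathbf A\mathbf\Omega(\mathbf\Omega^*\mathbf A\mathbf\Omega)^+\mathbf\Omega^*\mathbf A$ ($^+$ the Moore–Penrose pseudoinverse). Then $$\widehat{\operatorname{Tr}}_{\mathrm N++}=\operatorname{Tr}(\mathbf A\langle\mathbf\Omega\rangle)+\frac1\ell\sum_{i=1}^{\ell}\boldsymbol\psi_i^*(\mathbf A-\mathbf A\langle\mathbf\Omega\rangle)\boldsymbol\psi_i .$$ *)

theory Defs
  imports
    "HOL-Probability.Probability"
    "Jordan_Normal_Form.Schur_Decomposition"
    "Jordan_Normal_Form.DL_Rank"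
begin

text \<open>
  Everything below is polymorphic in the scalar field and is only used for \<open>real\<close> and \<open>complex\<close>,
  where \<^const>\<open>conjugate\<close> is the identity and complex conjugation, respectively, and where
  \<open>0 \<le> z\<close> for complex \<open>z\<close> means that \<open>z\<close> is real and nonnegative.
\<close>

section \<open>Linear algebra\<close>

definition mat_trace :: "'a::comm_monoid_add mat \<Rightarrow> 'a" where
  "mat_trace A = (\<Sum>i<dim_row A. A $$ (i, i))"

definition psd :: "'a::conjugatable_ordered_field mat \<Rightarrow> bool" where
  "psd A \<longleftrightarrow> A \<in> carrier_mat (dim_row A) (dim_row A) \<and> mat_adjoint A = A \<and>
     (\<forall>v\<in>carrier_vec (dim_row A). 0 \<le> (A *\<^sub>v v) \<bullet>c v)"

definition frobenius_norm :: "'a::real_normed_vector mat \<Rightarrow> real" where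
  "frobenius_norm A = sqrt (\<Sum>i<dim_row A. \<Sum>j<dim_col A. (norm (A $$ (i, j)))\<^sup>2)"

text \<open>
  Square roots of the eigenvalues of \<open>A\<^sup>* A\<close>, with algebraic multiplicity. The eigenvalues are
  nonnegative reals, possibly sitting inside \<open>complex\<close>, so \<open>norm\<close> only converts them to \<open>real\<close>.
\<close>
definition singular_values ::
    "'a::{conjugatable_ordered_field, real_normed_field} mat \<Rightarrow> real multiset" where
  "singular_values A = image_mset (\<lambda>x. sqrt (norm x)) (proots (char_poly (mat_adjoint A * A)))"

definition nuclear_norm :: "'a::{conjugatable_ordered_field, real_normed_field} mat \<Rightarrow> real" where
  "nuclear_norm A = sum_mset (singular_values A)"

text \<open>
  A best approximation of rank at most \<open>r\<close> need not be unique, hence a predicate. By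
  Eckart--Young--Mirsky the Frobenius minimizers are exactly the truncated singular value
  decompositions, so they also minimize the nuclear norm of the residual.
\<close>
definition best_rank_approx ::
    "nat \<Rightarrow> 'a::{field, real_normed_vector} mat \<Rightarrow> 'a mat \<Rightarrow> bool" where
  "best_rank_approx r A B \<longleftrightarrow>
     B \<in> carrier_mat (dim_row A) (dim_col A) \<and> vec_space.rank (dim_row A) B \<le> r \<and>
     (\<forall>C\<in>carrier_mat (dim_row A) (dim_col A).
        vec_space.rank (dim_row A) C \<le> r \<longrightarrow> frobenius_norm (A - B) \<le> frobenius_norm (A - C))"

text \<open>The Moore--Penrose pseudoinverse, characterized by the four Penrose equations.\<close>
definition is_pinv :: "'a::conjugatable_field mat \<Rightarrow> 'a mat \<Rightarrow> bool" where
  "is_pinv A X \<longleftrightarrow> X \<in> carrier_mat (dim_col A) (dim_row A) \<and>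
     A * X * A = A \<and> X * A * X = X \<and>
     mat_adjoint (A * X) = A * X \<and> mat_adjoint (X * A) = X * A"

definition pinv :: "'a::conjugatable_field mat \<Rightarrow> 'a mat" where
  "pinv A = (THE X. is_pinv A X)"

section \<open>Random matrix product states\<close>

definition real_normal :: "real \<Rightarrow> real measure" where
  "real_normal v = density lborel (normal_density 0 (sqrt v))"

definition complex_normal :: "real \<Rightarrow> complex measure" where
  "complex_normal v =
     distr (real_normal (v / 2) \<Otimes>\<^sub>M real_normal (v / 2)) borel (\<lambda>(x, y). Complex x y)"

text \<open>
  Sites are numbered \<open>1, \<dots>, n\<close>, and bond \<open>q \<in> {0, \<dots>, n}\<close> joins the sites \<open>q\<close> and \<open>q + 1\<close>.
  The bonds \<open>0\<close> and \<open>n\<close> are dummies of dimension 1, so that every core, including the two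
  matrices at the ends, has entries \<open>G (p, a, i, b)\<close> with left bond index \<open>a\<close>, physical index \<open>i\<close>
  and right bond index \<open>b\<close>. Bond and physical indices start at 0.
\<close>
definition bond_dim :: "nat \<Rightarrow> nat \<Rightarrow> nat \<Rightarrow> nat" where
  "bond_dim n bd q = (if q = 0 \<or> q = n then 1 else bd)"

definition core_index :: "nat \<Rightarrow> nat \<Rightarrow> nat \<Rightarrow> (nat \<times> nat \<times> nat \<times> nat) set" where
  "core_index d n bd = {(p, a, i, b). p \<in> {1..n} \<and>
     a < bond_dim n bd (p - 1) \<and> i < d \<and> b < bond_dim n bd p}"

definition core_variance :: "nat \<Rightarrow> nat \<Rightarrow> nat \<Rightarrow> real" where
  "core_variance n bd p = (if p = 1 \<or> p = n then 1 / sqrt (real bd) else 1 / real bd)"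

text \<open>
  The multi-index \<open>(i\<^sub>1, \<dots>, i\<^sub>n)\<close> is identified with the number \<open>x < d ^ n\<close> having these base-\<open>d\<close>
  digits, \<open>i\<^sub>1\<close> being the most significant one (lexicographic order).
\<close>
definition site_index :: "nat \<Rightarrow> nat \<Rightarrow> nat \<Rightarrow> nat \<Rightarrow> nat" where
  "site_index d n x p = (x div d ^ (n - p)) mod d"

definition mps_entry ::
    "nat \<Rightarrow> nat \<Rightarrow> nat \<Rightarrow> (nat \<times> nat \<times> nat \<times> nat \<Rightarrow> 'a::comm_semiring_1) \<Rightarrow> nat \<Rightarrow> 'a" where
  "mps_entry d n bd G x =
     (\<Sum>\<alpha>\<in>PiE {0..n} (\<lambda>q. {..<bond_dim n bd q}).
        \<Prod>p\<in>{1..n}. G (p, \<alpha> (p - 1), site_index d n x p, \<alpha> p))"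

text \<open>
  The law of an rMPS vector of order \<open>n\<close>, physical dimension \<open>d\<close> and bond dimension \<open>bd\<close>. Vectors are represented by their extensional coordinate functions on
  \<open>{..<d ^ n}\<close>. The argument \<open>N\<close> is \<^const>\<open>real_normal\<close> or \<^const>\<open>complex_normal\<close>.
\<close>
definition rmps_law ::
    "(real \<Rightarrow> 'a::real_normed_field measure) \<Rightarrow> nat \<Rightarrow> nat \<Rightarrow> nat \<Rightarrow> (nat \<Rightarrow> 'a) measure" where
  "rmps_law N d n bd =
     distr (PiM (core_index d n bd) (\<lambda>(p, a, i, b). N (core_variance n bd p)))
       (PiM {..<d ^ n} (\<lambda>_. borel))
       (\<lambda>G. \<lambda>x\<in>{..<d ^ n}. mps_entry d n bd G x)"

text \<open>The joint law of \<open>m\<close> iid rMPS vectors.\<close>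
definition iid_rmps ::
    "(real \<Rightarrow> 'a::real_normed_field measure) \<Rightarrow> nat \<Rightarrow> nat \<Rightarrow> nat \<Rightarrow> nat \<Rightarrow>
     (nat \<Rightarrow> nat \<Rightarrow> 'a) measure" where
  "iid_rmps N d n bd m = PiM {..<m} (\<lambda>_. rmps_law N d n bd)"

section \<open>The Nystrom++ estimator\<close>

definition sketch_mat :: "nat \<Rightarrow> nat \<Rightarrow> (nat \<Rightarrow> nat \<Rightarrow> 'a::real_normed_field) \<Rightarrow> 'a mat" where
  "sketch_mat m k \<omega> = Matrix.mat m k (\<lambda>(i, j). of_real (1 / sqrt (real k)) * \<omega> j i)"

definition nystrom :: "'a::conjugatable_field mat \<Rightarrow> 'a mat \<Rightarrow> 'a mat" where
  "nystrom A S = A * S * pinv (mat_adjoint S * A * S) * mat_adjoint S * A"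

definition nystrom_pp ::
    "'a::{conjugatable_field, real_normed_field} mat \<Rightarrow> nat \<Rightarrow> nat \<Rightarrow>
     (nat \<Rightarrow> nat \<Rightarrow> 'a) \<Rightarrow> (nat \<Rightarrow> nat \<Rightarrow> 'a) \<Rightarrow> 'a" where
  "nystrom_pp A k l \<omega> \<psi> =
     (let m = dim_row A; L = nystrom A (sketch_mat m k \<omega>) in
      mat_trace L +
      (\<Sum>j<l. ((A - L) *\<^sub>v Matrix.vec m (\<psi> j)) \<bullet>c Matrix.vec m (\<psi> j)) / of_nat l)"

end

theory Submission
  imports Defs
begin

text \<open>
  With the residual R of the Nystrom approximation, the estimator is tr (A - R) plus an unbiased
  estimate of tr R. Its error is the error of this Monte Carlo estimate, so the proof bounds the size of
  R and, given R, the variance of the estimate. Everything is done over the complex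
  numbers; real matrices and vectors are embedded.

  The residual. R is the smallest of the matrices (I - \<open>\<Omega>\<close> W)^* A (I - \<open>\<Omega>\<close> W) in the Loewner order
  (\<open>nystrom_residual\<close>), so its Frobenius norm and its trace are bounded by those for any
  convenient W. Let E = A - B with B of rank at most r, and let Q be an orthonormal basis of the range
  of B. If \<open>\<Omega>\<close>^* Q is bounded below, there is a bounded V with V \<open>\<Omega>\<close>^* Q = Q, and W = V^* replaces
  A by E (\<open>nystrom_residual_bounds\<close>). What remains are the norms of \<open>\<Omega>\<close>^* E, E \<open>\<Omega>\<close> and
  \<open>\<Omega>\<close>^* E \<open>\<Omega>\<close> and those of the sketched singular vectors of E, all of which are bounded in mean by
  isotropy and fourth moments.

  The lower bound on \<open>\<Omega>\<close>^* Q. Only fourth moments of linear forms are under control. They give a lower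
  tail of order exp (-c k) for a single vector (\<open>energy_lower_tail\<close>), but no exponential upper
  tail, which a bound on the operator norm of the sketch, as used to pass from a net to all vectors,
  would require. Instead, vectors are rounded to a
  lattice coordinate by coordinate, with signs chosen such that the error is measured by the
  Hilbert--Schmidt norm of \<open>\<Omega>\<close>^* Q (\<open>lattice_rounding\<close>). The latter is controlled in mean, and
  the lattice points in a ball of suitable radius number at most exp (C r) (\<open>lattice_net_card\<close>).

  The variance. By Wick's formula at each site, the fourth moment of an rMPS is a sum over
  configurations that assign one of three pairings to each site; each change of the pairing from one
  site to the next costs a factor \<open>1 / \<chi>\<close> (\<open>expectation_amp4\<close>). The constant configurations give the
  variance of a Gaussian vector, which is at most twice the squared Frobenius norm of R. Any other one
  contributes at most (tr R)^2 times its weight, by Cauchy--Schwarz site by site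
  (\<open>sites_paired_sum_bound\<close>), and for \<open>\<chi> = \<gamma> n\<close> these weights add up to at most \<open>12 / \<gamma>\<close>
  (\<open>excess_bounds\<close>). Chebyshev's inequality for the average over the \<open>\<psi>\<close> then yields the three terms
  of the bound, all divided by the number of the \<open>\<psi>\<close>: the squared Frobenius norm of R contributes that of
  E and, from the diagonal of \<open>\<Omega>\<close>^* E \<open>\<Omega>\<close>, the squared nuclear norm of E divided by k, while
  \<open>12 / \<gamma>\<close> times (tr R)^2 contributes the squared nuclear norm of E divided by \<open>\<gamma>\<close>.
\<close>

section \<open>Adjoints and matrix algebra\<close>

lemma sum_of_bool_mult:
  fixes f :: "nat \<Rightarrow> 'a::semiring_1"
  assumes "j < n"
  shows "(\<Sum>l<n. of_bool (l = j) * f l) = f j" "(\<Sum>l<n. of_bool (j = l) * f l) = f j"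
  using assms by (simp_all add: of_bool_def if_distrib[of "\<lambda>x. x * _"] sum.delta sum.delta' cong: if_cong)

lemma mat_adjoint_alt: "mat_adjoint A = Matrix.mat (dim_col A) (dim_row A) (\<lambda>(i, j). conjugate (A $$ (j, i)))"
  unfolding mat_adjoint_def by (rule eq_matI) (auto simp: mat_of_rows_def)

lemma mat_adjoint_dim [simp]: "dim_row (mat_adjoint A) = dim_col A" "dim_col (mat_adjoint A) = dim_row A"
  by (simp_all add: mat_adjoint_alt)

lemma mat_adjoint_carrier: "A \<in> carrier_mat p q \<Longrightarrow> mat_adjoint A \<in> carrier_mat q p"
  by (simp add: mat_adjoint_alt)

lemma mat_adjoint_index [simp]: "i < dim_col A \<Longrightarrow> j < dim_row A \<Longrightarrow> mat_adjoint A $$ (i, j) = conjugate (A $$ (j, i))"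
  by (simp add: mat_adjoint_alt)

lemma mat_adjoint_adjoint [simp]: "mat_adjoint (mat_adjoint A) = A"
  by (rule eq_matI) auto

lemma mult_mat_index: "i < dim_row A \<Longrightarrow> j < dim_col B \<Longrightarrow> dim_col A = dim_row B \<Longrightarrow>
   (A * B) $$ (i, j) = (\<Sum>l<dim_row B. A $$ (i, l) * B $$ (l, j))"
  by (simp add: scalar_prod_def atLeast0LessThan)

lemma mat_adjoint_mult: "dim_col A = dim_row B \<Longrightarrow> mat_adjoint (A * B) = mat_adjoint B * mat_adjoint A"
  by (rule eq_matI)
    (auto simp: mult_mat_index sum_conjugate conjugate_dist_mul mult.commute simp del: index_mult_mat(1))

lemma mat_adjoint_minus: "dim_row A = dim_row B \<Longrightarrow> dim_col A = dim_col B \<Longrightarrow> mat_adjoint (A - B) = mat_adjoint A - mat_adjoint B"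
  by (rule eq_matI) (auto simp: conjugate_dist_add conjugate_neg diff_conv_add_uminus simp del: add_uminus_conv_diff)

lemma mat_adjoint_add: "dim_row A = dim_row B \<Longrightarrow> dim_col A = dim_col B \<Longrightarrow> mat_adjoint (A + B) = mat_adjoint A + mat_adjoint B"
  by (rule eq_matI) (auto simp: conjugate_dist_add)

lemma mat_adjoint_one [simp]: "mat_adjoint (1\<^sub>m n :: complex mat) = 1\<^sub>m n"
  by (rule eq_matI) auto

lemma mat_mult_assoc: "dim_col A = dim_row B \<Longrightarrow> dim_col B = dim_row C \<Longrightarrow> (A * B) * C = A * (B * C)"
  for A :: "'a::semiring_0 mat"
  by (rule assoc_mult_mat[of _ "dim_row A" "dim_col A" _ "dim_col B" _ "dim_col C"]) auto

lemma mat_mult_minus: "dim_col A = dim_row B \<Longrightarrow> dim_row B = dim_row C \<Longrightarrow> dim_col B = dim_col C \<Longrightarrow> A * (B - C) = A * B - A * C"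
  for A :: "'a::ring mat"
  by (rule mult_minus_distrib_mat[of _ "dim_row A" "dim_col A" _ "dim_col B"]) auto

lemma mat_minus_mult: "dim_col A = dim_row C \<Longrightarrow> dim_row A = dim_row B \<Longrightarrow> dim_col A = dim_col B \<Longrightarrow> (A - B) * C = A * C - B * C"
  for A :: "'a::ring mat"
  by (rule minus_mult_distrib_mat[of _ "dim_row A" "dim_col A" _ _ "dim_col C"]) auto

lemma mat_mult_add: "dim_col A = dim_row B \<Longrightarrow> dim_row B = dim_row C \<Longrightarrow> dim_col B = dim_col C \<Longrightarrow> A * (B + C) = A * B + A * C"
  for A :: "'a::ring mat"
  by (rule mult_add_distrib_mat[of _ "dim_row A" "dim_col A" _ "dim_col B"]) auto

lemma mat_add_mult: "dim_col A = dim_row C \<Longrightarrow> dim_row A = dim_row B \<Longrightarrow> dim_col A = dim_col B \<Longrightarrow> (A + B) * C = A * C + B * C"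
  for A :: "'a::ring mat"
  by (rule add_mult_distrib_mat[of _ "dim_row A" "dim_col A" _ _ "dim_col C"]) auto

lemmas mat_alg = mat_mult_assoc mat_mult_minus mat_minus_mult mat_mult_add mat_add_mult
  mat_adjoint_mult mat_adjoint_minus mat_adjoint_add

section \<open>The spectral theorem and the pseudoinverse of Hermitian matrices\<close>

lemma pinv_unique:
  fixes M :: "'a::conjugatable_field mat"
  assumes X: "is_pinv M X" and Y: "is_pinv M Y"
  shows "X = Y"
proof -
  have d: "dim_row X = dim_col M" "dim_col X = dim_row M" "dim_row Y = dim_col M" "dim_col Y = dim_row M"
    using X Y by (auto simp: is_pinv_def)
  have x: "M * X * M = M" "X * M * X = X" "mat_adjoint (M * X) = M * X" "mat_adjoint (X * M) = X * M"
    and y: "M * Y * M = M" "Y * M * Y = Y" "mat_adjoint (M * Y) = M * Y" "mat_adjoint (Y * M) = Y * M"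
    using X Y by (auto simp: is_pinv_def)
  have "M * X = (M * Y) * (M * X)" using y(1) d by (metis mat_mult_assoc index_mult_mat(2,3))
  then have "mat_adjoint (M * X) = mat_adjoint ((M * Y) * (M * X))" by simp
  also have "\<dots> = (M * X) * (M * Y)" using x y d by (simp add: mat_adjoint_mult)
  also have "\<dots> = M * Y" using x(1) d by (metis mat_mult_assoc index_mult_mat(2,3))
  finally have 1: "M * X = M * Y" using x by simp
  have "X * M = (X * M) * (Y * M)" using y(1) d by (metis mat_mult_assoc index_mult_mat(2,3))
  then have "mat_adjoint (X * M) = mat_adjoint ((X * M) * (Y * M))" by simp
  also have "\<dots> = (Y * M) * (X * M)" using x y d by (simp add: mat_adjoint_mult)
  also have "\<dots> = Y * M" using x(1) d by (metis mat_mult_assoc index_mult_mat(2,3))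
  finally have 2: "X * M = Y * M" using x by simp
  have "X = X * M * X" using x by simp
  also have "\<dots> = Y * (M * X)" using 2 d by (simp add: mat_mult_assoc)
  also have "\<dots> = Y * M * Y" using 1 d by (simp add: mat_mult_assoc)
  finally show ?thesis using y by simp
qed

lemma pinv_eqI: "is_pinv M X \<Longrightarrow> pinv M = X"
  unfolding pinv_def using pinv_unique by blast

text \<open>
  A Householder reflection. The scalar c of modulus 1 makes c v_0 real and nonpositive; with
  w = c v - e_0 the matrix I - w w^* / (1 + |v_0|) is Hermitian and unitary and maps e_0 to c v.
  The sign of c v_0 keeps the denominator away from 0.
\<close>
lemma unitary_with_first_col:
  fixes v :: "nat \<Rightarrow> complex"
  assumes v: "(\<Sum>i<Suc n. (cmod (v i))\<^sup>2) = 1"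
  shows "\<exists>H \<in> carrier_mat (Suc n) (Suc n). \<exists>c. c \<noteq> 0 \<and> mat_adjoint H * H = 1\<^sub>m (Suc n) \<and> H * mat_adjoint H = 1\<^sub>m (Suc n) \<and>
     (\<forall>i<Suc n. H $$ (i, 0) = c * v i)"
proof -
  define c where "c = (if v 0 = 0 then 1 else - cnj (v 0) / cmod (v 0))"
  define u where "u i = c * v i" for i
  have cc: "cmod c = 1" by (auto simp: c_def norm_divide)
  have u0: "u 0 = complex_of_real (- cmod (v 0))"
    by (auto simp: u_def c_def mult.commute[of "cnj _"] complex_norm_square[symmetric] power2_eq_square)
  have un: "(\<Sum>i<Suc n. (cmod (u i))\<^sup>2) = 1" using v by (simp add: u_def norm_mult cc)
  have u1: "(\<Sum>i<Suc n. u i * cnj (u i)) = 1"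
    using un by (simp only: complex_norm_square[symmetric] of_real_sum[symmetric] of_real_1)
  define w where "w i = u i - of_bool (i = 0)" for i
  define a where "a = 1 + cmod (v 0)"
  have "a > 0" using norm_ge_zero[of "v 0"] unfolding a_def by linarith
  then have a: "a > 0" "complex_of_real a \<noteq> 0" by auto
  define H where "H = Matrix.mat (Suc n) (Suc n) (\<lambda>(i, j). of_bool (i = j) - w i * cnj (w j) / a)"
  have "(\<Sum>i<Suc n. cnj (w i) * w i) = (\<Sum>i<Suc n. u i * cnj (u i)) + (\<Sum>i<Suc n. of_bool (i = 0) * (1 - u i - cnj (u i)))"
    unfolding sum.distrib[symmetric] by (rule sum.cong) (auto simp: w_def algebra_simps)
  also have "(\<Sum>i<Suc n. of_bool (i = 0) * (1 - u i - cnj (u i))) = 1 - u 0 - cnj (u 0)"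
    by (subst sum.lessThan_Suc_shift) simp
  finally have ww: "(\<Sum>i<Suc n. cnj (w i) * w i) = 2 * a"
    using u1 by (simp add: u0 a_def)
  have Hadj: "mat_adjoint H = H"
    by (rule eq_matI) (auto simp: H_def)
  have HH: "H * H = 1\<^sub>m (Suc n)"
  proof (rule eq_matI)
    fix i j assume ij: "i < dim_row (1\<^sub>m (Suc n) :: complex mat)" "j < dim_col (1\<^sub>m (Suc n):: complex mat)"
    then have ij: "i < Suc n" "j < Suc n" by auto
    have "(H * H) $$ (i, j) = (\<Sum>l<Suc n. (of_bool (i = l) - w i * cnj (w l) / a) * (of_bool (l = j) - w l * cnj (w j) / a))"
      using ij by (subst mult_mat_index) (auto simp: H_def simp del: sum.lessThan_Suc intro!: sum.cong)
    also have "\<dots> = (\<Sum>l<Suc n. of_bool (i = l) * of_bool (l = j)) - (\<Sum>l<Suc n. of_bool (l = j) * (w i * cnj (w l) / a))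
        - (\<Sum>l<Suc n. of_bool (i = l) * (w l * cnj (w j) / a)) + w i * cnj (w j) / a / a * (\<Sum>l<Suc n. cnj (w l) * w l)"
      unfolding sum_distrib_left sum.distrib[symmetric] sum_subtractf[symmetric]
      by (rule sum.cong) (auto simp: algebra_simps)
    also have "\<dots> = of_bool (i = j) - w i * cnj (w j) / a - w i * cnj (w j) / a + w i * cnj (w j) / a / a * (2 * a)"
      unfolding ww by (simp only: sum_of_bool_mult(1)[OF ij(2)] sum_of_bool_mult(2)[OF ij(1)])
    also have "\<dots> = of_bool (i = j)" using a by (simp add: field_simps)
    finally show "(H * H) $$ (i, j) = 1\<^sub>m (Suc n) $$ (i, j)" using ij by auto
  qed (auto simp: H_def)
  have "H $$ (i, 0) = c * v i" if "i < Suc n" for i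
  proof -
    have "cnj (w 0) = - complex_of_real a" by (simp add: w_def u0 a_def)
    then have "H $$ (i, 0) = of_bool (i = 0) + w i" using that a by (simp add: H_def)
    then show ?thesis by (simp add: w_def u_def)
  qed
  moreover have "c \<noteq> 0" using cc by auto
  ultimately show ?thesis using HH Hadj by (intro bexI[of _ H] exI[of _ c]) (auto simp: H_def)
qed

lemma complex_mat_eigenvector:
  fixes A :: "complex mat"
  assumes A: "A \<in> carrier_mat (Suc n) (Suc n)"
  shows "\<exists>v e. (\<Sum>i<Suc n. (cmod (v i))\<^sup>2) = 1 \<and> (\<forall>i<Suc n. (\<Sum>j<Suc n. A $$ (i, j) * v j) = e * v i)"
proof -
  have "degree (char_poly A) = Suc n" using degree_monic_char_poly[OF A] by simp
  then have "\<not> constant (poly (char_poly A))" by (simp add: constant_degree)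
  then obtain e where "poly (char_poly A) e = 0" using fundamental_theorem_of_algebra by blast
  then have "eigenvalue A e" using eigenvalue_root_char_poly[OF A] by simp
  then obtain v where v: "eigenvector A v e" unfolding eigenvalue_def by auto
  then have vc: "v \<in> carrier_vec (Suc n)" "v \<noteq> 0\<^sub>v (Suc n)" and Av: "A *\<^sub>v v = e \<cdot>\<^sub>v v"
    using A by (auto simp: eigenvector_def)
  define s where "s = (\<Sum>i<Suc n. (cmod (v $ i))\<^sup>2)"
  have "s \<noteq> 0"
  proof
    assume "s = 0"
    then have "v $ i = 0" if "i < Suc n" for i
      using that unfolding s_def by (subst (asm) sum_nonneg_eq_0_iff) auto
    then have "v = 0\<^sub>v (Suc n)" using vc by (intro eq_vecI) auto
    then show False using vc by simp
  qed
  moreover have "s \<ge> 0" unfolding s_def by (intro sum_nonneg) auto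
  ultimately have s: "s > 0" by simp
  define w where "w i = v $ i / sqrt s" for i
  have "(\<Sum>i<Suc n. (cmod (w i))\<^sup>2) = (\<Sum>i<Suc n. (cmod (v $ i))\<^sup>2 / s)"
    using s by (intro sum.cong) (auto simp: w_def norm_divide power_divide)
  also have "\<dots> = 1" using s unfolding sum_divide_distrib[symmetric] s_def[symmetric] by simp
  finally have "(\<Sum>i<Suc n. (cmod (w i))\<^sup>2) = 1" .
  moreover have "(\<Sum>j<Suc n. A $$ (i, j) * w j) = e * w i" if i: "i < Suc n" for i
  proof -
    have "(\<Sum>j<Suc n. A $$ (i, j) * v $ j) = (A *\<^sub>v v) $ i"
      using A vc i by (simp add: scalar_prod_def atLeast0LessThan del: sum.lessThan_Suc)
    also have "\<dots> = e * v $ i" using Av vc i by simp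
    finally show ?thesis unfolding w_def times_divide_eq_right sum_divide_distrib[symmetric] by simp
  qed
  ultimately show ?thesis by blast
qed

text \<open>
  Induction on the dimension: conjugating with a unitary matrix whose first column is an eigenvector
  clears the first column of A below the diagonal, and by Hermitian symmetry also the first row.
\<close>
theorem hermitian_spectral:
  fixes A :: "complex mat"
  assumes "A \<in> carrier_mat n n" "mat_adjoint A = A"
  shows "\<exists>U\<in>carrier_mat n n. \<exists>l. mat_adjoint U * U = 1\<^sub>m n \<and> U * mat_adjoint U = 1\<^sub>m n \<and>
     mat_adjoint U * A * U = mat_diag n (\<lambda>i. complex_of_real (l i))"
  using assms
proof (induction n arbitrary: A)
  case 0
  then show ?case by (intro bexI[of _ "1\<^sub>m 0"] exI conjI) (auto intro!: eq_matI simp: mat_diag_def)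
next
  case (Suc n)
  note A = Suc.prems(1)
  obtain v e where v: "(\<Sum>i<Suc n. (cmod (v i))\<^sup>2) = 1" and ev: "\<And>i. i < Suc n \<Longrightarrow> (\<Sum>j<Suc n. A $$ (i, j) * v j) = e * v i"
    using complex_mat_eigenvector[OF A] by blast
  obtain H c where H: "H \<in> carrier_mat (Suc n) (Suc n)" and HH: "mat_adjoint H * H = 1\<^sub>m (Suc n)" "H * mat_adjoint H = 1\<^sub>m (Suc n)"
    and H0: "\<And>i. i < Suc n \<Longrightarrow> H $$ (i, 0) = c * v i" using unitary_with_first_col[OF v] by blast
  define C where "C = mat_adjoint H * A * H"
  have C: "C \<in> carrier_mat (Suc n) (Suc n)" using A H by (auto simp: C_def)
  have Cadj: "mat_adjoint C = C" using A H Suc.prems(2) by (simp add: C_def mat_alg)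
  have C0: "C $$ (i, 0) = (if i = 0 then e else 0)" if i: "i < Suc n" for i
  proof -
    have AH: "(A * H) $$ (l, 0) = e * H $$ (l, 0)" if "l < Suc n" for l
    proof -
      have "(A * H) $$ (l, 0) = (\<Sum>j<Suc n. A $$ (l, j) * (c * v j))"
        using A H that by (subst mult_mat_index) (auto simp: H0 simp del: sum.lessThan_Suc)
      also have "\<dots> = c * (\<Sum>j<Suc n. A $$ (l, j) * v j)"
        by (simp add: sum_distrib_left mult_ac del: sum.lessThan_Suc)
      finally show ?thesis using ev[OF that] H0[OF that] by simp
    qed
    have CH: "C = mat_adjoint H * (A * H)" using A H by (simp add: C_def mat_mult_assoc)
    have "C $$ (i, 0) = (\<Sum>l<dim_row (A * H). mat_adjoint H $$ (i, l) * (A * H) $$ (l, 0))"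
      using A H i by (simp only: CH, subst mult_mat_index) auto
    also have "\<dots> = (\<Sum>l<Suc n. mat_adjoint H $$ (i, l) * (e * H $$ (l, 0)))"
      by (rule sum.cong) (use A AH in auto)
    also have "\<dots> = e * (\<Sum>l<Suc n. mat_adjoint H $$ (i, l) * H $$ (l, 0))"
      by (simp add: sum_distrib_left mult_ac del: sum.lessThan_Suc)
    also have "(\<Sum>l<Suc n. mat_adjoint H $$ (i, l) * H $$ (l, 0)) = (mat_adjoint H * H) $$ (i, 0)"
      using H i by (subst mult_mat_index) auto
    finally show ?thesis using i by (simp add: HH)
  qed
  have Csym: "C $$ (i, j) = cnj (C $$ (j, i))" if "i < Suc n" "j < Suc n" for i j
    using mat_adjoint_index[of i C j] that C Cadj by simp
  have e: "e = complex_of_real (Re e)" using Csym[of 0 0] C0[of 0] by (simp add: complex_eq_iff)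
  define B where "B = Matrix.mat n n (\<lambda>(i, j). C $$ (Suc i, Suc j))"
  have B: "B \<in> carrier_mat n n" by (simp add: B_def)
  have "mat_adjoint B = B"
  proof (rule eq_matI)
    fix i j assume "i < dim_row B" "j < dim_col B"
    then show "mat_adjoint B $$ (i, j) = B $$ (i, j)"
      using Csym[of "Suc i" "Suc j"] by (simp add: B_def)
  qed (auto simp: B_def)
  note B = B this
  obtain U l where U: "U \<in> carrier_mat n n" "mat_adjoint U * U = 1\<^sub>m n" "U * mat_adjoint U = 1\<^sub>m n"
     and D: "mat_adjoint U * B * U = mat_diag n (\<lambda>i. complex_of_real (l i))" using Suc.IH[OF B] by blast
  \<comment> \<open>Extend the diagonalization of the lower block by the eigenvector already split off.\<close>
  define W where "W = four_block_mat (1\<^sub>m 1) (0\<^sub>m 1 n) (0\<^sub>m n 1) U"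
  have W: "W \<in> carrier_mat (Suc n) (Suc n)" using U by (auto simp: W_def)
  have U': "mat_adjoint U \<in> carrier_mat n n" using U by (auto intro: mat_adjoint_carrier)
  have Wadj: "mat_adjoint W = four_block_mat (1\<^sub>m 1) (0\<^sub>m 1 n) (0\<^sub>m n 1) (mat_adjoint U)"
    using U by (intro eq_matI) (auto simp: W_def)
  define E where "E = Matrix.mat 1 1 (\<lambda>_. e)"
  have Cb: "C = four_block_mat E (0\<^sub>m 1 n) (0\<^sub>m n 1) B"
  proof (rule eq_matI)
    fix i j assume "i < dim_row (four_block_mat E (0\<^sub>m 1 n) (0\<^sub>m n 1) B)" "j < dim_col (four_block_mat E (0\<^sub>m 1 n) (0\<^sub>m n 1) B)"
    then have ij: "i < Suc n" "j < Suc n" by (auto simp: E_def B_def)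
    show "C $$ (i, j) = four_block_mat E (0\<^sub>m 1 n) (0\<^sub>m n 1) B $$ (i, j)"
      using ij C0[of i] C0[of j] Csym[of i j] by (auto simp: E_def B_def)
  qed (use C in \<open>auto simp: E_def B_def\<close>)
  have Ec: "E \<in> carrier_mat 1 1" by (simp add: E_def)
  have m1: "mat_adjoint W * W = 1\<^sub>m (Suc n)"
    unfolding Wadj unfolding W_def
    using U U' by (subst mult_four_block_mat[of _ 1 1 _ n _ n _ _ 1 _ n]) (auto intro!: eq_matI)
  have m2: "W * mat_adjoint W = 1\<^sub>m (Suc n)"
    unfolding Wadj unfolding W_def
    using U U' by (subst mult_four_block_mat[of _ 1 1 _ n _ n _ _ 1 _ n]) (auto intro!: eq_matI)
  have BU: "B * U \<in> carrier_mat n n" using B U by auto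
  have m3': "C * W = four_block_mat E (0\<^sub>m 1 n) (0\<^sub>m n 1) (B * U)"
    unfolding Cb W_def using U B Ec BU
    by (subst mult_four_block_mat[of _ 1 1 _ n _ n _ _ 1 _ n]) auto
  have m3: "mat_adjoint W * (C * W) = mat_diag (Suc n) (\<lambda>i. complex_of_real (case i of 0 \<Rightarrow> Re e | Suc i \<Rightarrow> l i))"
  proof -
    have "mat_adjoint U * (B * U) = mat_diag n (\<lambda>i. complex_of_real (l i))"
      using D B U by (simp add: mat_mult_assoc)
    then have "mat_adjoint W * (C * W) = four_block_mat E (0\<^sub>m 1 n) (0\<^sub>m n 1) (mat_diag n (\<lambda>i. complex_of_real (l i)))"
      unfolding m3' Wadj using U U' B Ec BU
      by (subst mult_four_block_mat[of _ 1 1 _ n _ n _ _ 1 _ n]) auto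
    also have "\<dots> = mat_diag (Suc n) (\<lambda>i. complex_of_real (case i of 0 \<Rightarrow> Re e | Suc i \<Rightarrow> l i))"
      using e by (intro eq_matI) (auto simp: mat_diag_def E_def split: nat.split)
    finally show ?thesis .
  qed
  have a1: "mat_adjoint (H * W) * (H * W) = 1\<^sub>m (Suc n)"
  proof -
    have "mat_adjoint (H * W) * (H * W) = mat_adjoint W * ((mat_adjoint H * H) * W)"
      using H W by (simp add: mat_alg)
    then show ?thesis using W m1 HH by simp
  qed
  have a2: "(H * W) * mat_adjoint (H * W) = 1\<^sub>m (Suc n)"
  proof -
    have "(H * W) * mat_adjoint (H * W) = H * ((W * mat_adjoint W) * mat_adjoint H)"
      using H W by (simp add: mat_alg)
    then show ?thesis using H W m2 HH by simp
  qed
  have a3: "mat_adjoint (H * W) * A * (H * W) = mat_adjoint W * (C * W)"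
    using H W A by (simp add: mat_alg C_def)
  show ?case
    by (intro bexI[of _ "H * W"] exI conjI, rule a1, rule a2, unfold a3, rule m3) (use H W in auto)
qed

text \<open>
  The functional calculus of a Hermitian matrix diagonalized by U: f lists the values on the
  eigenvalues, so that products, square roots and pseudoinverses are computed pointwise.
\<close>
definition spectral_mat :: "nat \<Rightarrow> complex mat \<Rightarrow> (nat \<Rightarrow> real) \<Rightarrow> complex mat" where
  "spectral_mat n U f = U * mat_diag n (\<lambda>i. complex_of_real (f i)) * mat_adjoint U"

definition unitary_mat :: "nat \<Rightarrow> complex mat \<Rightarrow> bool" where
  "unitary_mat n U \<longleftrightarrow> U \<in> carrier_mat n n \<and> mat_adjoint U * U = 1\<^sub>m n \<and> U * mat_adjoint U = 1\<^sub>m n"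

lemma mat_diag_dims [simp]: "dim_row (mat_diag n f) = n" "dim_col (mat_diag n f) = n"
  by (auto simp: mat_diag_def)

lemma mat_diag_adjoint: "mat_adjoint (mat_diag n (\<lambda>i. complex_of_real (f i))) = mat_diag n (\<lambda>i. complex_of_real (f i))"
  by (rule eq_matI) (auto simp: mat_diag_def)

lemma unitary_mat_carrier: "unitary_mat n U \<Longrightarrow> U \<in> carrier_mat n n"
  by (simp add: unitary_mat_def)

lemma spectral_mat_carrier: "unitary_mat n U \<Longrightarrow> spectral_mat n U f \<in> carrier_mat n n"
  by (auto simp: spectral_mat_def unitary_mat_def)

lemma spectral_mat_dims [simp]: "unitary_mat n U \<Longrightarrow> dim_row (spectral_mat n U f) = n" "unitary_mat n U \<Longrightarrow> dim_col (spectral_mat n U f) = n"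
  by (auto simp: spectral_mat_def unitary_mat_def)

lemma spectral_mat_mult:
  assumes "unitary_mat n U"
  shows "spectral_mat n U f * spectral_mat n U g = spectral_mat n U (\<lambda>i. f i * g i)"
proof -
  have U: "U \<in> carrier_mat n n" "mat_adjoint U * U = 1\<^sub>m n" using assms by (auto simp: unitary_mat_def)
  have "spectral_mat n U f * spectral_mat n U g = U * (mat_diag n (\<lambda>i. complex_of_real (f i)) *
    ((mat_adjoint U * U) * (mat_diag n (\<lambda>i. complex_of_real (g i)) * mat_adjoint U)))"
    using U(1) by (simp add: spectral_mat_def mat_mult_assoc)
  also have "\<dots> = U * ((mat_diag n (\<lambda>i. complex_of_real (f i)) * mat_diag n (\<lambda>i. complex_of_real (g i))) * mat_adjoint U)"
    using U(1) unfolding U(2)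
    by (subst mat_mult_assoc[of "mat_diag n (\<lambda>i. complex_of_real (f i))" "mat_diag n (\<lambda>i. complex_of_real (g i))"]) simp_all
  finally show ?thesis using U(1) unfolding mat_diag_diag by (simp add: spectral_mat_def mat_mult_assoc)
qed

lemma spectral_mat_adjoint:
  assumes "unitary_mat n U"
  shows "mat_adjoint (spectral_mat n U f) = spectral_mat n U f"
  using unitary_mat_carrier[OF assms] by (simp add: spectral_mat_def mat_mult_assoc mat_adjoint_mult mat_diag_adjoint)

lemma spectral_mat_index:
  assumes "unitary_mat n U" "i < n" "j < n"
  shows "spectral_mat n U f $$ (i, j) = (\<Sum>l<n. complex_of_real (f l) * U $$ (i, l) * cnj (U $$ (j, l)))"
proof -
  have U: "U \<in> carrier_mat n n" using assms by (simp add: unitary_mat_def)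
  have "U * mat_diag n (\<lambda>i. complex_of_real (f i)) = Matrix.mat n n (\<lambda>(i, j). U $$ (i, j) * complex_of_real (f j))"
    by (rule mat_diag_mult_right[OF U])
  then show ?thesis using U assms
    unfolding spectral_mat_def by (subst mult_mat_index) (auto simp: mult_ac intro!: sum.cong)
qed

lemma unitary_col_norm:
  assumes "unitary_mat n U" "l < n"
  shows "(\<Sum>i<n. (cmod (U $$ (i, l)))\<^sup>2) = 1"
proof -
  have "complex_of_real (\<Sum>i<n. (cmod (U $$ (i, l)))\<^sup>2) = (mat_adjoint U * U) $$ (l, l)"
    using assms unfolding unitary_mat_def
    by (subst mult_mat_index) (auto simp: complex_norm_square mult.commute intro!: sum.cong simp del: of_real_power)
  also have "\<dots> = 1" using assms by (simp add: unitary_mat_def)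
  finally show ?thesis using of_real_eq_1_iff by blast
qed

lemma spectral_mat_cong: "(\<And>i. i < n \<Longrightarrow> f i = g i) \<Longrightarrow> spectral_mat n U f = spectral_mat n U g"
  unfolding spectral_mat_def by (rule arg_cong[of _ _ "\<lambda>D. U * D * mat_adjoint U"], rule eq_matI) (auto simp: mat_diag_def)

lemma spectral_mat_one: "unitary_mat n U \<Longrightarrow> spectral_mat n U (\<lambda>_. 1) = 1\<^sub>m n"
  by (simp add: spectral_mat_def unitary_mat_def right_mult_one_mat[of _ n n])

lemma hermitian_spectral_mat:
  fixes A :: "complex mat"
  assumes A: "A \<in> carrier_mat n n" and h: "mat_adjoint A = A"
  obtains U l where "unitary_mat n U" "A = spectral_mat n U l"
proof -
  obtain U l where U: "U \<in> carrier_mat n n" "mat_adjoint U * U = 1\<^sub>m n" "U * mat_adjoint U = 1\<^sub>m n"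
    and D: "mat_adjoint U * A * U = mat_diag n (\<lambda>i. complex_of_real (l i))"
    using hermitian_spectral[OF A h] by blast
  have "spectral_mat n U l = (U * mat_adjoint U) * A * (U * mat_adjoint U)"
    unfolding spectral_mat_def D[symmetric] using U(1) A by (simp add: mat_mult_assoc)
  also have "\<dots> = A" using A U by simp
  finally show ?thesis using U that by (auto simp: unitary_mat_def)
qed

lemma spectral_mat_char_poly:
  assumes U: "unitary_mat n U"
  shows "char_poly (spectral_mat n U l) = (\<Prod>i<n. [:- complex_of_real (l i), 1:])"
proof -
  let ?D = "mat_diag n (\<lambda>i. complex_of_real (l i))"
  have "similar_mat (spectral_mat n U l) ?D"
    using U by (intro similar_matI[of _ _ U "mat_adjoint U" n])
      (auto simp: spectral_mat_carrier mat_adjoint_carrier spectral_mat_def unitary_mat_def)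
  then have "char_poly (spectral_mat n U l) = char_poly ?D" by (rule char_poly_similar)
  also have "\<dots> = (\<Prod>a\<leftarrow>diag_mat ?D. [:- a, 1:])"
    by (rule char_poly_upper_triangular[of _ n]) (auto simp: mat_diag_def)
  also have "diag_mat ?D = map (\<lambda>i. complex_of_real (l i)) [0..<n]"
    by (auto simp: diag_mat_def mat_diag_def)
  finally show ?thesis by (simp add: o_def prod.list_conv_set_nth atLeast0LessThan)
qed

lemma proots_linear_factors:
  assumes "finite I"
  shows "proots (\<Prod>i\<in>I. [:- c i, 1:]) = image_mset c (mset_set I)"
  using assms
proof (induction I)
  case (insert i I)
  have "(\<Prod>i\<in>I. [:- c i, 1:]) \<noteq> 0" by (auto simp: insert.hyps)
  then show ?case using insert by (simp add: proots_mult del: mult_pCons_left)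
qed auto

lemma spectral_quadratic_form:
  assumes U: "unitary_mat n U" and i: "i < n"
  shows "(spectral_mat n U l *\<^sub>v col U i) \<bullet>c col U i = complex_of_real (l i)"
proof -
  have Uc: "U \<in> carrier_mat n n" using U by (simp add: unitary_mat_def)
  let ?S = "spectral_mat n U l"
  have "?S * U = U * mat_diag n (\<lambda>i. complex_of_real (l i))"
  proof -
    have "?S * U = U * mat_diag n (\<lambda>i. complex_of_real (l i)) * (mat_adjoint U * U)"
      using Uc by (simp add: spectral_mat_def mat_mult_assoc)
    then show ?thesis using U by (simp add: unitary_mat_def)
  qed
  also have "U * mat_diag n (\<lambda>i. complex_of_real (l i)) = Matrix.mat n n (\<lambda>(i, j). U $$ (i, j) * complex_of_real (l j))"
    by (rule mat_diag_mult_right[OF Uc])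
  finally have SU: "?S * U = Matrix.mat n n (\<lambda>(i, j). U $$ (i, j) * complex_of_real (l j))" .
  have "?S *\<^sub>v col U i = col (?S * U) i"
    using Uc i spectral_mat_carrier[OF U] by (intro eq_vecI) auto
  then have "(?S *\<^sub>v col U i) \<bullet>c col U i = (\<Sum>x<n. U $$ (x, i) * complex_of_real (l i) * cnj (U $$ (x, i)))"
    using i Uc unfolding SU by (simp add: scalar_prod_def atLeast0LessThan)
  also have "\<dots> = complex_of_real (l i * (\<Sum>x<n. (cmod (U $$ (x, i)))\<^sup>2))"
    by (simp add: sum_distrib_left complex_norm_square mult_ac del: of_real_power)
  finally show ?thesis using unitary_col_norm[OF U i] by simp
qed

lemma psd_spectral_nonneg:
  assumes U: "unitary_mat n U" and p: "psd (spectral_mat n U l)" and i: "i < n"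
  shows "l i \<ge> 0"
proof -
  have "col U i \<in> carrier_vec n" using U by (auto simp: unitary_mat_def)
  then have "0 \<le> (spectral_mat n U l *\<^sub>v col U i) \<bullet>c col U i"
    using p U by (auto simp: psd_def)
  then show ?thesis unfolding spectral_quadratic_form[OF U i] by (simp add: less_eq_complex_def)
qed

lemma adjoint_mult_self_quadratic_form:
  fixes F :: "complex mat"
  assumes F: "F \<in> carrier_mat p n" and v: "v \<in> carrier_vec n"
  shows "((mat_adjoint F * F) *\<^sub>v v) \<bullet>c v = complex_of_real (\<Sum>i<p. (cmod ((F *\<^sub>v v) $ i))\<^sup>2)"
proof -
  have "((mat_adjoint F * F) *\<^sub>v v) \<bullet>c v = (\<Sum>x<n. (\<Sum>y<n. (\<Sum>i<p. cnj (F $$ (i, x)) * F $$ (i, y)) * v $ y) * cnj (v $ x))"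
    using F v by (auto simp: scalar_prod_def atLeast0LessThan mult_mat_index intro!: sum.cong)
  also have "\<dots> = (\<Sum>x<n. \<Sum>y<n. \<Sum>i<p. cnj (F $$ (i, x)) * F $$ (i, y) * v $ y * cnj (v $ x))"
    by (simp add: sum_distrib_right)
  also have "\<dots> = (\<Sum>x<n. \<Sum>i<p. \<Sum>y<n. cnj (F $$ (i, x)) * F $$ (i, y) * v $ y * cnj (v $ x))"
    by (rule sum.cong[OF refl]) (rule sum.swap)
  also have "\<dots> = (\<Sum>i<p. \<Sum>x<n. \<Sum>y<n. cnj (F $$ (i, x)) * F $$ (i, y) * v $ y * cnj (v $ x))"
    by (rule sum.swap)
  also have "\<dots> = (\<Sum>i<p. (\<Sum>y<n. F $$ (i, y) * v $ y) * cnj (\<Sum>x<n. F $$ (i, x) * v $ x))"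
    unfolding cnj_sum sum_product by (rule sum.cong[OF refl], subst sum.swap) (simp add: mult_ac)
  also have "\<dots> = (\<Sum>i<p. ((F *\<^sub>v v) $ i) * cnj ((F *\<^sub>v v) $ i))"
    using F v by (intro sum.cong) (auto simp: scalar_prod_def atLeast0LessThan)
  finally show ?thesis by (simp add: complex_norm_square del: of_real_power)
qed

lemma psd_adjoint_mult_self:
  fixes F :: "complex mat"
  shows "psd (mat_adjoint F * F)"
proof -
  have "0 \<le> ((mat_adjoint F * F) *\<^sub>v v) \<bullet>c v" if "v \<in> carrier_vec (dim_col F)" for v
    by (subst adjoint_mult_self_quadratic_form[of F "dim_row F" "dim_col F"])
      (use that in \<open>auto simp: less_eq_complex_def sum_nonneg\<close>)
  then show ?thesis by (auto simp: psd_def mat_adjoint_mult)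
qed

text \<open>
  F is the square root of A in the functional calculus.
\<close>
lemma psd_factorization:
  fixes A :: "complex mat"
  assumes A: "A \<in> carrier_mat n n" and p: "psd A"
  shows "\<exists>F\<in>carrier_mat n n. A = mat_adjoint F * F"
proof -
  have "mat_adjoint A = A" using p by (simp add: psd_def)
  then obtain U l where U: "unitary_mat n U" and Al: "A = spectral_mat n U l"
    using hermitian_spectral_mat[OF A] by blast
  have "l i \<ge> 0" if "i < n" for i using psd_spectral_nonneg[OF U _ that] p Al by simp
  then have "A = spectral_mat n U (\<lambda>i. sqrt (l i)) * spectral_mat n U (\<lambda>i. sqrt (l i))"
    unfolding Al spectral_mat_mult[OF U] by (intro spectral_mat_cong) auto
  then show ?thesis by (intro bexI[of _ "spectral_mat n U (\<lambda>i. sqrt (l i))"])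
     (auto simp: spectral_mat_adjoint[OF U] spectral_mat_carrier[OF U])
qed

lemma spectral_mat_is_pinv:
  assumes U: "unitary_mat n U"
  shows "is_pinv (spectral_mat n U l) (spectral_mat n U (\<lambda>i. inverse (l i)))"
proof -
  have [simp]: "x * inverse x * x = x" "inverse x * x * inverse x = inverse x" for x :: real
    by (cases "x = 0"; simp)+
  show ?thesis unfolding is_pinv_def
    by (simp add: spectral_mat_mult[OF U] spectral_mat_adjoint[OF U] U spectral_mat_carrier[OF U])
qed

lemma hermitian_pinv:
  fixes M :: "complex mat"
  assumes M: "M \<in> carrier_mat n n" "mat_adjoint M = M"
  shows "is_pinv M (pinv M)" "pinv M \<in> carrier_mat n n"
proof -
  obtain U l where U: "unitary_mat n U" and Ml: "M = spectral_mat n U l"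
    using hermitian_spectral_mat[OF M] by blast
  show "is_pinv M (pinv M)" using spectral_mat_is_pinv[OF U] Ml pinv_eqI by metis
  then show "pinv M \<in> carrier_mat n n" using M by (auto simp: is_pinv_def)
qed

section \<open>Traces and Frobenius norms\<close>

lemma mat_trace_comm:
  fixes A :: "'a::comm_semiring_0 mat"
  assumes "dim_col A = dim_row B" "dim_row A = dim_col B"
  shows "mat_trace (A * B) = mat_trace (B * A)"
proof -
  have "mat_trace (A * B) = (\<Sum>i<dim_row A. \<Sum>l<dim_row B. A $$ (i, l) * B $$ (l, i))"
    using assms by (simp add: mat_trace_def mult_mat_index del: index_mult_mat(1))
  also have "\<dots> = (\<Sum>l<dim_row B. \<Sum>i<dim_row A. B $$ (l, i) * A $$ (i, l))"
    by (subst sum.swap) (simp add: mult.commute)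
  also have "\<dots> = mat_trace (B * A)"
    using assms by (simp add: mat_trace_def mult_mat_index del: index_mult_mat(1))
  finally show ?thesis .
qed

lemma frobenius_norm_square: "(frobenius_norm A)\<^sup>2 = (\<Sum>i<dim_row A. \<Sum>j<dim_col A. (norm (A $$ (i, j)))\<^sup>2)"
  unfolding frobenius_norm_def by (intro real_sqrt_pow2 sum_nonneg) auto

lemma frobenius_norm_square_trace:
  "complex_of_real ((frobenius_norm A)\<^sup>2) = mat_trace (mat_adjoint A * A)"
proof -
  have "mat_trace (mat_adjoint A * A) = (\<Sum>j<dim_col A. \<Sum>i<dim_row A. cnj (A $$ (i, j)) * A $$ (i, j))"
    by (simp add: mat_trace_def mult_mat_index del: index_mult_mat(1))
  also have "\<dots> = (\<Sum>i<dim_row A. \<Sum>j<dim_col A. A $$ (i, j) * cnj (A $$ (i, j)))"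
    by (subst sum.swap) (simp add: mult.commute)
  finally show ?thesis unfolding frobenius_norm_square by (simp add: complex_norm_square del: of_real_power)
qed

lemma frobenius_norm_spectral:
  assumes U: "unitary_mat n U"
  shows "(frobenius_norm (spectral_mat n U l))\<^sup>2 = (\<Sum>i<n. (l i)\<^sup>2)"
proof -
  have Uc: "U \<in> carrier_mat n n" using U by (simp add: unitary_mat_def)
  have "complex_of_real ((frobenius_norm (spectral_mat n U l))\<^sup>2) = mat_trace (spectral_mat n U (\<lambda>i. l i * l i))"
    unfolding frobenius_norm_square_trace by (simp add: spectral_mat_adjoint[OF U] spectral_mat_mult[OF U])
  also have "\<dots> = mat_trace (mat_adjoint U * (U * mat_diag n (\<lambda>i. complex_of_real (l i * l i))))"
    unfolding spectral_mat_def using Uc by (subst mat_trace_comm) auto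
  also have "mat_adjoint U * (U * mat_diag n (\<lambda>i. complex_of_real (l i * l i))) = mat_diag n (\<lambda>i. complex_of_real (l i * l i))"
    using U Uc by (simp add: unitary_mat_def mat_mult_assoc[symmetric])
  also have "mat_trace \<dots> = complex_of_real (\<Sum>i<n. (l i)\<^sup>2)"
    by (simp add: mat_trace_def mat_diag_def power2_eq_square)
  finally show ?thesis using of_real_eq_iff by blast
qed

section \<open>Low-rank factorizations and the nuclear norm\<close>

lemma (in vec_space) rank_factorization:
  assumes B: "B \<in> carrier_mat n c" and r: "rank B \<le> r"
  shows "\<exists>Y z. \<forall>x<n. \<forall>y<c. B $$ (x, y) = (\<Sum>i<r. Y i x * z i y)"
proof -
  have fin: "finite (set (cols B))" and sub: "set (cols B) \<subseteq> carrier_vec n" using B cols_dim[of B] by auto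
  have "lin_indpt {}" unfolding lin_dep_def by auto
  then obtain S where S: "maximal S (\<lambda>T. T \<subseteq> set (cols B) \<and> lin_indpt T)" "finite S"
    using maximal_exists_superset[of "set (cols B)" "\<lambda>T. T \<subseteq> set (cols B) \<and> lin_indpt T" "{}"] by auto
  have card: "card S \<le> r" using rank_card_indpt[OF B S(1)] r by simp
  have Ssub: "S \<subseteq> set (cols B)" and Sli: "lin_indpt S" using S(1) by (auto simp: maximal_def)
  have Sc: "S \<subseteq> carrier_vec n" using Ssub sub by auto
  have inspan: "s \<in> span S" if s: "s \<in> set (cols B)" for s
  proof (rule ccontr)
    assume ns: "s \<notin> span S"
    have sS: "s \<notin> S" using ns Sc span_mem by auto
    have sc: "s \<in> carrier_vec n" using s sub by blast
    have "lin_indpt (S \<union> {s})" using lin_dep_iff_in_span[of S s] Sc Sli sc sS ns by auto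
    moreover have "S \<union> {s} \<subseteq> set (cols B)" using Ssub s by auto
    moreover have "\<forall>T. S \<subseteq> T \<and> (T \<subseteq> set (cols B) \<and> lin_indpt T) \<longrightarrow> S = T"
      using S(1) unfolding maximal_def by blast
    ultimately have "S = S \<union> {s}" by (metis Un_upper1)
    then show False using sS by blast
  qed
  obtain f where f: "bij_betw f {..<card S} S" using S(2) by (metis atLeast0LessThan ex_bij_betw_nat_finite)
  have "\<forall>y<c. \<exists>a. col B y = lincomb a S"
  proof (intro allI impI)
    fix y assume "y < c"
    then have "col B y \<in> set (cols B)" using B by (auto simp: cols_def)
    then have "col B y \<in> span S" by (rule inspan)
    then show "\<exists>a. col B y = lincomb a S" using finite_span[OF S(2)] Sc by auto
  qed
  then obtain a where a: "\<And>y. y < c \<Longrightarrow> col B y = lincomb (a y) S" by metis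
  have "B $$ (x, y) = (\<Sum>i<r. (if i < card S then f i $ x else 0) * a y (f i))" if xy: "x < n" "y < c" for x y
  proof -
    have "B $$ (x, y) = lincomb (a y) S $ x" using a[OF xy(2)] B xy by (metis carrier_matD index_col)
    also have "\<dots> = (\<Sum>v\<in>S. a y v * v $ x)" by (rule lincomb_index[OF xy(1) Sc])
    also have "\<dots> = (\<Sum>i<card S. a y (f i) * f i $ x)" by (rule sum.reindex_bij_betw[OF f, symmetric])
    also have "\<dots> = (\<Sum>i<r. (if i < card S then f i $ x else 0) * a y (f i))"
      using card by (intro sum.mono_neutral_cong_left) (auto simp: mult.commute)
    finally show ?thesis .
  qed
  then show ?thesis by (intro exI[of _ "\<lambda>i x. if i < card S then f i $ x else 0"] exI[of _ "\<lambda>i y. a y (f i)"]) auto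
qed

lemma complex_cauchy_schwarz:
  "(cmod (\<Sum>i\<in>I. a i * cnj (b i)))\<^sup>2 \<le> (\<Sum>i\<in>I. (cmod (a i))\<^sup>2) * (\<Sum>i\<in>I. (cmod (b i))\<^sup>2)"
proof -
  have "cmod (\<Sum>i\<in>I. a i * cnj (b i)) \<le> (\<Sum>i\<in>I. \<bar>cmod (a i)\<bar> * \<bar>cmod (b i)\<bar>)"
    by (rule order_trans[OF norm_sum]) (auto simp: norm_mult intro!: sum_mono)
  also have "\<dots> \<le> L2_set (\<lambda>i. cmod (a i)) I * L2_set (\<lambda>i. cmod (b i)) I"
    by (rule L2_set_mult_ineq)
  finally have "(cmod (\<Sum>i\<in>I. a i * cnj (b i)))\<^sup>2 \<le> (L2_set (\<lambda>i. cmod (a i)) I * L2_set (\<lambda>i. cmod (b i)) I)\<^sup>2"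
    by (intro power_mono) auto
  also have "\<dots> = (\<Sum>i\<in>I. (cmod (a i))\<^sup>2) * (\<Sum>i\<in>I. (cmod (b i))\<^sup>2)"
    unfolding L2_set_def power_mult_distrib by (simp add: sum_nonneg)
  finally show ?thesis .
qed

text \<open>
  Gram--Schmidt, where vectors that depend linearly on their predecessors are dropped; this is why
  the orthonormal system may have fewer than r members.
\<close>
lemma orthonormal_span:
  fixes Y :: "nat \<Rightarrow> nat \<Rightarrow> complex"
  shows "\<exists>p\<le>r. \<exists>q. (\<forall>i<p. \<forall>j<p. (\<Sum>x<m. cnj (q i x) * q j x) = of_bool (i = j)) \<and>
     (\<forall>i<r. \<exists>c. \<forall>x<m. Y i x = (\<Sum>j<p. c j * q j x))"
proof (induction r)
  case 0
  then show ?case by auto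
next
  case (Suc r)
  then obtain p q where p: "p \<le> r" and on: "\<And>i j. i < p \<Longrightarrow> j < p \<Longrightarrow> (\<Sum>x<m. cnj (q i x) * q j x) = of_bool (i = j)"
    and sp: "\<And>i. i < r \<Longrightarrow> \<exists>c. \<forall>x<m. Y i x = (\<Sum>j<p. c j * q j x)" by blast
  define a where "a j = (\<Sum>x<m. cnj (q j x) * Y r x)" for j
  define w where "w x = Y r x - (\<Sum>j<p. a j * q j x)" for x
  have orth: "(\<Sum>x<m. cnj (q i x) * w x) = 0" if i: "i < p" for i
  proof -
    have "(\<Sum>x<m. cnj (q i x) * w x) = (\<Sum>x<m. cnj (q i x) * Y r x) - (\<Sum>x<m. \<Sum>j<p. a j * (cnj (q i x) * q j x))"
      by (simp add: w_def right_diff_distrib sum_subtractf sum_distrib_left mult_ac)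
    also have "(\<Sum>x<m. cnj (q i x) * Y r x) = a i" by (simp add: a_def)
    also have "(\<Sum>x<m. \<Sum>j<p. a j * (cnj (q i x) * q j x)) = (\<Sum>j<p. a j * (\<Sum>x<m. cnj (q i x) * q j x))"
      by (subst sum.swap) (simp add: sum_distrib_left)
    also have "\<dots> = (\<Sum>j<p. of_bool (i = j) * a j)"
      by (rule sum.cong) (auto simp: on i)
    also have "\<dots> = a i" using i by (rule sum_of_bool_mult)
    finally show ?thesis by simp
  qed
  define s where "s = (\<Sum>x<m. (cmod (w x))\<^sup>2)"
  have s0: "s \<ge> 0" by (auto simp: s_def intro: sum_nonneg)
  show ?case
  proof (cases "s = 0")
    case True
    then have "w x = 0" if "x < m" for x
      using that unfolding s_def by (subst (asm) sum_nonneg_eq_0_iff) auto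
    then have "\<forall>x<m. Y r x = (\<Sum>j<p. a j * q j x)" by (auto simp: w_def)
    then show ?thesis using p on sp by (intro exI[of _ p] conjI exI[of _ q]) (auto simp: less_Suc_eq)
  next
    case False
    with s0 have s: "s > 0" by simp
    define q' where "q' j x = (if j < p then q j x else w x / sqrt s)" for j x
    have ww: "(\<Sum>x<m. cnj (w x) * w x) = s"
      unfolding s_def of_real_sum by (rule sum.cong) (auto simp: complex_norm_square mult.commute simp del: of_real_power)
    have 1: "(\<Sum>x<m. cnj (q' i x) * q' j x) = of_bool (i = j)" if ij: "i < Suc p" "j < Suc p" for i j
    proof -
      consider "i < p" "j < p" | "i < p" "j = p" | "i = p" "j < p" | "i = p" "j = p" using ij by linarith
      then show ?thesis
      proof cases
        case 1 then show ?thesis by (simp add: q'_def on)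
      next
        case 2
        have "(\<Sum>x<m. cnj (q' i x) * q' j x) = (\<Sum>x<m. cnj (q i x) * w x) / sqrt s"
          using 2 by (simp add: q'_def sum_divide_distrib)
        then show ?thesis using 2 orth by simp
      next
        case 3
        have "(\<Sum>x<m. cnj (q' i x) * q' j x) = cnj (\<Sum>x<m. cnj (q j x) * w x) / sqrt s"
          using 3 by (simp add: q'_def sum_divide_distrib mult.commute)
        then show ?thesis using 3 orth by simp
      next
        case 4
        have "(\<Sum>x<m. cnj (q' i x) * q' j x) = (\<Sum>x<m. cnj (w x) * w x) / (complex_of_real (sqrt s) * complex_of_real (sqrt s))"
          using 4 by (simp add: q'_def sum_divide_distrib)
        also have "\<dots> = 1" unfolding ww of_real_mult[symmetric] using s by simp
        finally show ?thesis using 4 by simp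
      qed
    qed
    have 2: "\<exists>c. \<forall>x<m. Y i x = (\<Sum>j<Suc p. c j * q' j x)" if i: "i < Suc r" for i
    proof (cases "i = r")
      case True
      have "\<forall>x<m. Y i x = (\<Sum>j<Suc p. (if j < p then a j else sqrt s) * q' j x)"
        using s True by (simp add: q'_def w_def)
      then show ?thesis by (rule exI[of _ "\<lambda>j. if j < p then a j else complex_of_real (sqrt s)"])
    next
      case False
      then obtain c where "\<forall>x<m. Y i x = (\<Sum>j<p. c j * q j x)" using sp[of i] i by auto
      then have "\<forall>x<m. Y i x = (\<Sum>j<Suc p. (if j < p then c j else 0) * q' j x)" by (simp add: q'_def)
      then show ?thesis by (rule exI[of _ "\<lambda>j. if j < p then c j else 0"])
    qed
    show ?thesis using p 1 2 by (intro exI[of _ "Suc p"] conjI exI[of _ q']) auto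
  qed
qed

lemma orthonormal_factorization:
  assumes B: "B \<in> carrier_mat m c" and Y: "\<forall>x<m. \<forall>y<c. B $$ (x, y) = (\<Sum>i<r. Y i x * z i y)"
  shows "\<exists>p\<le>r. \<exists>Q\<in>carrier_mat m p. mat_adjoint Q * Q = 1\<^sub>m p \<and> (\<exists>C\<in>carrier_mat p c. (B :: complex mat) = Q * C)"
proof -
  obtain p q where p: "p \<le> r" and on: "\<forall>i<p. \<forall>j<p. (\<Sum>x<m. cnj (q i x) * q j x) = of_bool (i = j)"
    and sp: "\<forall>i<r. \<exists>c. \<forall>x<m. Y i x = (\<Sum>j<p. c j * q j x)"
    using orthonormal_span[where r = r and m = m and Y = Y] by blast
  then obtain d where d: "\<And>i x. i < r \<Longrightarrow> x < m \<Longrightarrow> Y i x = (\<Sum>j<p. d i j * q j x)" by metis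
  define Q where "Q = Matrix.mat m p (\<lambda>(x, j). q j x)"
  define C where "C = Matrix.mat p c (\<lambda>(j, y). \<Sum>i<r. d i j * z i y)"
  have "B = Q * C"
  proof (rule eq_matI)
    fix x y assume "x < dim_row (Q * C)" "y < dim_col (Q * C)"
    then have xy: "x < m" "y < c" by (auto simp: Q_def C_def)
    have "B $$ (x, y) = (\<Sum>i<r. \<Sum>j<p. d i j * q j x * z i y)"
      using Y xy by (simp add: d sum_distrib_right)
    also have "\<dots> = (\<Sum>j<p. q j x * (\<Sum>i<r. d i j * z i y))"
      by (subst sum.swap) (simp add: sum_distrib_left mult_ac)
    also have "\<dots> = (Q * C) $$ (x, y)"
      using xy by (subst mult_mat_index) (auto simp: Q_def C_def)
    finally show "B $$ (x, y) = (Q * C) $$ (x, y)" .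
  qed (use B in \<open>auto simp: Q_def C_def\<close>)
  moreover have "mat_adjoint Q * Q = 1\<^sub>m p"
  proof (rule eq_matI)
    fix i j assume "i < dim_row (1\<^sub>m p :: complex mat)" "j < dim_col (1\<^sub>m p :: complex mat)"
    then show "(mat_adjoint Q * Q) $$ (i, j) = 1\<^sub>m p $$ (i, j)"
      using on by (subst mult_mat_index) (auto simp: Q_def)
  qed (auto simp: Q_def)
  moreover have "Q \<in> carrier_mat m p" "C \<in> carrier_mat p c" by (auto simp: Q_def C_def)
  ultimately show ?thesis using p by blast
qed

text \<open>
  A singular value decomposition: the v_j are orthonormal eigenvectors of E^* E, the s_j are the roots
  of the eigenvalues and u_j = E v_j / s_j. For s_j = 0 this makes u_j = 0, so the u_j are only
  asserted to have norm at most 1.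
\<close>
lemma nuclear_norm_decomposition:
  fixes E :: "complex mat"
  assumes E: "E \<in> carrier_mat m m"
  shows "\<exists>s u v. (\<forall>j<m. s j \<ge> 0 \<and> (\<Sum>x<m. (cmod (u j x))\<^sup>2) \<le> 1 \<and> (\<Sum>x<m. (cmod (v j x))\<^sup>2) \<le> 1) \<and>
     (\<Sum>j<m. s j) = nuclear_norm E \<and>
     (\<forall>x<m. \<forall>y<m. E $$ (x, y) = (\<Sum>j<m. complex_of_real (s j) * u j x * cnj (v j y)))"
proof -
  let ?P = "mat_adjoint E * E"
  have P: "?P \<in> carrier_mat m m" "mat_adjoint ?P = ?P" using E by (auto simp: mat_adjoint_mult)
  obtain U l where U: "unitary_mat m U" and Pl: "?P = spectral_mat m U l" using hermitian_spectral_mat[OF P] by blast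
  have Uc: "U \<in> carrier_mat m m" using U by (simp add: unitary_mat_def)
  have l0: "l j \<ge> 0" if "j < m" for j using psd_spectral_nonneg[OF U _ that] psd_adjoint_mult_self[of E] Pl by simp
  have "proots (char_poly ?P) = image_mset (\<lambda>i. complex_of_real (l i)) (mset_set {..<m})"
    unfolding Pl spectral_mat_char_poly[OF U] by (rule proots_linear_factors) simp
  then have "nuclear_norm E = (\<Sum>j<m. sqrt (cmod (complex_of_real (l j))))"
    unfolding nuclear_norm_def singular_values_def by (simp add: image_mset.compositionality o_def sum_unfold_sum_mset)
  also have "\<dots> = (\<Sum>j<m. sqrt (l j))" using l0 by (intro sum.cong) auto
  finally have nuc: "(\<Sum>j<m. sqrt (l j)) = nuclear_norm E" by simp
  define e where "e j x = (E * U) $$ (x, j)" for j x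
  have en: "(\<Sum>x<m. (cmod (e j x))\<^sup>2) = l j" if j: "j < m" for j
  proof -
    have "col U j \<in> carrier_vec m" using Uc by auto
    then have "complex_of_real (\<Sum>x<m. (cmod ((E *\<^sub>v col U j) $ x))\<^sup>2) = complex_of_real (l j)"
      using adjoint_mult_self_quadratic_form[OF E, of "col U j"] spectral_quadratic_form[OF U j, of l] Pl Uc by simp
    moreover have "(E *\<^sub>v col U j) $ x = e j x" if "x < m" for x using that j E Uc by (simp add: e_def)
    ultimately show ?thesis by (simp del: of_real_sum)
  qed
  define u where "u j x = e j x / sqrt (l j)" for j x
  have 1: "(\<Sum>x<m. (cmod (u j x))\<^sup>2) \<le> 1" if j: "j < m" for j
  proof -
    have "(\<Sum>x<m. (cmod (u j x))\<^sup>2) = (\<Sum>x<m. (cmod (e j x))\<^sup>2) / l j"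
      using l0[OF j] by (simp add: u_def norm_divide power_divide sum_divide_distrib)
    then show ?thesis using en[OF j] by simp
  qed
  have 2: "e j x = sqrt (l j) * u j x" if "j < m" "x < m" for j x
  proof (cases "l j = 0")
    case True
    then have "(\<Sum>x<m. (cmod (e j x))\<^sup>2) = 0" using en that by simp
    then have "e j x = 0" using that by (subst (asm) sum_nonneg_eq_0_iff) auto
    then show ?thesis using True by simp
  qed (use l0[of j] that in \<open>simp add: u_def\<close>)
  have 3: "E $$ (x, y) = (\<Sum>j<m. complex_of_real (sqrt (l j)) * u j x * cnj (U $$ (y, j)))" if xy: "x < m" "y < m" for x y
  proof -
    have "E = (E * U) * mat_adjoint U" using U Uc E by (simp add: unitary_mat_def mat_mult_assoc)
    then have "E $$ (x, y) = ((E * U) * mat_adjoint U) $$ (x, y)" by simp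
    also have "\<dots> = (\<Sum>j<m. e j x * cnj (U $$ (y, j)))"
      using xy E Uc by (subst mult_mat_index) (auto simp: e_def)
    finally show ?thesis using 2 xy by simp
  qed
  show ?thesis
    by (intro exI[of _ "\<lambda>j. sqrt (l j)"] exI[of _ u] exI[of _ "\<lambda>j y. U $$ (y, j)"])
      (use 1 3 nuc l0 unitary_col_norm[OF U] in auto)
qed

section \<open>The pseudoinverse as a limit\<close>

text \<open>
  The Landweber iteration for the pseudoinverse of a Hermitian matrix. The pseudoinverse is not a
  continuous function of the matrix, but its iterates are explicit measurable functions of the
  entries, and measurability passes to the limit.
\<close>
fun pinv_iter :: "complex mat \<Rightarrow> nat \<Rightarrow> complex mat" where
  "pinv_iter M 0 = 0\<^sub>m (dim_row M) (dim_row M)"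
| "pinv_iter M (Suc t) = pinv_iter M t +
     complex_of_real (inverse (1 + (frobenius_norm M)\<^sup>2)) \<cdot>\<^sub>m (M * (1\<^sub>m (dim_row M) - M * pinv_iter M t))"

text \<open>
  In an eigenvector of M for l the iterates act as (1 - (1 - c l^2)^t) / l, where 0 < c l^2 < 1 unless
  l = 0 by the choice of the step size c. This tends to 1 / l, and it stays 0 if l = 0.
\<close>
lemma pinv_iter_tendsto:
  assumes M: "M \<in> carrier_mat n n" "mat_adjoint M = M" and ij: "i < n" "j < n"
  shows "(\<lambda>t. pinv_iter M t $$ (i, j)) \<longlonglongrightarrow> pinv M $$ (i, j)"
proof -
  obtain U l where U: "unitary_mat n U" and Ml: "M = spectral_mat n U l"
    using hermitian_spectral_mat[OF M] by blast
  define c where "c = inverse (1 + (frobenius_norm M)\<^sup>2)"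
  have fn: "(frobenius_norm M)\<^sup>2 = (\<Sum>i<n. (l i)\<^sup>2)" unfolding Ml by (rule frobenius_norm_spectral[OF U])
  define q where "q i = 1 - c * (l i)\<^sup>2" for i
  have q: "\<bar>q i\<bar> < 1" if "i < n" "l i \<noteq> 0" for i
  proof -
    have "(l i)\<^sup>2 \<le> (frobenius_norm M)\<^sup>2" unfolding fn using that by (intro member_le_sum) auto
    moreover have "0 < 1 + (frobenius_norm M)\<^sup>2" by (simp add: add_pos_nonneg)
    ultimately have "c * (l i)\<^sup>2 < 1" by (simp add: c_def field_simps)
    moreover have "c * (l i)\<^sup>2 > 0" unfolding c_def using that
      by (intro mult_pos_pos) (auto simp: add_pos_nonneg)
    ultimately show ?thesis by (auto simp: q_def)
  qed
  define g where "g t i = (1 - q i ^ t) * inverse (l i)" for t i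
  have it: "pinv_iter M t = spectral_mat n U (g t)" for t
  proof (induction t)
    case 0
    have "spectral_mat n U (g 0) = 0\<^sub>m n n"
      by (rule eq_matI) (use U in \<open>auto simp: spectral_mat_index g_def\<close>)
    then show ?case using M by simp
  next
    case (Suc t)
    show ?case
    proof (rule eq_matI)
      fix i j assume "i < dim_row (spectral_mat n U (g (Suc t)))" "j < dim_col (spectral_mat n U (g (Suc t)))"
      then have ij: "i < n" "j < n" using U by auto
      have "1\<^sub>m n - M * pinv_iter M t = spectral_mat n U (\<lambda>i. 1 - l i * g t i)"
      proof (rule eq_matI)
        fix i j assume "i < dim_row (spectral_mat n U (\<lambda>i. 1 - l i * g t i))" "j < dim_col (spectral_mat n U (\<lambda>i. 1 - l i * g t i))"
        then have ij: "i < n" "j < n" using U by auto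
        have "(1\<^sub>m n - M * pinv_iter M t) $$ (i, j) = spectral_mat n U (\<lambda>_. 1) $$ (i, j) - spectral_mat n U (\<lambda>i. l i * g t i) $$ (i, j)"
          unfolding Suc.IH unfolding Ml spectral_mat_mult[OF U] spectral_mat_one[OF U] using ij U by simp
        then show "(1\<^sub>m n - M * pinv_iter M t) $$ (i, j) = spectral_mat n U (\<lambda>i. 1 - l i * g t i) $$ (i, j)"
          using ij by (simp add: spectral_mat_index[OF U] sum_subtractf[symmetric] algebra_simps)
      qed (use U Suc.IH Ml in \<open>auto simp: spectral_mat_mult\<close>)
      then have "M * (1\<^sub>m (dim_row M) - M * pinv_iter M t) = spectral_mat n U (\<lambda>i. l i * (1 - l i * g t i))"
        using M Ml spectral_mat_mult[OF U] by simp
      then have "pinv_iter M (Suc t) $$ (i, j) = spectral_mat n U (g t) $$ (i, j) +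
          complex_of_real c * spectral_mat n U (\<lambda>i. l i * (1 - l i * g t i)) $$ (i, j)"
        using ij U by (simp add: Suc.IH c_def)
      also have "\<dots> = (\<Sum>x<n. complex_of_real (g t x + c * (l x * (1 - l x * g t x))) * U $$ (i, x) * cnj (U $$ (j, x)))"
        using ij by (simp add: spectral_mat_index[OF U] sum_distrib_left sum.distrib[symmetric] algebra_simps)
      also have "\<dots> = (\<Sum>x<n. complex_of_real (g (Suc t) x) * U $$ (i, x) * cnj (U $$ (j, x)))"
      proof -
        have "g t x + c * (l x * (1 - l x * g t x)) = g (Suc t) x" for x
          by (cases "l x = 0") (simp_all add: g_def q_def field_simps power2_eq_square)
        then show ?thesis by simp
      qed
      finally show "pinv_iter M (Suc t) $$ (i, j) = spectral_mat n U (g (Suc t)) $$ (i, j)"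
        using ij by (simp add: spectral_mat_index[OF U])
    qed (use U M Suc.IH in auto)
  qed
  have pv: "pinv M = spectral_mat n U (\<lambda>i. inverse (l i))"
    unfolding Ml by (rule pinv_eqI[OF spectral_mat_is_pinv[OF U]])
  have "(\<lambda>t. g t x) \<longlonglongrightarrow> inverse (l x)" if "x < n" for x
  proof (cases "l x = 0")
    case False
    have "norm (q x) < 1" using q[OF that False] by simp
    then have "(\<lambda>t. (1 - q x ^ t) * inverse (l x)) \<longlonglongrightarrow> (1 - 0) * inverse (l x)"
      by (intro tendsto_intros LIMSEQ_power_zero)
    then show ?thesis by (simp add: g_def)
  qed (simp add: g_def)
  then have "(\<lambda>t. \<Sum>x<n. complex_of_real (g t x) * U $$ (i, x) * cnj (U $$ (j, x)))
      \<longlonglongrightarrow> (\<Sum>x<n. complex_of_real (inverse (l x)) * U $$ (i, x) * cnj (U $$ (j, x)))"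
    by (intro tendsto_intros) auto
  then show ?thesis unfolding it pv using ij by (simp only: spectral_mat_index[OF U])
qed

section \<open>The residual of the Nystrom approximation\<close>

lemma mat_diff_cancel: "A \<in> carrier_mat p q \<Longrightarrow> B \<in> carrier_mat p q \<Longrightarrow> A - B = 0\<^sub>m p q \<Longrightarrow> A = (B :: complex mat)"
proof (rule eq_matI)
  fix i j assume *: "A \<in> carrier_mat p q" "B \<in> carrier_mat p q" "A - B = 0\<^sub>m p q" "i < dim_row B" "j < dim_col B"
  then have "(A - B) $$ (i, j) = 0" by auto
  then show "A $$ (i, j) = B $$ (i, j)" using *(1,2,4,5) by simp
qed auto

lemma adjoint_mult_self_eq_0:
  fixes N :: "complex mat"
  assumes N: "N \<in> carrier_mat p q" and 0: "N * mat_adjoint N = 0\<^sub>m p p"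
  shows "N = 0\<^sub>m p q"
proof (rule eq_matI)
  fix i j assume "i < dim_row (0\<^sub>m p q :: complex mat)" "j < dim_col (0\<^sub>m p q :: complex mat)"
  then have ij: "i < p" "j < q" by auto
  have "complex_of_real (\<Sum>l<q. (cmod (N $$ (i, l)))\<^sup>2) = (N * mat_adjoint N) $$ (i, i)"
    using ij N by (subst mult_mat_index) (auto simp: complex_norm_square intro!: sum.cong simp del: of_real_power)
  then have "(\<Sum>l<q. (cmod (N $$ (i, l)))\<^sup>2) = 0" using 0 ij by (simp del: of_real_sum)
  then show "N $$ (i, j) = 0\<^sub>m p q $$ (i, j)" using ij by (subst (asm) sum_nonneg_eq_0_iff) auto
qed (use N in auto)

text \<open>
  Write M = K^* K with K = F S. The matrix N = (I - M M^+) K^* satisfies N K = M - M M^+ M = 0, hence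
  N N^* = 0 and N = 0. Thus M M^+ acts as the identity on the range of K^*, which contains the range
  of S^* A = K^* F.
\<close>
lemma nystrom_pinv_absorb:
  fixes F S :: "complex mat"
  assumes F: "F \<in> carrier_mat m m" and S: "S \<in> carrier_mat m k"
  defines "A \<equiv> mat_adjoint F * F"
  defines "M \<equiv> mat_adjoint S * A * S"
  shows "M * (pinv M * (mat_adjoint S * A)) = mat_adjoint S * A" "pinv M \<in> carrier_mat k k"
proof -
  have M: "M \<in> carrier_mat k k" "mat_adjoint M = M" using F S by (auto simp: M_def A_def mat_alg)
  let ?X = "pinv M"
  have X: "?X \<in> carrier_mat k k" "M * ?X * M = M" using hermitian_pinv[OF M] by (auto simp: is_pinv_def)
  then show "pinv M \<in> carrier_mat k k" by simp
  have Md: "M = mat_adjoint (F * S) * (F * S)" using F S by (simp add: M_def A_def mat_alg)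
  define K where "K = F * S"
  have K: "K \<in> carrier_mat m k" using F S by (simp add: K_def)
  define N where "N = mat_adjoint K - M * ?X * mat_adjoint K"
  have Nc: "N \<in> carrier_mat k m" using K M X by (auto simp: N_def)
  have NK: "N * K = 0\<^sub>m k k"
  proof -
    have "N * K = M - M * ?X * M" using K M(1) X(1) unfolding N_def Md K_def[symmetric] by (simp add: mat_alg)
    also have "\<dots> = 0\<^sub>m k k" using M X by simp
    finally show ?thesis .
  qed
  have "N * mat_adjoint N = N * K - (N * K) * mat_adjoint (M * ?X)"
    using K M(1) X(1) Nc by (subst (2) N_def) (simp add: mat_alg)
  also have "\<dots> = 0\<^sub>m k k" unfolding NK using M X(1) by (intro eq_matI) auto
  finally have "N = 0\<^sub>m k m" by (rule adjoint_mult_self_eq_0[OF Nc])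
  then have "mat_adjoint K = M * ?X * mat_adjoint K"
    using mat_diff_cancel[OF mat_adjoint_carrier[OF K], of "M * ?X * mat_adjoint K"] K M(1) X(1)
    unfolding N_def by (metis carrier_matD carrier_matI index_mult_mat(2,3) mat_adjoint_dim(2))
  then have "mat_adjoint K * F = M * ?X * mat_adjoint K * F" by simp
  moreover have "mat_adjoint K * F = mat_adjoint S * A" using F S by (simp add: K_def A_def mat_alg)
  moreover have "M * ?X * mat_adjoint K * F = M * (?X * (mat_adjoint K * F))"
    using M(1) X(1) K F by (simp add: mat_alg)
  ultimately show "M * (pinv M * (mat_adjoint S * A)) = mat_adjoint S * A" by simp
qed

text \<open>
  Put T = S M^+ S^* A with M = S^* A S, and Z = I - T. Then Z^* A S = 0 by nystrom_pinv_absorb, and the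
  residual A - A S M^+ S^* A equals A Z = Z^* A Z, which is psd. Any other matrix I - S W differs from
  Z by some S V; the cross terms vanish by Z^* A S = 0, so that passing from Z to I - S W adds the psd
  matrix (S V)^* A (S V). The residual is therefore the smallest of all
  (I - S W)^* A (I - S W) in the Loewner order.
\<close>
lemma nystrom_residual:
  fixes A S :: "complex mat"
  assumes A: "A \<in> carrier_mat m m" and p: "psd A" and S: "S \<in> carrier_mat m k"
  shows "nystrom A S \<in> carrier_mat m m"
    and "\<exists>G\<in>carrier_mat m m. A - nystrom A S = mat_adjoint G * G"
    and "\<And>W. W \<in> carrier_mat k m \<Longrightarrow> \<exists>H\<in>carrier_mat m m.
       mat_adjoint (1\<^sub>m m - S * W) * A * (1\<^sub>m m - S * W) = (A - nystrom A S) + mat_adjoint H * H"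
proof -
  obtain F where F: "F \<in> carrier_mat m m" and AF: "A = mat_adjoint F * F" using psd_factorization[OF A p] by blast
  have Ah: "mat_adjoint A = A" using p by (simp add: psd_def)
  define M where "M = mat_adjoint S * A * S"
  define X where "X = pinv M"
  have X: "X \<in> carrier_mat k k" and MX: "M * (X * (mat_adjoint S * A)) = mat_adjoint S * A"
    using nystrom_pinv_absorb[OF F S] by (simp_all add: X_def M_def AF)
  have L: "nystrom A S = A * S * X * mat_adjoint S * A" by (simp add: nystrom_def X_def M_def)
  show Lc: "nystrom A S \<in> carrier_mat m m" using A S X by (intro carrier_matI) (auto simp: L)
  define T where "T = S * (X * (mat_adjoint S * A))"
  define Z where "Z = 1\<^sub>m m - T"
  have T: "T \<in> carrier_mat m m" and Z: "Z \<in> carrier_mat m m" using A S X by (auto simp: T_def Z_def)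
  have SAZ: "mat_adjoint S * (A * Z) = 0\<^sub>m k m"
  proof -
    have "mat_adjoint S * (A * Z) = mat_adjoint S * A - M * (X * (mat_adjoint S * A))"
      using A S X by (simp add: Z_def T_def M_def mat_alg right_mult_one_mat[of _ m m])
    then show ?thesis unfolding MX using A S by auto
  qed
  have ZAS: "mat_adjoint Z * (A * S) = 0\<^sub>m m k"
  proof -
    have "mat_adjoint Z * (A * S) = mat_adjoint (mat_adjoint S * (A * Z))" using A S Z Ah by (simp add: mat_alg)
    also have "\<dots> = 0\<^sub>m m k" unfolding SAZ by (rule eq_matI) auto
    finally show ?thesis .
  qed
  have AZ: "A * Z = A - nystrom A S"
    using A S X T by (simp add: Z_def T_def L mat_alg right_mult_one_mat[of _ m m])
  have ZAZ: "mat_adjoint Z * (A * Z) = A - nystrom A S"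
  proof -
    have "mat_adjoint Z * (A * Z) = A * Z - mat_adjoint (X * (mat_adjoint S * A)) * (mat_adjoint S * (A * Z))"
      using A S X Z by (subst Z_def) (simp add: T_def mat_alg left_mult_one_mat[of _ m m])
    also have "\<dots> = A * Z" unfolding SAZ using A S X Z by (intro eq_matI) auto
    finally show ?thesis using AZ by simp
  qed
  show "\<exists>G\<in>carrier_mat m m. A - nystrom A S = mat_adjoint G * G"
  proof (intro bexI[of _ "F * Z"])
    show "A - nystrom A S = mat_adjoint (F * Z) * (F * Z)"
      using F Z unfolding ZAZ[symmetric] by (simp add: AF mat_alg)
  qed (use F Z in auto)
  fix W :: "complex mat" assume W: "W \<in> carrier_mat k m"
  define V where "V = X * (mat_adjoint S * A) - W"
  have V: "V \<in> carrier_mat k m" using W X S A by (auto simp: V_def)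
  have eq: "1\<^sub>m m - S * W = Z + S * V"
  proof -
    have "Z + S * V = (1\<^sub>m m - T) + (T - S * W)" using W X S A by (simp add: Z_def V_def T_def mat_alg)
    also have "\<dots> = 1\<^sub>m m - S * W" using T S W by (intro eq_matI) auto
    finally show ?thesis by simp
  qed
  have SV: "S * V \<in> carrier_mat m m" using S V by simp
  have c1: "mat_adjoint Z * (A * (S * V)) = 0\<^sub>m m m"
  proof -
    have "mat_adjoint Z * (A * (S * V)) = (mat_adjoint Z * (A * S)) * V" using A S V Z by (simp add: mat_mult_assoc)
    then show ?thesis unfolding ZAS using V by simp
  qed
  have c2: "mat_adjoint (S * V) * (A * Z) = 0\<^sub>m m m"
  proof -
    have "mat_adjoint (S * V) * (A * Z) = mat_adjoint V * (mat_adjoint S * (A * Z))"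
      using A S V Z by (simp add: mat_mult_assoc mat_adjoint_mult)
    then show ?thesis unfolding SAZ using V by (simp add: mat_adjoint_carrier)
  qed
  have c3: "mat_adjoint (S * V) * (A * (S * V)) = mat_adjoint (F * (S * V)) * (F * (S * V))"
  proof -
    have "mat_adjoint Y * (mat_adjoint F * F * Y) = mat_adjoint (F * Y) * (F * Y)" if "Y \<in> carrier_mat m m" for Y
      using F that by (simp add: mat_alg)
    then show ?thesis using SV by (simp add: AF)
  qed
  have exp: "mat_adjoint (Z + Y) * A * (Z + Y) =
     (mat_adjoint Z * (A * Z) + mat_adjoint Y * (A * Z)) + (mat_adjoint Z * (A * Y) + mat_adjoint Y * (A * Y))"
    if Y: "Y \<in> carrier_mat m m" for Y
  proof -
    have "mat_adjoint (Z + Y) * A * (Z + Y) = (mat_adjoint Z + mat_adjoint Y) * (A * Z + A * Y)"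
      using A Y Z by (simp add: mat_mult_assoc mat_mult_add mat_adjoint_add)
    then show ?thesis using A Y Z by (simp add: mat_mult_add mat_add_mult)
  qed
  have "mat_adjoint (1\<^sub>m m - S * W) * A * (1\<^sub>m m - S * W) =
     (mat_adjoint Z * (A * Z) + mat_adjoint (S * V) * (A * Z)) + (mat_adjoint Z * (A * (S * V)) + mat_adjoint (S * V) * (A * (S * V)))"
    unfolding eq by (rule exp[OF SV])
  also have "\<dots> = mat_adjoint Z * (A * Z) + mat_adjoint (F * (S * V)) * (F * (S * V))"
    unfolding c1 c2 c3 using A SV Z F by (intro eq_matI) auto
  finally show "\<exists>H\<in>carrier_mat m m.
       mat_adjoint (1\<^sub>m m - S * W) * A * (1\<^sub>m m - S * W) = (A - nystrom A S) + mat_adjoint H * H"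
    unfolding ZAZ using F S V by (intro bexI[of _ "F * (S * V)"]) auto
qed

lemma frobenius_norm_nonneg [simp]: "frobenius_norm A \<ge> 0"
  unfolding frobenius_norm_def by (intro real_sqrt_ge_zero sum_nonneg) auto

lemma frobenius_norm_L2_set: "frobenius_norm A = L2_set (\<lambda>ij. norm (A $$ ij)) ({..<dim_row A} \<times> {..<dim_col A})"
  by (simp add: frobenius_norm_def L2_set_def sum.cartesian_product case_prod_beta')

lemma frobenius_norm_triangle_minus:
  fixes A :: "complex mat"
  assumes "dim_row A = dim_row B" "dim_col A = dim_col B"
  shows "frobenius_norm (A - B) \<le> frobenius_norm A + frobenius_norm B"
proof -
  have "frobenius_norm (A - B) \<le> L2_set (\<lambda>ij. norm (A $$ ij) + norm (B $$ ij)) ({..<dim_row A} \<times> {..<dim_col A})"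
    unfolding frobenius_norm_L2_set using assms by (auto intro!: L2_set_mono norm_triangle_ineq4)
  also have "\<dots> \<le> frobenius_norm A + frobenius_norm B"
    unfolding frobenius_norm_L2_set using assms by (auto intro!: L2_set_triangle_ineq)
  finally show ?thesis .
qed

lemma frobenius_norm_adjoint [simp]: "frobenius_norm (mat_adjoint (A :: complex mat)) = frobenius_norm A"
  unfolding frobenius_norm_def by (subst sum.swap) simp

lemma cmod_trace_adjoint_mult_le:
  fixes R T :: "complex mat"
  assumes R: "R \<in> carrier_mat p m" and T: "T \<in> carrier_mat p m"
  shows "cmod (mat_trace (mat_adjoint R * T)) \<le> frobenius_norm R * frobenius_norm T"
proof (rule power2_le_imp_le)
  have "mat_trace (mat_adjoint R * T) = (\<Sum>i<m. \<Sum>j<p. cnj (R $$ (j, i)) * T $$ (j, i))"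
    using R T by (auto simp: mat_trace_def mult_mat_index simp del: index_mult_mat(1) intro!: sum.cong)
  also have "\<dots> = (\<Sum>ij\<in>{..<p} \<times> {..<m}. T $$ ij * cnj (R $$ ij))"
    by (subst sum.swap) (simp add: sum.cartesian_product case_prod_beta' mult.commute)
  finally have "(cmod (mat_trace (mat_adjoint R * T)))\<^sup>2 \<le>
     (\<Sum>ij\<in>{..<p} \<times> {..<m}. (cmod (T $$ ij))\<^sup>2) * (\<Sum>ij\<in>{..<p} \<times> {..<m}. (cmod (R $$ ij))\<^sup>2)"
    by (simp only: complex_cauchy_schwarz)
  then show "(cmod (mat_trace (mat_adjoint R * T)))\<^sup>2 \<le> (frobenius_norm R * frobenius_norm T)\<^sup>2"
    using R T unfolding power_mult_distrib frobenius_norm_square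
    by (simp add: sum.cartesian_product case_prod_beta' mult.commute)
qed simp

text \<open>
  tr (R D) = |G H^*|_F^2 is nonnegative, so |R|_F^2 is at most tr (R (R + D)), which by Cauchy--Schwarz
  for the trace inner product is at most |R|_F |R + D|_F.
\<close>
lemma frobenius_norm_mono_psd:
  fixes R G H :: "complex mat"
  assumes G: "G \<in> carrier_mat m m" and H: "H \<in> carrier_mat m m"
  defines "R \<equiv> mat_adjoint G * G" and "D \<equiv> mat_adjoint H * H"
  shows "frobenius_norm R \<le> frobenius_norm (R + D)"
proof -
  have R: "R \<in> carrier_mat m m" and D: "D \<in> carrier_mat m m" and Rh: "mat_adjoint R = R"
    using G H by (auto simp: R_def D_def mat_alg)
  have "mat_trace (mat_adjoint R * (R + D)) = complex_of_real ((frobenius_norm R)\<^sup>2) + mat_trace (R * D)"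
    unfolding frobenius_norm_square_trace using R D
    by (simp add: Rh mat_alg mat_trace_def sum.distrib)
  also have "mat_trace (R * D) = mat_trace (mat_adjoint (G * mat_adjoint H) * (G * mat_adjoint H))"
  proof -
    have "R * D = (mat_adjoint G * (G * mat_adjoint H)) * H" using G H by (simp add: R_def D_def mat_alg)
    then have "mat_trace (R * D) = mat_trace (H * (mat_adjoint G * (G * mat_adjoint H)))"
      using G H by (simp add: mat_trace_comm)
    then show ?thesis using G H by (simp add: mat_alg)
  qed
  also have "\<dots> = complex_of_real ((frobenius_norm (G * mat_adjoint H))\<^sup>2)" unfolding frobenius_norm_square_trace ..
  finally have "(frobenius_norm R)\<^sup>2 \<le> Re (mat_trace (mat_adjoint R * (R + D)))" by simp
  also have "\<dots> \<le> cmod (mat_trace (mat_adjoint R * (R + D)))" by (rule complex_Re_le_cmod)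
  also have "\<dots> \<le> frobenius_norm R * frobenius_norm (R + D)"
    by (rule cmod_trace_adjoint_mult_le) (use R D in auto)
  finally have *: "frobenius_norm R * frobenius_norm R \<le> frobenius_norm R * frobenius_norm (R + D)"
    by (simp add: power2_eq_square)
  show ?thesis
  proof (cases "frobenius_norm R = 0")
    case False
    then have "frobenius_norm R > 0" using frobenius_norm_nonneg[of R] by linarith
    then show ?thesis using * by simp
  qed simp
qed

definition vnorm2 :: "complex vec \<Rightarrow> real" where
  "vnorm2 v = (\<Sum>i<dim_vec v. (cmod (v $ i))\<^sup>2)"

lemma vnorm2_nonneg [simp]: "vnorm2 v \<ge> 0"
  by (auto simp: vnorm2_def intro: sum_nonneg)

lemma vnorm2_quadratic_form:
  fixes F :: "complex mat"
  assumes F: "F \<in> carrier_mat p n" and v: "v \<in> carrier_vec n"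
  shows "complex_of_real (vnorm2 (F *\<^sub>v v)) = ((mat_adjoint F * F) *\<^sub>v v) \<bullet>c v"
  using adjoint_mult_self_quadratic_form[OF F v] F by (simp add: vnorm2_def)

lemma adjoint_scalar_prod:
  fixes P :: "complex mat"
  assumes P: "P \<in> carrier_mat k n" and z: "z \<in> carrier_vec k" and t: "t \<in> carrier_vec n"
  shows "(mat_adjoint P *\<^sub>v z) \<bullet>c t = z \<bullet>c (P *\<^sub>v t)"
proof -
  have "(mat_adjoint P *\<^sub>v z) \<bullet>c t = (\<Sum>j<n. \<Sum>i<k. cnj (P $$ (i, j)) * z $ i * cnj (t $ j))"
    using P z t by (simp add: scalar_prod_def atLeast0LessThan sum_distrib_right)
  also have "\<dots> = (\<Sum>i<k. \<Sum>j<n. z $ i * (cnj (P $$ (i, j)) * cnj (t $ j)))"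
    by (subst sum.swap) (simp add: mult_ac)
  also have "\<dots> = z \<bullet>c (P *\<^sub>v t)"
    using P z t by (simp add: scalar_prod_def atLeast0LessThan sum_distrib_left)
  finally show ?thesis .
qed

lemma cscalar_prod_bound:
  fixes v w :: "complex vec"
  assumes "dim_vec v = dim_vec w"
  shows "(cmod (v \<bullet>c w))\<^sup>2 \<le> vnorm2 v * vnorm2 w"
  using complex_cauchy_schwarz[of "\<lambda>i. v $ i" "\<lambda>i. w $ i" "{..<dim_vec w}"] assms
  by (simp add: scalar_prod_def vnorm2_def atLeast0LessThan)

text \<open>
  N = (P^* P)^{-1} P^*. For t = N z one has P^* P t = P^* z, hence |P t|^2 = (z, P t) and |P t| is at
  most |z|; the lower bound on P turns this into a bound on |t|.
\<close>
lemma bounded_left_inverse: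
  fixes P :: "complex mat"
  assumes P: "P \<in> carrier_mat k n" and c: "c > 0"
    and low: "\<And>t. t \<in> carrier_vec n \<Longrightarrow> c * vnorm2 t \<le> vnorm2 (P *\<^sub>v t)"
  shows "\<exists>N\<in>carrier_mat n k. N * P = 1\<^sub>m n \<and> (\<forall>z\<in>carrier_vec k. c * vnorm2 (N *\<^sub>v z) \<le> vnorm2 z)"
proof -
  let ?G = "mat_adjoint P * P"
  have Gc: "?G \<in> carrier_mat n n" "mat_adjoint ?G = ?G" using P by (auto simp: mat_alg)
  obtain U l where U: "unitary_mat n U" and Gl: "?G = spectral_mat n U l" using hermitian_spectral_mat[OF Gc] by blast
  have Uc: "U \<in> carrier_mat n n" using U by (simp add: unitary_mat_def)
  have l: "l i > 0" if i: "i < n" for i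
  proof -
    have "complex_of_real (vnorm2 (P *\<^sub>v col U i)) = complex_of_real (l i)"
      using vnorm2_quadratic_form[OF P, of "col U i"] spectral_quadratic_form[OF U i, of l] Gl Uc by (simp add: carrier_vecI)
    then have "vnorm2 (P *\<^sub>v col U i) = l i" using of_real_eq_iff by blast
    moreover have "vnorm2 (col U i) = 1" using unitary_col_norm[OF U i] Uc i by (simp add: vnorm2_def)
    ultimately show ?thesis using low[of "col U i"] Uc c by (simp add: carrier_vecI)
  qed
  let ?I = "spectral_mat n U (\<lambda>i. inverse (l i))"
  have I: "?I \<in> carrier_mat n n" using U by (rule spectral_mat_carrier)
  have IG: "?I * ?G = 1\<^sub>m n" "?G * ?I = 1\<^sub>m n"
  proof -
    have "spectral_mat n U (\<lambda>i. inverse (l i) * l i) = spectral_mat n U (\<lambda>_. 1)" "spectral_mat n U (\<lambda>i. l i * inverse (l i)) = spectral_mat n U (\<lambda>_. 1)"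
      by (rule spectral_mat_cong, use l in force)+
    then show "?I * ?G = 1\<^sub>m n" "?G * ?I = 1\<^sub>m n"
      unfolding Gl spectral_mat_mult[OF U] by (simp_all add: spectral_mat_one[OF U])
  qed
  define N where "N = ?I * mat_adjoint P"
  have N: "N \<in> carrier_mat n k" using I P by (intro carrier_matI) (auto simp: N_def)
  have 1: "N * P = 1\<^sub>m n" using I P IG by (simp add: N_def mat_alg)
  have 2: "c * vnorm2 (N *\<^sub>v z) \<le> vnorm2 z" if z: "z \<in> carrier_vec k" for z
  proof -
    define t where "t = N *\<^sub>v z"
    have t: "t \<in> carrier_vec n" using N z by (simp add: t_def)
    have "?G * N = mat_adjoint P"
    proof -
      have "?G * N = (?G * ?I) * mat_adjoint P" using I P by (simp add: N_def mat_alg)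
      then show ?thesis using IG P by simp
    qed
    then have Gt: "?G *\<^sub>v t = mat_adjoint P *\<^sub>v z"
      unfolding t_def using Gc N z by (metis assoc_mult_mat_vec)
    have "complex_of_real (vnorm2 (P *\<^sub>v t)) = z \<bullet>c (P *\<^sub>v t)"
      unfolding vnorm2_quadratic_form[OF P t] Gt by (rule adjoint_scalar_prod[OF P z t])
    then have "(vnorm2 (P *\<^sub>v t))\<^sup>2 \<le> vnorm2 z * vnorm2 (P *\<^sub>v t)"
      using cscalar_prod_bound[of z "P *\<^sub>v t"] P z by (metis carrier_matD(1) carrier_vecD dim_mult_mat_vec norm_of_real power2_abs)
    then have "vnorm2 (P *\<^sub>v t) \<le> vnorm2 z"
      using vnorm2_nonneg[of "P *\<^sub>v t"] vnorm2_nonneg[of z]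
      by (cases "vnorm2 (P *\<^sub>v t) = 0") (auto simp: power2_eq_square)
    then show ?thesis using low[OF t] by (simp add: t_def)
  qed
  show ?thesis using N 1 2 by blast
qed

lemma frobenius_norm_square_cols: "(frobenius_norm (A :: complex mat))\<^sup>2 = (\<Sum>j<dim_col A. vnorm2 (col A j))"
  unfolding frobenius_norm_square vnorm2_def by (subst sum.swap) simp

lemma frobenius_norm_mult_le:
  fixes V :: "complex mat"
  assumes V: "V \<in> carrier_mat p k" and X: "X \<in> carrier_mat k q" and kap: "\<kappa> \<ge> 0"
    and bd: "\<And>z. z \<in> carrier_vec k \<Longrightarrow> vnorm2 (V *\<^sub>v z) \<le> \<kappa>\<^sup>2 * vnorm2 z"
  shows "frobenius_norm (V * X) \<le> \<kappa> * frobenius_norm X"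
proof (rule power2_le_imp_le)
  have "(frobenius_norm (V * X))\<^sup>2 = (\<Sum>j<q. vnorm2 (V *\<^sub>v col X j))"
    unfolding frobenius_norm_square_cols using X by (intro sum.cong arg_cong[of _ _ vnorm2] col_mult2[OF V X]) auto
  also have "\<dots> \<le> (\<Sum>j<q. \<kappa>\<^sup>2 * vnorm2 (col X j))" using X by (intro sum_mono bd) (auto intro: carrier_vecI)
  also have "\<dots> = (\<kappa> * frobenius_norm X)\<^sup>2"
    using X by (simp add: power_mult_distrib frobenius_norm_square_cols sum_distrib_left)
  finally show "(frobenius_norm (V * X))\<^sup>2 \<le> (\<kappa> * frobenius_norm X)\<^sup>2" .
qed (use kap in simp)

lemma vnorm2_isometry:
  assumes Q: "Q \<in> carrier_mat m p" and QQ: "mat_adjoint Q * Q = 1\<^sub>m p" and t: "t \<in> carrier_vec p"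
  shows "vnorm2 (Q *\<^sub>v t) = vnorm2 t"
proof -
  have "complex_of_real (vnorm2 (Q *\<^sub>v t)) = t \<bullet>c t"
    unfolding vnorm2_quadratic_form[OF Q t] QQ using t by simp
  also have "\<dots> = complex_of_real (vnorm2 t)"
    using t by (simp add: scalar_prod_def vnorm2_def atLeast0LessThan complex_norm_square del: of_real_power)
  finally show ?thesis using of_real_eq_iff by blast
qed

lemma cmod_diff_square_le: "(cmod (a - b))\<^sup>2 \<le> 2 * (cmod a)\<^sup>2 + 2 * (cmod b)\<^sup>2"
proof -
  have "(cmod (a - b))\<^sup>2 \<le> (cmod a + cmod b)\<^sup>2" by (intro power_mono norm_triangle_ineq4) auto
  also have "\<dots> \<le> 2 * (cmod a)\<^sup>2 + 2 * (cmod b)\<^sup>2"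
    using sum_squares_bound[of "cmod a" "cmod b"] by (simp add: power2_sum)
  finally show ?thesis .
qed

lemma vnorm2_diff_le:
  assumes "dim_vec a = dim_vec b"
  shows "vnorm2 (a - b) \<le> 2 * vnorm2 a + 2 * vnorm2 b"
proof -
  have "vnorm2 (a - b) = (\<Sum>i<dim_vec b. (cmod (a $ i - b $ i))\<^sup>2)" using assms by (simp add: vnorm2_def)
  also have "\<dots> \<le> (\<Sum>i<dim_vec b. 2 * (cmod (a $ i))\<^sup>2 + 2 * (cmod (b $ i))\<^sup>2)"
    by (intro sum_mono cmod_diff_square_le)
  also have "\<dots> = 2 * vnorm2 a + 2 * vnorm2 b"
    using assms by (simp add: vnorm2_def sum.distrib sum_distrib_left)
  finally show ?thesis .
qed

text \<open>
  V S^* is an oblique projection onto the range of Q that sees its argument only through the sketch: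
  V = Q N with a bounded left inverse N of S^* Q.
\<close>
lemma sketch_oblique_projector:
  fixes Q S :: "complex mat"
  assumes Q: "Q \<in> carrier_mat m p" and QQ: "mat_adjoint Q * Q = 1\<^sub>m p"
    and S: "S \<in> carrier_mat m k" and kap: "\<kappa> > 0"
    and low: "\<And>t. t \<in> carrier_vec p \<Longrightarrow> vnorm2 t \<le> \<kappa>\<^sup>2 * vnorm2 ((mat_adjoint S * Q) *\<^sub>v t)"
  obtains V where "V \<in> carrier_mat m k" "V * (mat_adjoint S * Q) = Q"
    "\<And>z. z \<in> carrier_vec k \<Longrightarrow> vnorm2 (V *\<^sub>v z) \<le> \<kappa>\<^sup>2 * vnorm2 z"
proof -
  have P: "mat_adjoint S * Q \<in> carrier_mat k p" using S Q by (intro carrier_matI) auto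
  have "inverse (\<kappa>\<^sup>2) * vnorm2 t \<le> vnorm2 ((mat_adjoint S * Q) *\<^sub>v t)" if "t \<in> carrier_vec p" for t
    using low[OF that] kap by (simp add: field_simps)
  from bounded_left_inverse[OF P _ this] kap obtain N where N: "N \<in> carrier_mat p k" "N * (mat_adjoint S * Q) = 1\<^sub>m p"
    and Nb: "\<forall>z\<in>carrier_vec k. inverse (\<kappa>\<^sup>2) * vnorm2 (N *\<^sub>v z) \<le> vnorm2 z" by auto
  show ?thesis
  proof (rule that[of "Q * N"])
    show "Q * N \<in> carrier_mat m k" using Q N by simp
    have "Q * N * (mat_adjoint S * Q) = Q * (N * (mat_adjoint S * Q))" using Q N S by (simp add: mat_mult_assoc)
    then show "Q * N * (mat_adjoint S * Q) = Q" unfolding N(2) using Q by simp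
    fix z :: "complex vec" assume z: "z \<in> carrier_vec k"
    have Nz: "N *\<^sub>v z \<in> carrier_vec p" using N z by simp
    have "vnorm2 (Q * N *\<^sub>v z) = vnorm2 (N *\<^sub>v z)"
      using vnorm2_isometry[OF Q QQ Nz] assoc_mult_mat_vec[OF Q N(1) z] by simp
    then show "vnorm2 (Q * N *\<^sub>v z) \<le> \<kappa>\<^sup>2 * vnorm2 z"
      using Nb z kap by (auto simp: field_simps)
  qed
qed

text \<open>
  Choose W = V^* in the minimality property of the Nystrom residual. As V S^* Q = Q, the matrix
  Z = I - V S^* annihilates the low-rank part A - E = Q C, so that Z A Z^* = Z E Z^*. Expanding both
  factors Z gives the four terms of the first bound. For the trace, the decomposition of E gives
  tr (Z E Z^*) = sum_j s_j (Z u_j, Z v_j), and a b is at most (a^2 + b^2) / 2.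
\<close>
lemma nystrom_residual_bounds:
  fixes A E Q C S :: "complex mat"
  assumes A: "A \<in> carrier_mat m m" and p: "psd A" and E: "E \<in> carrier_mat m m"
    and AE: "A - E = Q * C" and Q: "Q \<in> carrier_mat m p" and QQ: "mat_adjoint Q * Q = 1\<^sub>m p" and C: "C \<in> carrier_mat p m"
    and S: "S \<in> carrier_mat m k" and kap: "\<kappa> > 0"
    and low: "\<And>t. t \<in> carrier_vec p \<Longrightarrow> vnorm2 t \<le> \<kappa>\<^sup>2 * vnorm2 ((mat_adjoint S * Q) *\<^sub>v t)"
  shows "frobenius_norm (A - nystrom A S) \<le> frobenius_norm E + \<kappa> * frobenius_norm (mat_adjoint S * E)
      + \<kappa> * frobenius_norm (E * S) + \<kappa>\<^sup>2 * frobenius_norm (mat_adjoint S * E * S)" (is ?frob)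
    and "(\<And>j. j < m \<Longrightarrow> s j \<ge> 0 \<and> (\<Sum>x<m. (cmod (u j x))\<^sup>2) \<le> 1 \<and> (\<Sum>x<m. (cmod (v j x))\<^sup>2) \<le> 1) \<Longrightarrow>
     (\<And>x y. x < m \<Longrightarrow> y < m \<Longrightarrow> E $$ (x, y) = (\<Sum>j<m. complex_of_real (s j) * u j x * cnj (v j y))) \<Longrightarrow>
     Re (mat_trace (A - nystrom A S)) \<le>
       (\<Sum>j<m. s j * (2 + \<kappa>\<^sup>2 * (vnorm2 (mat_adjoint S *\<^sub>v Matrix.vec m (u j)) + vnorm2 (mat_adjoint S *\<^sub>v Matrix.vec m (v j)))))"
proof -
  obtain V where V: "V \<in> carrier_mat m k" and VS: "V * (mat_adjoint S * Q) = Q"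
    and Vb: "\<And>z. z \<in> carrier_vec k \<Longrightarrow> vnorm2 (V *\<^sub>v z) \<le> \<kappa>\<^sup>2 * vnorm2 z"
    using sketch_oblique_projector[OF Q QQ S kap low] by metis
  define W where "W = mat_adjoint V"
  have W: "W \<in> carrier_mat k m" using V by (simp add: W_def mat_adjoint_carrier)
  define R where "R = A - nystrom A S"
  obtain G where G: "G \<in> carrier_mat m m" "R = mat_adjoint G * G" using nystrom_residual(2)[OF A p S] by (auto simp: R_def)
  obtain H where H: "H \<in> carrier_mat m m"
    and RH: "mat_adjoint (1\<^sub>m m - S * W) * A * (1\<^sub>m m - S * W) = R + mat_adjoint H * H"
    using nystrom_residual(3)[OF A p S W] by (auto simp: R_def)
  define Z where "Z = 1\<^sub>m m - V * mat_adjoint S"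
  have Z: "Z \<in> carrier_mat m m" using V S by (auto simp: Z_def)
  have ZZ: "mat_adjoint (1\<^sub>m m - S * W) = Z" "1\<^sub>m m - S * W = mat_adjoint Z"
    using V S by (simp_all add: Z_def W_def mat_adjoint_minus mat_adjoint_mult)
  have ZQ: "Z * (Q * C) = 0\<^sub>m m m"
  proof -
    have "Z * (Q * C) = Q * C - (V * (mat_adjoint S * Q)) * C"
      using V S Q C by (simp add: Z_def mat_mult_assoc mat_minus_mult left_mult_one_mat[of _ m m])
    then show ?thesis unfolding VS using Q C by simp
  qed
  have AEQ: "A = E + Q * C" unfolding AE[symmetric] using A E by (intro eq_matI) auto
  have "Z * A = Z * E + Z * (Q * C)" unfolding AEQ using Z E Q C by (simp add: mat_mult_add)
  then have ZA: "Z * A = Z * E" unfolding ZQ using Z E by simp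
  have T: "R + mat_adjoint H * H = Z * E * mat_adjoint Z" using RH ZA unfolding ZZ by simp
  have SE: "mat_adjoint S * E \<in> carrier_mat k m" and ES: "E * S \<in> carrier_mat m k"
    and SES: "mat_adjoint S * E * S \<in> carrier_mat k k" using S E by (auto intro!: carrier_matI)
  have "Z * E * mat_adjoint Z = (E - V * (mat_adjoint S * E)) - (E - V * (mat_adjoint S * E)) * (S * W)"
  proof -
    have "Z * E = E - V * (mat_adjoint S * E)" using V S E by (simp add: Z_def mat_mult_assoc mat_minus_mult left_mult_one_mat[of _ m m])
    moreover have "K * mat_adjoint Z = K - K * (S * W)" if "K \<in> carrier_mat m m" for K
    proof -
      have "K * (1\<^sub>m m - S * W) = K - K * (S * W)"
        using that S W by (simp add: mat_mult_minus right_mult_one_mat[of _ m m])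
      then show ?thesis unfolding ZZ(2) .
    qed
    moreover have "E - V * (mat_adjoint S * E) \<in> carrier_mat m m" using V S E by (intro carrier_matI) auto
    ultimately show ?thesis by metis
  qed
  also have "(E - V * (mat_adjoint S * E)) * (S * W) = (E * S) * W - V * ((mat_adjoint S * E * S) * W)"
    using V S E W by (simp add: mat_mult_assoc mat_minus_mult)
  finally have dec: "R + mat_adjoint H * H = (E - V * (mat_adjoint S * E)) - ((E * S) * W - V * ((mat_adjoint S * E * S) * W))"
    using T by simp
  have kap0: "\<kappa> \<ge> 0" using kap by simp
  have right: "frobenius_norm (X * W) \<le> \<kappa> * frobenius_norm X" if X: "X \<in> carrier_mat q k" for X q
  proof -
    have "frobenius_norm (X * W) = frobenius_norm (V * mat_adjoint X)"
      using X V by (subst frobenius_norm_adjoint[symmetric]) (simp add: W_def mat_adjoint_mult)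
    also have "\<dots> \<le> \<kappa> * frobenius_norm (mat_adjoint X)"
      by (rule frobenius_norm_mult_le[OF V mat_adjoint_carrier[OF X] kap0 Vb])
    finally show ?thesis by simp
  qed
  have "frobenius_norm R \<le> frobenius_norm (R + mat_adjoint H * H)"
    unfolding G(2) by (rule frobenius_norm_mono_psd[OF G(1) H])
  also have "\<dots> \<le> frobenius_norm (E - V * (mat_adjoint S * E)) + frobenius_norm ((E * S) * W - V * ((mat_adjoint S * E * S) * W))"
    unfolding dec using V S E W by (intro frobenius_norm_triangle_minus) auto
  also have "\<dots> \<le> (frobenius_norm E + frobenius_norm (V * (mat_adjoint S * E))) +
      (frobenius_norm ((E * S) * W) + frobenius_norm (V * ((mat_adjoint S * E * S) * W)))"
    using V S E W by (intro add_mono frobenius_norm_triangle_minus) auto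
  also have "\<dots> \<le> (frobenius_norm E + \<kappa> * frobenius_norm (mat_adjoint S * E)) +
      (\<kappa> * frobenius_norm (E * S) + \<kappa> * (\<kappa> * frobenius_norm (mat_adjoint S * E * S)))"
  proof (intro add_mono order_refl)
    show "frobenius_norm (V * (mat_adjoint S * E)) \<le> \<kappa> * frobenius_norm (mat_adjoint S * E)"
      by (rule frobenius_norm_mult_le[OF V SE kap0 Vb])
    show "frobenius_norm ((E * S) * W) \<le> \<kappa> * frobenius_norm (E * S)" by (rule right[OF ES])
    have "frobenius_norm (V * ((mat_adjoint S * E * S) * W)) \<le> \<kappa> * frobenius_norm ((mat_adjoint S * E * S) * W)"
      using mult_carrier_mat[OF SES W] by (rule frobenius_norm_mult_le[OF V _ kap0 Vb])
    also have "\<dots> \<le> \<kappa> * (\<kappa> * frobenius_norm (mat_adjoint S * E * S))"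
      by (intro mult_left_mono right[OF SES] kap0)
    finally show "frobenius_norm (V * ((mat_adjoint S * E * S) * W)) \<le> \<kappa> * (\<kappa> * frobenius_norm (mat_adjoint S * E * S))" .
  qed
  finally show ?frob by (simp add: R_def power2_eq_square)

  assume uv: "\<And>j. j < m \<Longrightarrow> s j \<ge> 0 \<and> (\<Sum>x<m. (cmod (u j x))\<^sup>2) \<le> 1 \<and> (\<Sum>x<m. (cmod (v j x))\<^sup>2) \<le> 1"
    and Es: "\<And>x y. x < m \<Longrightarrow> y < m \<Longrightarrow> E $$ (x, y) = (\<Sum>j<m. complex_of_real (s j) * u j x * cnj (v j y))"
  define P1 where "P1 = Matrix.mat m m (\<lambda>(x, j). complex_of_real (s j) * u j x)"
  define P2 where "P2 = Matrix.mat m m (\<lambda>(x, j). v j x)"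
  have P: "P1 \<in> carrier_mat m m" "P2 \<in> carrier_mat m m" by (auto simp: P1_def P2_def)
  have EP: "E = P1 * mat_adjoint P2"
  proof (rule eq_matI)
    fix x y assume "x < dim_row (P1 * mat_adjoint P2)" "y < dim_col (P1 * mat_adjoint P2)"
    then have "x < m" "y < m" using P by auto
    then show "E $$ (x, y) = (P1 * mat_adjoint P2) $$ (x, y)"
      using Es P by (subst mult_mat_index) (auto simp: P1_def P2_def)
  qed (use E P in auto)
  define a where "a j = Z *\<^sub>v Matrix.vec m (u j)" for j
  define b where "b j = Z *\<^sub>v Matrix.vec m (v j)" for j
  have ZP1: "(Z * P1) $$ (x, j) = complex_of_real (s j) * a j $ x" if "x < m" "j < m" for x j
    using that Z P by (subst mult_mat_index) (auto simp: a_def P1_def scalar_prod_def atLeast0LessThan sum_distrib_left mult_ac)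
  have ZP2: "(Z * P2) $$ (x, j) = b j $ x" if "x < m" "j < m" for x j
    using that Z P by (subst mult_mat_index) (auto simp: b_def P2_def scalar_prod_def atLeast0LessThan)
  have "Z * E * mat_adjoint Z = (Z * P1) * mat_adjoint (Z * P2)"
    unfolding EP using Z P by (simp add: mat_mult_assoc mat_adjoint_mult)
  then have "mat_trace (Z * E * mat_adjoint Z) = (\<Sum>x<m. \<Sum>j<m. (Z * P1) $$ (x, j) * cnj ((Z * P2) $$ (x, j)))"
    using Z P by (auto simp: mat_trace_def mult_mat_index simp del: index_mult_mat(1) intro!: sum.cong)
  also have "\<dots> = (\<Sum>j<m. \<Sum>x<m. (complex_of_real (s j) * a j $ x) * cnj (b j $ x))"
    by (subst sum.swap) (auto simp: ZP1 ZP2 intro!: sum.cong)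
  finally have "Re (mat_trace (Z * E * mat_adjoint Z)) \<le> cmod (\<Sum>j<m. \<Sum>x<m. (complex_of_real (s j) * a j $ x) * cnj (b j $ x))"
    by (simp only: complex_Re_le_cmod)
  also have "\<dots> \<le> (\<Sum>j<m. \<Sum>x<m. s j * (((cmod (a j $ x))\<^sup>2 + (cmod (b j $ x))\<^sup>2) / 2))"
  proof (intro sum_norm_le)
    fix j x assume jx: "j \<in> {..<m}" "x \<in> {..<m}"
    have "cmod (a j $ x) * cmod (b j $ x) \<le> ((cmod (a j $ x))\<^sup>2 + (cmod (b j $ x))\<^sup>2) / 2"
      using sum_squares_bound[of "cmod (a j $ x)" "cmod (b j $ x)"] by simp
    then show "cmod (complex_of_real (s j) * a j $ x * cnj (b j $ x)) \<le> s j * (((cmod (a j $ x))\<^sup>2 + (cmod (b j $ x))\<^sup>2) / 2)"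
      using uv[of j] jx by (simp add: norm_mult mult.assoc mult_left_mono)
  qed
  also have "\<dots> = (\<Sum>j<m. s j * ((vnorm2 (a j) + vnorm2 (b j)) / 2))"
  proof (intro sum.cong refl)
    fix j
    have "(\<Sum>x<m. s j * (((cmod (a j $ x))\<^sup>2 + (cmod (b j $ x))\<^sup>2) / 2))
        = s j * ((\<Sum>x<m. (cmod (a j $ x))\<^sup>2 + (cmod (b j $ x))\<^sup>2) / 2)"
      by (simp only: sum_distrib_left sum_divide_distrib)
    then show "(\<Sum>x<m. s j * (((cmod (a j $ x))\<^sup>2 + (cmod (b j $ x))\<^sup>2) / 2)) = s j * ((vnorm2 (a j) + vnorm2 (b j)) / 2)"
      using Z by (simp add: vnorm2_def a_def b_def sum.distrib)
  qed
  also have "\<dots> \<le> (\<Sum>j<m. s j * (2 + \<kappa>\<^sup>2 * (vnorm2 (mat_adjoint S *\<^sub>v Matrix.vec m (u j)) + vnorm2 (mat_adjoint S *\<^sub>v Matrix.vec m (v j)))))"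
  proof (intro sum_mono mult_left_mono)
    fix j assume j: "j \<in> {..<m}"
    have *: "vnorm2 (Z *\<^sub>v Matrix.vec m w) \<le> 2 + 2 * \<kappa>\<^sup>2 * vnorm2 (mat_adjoint S *\<^sub>v Matrix.vec m w)" if "(\<Sum>x<m. (cmod (w x))\<^sup>2) \<le> 1" for w
    proof -
      let ?w = "Matrix.vec m w"
      have Sw: "mat_adjoint S *\<^sub>v ?w \<in> carrier_vec k" using S by (auto intro: carrier_vecI)
      have "Z *\<^sub>v ?w = ?w - V *\<^sub>v (mat_adjoint S *\<^sub>v ?w)"
      proof -
        have "Z *\<^sub>v ?w = 1\<^sub>m m *\<^sub>v ?w - (V * mat_adjoint S) *\<^sub>v ?w"
          unfolding Z_def by (rule minus_mult_distrib_mat_vec) (use V S in \<open>auto intro: mat_adjoint_carrier\<close>)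
        also have "(V * mat_adjoint S) *\<^sub>v ?w = V *\<^sub>v (mat_adjoint S *\<^sub>v ?w)"
          by (rule assoc_mult_mat_vec[OF V mat_adjoint_carrier[OF S]]) simp
        finally show ?thesis by simp
      qed
      then have "vnorm2 (Z *\<^sub>v ?w) \<le> 2 * vnorm2 ?w + 2 * vnorm2 (V *\<^sub>v (mat_adjoint S *\<^sub>v ?w))"
        using V by (simp add: vnorm2_diff_le)
      also have "\<dots> \<le> 2 * 1 + 2 * (\<kappa>\<^sup>2 * vnorm2 (mat_adjoint S *\<^sub>v ?w))"
        using that Vb[OF Sw] by (intro add_mono mult_left_mono) (auto simp: vnorm2_def)
      finally show ?thesis by simp
    qed
    have "vnorm2 (a j) \<le> 2 + 2 * \<kappa>\<^sup>2 * vnorm2 (mat_adjoint S *\<^sub>v Matrix.vec m (u j))"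
      "vnorm2 (b j) \<le> 2 + 2 * \<kappa>\<^sup>2 * vnorm2 (mat_adjoint S *\<^sub>v Matrix.vec m (v j))"
      unfolding a_def b_def using uv[of j] j by (auto intro!: *)
    then show "(vnorm2 (a j) + vnorm2 (b j)) / 2 \<le> 2 + \<kappa>\<^sup>2 * (vnorm2 (mat_adjoint S *\<^sub>v Matrix.vec m (u j)) + vnorm2 (mat_adjoint S *\<^sub>v Matrix.vec m (v j)))"
      by (simp add: algebra_simps)
  qed (use uv in auto)
  finally have "Re (mat_trace (R + mat_adjoint H * H)) \<le> (\<Sum>j<m. s j * (2 + \<kappa>\<^sup>2 * (vnorm2 (mat_adjoint S *\<^sub>v Matrix.vec m (u j)) + vnorm2 (mat_adjoint S *\<^sub>v Matrix.vec m (v j)))))"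
    unfolding T .
  moreover have "mat_trace (R + mat_adjoint H * H) = mat_trace R + complex_of_real ((frobenius_norm H)\<^sup>2)"
    unfolding frobenius_norm_square_trace using H G by (simp add: mat_trace_def sum.distrib)
  ultimately have "Re (mat_trace R) + (frobenius_norm H)\<^sup>2 \<le> (\<Sum>j<m. s j * (2 + \<kappa>\<^sup>2 * (vnorm2 (mat_adjoint S *\<^sub>v Matrix.vec m (u j)) + vnorm2 (mat_adjoint S *\<^sub>v Matrix.vec m (v j)))))"
    by simp
  then show "Re (mat_trace (A - nystrom A S)) \<le>
       (\<Sum>j<m. s j * (2 + \<kappa>\<^sup>2 * (vnorm2 (mat_adjoint S *\<^sub>v Matrix.vec m (u j)) + vnorm2 (mat_adjoint S *\<^sub>v Matrix.vec m (v j)))))"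
    using zero_le_power2[of "frobenius_norm H"] unfolding R_def by linarith
qed

section \<open>Embedding of real into complex matrices\<close>

text \<open>
  Positive semidefiniteness, the norms and the pseudoinverse, and hence the whole estimator, are
  preserved by the embedding of real into complex matrices, which reduces the real case to the complex
  one.
\<close>
abbreviation cmat :: "real mat \<Rightarrow> complex mat" where "cmat \<equiv> map_mat complex_of_real"

lemma cmat_inj: "cmat A = cmat B \<Longrightarrow> A = B"
  by (auto simp: mat_eq_iff)

lemma cmat_adjoint: "mat_adjoint (cmat A) = cmat (mat_adjoint A)"
  by (rule eq_matI) auto

lemma cmat_mult: "dim_col A = dim_row B \<Longrightarrow> cmat (A * B) = cmat A * cmat B"
  by (rule eq_matI) (auto simp: mult_mat_index simp del: index_mult_mat(1))

lemma cmat_minus: "dim_row A = dim_row B \<Longrightarrow> dim_col A = dim_col B \<Longrightarrow> cmat (A - B) = cmat A - cmat B"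
  by (rule eq_matI) auto

lemma cnj_mat_mult: "dim_col A = dim_row B \<Longrightarrow> map_mat cnj (A * B) = map_mat cnj A * map_mat cnj B"
  by (rule eq_matI) (auto simp: mult_mat_index simp del: index_mult_mat(1))

lemma cnj_mat_adjoint: "mat_adjoint (map_mat cnj A) = map_mat cnj (mat_adjoint A)"
  by (rule eq_matI) auto

text \<open>
  The entrywise conjugate of the pseudoinverse of a real matrix satisfies the same Penrose equations.
  By uniqueness the pseudoinverse has real entries.
\<close>
lemma cmat_pinv:
  assumes M: "M \<in> carrier_mat n n" "mat_adjoint M = M"
  shows "cmat (pinv M) = pinv (cmat M)" "pinv M \<in> carrier_mat n n"
proof -
  let ?X = "pinv (cmat M)"
  have Mc: "cmat M \<in> carrier_mat n n" "mat_adjoint (cmat M) = cmat M" using M by (auto simp: cmat_adjoint)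
  have X: "is_pinv (cmat M) ?X" "?X \<in> carrier_mat n n" using hermitian_pinv[OF Mc] by auto
  have cM: "map_mat cnj (cmat M) = cmat M" by (rule eq_matI) auto
  have "is_pinv (cmat M) (map_mat cnj ?X)"
  proof -
    have eqs: "cmat M * ?X * cmat M = cmat M" "?X * cmat M * ?X = ?X"
      "mat_adjoint (cmat M * ?X) = cmat M * ?X" "mat_adjoint (?X * cmat M) = ?X * cmat M"
      using X by (auto simp: is_pinv_def)
    have c: "cmat M * map_mat cnj ?X = map_mat cnj (cmat M * ?X)" "map_mat cnj ?X * cmat M = map_mat cnj (?X * cmat M)"
      using X(2) M by (simp_all add: cnj_mat_mult cM)
    have "map_mat cnj (cmat M * ?X * cmat M) = map_mat cnj (cmat M * ?X) * cmat M"
      "map_mat cnj (?X * cmat M * ?X) = map_mat cnj (?X * cmat M) * map_mat cnj ?X"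
      using X(2) M by (simp_all add: cnj_mat_mult cM)
    then show ?thesis
      unfolding is_pinv_def c cnj_mat_adjoint eqs(3,4) using X(2) M eqs(1,2) cM by auto
  qed
  then have cX: "map_mat cnj ?X = ?X" using pinv_unique X(1) by blast
  define Y where "Y = map_mat Re ?X"
  have Y: "Y \<in> carrier_mat n n" using X by (simp add: Y_def)
  have XY: "?X = cmat Y"
  proof (rule eq_matI)
    fix i j assume "i < dim_row (cmat Y)" "j < dim_col (cmat Y)"
    then have ij: "i < n" "j < n" using Y by auto
    then have "cnj (?X $$ (i, j)) = ?X $$ (i, j)" using cX X(2) by (metis carrier_matD index_map_mat(1))
    then show "?X $$ (i, j) = cmat Y $$ (i, j)" using ij X(2) by (simp add: Y_def complex_eq_iff)
  qed (use X Y in auto)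
  have "is_pinv M Y"
  proof -
    have e: "cmat M * cmat Y * cmat M = cmat M" "cmat Y * cmat M * cmat Y = cmat Y"
      "mat_adjoint (cmat M * cmat Y) = cmat M * cmat Y" "mat_adjoint (cmat Y * cmat M) = cmat Y * cmat M"
      using X(1) unfolding XY is_pinv_def by auto
    have "M * Y * M = M" by (rule cmat_inj) (use e(1) M Y in \<open>simp add: cmat_mult\<close>)
    moreover have "Y * M * Y = Y" by (rule cmat_inj) (use e(2) M Y in \<open>simp add: cmat_mult\<close>)
    moreover have "mat_adjoint (M * Y) = M * Y" by (rule cmat_inj) (use e(3) M Y in \<open>simp add: cmat_mult cmat_adjoint[symmetric]\<close>)
    moreover have "mat_adjoint (Y * M) = Y * M" by (rule cmat_inj) (use e(4) M Y in \<open>simp add: cmat_mult cmat_adjoint[symmetric]\<close>)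
    ultimately show ?thesis using M Y by (auto simp: is_pinv_def)
  qed
  then have "pinv M = Y" by (rule pinv_eqI)
  then show "cmat (pinv M) = pinv (cmat M)" "pinv M \<in> carrier_mat n n" using XY Y by auto
qed

lemma cmat_nystrom:
  assumes A: "A \<in> carrier_mat m m" "mat_adjoint A = A" and S: "S \<in> carrier_mat m k"
  shows "cmat (nystrom A S) = nystrom (cmat A) (cmat S)" "nystrom A S \<in> carrier_mat m m"
proof -
  have M: "mat_adjoint S * A * S \<in> carrier_mat k k" "mat_adjoint (mat_adjoint S * A * S) = mat_adjoint S * A * S"
    using A S by (auto simp: mat_adjoint_mult mat_mult_assoc)
  note P = cmat_pinv[OF M]
  show "nystrom A S \<in> carrier_mat m m" unfolding nystrom_def using A S P(2) by (intro carrier_matI) auto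
  have eq: "cmat (mat_adjoint S * A * S) = mat_adjoint (cmat S) * cmat A * cmat S"
    using A S by (simp add: cmat_mult cmat_adjoint)
  define X where "X = pinv (mat_adjoint S * A * S)"
  have X: "X \<in> carrier_mat k k" using P by (simp add: X_def)
  have "cmat (A * S * X * mat_adjoint S * A) = cmat A * cmat S * cmat X * mat_adjoint (cmat S) * cmat A"
    using A S X by (simp add: cmat_mult cmat_adjoint mat_mult_assoc)
  then show "cmat (nystrom A S) = nystrom (cmat A) (cmat S)"
    unfolding nystrom_def X_def P(1) eq .
qed

lemma cmat_sketch_mat: "cmat (sketch_mat m k \<omega>) = sketch_mat m k (\<lambda>j x. complex_of_real (\<omega> j x))"
  unfolding sketch_mat_def by (rule eq_matI) auto

lemma cmat_trace: "dim_row A = dim_col A \<Longrightarrow> mat_trace (cmat A) = complex_of_real (mat_trace A)"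
  by (simp add: mat_trace_def)

lemma cmat_nystrom_pp:
  assumes A: "A \<in> carrier_mat m m" "mat_adjoint A = A"
  shows "complex_of_real (nystrom_pp A k l \<omega> \<psi>) =
     nystrom_pp (cmat A) k l (\<lambda>j x. complex_of_real (\<omega> j x)) (\<lambda>j x. complex_of_real (\<psi> j x))"
proof -
  let ?S = "sketch_mat m k \<omega>"
  have S: "?S \<in> carrier_mat m k" by (simp add: sketch_mat_def)
  note N = cmat_nystrom[OF A S]
  have q: "complex_of_real ((B *\<^sub>v Matrix.vec m w) \<bullet>c Matrix.vec m w) =
      (cmat B *\<^sub>v Matrix.vec m (\<lambda>x. complex_of_real (w x))) \<bullet>c Matrix.vec m (\<lambda>x. complex_of_real (w x))" if "B \<in> carrier_mat m m" for B w
    using that by (simp add: scalar_prod_def)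
  have R: "A - nystrom A ?S \<in> carrier_mat m m" using A N by auto
  have d: "dim_row A = m" "dim_row (cmat A) = m" using A by auto
  have t: "mat_trace (nystrom (cmat A) (cmat ?S)) = complex_of_real (mat_trace (nystrom A ?S))"
    using N by (simp add: cmat_trace flip: N(1))
  have r: "cmat A - nystrom (cmat A) (cmat ?S) = cmat (A - nystrom A ?S)"
    unfolding N(1)[symmetric] using A N(2) by (intro cmat_minus[symmetric]) auto
  show ?thesis
    unfolding nystrom_pp_def Let_def d cmat_sketch_mat[symmetric] t r
    by (simp only: of_real_add of_real_divide of_real_sum of_real_of_nat_eq q[OF R])
qed

lemma cmat_frobenius_norm: "frobenius_norm (cmat A) = frobenius_norm A"
  by (simp add: frobenius_norm_def)

lemma cmat_char_poly:
  assumes A: "A \<in> carrier_mat n n"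
  shows "char_poly (cmat A) = map_poly complex_of_real (char_poly A)"
  by (rule of_real_hom.char_poly_hom[OF A])

lemma map_poly_of_real_mult: "map_poly complex_of_real (p * q) = map_poly complex_of_real p * map_poly complex_of_real q"
  by (rule poly_eqI) (simp add: coeff_map_poly coeff_mult)

lemma map_poly_of_real_inj: "map_poly complex_of_real p = map_poly complex_of_real q \<Longrightarrow> p = q"
  by (simp add: poly_eq_iff coeff_map_poly)

lemma map_poly_linear_factors:
  "map_poly complex_of_real (\<Prod>i<m. [:- l i, 1:]) = (\<Prod>i<(m::nat). [:- complex_of_real (l i), 1:])"
  by (induction m) (simp_all add: map_poly_of_real_mult map_poly_pCons del: mult_pCons_left mult_pCons_right)

lemma cmat_nuclear_norm:
  assumes E: "E \<in> carrier_mat m m"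
  shows "nuclear_norm (cmat E) = nuclear_norm E"
proof -
  let ?P = "mat_adjoint E * E"
  have P: "?P \<in> carrier_mat m m" "mat_adjoint ?P = ?P" using E by (auto simp: mat_adjoint_mult)
  have Pc: "mat_adjoint (cmat E) * cmat E = cmat ?P" using E by (simp add: cmat_mult cmat_adjoint)
  obtain U l where U: "unitary_mat m U" and Pl: "cmat ?P = spectral_mat m U l"
    using hermitian_spectral_mat[of "cmat ?P" m] P by (auto simp: cmat_adjoint)
  have "map_poly complex_of_real (char_poly ?P) = (\<Prod>i<m. [:- complex_of_real (l i), 1:])"
    using spectral_mat_char_poly[OF U, of l] unfolding Pl[symmetric] cmat_char_poly[OF P(1)] .
  also have "\<dots> = map_poly complex_of_real (\<Prod>i<m. [:- l i, 1:])"
    by (rule map_poly_linear_factors[symmetric])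
  finally have cp: "char_poly ?P = (\<Prod>i<m. [:- l i, 1:])"
    by (rule map_poly_of_real_inj)
  have "proots (char_poly ?P) = image_mset l (mset_set {..<m})"
    unfolding cp by (rule proots_linear_factors) simp
  moreover have "proots (char_poly (cmat ?P)) = image_mset (\<lambda>i. complex_of_real (l i)) (mset_set {..<m})"
    unfolding Pl spectral_mat_char_poly[OF U] by (rule proots_linear_factors) simp
  ultimately show ?thesis
    unfolding nuclear_norm_def singular_values_def Pc by (simp add: image_mset.compositionality o_def)
qed

text \<open>
  At x + i y the Hermitian form of a real symmetric matrix is the sum of its values at x and at y:
  the mixed terms cancel.
\<close>
lemma cmat_psd:
  assumes A: "A \<in> carrier_mat m m" and p: "psd A"
  shows "psd (cmat A)"
proof -
  have sym: "A $$ (x, y) = A $$ (y, x)" if "x < m" "y < m" for x y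
  proof -
    have "mat_adjoint A $$ (x, y) = A $$ (x, y)" using p by (simp only: psd_def)
    then show ?thesis using that A by simp
  qed
  have "0 \<le> (cmat A *\<^sub>v v) \<bullet>c v" if v: "v \<in> carrier_vec m" for v
  proof -
    have q: "0 \<le> (\<Sum>x<m. \<Sum>y<m. A $$ (x, y) * w y * w x)" for w
    proof -
      have "0 \<le> (A *\<^sub>v Matrix.vec m w) \<bullet>c Matrix.vec m w" using p A by (auto simp: psd_def)
      then show ?thesis using A by (simp add: scalar_prod_def atLeast0LessThan sum_distrib_right)
    qed
    have e: "(cmat A *\<^sub>v v) \<bullet>c v = (\<Sum>x<m. \<Sum>y<m. A $$ (x, y) * v $ y * cnj (v $ x))"
      using A v by (simp add: scalar_prod_def atLeast0LessThan sum_distrib_right)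
    have "Re ((cmat A *\<^sub>v v) \<bullet>c v) = (\<Sum>x<m. \<Sum>y<m. A $$ (x, y) * Re (v $ y) * Re (v $ x)) + (\<Sum>x<m. \<Sum>y<m. A $$ (x, y) * Im (v $ y) * Im (v $ x))"
      unfolding e Re_sum sum.distrib[symmetric] by (intro sum.cong refl) (simp add: algebra_simps)
    moreover have "Im ((cmat A *\<^sub>v v) \<bullet>c v) = 0"
    proof -
      have "Im ((cmat A *\<^sub>v v) \<bullet>c v) = (\<Sum>x<m. \<Sum>y<m. A $$ (x, y) * Im (v $ y) * Re (v $ x)) - (\<Sum>x<m. \<Sum>y<m. A $$ (x, y) * Re (v $ y) * Im (v $ x))"
        unfolding e Im_sum sum_subtractf[symmetric] by (intro sum.cong refl) (simp add: algebra_simps)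
      also have "(\<Sum>x<m. \<Sum>y<m. A $$ (x, y) * Re (v $ y) * Im (v $ x)) = (\<Sum>x<m. \<Sum>y<m. A $$ (x, y) * Im (v $ y) * Re (v $ x))"
        by (subst sum.swap) (auto simp: sym mult_ac intro!: sum.cong)
      finally show ?thesis by simp
    qed
    ultimately show ?thesis using q by (simp add: less_eq_complex_def)
  qed
  then show ?thesis using A p by (auto simp: psd_def cmat_adjoint)
qed

section \<open>Rounding to a lattice\<close>

text \<open>
  The expression sum_i |X_i + t b_i|^2 is |X|^2 + 2 t g + t^2 |b|^2, and rounding a down or up gives
  offsets t of opposite sign, one of which makes the cross term 2 t g nonpositive. This derandomizes
  rounding with mean zero.
\<close>
lemma round_coordinate:
  fixes a \<eta> :: real and X :: "nat \<Rightarrow> complex" and b :: "nat \<Rightarrow> complex"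
  assumes eta: "\<eta> > 0"
  shows "\<exists>z::int. \<bar>a - \<eta> * z\<bar> \<le> \<eta> \<and>
    (\<Sum>i<N. (cmod (X i + complex_of_real (a - \<eta> * z) * b i))\<^sup>2) \<le> (\<Sum>i<N. (cmod (X i))\<^sup>2) + \<eta>\<^sup>2 * (\<Sum>i<N. (cmod (b i))\<^sup>2)"
proof -
  define g where "g = (\<Sum>i<N. Re (X i * cnj (b i)))"
  have ex: "(\<Sum>i<N. (cmod (X i + complex_of_real t * b i))\<^sup>2) = (\<Sum>i<N. (cmod (X i))\<^sup>2) + 2 * (t * g) + t\<^sup>2 * (\<Sum>i<N. (cmod (b i))\<^sup>2)" for t
  proof -
    have "(cmod (X i + complex_of_real t * b i))\<^sup>2 = (cmod (X i))\<^sup>2 + 2 * t * Re (X i * cnj (b i)) + t\<^sup>2 * (cmod (b i))\<^sup>2" for i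
      unfolding cmod_power2 by (simp add: power2_eq_square algebra_simps)
    then show ?thesis by (simp only: sum.distrib sum_distrib_left g_def mult.assoc)
  qed
  define f where "f = \<lfloor>a / \<eta>\<rfloor>"
  have f: "\<eta> * f \<le> a" "a < \<eta> * f + \<eta>"
  proof -
    have "of_int f \<le> a / \<eta>" "a / \<eta> < of_int f + 1" unfolding f_def by linarith+
    then show "\<eta> * f \<le> a" "a < \<eta> * f + \<eta>" using eta by (auto simp: field_simps)
  qed
  obtain z where z: "z = f \<or> z = f + 1" "(a - \<eta> * of_int z) * g \<le> 0"
  proof (cases "g \<le> 0")
    case True
    then have "(a - \<eta> * of_int f) * g \<le> 0" using f by (intro mult_nonneg_nonpos) auto
    then show ?thesis using that[of f] by simp
  next
    case False
    have "(a - \<eta> * of_int (f + 1)) * g \<le> 0" using f False by (intro mult_nonpos_nonneg) (auto simp: algebra_simps)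
    then show ?thesis using that[of "f + 1"] by simp
  qed
  have t: "\<bar>a - \<eta> * z\<bar> \<le> \<eta>" using z(1) f by (auto simp: algebra_simps)
  then have "(a - \<eta> * z)\<^sup>2 \<le> \<eta>\<^sup>2" using abs_le_square_iff[of "a - \<eta> * z" \<eta>] eta by simp
  then have "(a - \<eta> * z)\<^sup>2 * (\<Sum>i<N. (cmod (b i))\<^sup>2) \<le> \<eta>\<^sup>2 * (\<Sum>i<N. (cmod (b i))\<^sup>2)"
    by (intro mult_right_mono sum_nonneg) auto
  then show ?thesis using t z(2) unfolding ex by (intro exI[of _ z]) auto
qed

definition lattice_pt :: "real \<Rightarrow> (nat \<Rightarrow> int \<times> int) \<Rightarrow> nat \<Rightarrow> complex" where
  "lattice_pt \<eta> z q = Complex (\<eta> * fst (z q)) (\<eta> * snd (z q))"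

text \<open>
  Round the real and imaginary parts of the coordinates one after the other, each time in the
  direction that makes the cross term nonpositive; then only the diagonal terms accumulate. The image
  of the rounding error is thus bounded through the Hilbert--Schmidt norm of b instead of its operator
  norm, and the former can be controlled by Markov's inequality.
\<close>
lemma lattice_rounding:
  fixes v :: "nat \<Rightarrow> complex" and b :: "nat \<Rightarrow> nat \<Rightarrow> complex"
  assumes eta: "\<eta> > 0"
  shows "\<exists>z. (\<forall>q<p. (cmod (v q - lattice_pt \<eta> z q))\<^sup>2 \<le> 2 * \<eta>\<^sup>2) \<and>
    (\<Sum>i<N. (cmod (\<Sum>q<p. (v q - lattice_pt \<eta> z q) * b q i))\<^sup>2) \<le> 2 * \<eta>\<^sup>2 * (\<Sum>q<p. \<Sum>i<N. (cmod (b q i))\<^sup>2)"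
proof (induction p)
  case 0
  show ?case by auto
next
  case (Suc p)
  then obtain z where z1: "\<And>q. q < p \<Longrightarrow> (cmod (v q - lattice_pt \<eta> z q))\<^sup>2 \<le> 2 * \<eta>\<^sup>2"
    and z2: "(\<Sum>i<N. (cmod (\<Sum>q<p. (v q - lattice_pt \<eta> z q) * b q i))\<^sup>2) \<le> 2 * \<eta>\<^sup>2 * (\<Sum>q<p. \<Sum>i<N. (cmod (b q i))\<^sup>2)" by blast
  define X where "X i = (\<Sum>q<p. (v q - lattice_pt \<eta> z q) * b q i)" for i
  define B where "B = (\<Sum>i<N. (cmod (b p i))\<^sup>2)"
  obtain k1 :: int where k1: "\<bar>Re (v p) - \<eta> * k1\<bar> \<le> \<eta>"
    "(\<Sum>i<N. (cmod (X i + complex_of_real (Re (v p) - \<eta> * k1) * b p i))\<^sup>2) \<le> (\<Sum>i<N. (cmod (X i))\<^sup>2) + \<eta>\<^sup>2 * B"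
    using round_coordinate[OF eta, where a = "Re (v p)" and X = X and b = "b p" and N = N] by (auto simp: B_def)
  obtain k2 :: int where k2: "\<bar>Im (v p) - \<eta> * k2\<bar> \<le> \<eta>"
    "(\<Sum>i<N. (cmod ((X i + complex_of_real (Re (v p) - \<eta> * k1) * b p i) + complex_of_real (Im (v p) - \<eta> * k2) * (\<i> * b p i)))\<^sup>2)
       \<le> (\<Sum>i<N. (cmod (X i + complex_of_real (Re (v p) - \<eta> * k1) * b p i))\<^sup>2) + \<eta>\<^sup>2 * B"
    using round_coordinate[OF eta, where a = "Im (v p)" and X = "\<lambda>i. X i + complex_of_real (Re (v p) - \<eta> * k1) * b p i" and b = "\<lambda>i. \<i> * b p i" and N = N]
    by (auto simp: B_def norm_mult)
  define z' where "z' = z(p := (k1, k2))"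
  have zp: "v p - lattice_pt \<eta> z' p = complex_of_real (Re (v p) - \<eta> * k1) + complex_of_real (Im (v p) - \<eta> * k2) * \<i>"
    by (simp add: z'_def lattice_pt_def complex_eq_iff)
  have zq: "lattice_pt \<eta> z' q = lattice_pt \<eta> z q" if "q < p" for q
    using that by (simp add: z'_def lattice_pt_def)
  have "(cmod (v q - lattice_pt \<eta> z' q))\<^sup>2 \<le> 2 * \<eta>\<^sup>2" if "q < Suc p" for q
  proof (cases "q = p")
    case True
    have "(Re (v p) - \<eta> * k1)\<^sup>2 \<le> \<eta>\<^sup>2" "(Im (v p) - \<eta> * k2)\<^sup>2 \<le> \<eta>\<^sup>2"
      using abs_le_square_iff[of "Re (v p) - \<eta> * k1" \<eta>] abs_le_square_iff[of "Im (v p) - \<eta> * k2" \<eta>] k1(1) k2(1) eta by auto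
    then show ?thesis unfolding True zp by (simp add: cmod_power2)
  next
    case False
    then have "q < p" using that by simp
    then show ?thesis using z1[of q] zq[of q] by simp
  qed
  moreover have "(\<Sum>i<N. (cmod (\<Sum>q<Suc p. (v q - lattice_pt \<eta> z' q) * b q i))\<^sup>2) \<le> 2 * \<eta>\<^sup>2 * (\<Sum>q<Suc p. \<Sum>i<N. (cmod (b q i))\<^sup>2)"
  proof -
    have "(\<Sum>q<Suc p. (v q - lattice_pt \<eta> z' q) * b q i) =
       (X i + complex_of_real (Re (v p) - \<eta> * k1) * b p i) + complex_of_real (Im (v p) - \<eta> * k2) * (\<i> * b p i)" for i
    proof -
      have "(\<Sum>q<Suc p. (v q - lattice_pt \<eta> z' q) * b q i) = X i + (v p - lattice_pt \<eta> z' p) * b p i"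
        by (simp add: X_def zq)
      then show ?thesis unfolding zp by (simp add: algebra_simps)
    qed
    then have "(\<Sum>i<N. (cmod (\<Sum>q<Suc p. (v q - lattice_pt \<eta> z' q) * b q i))\<^sup>2)
      \<le> (\<Sum>i<N. (cmod (X i + complex_of_real (Re (v p) - \<eta> * k1) * b p i))\<^sup>2) + \<eta>\<^sup>2 * B"
      using k2(2) by (simp only:)
    also have "\<dots> \<le> ((\<Sum>i<N. (cmod (X i))\<^sup>2) + \<eta>\<^sup>2 * B) + \<eta>\<^sup>2 * B"
      by (intro add_right_mono k1(2))
    also have "\<dots> \<le> (2 * \<eta>\<^sup>2 * (\<Sum>q<p. \<Sum>i<N. (cmod (b q i))\<^sup>2) + \<eta>\<^sup>2 * B) + \<eta>\<^sup>2 * B"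
      unfolding X_def by (intro add_right_mono z2)
    also have "\<dots> = 2 * \<eta>\<^sup>2 * (\<Sum>q<Suc p. \<Sum>i<N. (cmod (b q i))\<^sup>2)"
      by (simp add: B_def distrib_left)
    finally show ?thesis .
  qed
  ultimately show ?case by blast
qed

definition lattice_net :: "nat \<Rightarrow> nat \<Rightarrow> (nat \<Rightarrow> int \<times> int) set" where
  "lattice_net p L = {z \<in> PiE {..<p} (\<lambda>_. UNIV). (\<Sum>q<p. (fst (z q))\<^sup>2 + (snd (z q))\<^sup>2) \<le> int L}"

lemma int_abs_le_square: "\<bar>a\<bar> \<le> (a::int)\<^sup>2"
proof (cases "a = 0")
  case False
  then have "\<bar>a\<bar> * 1 \<le> \<bar>a\<bar> * \<bar>a\<bar>" by (intro mult_left_mono) auto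
  then show ?thesis by (simp add: power2_eq_square abs_mult_self_eq flip: abs_mult)
qed simp

lemma sum_half_powers: "(\<Sum>a\<in>{- int L..int L}. (1/2) ^ nat \<bar>a\<bar>) \<le> (3::real)"
proof -
  have "{- int L..int L} = (\<lambda>n. int n) ` {..L} \<union> (\<lambda>n. - int n) ` {1..L}"
  proof (intro equalityI subsetI)
    fix a assume a: "a \<in> {- int L..int L}"
    show "a \<in> (\<lambda>n. int n) ` {..L} \<union> (\<lambda>n. - int n) ` {1..L}"
    proof (cases "a \<ge> 0")
      case True then show ?thesis using a by (intro UnI1 image_eqI[of _ _ "nat a"]) auto
    next
      case False then show ?thesis using a by (intro UnI2 image_eqI[of _ _ "nat (- a)"]) auto
    qed
  qed auto
  also have "(\<Sum>a\<in>\<dots>. (1/2) ^ nat \<bar>a\<bar>) \<le> (\<Sum>a\<in>(\<lambda>n. int n) ` {..L}. (1/2) ^ nat \<bar>a\<bar>) + (\<Sum>a\<in>(\<lambda>n. - int n) ` {1..L}. (1/2::real) ^ nat \<bar>a\<bar>)"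
    by (subst sum_Un) (auto intro: sum_nonneg)
  also have "\<dots> = (\<Sum>n\<le>L. (1/2) ^ n) + (\<Sum>n=1..L. (1/2::real) ^ n)"
    by (simp add: sum.reindex inj_on_def)
  also have "(\<Sum>n=1..L. (1/2::real) ^ n) = (\<Sum>n\<le>L. (1/2) ^ n) - 1"
    by (simp add: sum.atMost_shift[of _ L] atLeast1_atMost_eq_remove0 sum_diff1 )
  also have "(\<Sum>n\<le>L. (1/2::real) ^ n) \<le> 2"
    unfolding lessThan_Suc_atMost[symmetric] by (subst geometric_sum) (auto simp: field_simps)
  finally show ?thesis by simp
qed

lemma lattice_net_bounds:
  assumes "z \<in> lattice_net p L" "q < p"
  shows "fst (z q) \<in> {- int L..int L}" "snd (z q) \<in> {- int L..int L}"
proof -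
  have "(fst (z q))\<^sup>2 + (snd (z q))\<^sup>2 \<le> (\<Sum>q<p. (fst (z q))\<^sup>2 + (snd (z q))\<^sup>2)"
    using assms(2) by (intro member_le_sum) auto
  also have "\<dots> \<le> int L" using assms(1) by (simp add: lattice_net_def)
  finally have "(fst (z q))\<^sup>2 + (snd (z q))\<^sup>2 \<le> int L" .
  moreover have "\<bar>fst (z q)\<bar> \<le> (fst (z q))\<^sup>2" "\<bar>snd (z q)\<bar> \<le> (snd (z q))\<^sup>2" by (rule int_abs_le_square)+
  moreover have "(fst (z q))\<^sup>2 \<ge> 0" "(snd (z q))\<^sup>2 \<ge> 0" by auto
  ultimately have "\<bar>fst (z q)\<bar> \<le> int L" "\<bar>snd (z q)\<bar> \<le> int L" by linarith+
  then show "fst (z q) \<in> {- int L..int L}" "snd (z q) \<in> {- int L..int L}" by auto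
qed

text \<open>
  Give a lattice point the weight 2^L times 2^(-s), where s is the sum of the absolute values of its
  2 p integer coordinates. As |a| is at most a^2 for an integer a, points of the net have weight at
  least 1. The weights multiply over the coordinates, each of which contributes a factor of at most 3.
\<close>
lemma lattice_net_card:
  "finite (lattice_net p L)" "real (card (lattice_net p L)) \<le> 2 ^ L * 9 ^ p"
proof -
  let ?box = "PiE {..<p} (\<lambda>_. {- int L..int L} \<times> {- int L..int L})"
  have sub: "lattice_net p L \<subseteq> ?box"
  proof
    fix z assume z: "z \<in> lattice_net p L"
    then have "z \<in> PiE {..<p} (\<lambda>_. UNIV)" by (simp add: lattice_net_def)
    then show "z \<in> ?box" using lattice_net_bounds[OF z] by (auto simp: PiE_iff mem_Times_iff)
  qed
  have fin: "finite ?box" by (intro finite_PiE) auto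
  show fl: "finite (lattice_net p L)" by (rule finite_subset[OF sub fin])
  let ?w = "\<lambda>c :: int \<times> int. (1/2::real) ^ nat \<bar>fst c\<bar> * (1/2) ^ nat \<bar>snd c\<bar>"
  have "real (card (lattice_net p L)) = (\<Sum>z\<in>lattice_net p L. 1)" by simp
  also have "\<dots> \<le> (\<Sum>z\<in>lattice_net p L. 2 ^ L * (\<Prod>q<p. ?w (z q)))"
  proof (rule sum_mono)
    fix z assume z: "z \<in> lattice_net p L"
    define s where "s q = nat \<bar>fst (z q)\<bar> + nat \<bar>snd (z q)\<bar>" for q
    have "int (\<Sum>q<p. s q) \<le> (\<Sum>q<p. (fst (z q))\<^sup>2 + (snd (z q))\<^sup>2)"
      unfolding of_nat_sum s_def using int_abs_le_square by (intro sum_mono) (simp add: add_mono)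
    also have "\<dots> \<le> int L" using z by (simp add: lattice_net_def)
    finally have "(\<Sum>q<p. s q) \<le> L" by (simp only: of_nat_le_iff)
    then have "(1/2::real) ^ L \<le> (1/2) ^ (\<Sum>q<p. s q)" by (intro power_decreasing) auto
    also have "\<dots> = (\<Prod>q<p. ?w (z q))" by (simp add: power_sum s_def power_add)
    finally have "2 ^ L * (1/2::real) ^ L \<le> 2 ^ L * (\<Prod>q<p. ?w (z q))" by (intro mult_left_mono) auto
    then show "1 \<le> 2 ^ L * (\<Prod>q<p. ?w (z q))" by (simp add: power_mult_distrib[symmetric])
  qed
  also have "\<dots> \<le> (\<Sum>z\<in>?box. 2 ^ L * (\<Prod>q<p. ?w (z q)))"
    using sub fin by (intro sum_mono2) (auto intro!: mult_nonneg_nonneg prod_nonneg)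
  also have "\<dots> = 2 ^ L * (\<Prod>q<p. \<Sum>c\<in>{- int L..int L} \<times> {- int L..int L}. ?w c)"
    unfolding sum_distrib_left[symmetric] by (subst prod_sum_PiE) auto
  also have "(\<Sum>c\<in>{- int L..int L} \<times> {- int L..int L}. ?w c) = (\<Sum>a\<in>{- int L..int L}. (1/2) ^ nat \<bar>a\<bar>) * (\<Sum>a\<in>{- int L..int L}. (1/2) ^ nat \<bar>a\<bar>)"
    by (simp add: sum_product sum.cartesian_product case_prod_beta')
  also have "2 ^ L * (\<Prod>q<p. \<dots>) \<le> 2 ^ L * (\<Prod>q<p. 3 * 3)"
    by (intro mult_left_mono prod_mono conjI mult_mono sum_half_powers mult_nonneg_nonneg sum_nonneg) auto
  finally show "real (card (lattice_net p L)) \<le> 2 ^ L * 9 ^ p" by simp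
qed

section \<open>Products of entries of Gaussian cores\<close>

text \<open>
  The moment E (g^a cnj(g)^b), for a and b at most 2, of a centred Gaussian g of variance v. The
  parameter \<open>\<kappa>\<close> is E (g^2) / v, which is 1 for real and 0 for complex Gaussians.
\<close>
definition gauss_moment :: "real \<Rightarrow> real \<Rightarrow> nat \<Rightarrow> nat \<Rightarrow> real" where
  "gauss_moment \<kappa> v a b =
     (if a = b then (if a = 0 then 1 else if a = 1 then v else (2 + \<kappa>) * v\<^sup>2)
      else if (a = 2 \<and> b = 0) \<or> (a = 0 \<and> b = 2) then \<kappa> * v else 0)"

text \<open>
  The three pairings t = 0, 1, 2 of the factors of a product z_a cnj(z_b) z_c cnj(z_d). The last one
  pairs the two factors without conjugation with each other; it has nonzero weight only for real
  scalars.
\<close>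
definition paired :: "nat \<Rightarrow> 'b \<Rightarrow> 'b \<Rightarrow> 'b \<Rightarrow> 'b \<Rightarrow> bool" where
  "paired t a b c d \<longleftrightarrow> (if t = 0 then a = b \<and> c = d else if t = 1 then a = d \<and> c = b else a = c \<and> b = d)"

definition pairing_coeff :: "real \<Rightarrow> nat \<Rightarrow> real" where
  "pairing_coeff \<kappa> t = (if t < 2 then 1 else \<kappa>)"

lemma sum_three: "(\<Sum>t<3. f t) = f 0 + f 1 + f (2::nat)" for f :: "nat \<Rightarrow> 'b::comm_monoid_add"
  by (simp add: eval_nat_numeral)

lemma gauss_moment_values [simp]:
  "gauss_moment \<kappa> v 0 0 = 1" "gauss_moment \<kappa> v 1 1 = v" "gauss_moment \<kappa> v 2 2 = (2 + \<kappa>) * v\<^sup>2"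
  "gauss_moment \<kappa> v 1 0 = 0" "gauss_moment \<kappa> v 0 1 = 0" "gauss_moment \<kappa> v 2 1 = 0" "gauss_moment \<kappa> v 1 2 = 0"
  "gauss_moment \<kappa> v 2 0 = \<kappa> * v" "gauss_moment \<kappa> v 0 2 = \<kappa> * v"
  "gauss_moment \<kappa> v (Suc 0) (Suc 0) = v" "gauss_moment \<kappa> v (Suc 0) 0 = 0" "gauss_moment \<kappa> v 0 (Suc 0) = 0"
  "gauss_moment \<kappa> v (Suc (Suc 0)) (Suc (Suc 0)) = (2 + \<kappa>) * v\<^sup>2"
  "gauss_moment \<kappa> v (Suc (Suc 0)) 0 = \<kappa> * v" "gauss_moment \<kappa> v 0 (Suc (Suc 0)) = \<kappa> * v"
  "gauss_moment \<kappa> v (Suc (Suc 0)) (Suc 0) = 0" "gauss_moment \<kappa> v (Suc 0) (Suc (Suc 0)) = 0"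
  "gauss_moment \<kappa> v 2 (Suc 0) = 0" "gauss_moment \<kappa> v (Suc 0) 2 = 0"
  by (simp_all add: gauss_moment_def)

lemma wick_pair:
  assumes "finite J" "c1 \<in> J" "c2 \<in> J"
  shows "(\<Prod>c\<in>J. gauss_moment \<kappa> v (of_bool (c = c1)) (of_bool (c = c2))) = v * of_bool (c1 = c2)"
proof -
  have "(\<Prod>c\<in>J. gauss_moment \<kappa> v (of_bool (c = c1)) (of_bool (c = c2))) =
     (\<Prod>c\<in>{c1, c2}. gauss_moment \<kappa> v (of_bool (c = c1)) (of_bool (c = c2)))"
    using assms by (intro prod.mono_neutral_right) auto
  also have "\<dots> = v * of_bool (c1 = c2)"
    by (cases "c1 = c2") simp_all
  finally show ?thesis .
qed

text \<open>
  The formula of Isserlis and Wick for fourth moments, by checking every pattern of coincidences among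
  the four indices. If all of them coincide, all three pairings hold, and \<open>2 + \<kappa>\<close> is the number
  of pairings that count.
\<close>
lemma wick_quad:
  assumes "finite J" "c1 \<in> J" "c2 \<in> J" "c3 \<in> J" "c4 \<in> J" and kap: "\<kappa> = 0 \<or> \<kappa> = 1"
  shows "(\<Prod>c\<in>J. gauss_moment \<kappa> v (of_bool (c = c1) + of_bool (c = c3)) (of_bool (c = c2) + of_bool (c = c4))) =
    v\<^sup>2 * (\<Sum>t<3. pairing_coeff \<kappa> t * of_bool (paired t c1 c2 c3 c4))"
proof -
  have v1: "(\<Prod>c\<in>J. gauss_moment \<kappa> v (of_bool (c = c1) + of_bool (c = c3)) (of_bool (c = c2) + of_bool (c = c4))) =
     (\<Prod>c\<in>{c1, c2, c3, c4}. gauss_moment \<kappa> v (of_bool (c = c1) + of_bool (c = c3)) (of_bool (c = c2) + of_bool (c = c4)))"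
    using assms by (intro prod.mono_neutral_right) auto

  have dup: "{a, b, a, b} = {a, b}" "{a, b, a} = {a, b}" for a b :: 'a by auto
  have v2: "(\<Prod>c\<in>{c1, c2, c3, c4}. gauss_moment \<kappa> v (of_bool (c = c1) + of_bool (c = c3)) (of_bool (c = c2) + of_bool (c = c4)))
     = v\<^sup>2 * (\<Sum>t<3. pairing_coeff \<kappa> t * of_bool (paired t c1 c2 c3 c4))"
    unfolding sum_three pairing_coeff_def paired_def
    by (rule disjE[OF kap]; cases "c1 = c2"; cases "c1 = c3"; cases "c1 = c4"; cases "c2 = c3"; cases "c2 = c4"; cases "c3 = c4")
      (simp_all add: power2_eq_square dup)
  show ?thesis unfolding v1 v2 ..
qed

text \<open>
  This treats both scalar fields at once: \<open>N v\<close> is the law of a Gaussian of variance v, and e embeds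
  its values into the complex numbers, by \<^const>\<open>of_real\<close> or by the identity.
\<close>
locale gaussian_cores =
  fixes N :: "real \<Rightarrow> 'a::{real_normed_field, second_countable_topology} measure"
    and e :: "'a \<Rightarrow> complex" and \<kappa> :: real and d n bd :: nat
  assumes N_prob: "\<And>v. v > 0 \<Longrightarrow> prob_space (N v)"
    and N_sets: "\<And>v. sets (N v) = sets borel"
    and e_meas: "e \<in> borel_measurable borel"
    and e_hom: "\<And>x y. e (x + y) = e x + e y" "\<And>x y. e (x * y) = e x * e y" "e 0 = 0" "e 1 = 1"
    and kap: "\<kappa> = 0 \<or> \<kappa> = 1"
    and mom: "\<And>v a b. v > 0 \<Longrightarrow> a \<le> 2 \<Longrightarrow> b \<le> 2 \<Longrightarrow>
       has_bochner_integral (N v) (\<lambda>g. e g ^ a * cnj (e g) ^ b) (complex_of_real (gauss_moment \<kappa> v a b))"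
    and bd_pos: "bd > 0" and n_ge: "n \<ge> 2" and d_pos: "d > 0"
begin

definition I where "I = core_index d n bd"
definition P where "P = (\<lambda>c :: nat \<times> nat \<times> nat \<times> nat. N (core_variance n bd (fst c)))"

lemma var_pos: "core_variance n bd p > 0"
  using bd_pos by (simp add: core_variance_def)

lemma P_alt: "(\<lambda>(p, a, i, b). N (core_variance n bd p)) = P"
  by (auto simp: P_def fun_eq_iff)

sublocale PI: product_prob_space P I
proof -
  have "prob_space (P c)" for c unfolding P_def by (rule N_prob[OF var_pos])
  then show "product_prob_space P"
    by (simp add: product_prob_space_def product_prob_space_axioms_def product_sigma_finite_def prob_space_imp_sigma_finite)
qed

lemma I_eq: "I = (\<Union>p\<in>{1..n}. {p} \<times> ({..<bond_dim n bd (p - 1)} \<times> ({..<d} \<times> {..<bond_dim n bd p})))"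
  by (auto simp: I_def core_index_def)

lemma finite_I: "finite I" unfolding I_eq by auto

lemma finite_I_site: "finite {c \<in> I. fst c = p}" using finite_I by auto

lemma fst_I: "c \<in> I \<Longrightarrow> fst c \<in> {1..n}" by (auto simp: I_eq)

text \<open>
  A choice of one entry of each core, as made by the factors of one term of \<^const>\<open>mps_entry\<close>.
\<close>
definition site_sel :: "(nat \<Rightarrow> nat \<times> nat \<times> nat \<times> nat) \<Rightarrow> bool" where
  "site_sel c \<longleftrightarrow> (\<forall>p\<in>{1..n}. c p \<in> I \<and> fst (c p) = p)"

lemma prod_site_sel:
  fixes h :: "nat \<times> nat \<times> nat \<times> nat \<Rightarrow> complex"
  assumes "site_sel c"
  shows "(\<Prod>p\<in>{1..n}. h (c p)) = (\<Prod>x\<in>I. h x ^ of_bool (x = c (fst x)))"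
proof -
  have "(\<Prod>x\<in>I. h x ^ of_bool (x = c (fst x))) = (\<Prod>x\<in>{x\<in>I. x = c (fst x)}. h x)"
    using finite_I by (intro prod.mono_neutral_cong_right) auto
  also have "{x\<in>I. x = c (fst x)} = c ` {1..n}"
  proof (intro equalityI subsetI)
    fix x assume "x \<in> {x\<in>I. x = c (fst x)}"
    then have "x = c (fst x)" "fst x \<in> {1..n}" using fst_I by blast+
    then show "x \<in> c ` {1..n}" by (rule image_eqI)
  next
    fix x assume "x \<in> c ` {1..n}"
    then obtain p where "p \<in> {1..n}" "x = c p" by blast
    then show "x \<in> {x\<in>I. x = c (fst x)}" using assms by (simp add: site_sel_def)
  qed
  also have "(\<Prod>x\<in>c ` {1..n}. h x) = (\<Prod>p\<in>{1..n}. h (c p))"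
  proof -
    have "inj_on c {1..n}"
    proof (rule inj_onI)
      fix p q assume "p \<in> {1..n}" "q \<in> {1..n}" "c p = c q"
      moreover have "fst (c p) = p" "fst (c q) = q" using assms calculation(1,2) by (auto simp: site_sel_def)
      ultimately show "p = q" by metis
    qed
    then show ?thesis by (simp add: prod.reindex)
  qed
  finally show ?thesis ..
qed

text \<open>
  Independence of the entries turns the expectation of a monomial into a product of moments.
\<close>
lemma expectation_monomial:
  assumes "\<And>x. x \<in> I \<Longrightarrow> a x \<le> 2 \<and> b x \<le> 2"
  shows "has_bochner_integral (PiM I P) (\<lambda>G. \<Prod>x\<in>I. e (G x) ^ a x * cnj (e (G x)) ^ b x)
     (complex_of_real (\<Prod>x\<in>I. gauss_moment \<kappa> (core_variance n bd (fst x)) (a x) (b x)))"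
proof -
  have h: "has_bochner_integral (P x) (\<lambda>g. e g ^ a x * cnj (e g) ^ b x) (complex_of_real (gauss_moment \<kappa> (core_variance n bd (fst x)) (a x) (b x)))"
    if "x \<in> I" for x
    unfolding P_def using assms[OF that] by (intro mom var_pos) auto
  then have i: "integrable (P x) (\<lambda>g. e g ^ a x * cnj (e g) ^ b x)" if "x \<in> I" for x
    using that by (auto simp: has_bochner_integral_iff)
  have "(\<integral>G. (\<Prod>x\<in>I. e (G x) ^ a x * cnj (e (G x)) ^ b x) \<partial>PiM I P) = (\<Prod>x\<in>I. \<integral>g. e g ^ a x * cnj (e g) ^ b x \<partial>P x)"
    by (rule PI.product_integral_prod[OF finite_I i])
  also have "\<dots> = (\<Prod>x\<in>I. complex_of_real (gauss_moment \<kappa> (core_variance n bd (fst x)) (a x) (b x)))"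
    using h by (intro prod.cong) (auto simp: has_bochner_integral_iff)
  finally show ?thesis using PI.product_integrable_prod[OF finite_I i] by (simp add: has_bochner_integral_iff)
qed

lemma prod_by_site:
  fixes f :: "nat \<times> nat \<times> nat \<times> nat \<Rightarrow> real"
  shows "(\<Prod>x\<in>I. f x) = (\<Prod>p\<in>{1..n}. \<Prod>x\<in>{x\<in>I. fst x = p}. f x)"
  by (rule prod.group[symmetric]) (use finite_I fst_I in auto)

lemma expectation_pair:
  assumes c: "site_sel c1" "site_sel c2"
  shows "has_bochner_integral (PiM I P) (\<lambda>G. \<Prod>p\<in>{1..n}. e (G (c1 p)) * cnj (e (G (c2 p))))
     (complex_of_real (\<Prod>p\<in>{1..n}. core_variance n bd p * of_bool (c1 p = c2 p)))"
proof -
  have eq: "(\<Prod>p\<in>{1..n}. e (G (c1 p)) * cnj (e (G (c2 p)))) =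
      (\<Prod>x\<in>I. e (G x) ^ of_bool (x = c1 (fst x)) * cnj (e (G x)) ^ of_bool (x = c2 (fst x)))" for G
    unfolding prod.distrib using prod_site_sel[OF c(1), of "\<lambda>x. e (G x)"] prod_site_sel[OF c(2), of "\<lambda>x. cnj (e (G x))"] by simp
  have "(\<Prod>x\<in>I. gauss_moment \<kappa> (core_variance n bd (fst x)) (of_bool (x = c1 (fst x))) (of_bool (x = c2 (fst x)))) =
     (\<Prod>p\<in>{1..n}. \<Prod>x\<in>{x\<in>I. fst x = p}. gauss_moment \<kappa> (core_variance n bd p) (of_bool (x = c1 p)) (of_bool (x = c2 p)))"
    unfolding prod_by_site by (intro prod.cong) auto
  also have "\<dots> = (\<Prod>p\<in>{1..n}. core_variance n bd p * of_bool (c1 p = c2 p))"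
    by (intro prod.cong[OF refl] wick_pair finite_I_site) (use c in \<open>auto simp: site_sel_def\<close>)
  finally show ?thesis
    unfolding eq using expectation_monomial[of "\<lambda>x. of_bool (x = c1 (fst x))" "\<lambda>x. of_bool (x = c2 (fst x))"] by simp
qed

text \<open>
  Entries at different sites are independent, so the expectation is a product over the sites with
  Wick's formula at each of them.
\<close>
lemma expectation_quad:
  assumes c: "site_sel c1" "site_sel c2" "site_sel c3" "site_sel c4"
  shows "has_bochner_integral (PiM I P) (\<lambda>G. \<Prod>p\<in>{1..n}. e (G (c1 p)) * cnj (e (G (c2 p))) * e (G (c3 p)) * cnj (e (G (c4 p))))
     (complex_of_real (\<Prod>p\<in>{1..n}. (core_variance n bd p)\<^sup>2 * (\<Sum>t<3. pairing_coeff \<kappa> t * of_bool (paired t (c1 p) (c2 p) (c3 p) (c4 p)))))"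
proof -
  let ?a = "\<lambda>x. of_bool (x = c1 (fst x)) + of_bool (x = c3 (fst x)) :: nat"
  let ?b = "\<lambda>x. of_bool (x = c2 (fst x)) + of_bool (x = c4 (fst x)) :: nat"
  have eq: "(\<Prod>p\<in>{1..n}. e (G (c1 p)) * cnj (e (G (c2 p))) * e (G (c3 p)) * cnj (e (G (c4 p)))) =
      (\<Prod>x\<in>I. e (G x) ^ ?a x * cnj (e (G x)) ^ ?b x)" for G
    unfolding prod.distrib power_add
    using prod_site_sel[OF c(1), of "\<lambda>x. e (G x)"] prod_site_sel[OF c(2), of "\<lambda>x. cnj (e (G x))"]
     prod_site_sel[OF c(3), of "\<lambda>x. e (G x)"] prod_site_sel[OF c(4), of "\<lambda>x. cnj (e (G x))"] by (simp add: mult_ac)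
  have "(\<Prod>x\<in>I. gauss_moment \<kappa> (core_variance n bd (fst x)) (?a x) (?b x)) =
     (\<Prod>p\<in>{1..n}. \<Prod>x\<in>{x\<in>I. fst x = p}. gauss_moment \<kappa> (core_variance n bd p) (of_bool (x = c1 p) + of_bool (x = c3 p)) (of_bool (x = c2 p) + of_bool (x = c4 p)))"
    unfolding prod_by_site by (intro prod.cong) auto
  also have "\<dots> = (\<Prod>p\<in>{1..n}. (core_variance n bd p)\<^sup>2 * (\<Sum>t<3. pairing_coeff \<kappa> t * of_bool (paired t (c1 p) (c2 p) (c3 p) (c4 p))))"
    by (intro prod.cong[OF refl] wick_quad finite_I_site kap) (use c in \<open>auto simp: site_sel_def\<close>)
  finally show ?thesis
    unfolding eq using expectation_monomial[of ?a ?b] by simp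
qed

end

section \<open>Second and fourth moments of an rMPS\<close>

lemma site_index_Suc_last: "site_index d (Suc n) x (Suc n) = x mod d"
  by (simp add: site_index_def)

lemma site_index_Suc: "p \<le> n \<Longrightarrow> site_index d (Suc n) x p = site_index d n (x div d) p"
  by (simp add: site_index_def Suc_diff_le div_mult2_eq)

lemma site_index_inj:
  assumes "x < d ^ n" "y < d ^ n" "\<forall>p\<in>{1..n}. site_index d n x p = site_index d n y p"
  shows "x = y"
  using assms
proof (induction n arbitrary: x y)
  case (Suc n)
  have "x div d = y div d"
  proof (rule Suc.IH)
    show "x div d < d ^ n" "y div d < d ^ n" using Suc.prems by (auto simp: less_mult_imp_div_less mult.commute)
    show "\<forall>p\<in>{1..n}. site_index d n (x div d) p = site_index d n (y div d) p"
    proof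
      fix p assume p: "p \<in> {1..n}"
      then have "site_index d (Suc n) x p = site_index d (Suc n) y p" using Suc.prems(3) by auto
      then show "site_index d n (x div d) p = site_index d n (y div d) p" using p by (simp add: site_index_Suc)
    qed
  qed
  moreover have "x mod d = y mod d" using Suc.prems(3)[rule_format, of "Suc n"] by (simp add: site_index_Suc_last)
  ultimately show ?case by (metis div_mult_mod_eq)
qed auto

lemma paired_tuple:
  "paired t (p, a1, i1, b1) (p, a2, i2, b2) (p, a3, i3, b3) (p, a4, i4, b4) \<longleftrightarrow>
     paired t a1 a2 a3 a4 \<and> paired t i1 i2 i3 i4 \<and> paired t b1 b2 b3 b4"
  by (auto simp: paired_def)

lemma paired_simps:
  "paired 0 a b c f \<longleftrightarrow> a = b \<and> c = f" "paired 1 a b c f \<longleftrightarrow> a = f \<and> c = b" "paired 2 a b c f \<longleftrightarrow> a = c \<and> b = f"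
  by (simp_all add: paired_def)

text \<open>
  Imposing one pairing leaves two free values among four indices, imposing two different ones leaves a
  single free value. This is the factor lost when the pairing changes from one site to the next.
\<close>
lemma count_paired:
  assumes "s < 3" "t < 3"
  shows "(\<Sum>a<N. \<Sum>b<N. \<Sum>c<N. \<Sum>f<N. of_bool (paired s a b c f) * of_bool (paired t a b c f)) = (if s = t then (real N)\<^sup>2 else real N)"
proof -
  have "s \<in> {0, 1, 2}" "t \<in> {0, 1, 2}" using assms by auto
  moreover have A1: "(\<Sum>f<N. of_bool (a = b \<and> c = f)) = (of_bool (a = b) :: real)" if "c < N" for a b c
    using sum_of_bool_mult(2)[OF that, of "\<lambda>_. of_bool (a = b) :: real"] by (simp add: of_bool_conj mult.commute)
  moreover have A2: "(\<Sum>f<N. of_bool (a = f \<and> c = b)) = (of_bool (c = b) :: real)" if "a < N" for a b c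
    using sum_of_bool_mult(2)[OF that, of "\<lambda>_. of_bool (c = b) :: real"] by (simp add: of_bool_conj mult.commute)
  moreover have A3: "(\<Sum>f<N. of_bool (a = c \<and> b = f)) = (of_bool (a = c) :: real)" if "b < N" for a b c
    using sum_of_bool_mult(2)[OF that, of "\<lambda>_. of_bool (a = c) :: real"] by (simp add: of_bool_conj mult.commute)
  moreover have A4: "(\<Sum>f<N. of_bool (a = b \<and> a = c \<and> a = f)) = (of_bool (a = b \<and> a = c) :: real)" if "a < N" for a b c
    using sum_of_bool_mult(2)[OF that, of "\<lambda>_. of_bool (a = b \<and> a = c) :: real"] by (simp add: of_bool_conj mult_ac)
  moreover have A5: "(\<Sum>c<N. of_bool (a = b \<and> a = c)) = (of_bool (a = b) :: real)" if "a < N" for a b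
    using sum_of_bool_mult(2)[OF that, of "\<lambda>_. of_bool (a = b) :: real"] by (simp add: of_bool_conj mult_ac)
  moreover have A6: "(\<Sum>b<N. of_bool (a = b)) = (1 :: real)" "(\<Sum>b<N. of_bool (b = a)) = (1 :: real)" if "a < N" for a
    using sum_of_bool_mult[OF that, of "\<lambda>_. 1 :: real"] by simp_all
  moreover have A7: "of_bool (paired s a b c f) * of_bool (paired t a b c f) = (of_bool (a = b \<and> a = c \<and> a = f) :: real)" if "s \<noteq> t" for a b c f :: nat
    using that calculation(1,2) by (auto simp: paired_def)
  show ?thesis
  proof (cases "s = t")
    case False
    have "(\<Sum>a<N. \<Sum>b<N. \<Sum>c<N. \<Sum>f<N. of_bool (paired s a b c f) * of_bool (paired t a b c f)) =
        (\<Sum>a<N. \<Sum>b<N. \<Sum>c<N. \<Sum>f<N. of_bool (a = b \<and> a = c \<and> a = f) :: real)" by (simp only: A7[OF False])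
    also have "\<dots> = (\<Sum>a<N. \<Sum>b<N. \<Sum>c<N. of_bool (a = b \<and> a = c))" by (intro sum.cong refl A4) auto
    also have "\<dots> = (\<Sum>a<N. \<Sum>b<N. of_bool (a = b))" by (intro sum.cong refl A5) auto
    also have "\<dots> = (\<Sum>a<N. 1)" by (intro sum.cong refl A6) auto
    finally show ?thesis using False by simp
  next
    case True
    have e: "(\<Sum>a<N. \<Sum>b<N. \<Sum>c<N. \<Sum>f<N. of_bool (paired s a b c f) * of_bool (paired t a b c f)) =
        (\<Sum>a<N. \<Sum>b<N. \<Sum>c<N. \<Sum>f<N. of_bool (paired s a b c f) :: real)" unfolding True by (simp only: of_bool_conj[symmetric] simp_thms)
    consider "s = 0" | "s = 1" | "s = 2" using calculation(1) by auto
    then have "(\<Sum>a<N. \<Sum>b<N. \<Sum>c<N. \<Sum>f<N. of_bool (paired s a b c f)) = (real N)\<^sup>2"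
    proof cases
      case 1
      have "(\<Sum>a<N. \<Sum>b<N. \<Sum>c<N. \<Sum>f<N. of_bool (paired s a b c f)) = (\<Sum>a<N. \<Sum>b<N. \<Sum>c<N. of_bool (a = b) :: real)"
        unfolding 1 paired_simps by (intro sum.cong refl A1) auto
      also have "\<dots> = (\<Sum>a<N. \<Sum>b<N. real N * of_bool (a = b))" by simp
      also have "\<dots> = (\<Sum>a<N. real N * 1)" unfolding sum_distrib_left[symmetric] by (intro sum.cong refl arg_cong[of _ _ "\<lambda>x. _ * x"] A6) auto
      finally show ?thesis by (simp add: power2_eq_square)
    next
      case 2
      have "(\<Sum>a<N. \<Sum>b<N. \<Sum>c<N. \<Sum>f<N. of_bool (paired s a b c f)) = (\<Sum>a<N. \<Sum>b<N. \<Sum>c<N. of_bool (c = b) :: real)"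
        unfolding 2 paired_simps by (intro sum.cong refl A2) auto
      also have "\<dots> = (\<Sum>a<N. \<Sum>b<N. 1)" by (intro sum.cong refl A6) auto
      finally show ?thesis by (simp add: power2_eq_square)
    next
      case 3
      have "(\<Sum>a<N. \<Sum>b<N. \<Sum>c<N. \<Sum>f<N. of_bool (paired s a b c f)) = (\<Sum>a<N. \<Sum>b<N. \<Sum>c<N. of_bool (a = c) :: real)"
        unfolding 3 paired_simps by (intro sum.cong refl A3) auto
      also have "\<dots> = (\<Sum>a<N. \<Sum>b<N. 1)" by (intro sum.cong refl A6) auto
      finally show ?thesis by (simp add: power2_eq_square)
    qed
    then show ?thesis using e True by simp
  qed
qed

context gaussian_cores
begin

definition amp :: "(nat \<times> nat \<times> nat \<times> nat \<Rightarrow> 'a) \<Rightarrow> nat \<Rightarrow> complex" where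
  "amp G x = mps_entry d n bd (\<lambda>c. e (G c)) x"

lemma e_sum: "e (sum f A) = (\<Sum>x\<in>A. e (f x))"
  by (induction A rule: infinite_finite_induct) (simp_all add: e_hom)

lemma e_prod: "e (prod f A) = (\<Prod>x\<in>A. e (f x))"
  by (induction A rule: infinite_finite_induct) (simp_all add: e_hom)

lemma e_mps_entry: "e (mps_entry d n bd G x) = amp G x"
  by (simp add: amp_def mps_entry_def e_sum e_prod)

definition bonds where "bonds = PiE {0..n} (\<lambda>q. {..<bond_dim n bd q})"

definition factor_index :: "(nat \<Rightarrow> nat) \<Rightarrow> nat \<Rightarrow> nat \<Rightarrow> nat \<times> nat \<times> nat \<times> nat" where
  "factor_index \<alpha> x p = (p, \<alpha> (p - 1), site_index d n x p, \<alpha> p)"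

lemma factor_index_sel: assumes "\<alpha> \<in> bonds" shows "site_sel (factor_index \<alpha> x)"
proof -
  have "\<alpha> q < bond_dim n bd q" if "q \<le> n" for q using assms that by (auto simp: bonds_def PiE_iff)
  then show ?thesis using d_pos by (auto simp: site_sel_def factor_index_def I_def core_index_def site_index_def)
qed

lemma amp_eq: "amp G x = (\<Sum>\<alpha>\<in>bonds. \<Prod>p\<in>{1..n}. e (G (factor_index \<alpha> x p)))"
  by (simp add: amp_def mps_entry_def bonds_def factor_index_def)

lemma expectation_amp2_raw:
  "has_bochner_integral (PiM I P) (\<lambda>G. amp G x1 * cnj (amp G x2))
    (complex_of_real (\<Sum>a1\<in>bonds. \<Sum>a2\<in>bonds. \<Prod>p\<in>{1..n}. core_variance n bd p * of_bool (factor_index a1 x1 p = factor_index a2 x2 p)))"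
proof -
  have "amp G x1 * cnj (amp G x2) = (\<Sum>a1\<in>bonds. \<Sum>a2\<in>bonds. \<Prod>p\<in>{1..n}. e (G (factor_index a1 x1 p)) * cnj (e (G (factor_index a2 x2 p))))" for G
    unfolding amp_eq cnj_sum cnj_prod sum_product prod.distrib ..
  then show ?thesis unfolding of_real_sum
    by (simp only:) (intro has_bochner_integral_sum expectation_pair factor_index_sel)
qed

lemma expectation_amp4_raw:
  "has_bochner_integral (PiM I P) (\<lambda>G. amp G x1 * cnj (amp G x2) * amp G x3 * cnj (amp G x4))
    (complex_of_real (\<Sum>a1\<in>bonds. \<Sum>a2\<in>bonds. \<Sum>a3\<in>bonds. \<Sum>a4\<in>bonds. \<Prod>p\<in>{1..n}. (core_variance n bd p)\<^sup>2 *
       (\<Sum>t<3. pairing_coeff \<kappa> t * of_bool (paired t (factor_index a1 x1 p) (factor_index a2 x2 p) (factor_index a3 x3 p) (factor_index a4 x4 p)))))"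
proof -
  have "amp G x1 * cnj (amp G x2) * amp G x3 * cnj (amp G x4) = (\<Sum>a1\<in>bonds. \<Sum>a2\<in>bonds. \<Sum>a3\<in>bonds. \<Sum>a4\<in>bonds.
     \<Prod>p\<in>{1..n}. e (G (factor_index a1 x1 p)) * cnj (e (G (factor_index a2 x2 p))) * e (G (factor_index a3 x3 p)) * cnj (e (G (factor_index a4 x4 p))))" for G
    unfolding amp_eq cnj_sum cnj_prod prod.distrib by (simp only: sum_distrib_left[symmetric] sum_distrib_right[symmetric])
  then show ?thesis unfolding of_real_sum
    by (simp only:) (intro has_bochner_integral_sum expectation_quad factor_index_sel)
qed

text \<open>
  The variance of a core is shared between its two bonds. An inner bond receives 1 / sqrt bd from each
  of the two adjacent cores, which compensates the summation over one index of that bond.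
\<close>
definition bond_scale :: "nat \<Rightarrow> real" where
  "bond_scale q = (if q = 0 \<or> q = n then 1 else 1 / sqrt (real bd))"

lemma core_variance_bond_scale: "p \<in> {1..n} \<Longrightarrow> core_variance n bd p = bond_scale (p - 1) * bond_scale p"
  using n_ge by (auto simp: core_variance_def bond_scale_def)

lemma bond_scale_square: "(bond_scale q)\<^sup>2 = (if q = 0 \<or> q = n then 1 else 1 / real bd)"
  by (simp add: bond_scale_def power_divide)

text \<open>
  Site p touches the bonds p - 1 and p; regrouped by bonds, every bond collects a factor from the site
  to its right (unless it is the last bond) and one from the site to its left (unless it is the first).
\<close>
lemma prod_sites_bonds:
  fixes A B :: "nat \<Rightarrow> real"
  shows "(\<Prod>p\<in>{1..n}. A (p - 1) * B p) = (\<Prod>q\<in>{0..n}. (if q < n then A q else 1) * (if q \<ge> 1 then B q else 1))"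
proof -
  have "(\<Prod>p\<in>{1..n}. A (p - 1)) = (\<Prod>q<n. A q)" using prod.atLeast1_atMost_eq[of "\<lambda>p. A (p - 1)" n] by simp
  also have "\<dots> = (\<Prod>q\<in>{0..n}. if q < n then A q else 1)" by (intro prod.mono_neutral_cong_left) auto
  finally have 1: "(\<Prod>p\<in>{1..n}. A (p - 1)) = (\<Prod>q\<in>{0..n}. if q < n then A q else 1)" .
  have 2: "(\<Prod>p\<in>{1..n}. B p) = (\<Prod>q\<in>{0..n}. if q \<ge> 1 then B q else 1)"
    by (intro prod.mono_neutral_cong_left) auto
  show ?thesis unfolding prod.distrib 1 2 ..
qed

lemma sum_bonds2:
  fixes f :: "nat \<Rightarrow> nat \<Rightarrow> nat \<Rightarrow> real"
  shows "(\<Sum>a1\<in>bonds. \<Sum>a2\<in>bonds. \<Prod>q\<in>{0..n}. f q (a1 q) (a2 q)) =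
    (\<Prod>q\<in>{0..n}. \<Sum>a<bond_dim n bd q. \<Sum>b<bond_dim n bd q. f q a b)"
  unfolding bonds_def by (simp add: prod_sum_PiE)

lemma sum_bonds4:
  fixes f :: "nat \<Rightarrow> nat \<Rightarrow> nat \<Rightarrow> nat \<Rightarrow> nat \<Rightarrow> real"
  shows "(\<Sum>a1\<in>bonds. \<Sum>a2\<in>bonds. \<Sum>a3\<in>bonds. \<Sum>a4\<in>bonds. \<Prod>q\<in>{0..n}. f q (a1 q) (a2 q) (a3 q) (a4 q)) =
    (\<Prod>q\<in>{0..n}. \<Sum>a<bond_dim n bd q. \<Sum>b<bond_dim n bd q. \<Sum>c<bond_dim n bd q. \<Sum>x<bond_dim n bd q. f q a b c x)"
  unfolding bonds_def by (simp add: prod_sum_PiE)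

lemma expectation_amp2:
  assumes "x1 < d ^ n" "x2 < d ^ n"
  shows "has_bochner_integral (PiM I P) (\<lambda>G. amp G x1 * cnj (amp G x2)) (of_bool (x1 = x2))"
proof -
  let ?S = "\<lambda>p. of_bool (site_index d n x1 p = site_index d n x2 p) :: real"
  have "(\<Prod>p\<in>{1..n}. core_variance n bd p * of_bool (factor_index a1 x1 p = factor_index a2 x2 p)) =
     (\<Prod>p\<in>{1..n}. ?S p) * (\<Prod>p\<in>{1..n}. (bond_scale (p - 1) * of_bool (a1 (p - 1) = a2 (p - 1))) * (bond_scale p * of_bool (a1 p = a2 p)))" for a1 a2
    unfolding prod.distrib[symmetric]
    by (intro prod.cong refl) (simp add: core_variance_bond_scale factor_index_def of_bool_conj)
  then have "(\<Sum>a1\<in>bonds. \<Sum>a2\<in>bonds. \<Prod>p\<in>{1..n}. core_variance n bd p * of_bool (factor_index a1 x1 p = factor_index a2 x2 p)) =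
     (\<Prod>p\<in>{1..n}. ?S p) * (\<Sum>a1\<in>bonds. \<Sum>a2\<in>bonds. \<Prod>q\<in>{0..n}.
        (if q < n then bond_scale q * of_bool (a1 q = a2 q) else 1) * (if q \<ge> 1 then bond_scale q * of_bool (a1 q = a2 q) else 1))"
    by (simp only: sum_distrib_left[symmetric] prod_sites_bonds[of "\<lambda>q. bond_scale q * of_bool (_ q = _ q)" "\<lambda>q. bond_scale q * of_bool (_ q = _ q)"])
  also have "(\<Sum>a1\<in>bonds. \<Sum>a2\<in>bonds. \<Prod>q\<in>{0..n}.
        (if q < n then bond_scale q * of_bool (a1 q = a2 q) else 1) * (if q \<ge> 1 then bond_scale q * of_bool (a1 q = a2 q) else 1)) =
      (\<Prod>q\<in>{0..n}. \<Sum>a<bond_dim n bd q. \<Sum>b<bond_dim n bd q. (if q < n then bond_scale q * of_bool (a = b) else 1) * (if q \<ge> 1 then bond_scale q * of_bool (a = b) else 1))"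
    by (rule sum_bonds2)
  also have "\<dots> = 1"
  proof (intro prod.neutral ballI)
    fix q assume q: "q \<in> {0..n}"
    show "(\<Sum>a<bond_dim n bd q. \<Sum>b<bond_dim n bd q. (if q < n then bond_scale q * of_bool (a = b) else 1) * (if q \<ge> 1 then bond_scale q * of_bool (a = b) else 1)) = 1"
    proof (cases "q = 0 \<or> q = n")
      case True
      then show ?thesis using n_ge by (auto simp: bond_dim_def bond_scale_def)
    next
      case False
      then have "(\<Sum>a<bond_dim n bd q. \<Sum>b<bond_dim n bd q. (if q < n then bond_scale q * of_bool (a = b) else 1) * (if q \<ge> 1 then bond_scale q * of_bool (a = b) else 1)) =
        (\<Sum>a<bd. \<Sum>b<bd. of_bool (a = b) * (bond_scale q)\<^sup>2)"
        using q by (intro sum.cong) (auto simp: bond_dim_def power2_eq_square)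
      also have "\<dots> = (\<Sum>a<bd. (bond_scale q)\<^sup>2)" by (intro sum.cong refl sum_of_bool_mult) auto
      also have "\<dots> = 1" using False bd_pos by (simp add: bond_scale_square)
      finally show ?thesis .
    qed
  qed
  also have "(\<Prod>p\<in>{1..n}. ?S p) = of_bool (x1 = x2)"
  proof (cases "x1 = x2")
    case False
    then obtain p where "p \<in> {1..n}" "site_index d n x1 p \<noteq> site_index d n x2 p" using site_index_inj assms by blast
    then have "(\<Prod>p\<in>{1..n}. ?S p) = 0" by (intro prod_zero) auto
    then show ?thesis using False by simp
  qed simp
  finally show ?thesis using expectation_amp2_raw[of x1 x2] by (cases "x1 = x2") simp_all
qed

text \<open>
  The coefficient of a configuration of pairings, one for each site, in the fourth moment. It is the
  weight of a configuration of a Potts chain: a change of the pairing across a bond costs 1 / bd.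
\<close>
definition pairing_weight :: "(nat \<Rightarrow> nat) \<Rightarrow> real" where
  "pairing_weight \<tau> = (\<Prod>p\<in>{1..n}. pairing_coeff \<kappa> (\<tau> p)) * (\<Prod>q\<in>{1..<n}. if \<tau> q = \<tau> (Suc q) then 1 else 1 / real bd)"

definition sites_paired :: "(nat \<Rightarrow> nat) \<Rightarrow> nat \<Rightarrow> nat \<Rightarrow> nat \<Rightarrow> nat \<Rightarrow> bool" where
  "sites_paired \<tau> x1 x2 x3 x4 \<longleftrightarrow> (\<forall>p\<in>{1..n}. paired (\<tau> p) (site_index d n x1 p) (site_index d n x2 p) (site_index d n x3 p) (site_index d n x4 p))"

definition pairings :: "(nat \<Rightarrow> nat) set" where "pairings = PiE {1..n} (\<lambda>_. {..<3})"

lemma prod_of_bool: "finite A \<Longrightarrow> (\<Prod>p\<in>A. of_bool (Q p)) = (of_bool (\<forall>p\<in>A. Q p) :: real)"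
  by (induction A rule: finite_induct) auto

text \<open>
  The summation over the bond indices factors into one sum for each bond, in which the pairings of the
  two adjacent sites meet. At an inner bond, the squared scales contribute 1 / bd^2 and the number of
  admissible indices is bd^2 or bd.
\<close>
lemma bond_sum_eq:
  assumes tau: "\<tau> \<in> pairings"
  shows "(\<Sum>a1\<in>bonds. \<Sum>a2\<in>bonds. \<Sum>a3\<in>bonds. \<Sum>a4\<in>bonds. \<Prod>p\<in>{1..n}. (core_variance n bd p)\<^sup>2 *
      (of_bool (paired (\<tau> p) (a1 (p - 1)) (a2 (p - 1)) (a3 (p - 1)) (a4 (p - 1))) * of_bool (paired (\<tau> p) (a1 p) (a2 p) (a3 p) (a4 p)))) =
    (\<Prod>q\<in>{1..<n}. if \<tau> q = \<tau> (Suc q) then 1 else 1 / real bd)"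
proof -
  let ?A = "\<lambda>q a b c x. (bond_scale q)\<^sup>2 * of_bool (paired (\<tau> (Suc q)) a b c (x::nat))"
  let ?B = "\<lambda>q a b c x. (bond_scale q)\<^sup>2 * of_bool (paired (\<tau> q) a b c (x::nat))"
  let ?f = "\<lambda>q a b c x. (if q < n then ?A q a b c x else 1) * (if q \<ge> 1 then ?B q a b c x else 1)"
  have "(\<Prod>p\<in>{1..n}. (core_variance n bd p)\<^sup>2 *
      (of_bool (paired (\<tau> p) (a1 (p - 1)) (a2 (p - 1)) (a3 (p - 1)) (a4 (p - 1))) * of_bool (paired (\<tau> p) (a1 p) (a2 p) (a3 p) (a4 p)))) =
    (\<Prod>q\<in>{0..n}. ?f q (a1 q) (a2 q) (a3 q) (a4 q))" for a1 a2 a3 a4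
  proof -
    have "(\<Prod>p\<in>{1..n}. (core_variance n bd p)\<^sup>2 *
      (of_bool (paired (\<tau> p) (a1 (p - 1)) (a2 (p - 1)) (a3 (p - 1)) (a4 (p - 1))) * of_bool (paired (\<tau> p) (a1 p) (a2 p) (a3 p) (a4 p)))) =
      (\<Prod>p\<in>{1..n}. ?A (p - 1) (a1 (p - 1)) (a2 (p - 1)) (a3 (p - 1)) (a4 (p - 1)) * ?B p (a1 p) (a2 p) (a3 p) (a4 p))"
      by (intro prod.cong refl) (simp add: core_variance_bond_scale power_mult_distrib)
    also have "\<dots> = (\<Prod>q\<in>{0..n}. ?f q (a1 q) (a2 q) (a3 q) (a4 q))"
      by (rule prod_sites_bonds[of "\<lambda>q. ?A q (a1 q) (a2 q) (a3 q) (a4 q)" "\<lambda>q. ?B q (a1 q) (a2 q) (a3 q) (a4 q)"])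
    finally show ?thesis .
  qed
  then have "(\<Sum>a1\<in>bonds. \<Sum>a2\<in>bonds. \<Sum>a3\<in>bonds. \<Sum>a4\<in>bonds. \<Prod>p\<in>{1..n}. (core_variance n bd p)\<^sup>2 *
      (of_bool (paired (\<tau> p) (a1 (p - 1)) (a2 (p - 1)) (a3 (p - 1)) (a4 (p - 1))) * of_bool (paired (\<tau> p) (a1 p) (a2 p) (a3 p) (a4 p)))) =
      (\<Sum>a1\<in>bonds. \<Sum>a2\<in>bonds. \<Sum>a3\<in>bonds. \<Sum>a4\<in>bonds. \<Prod>q\<in>{0..n}. ?f q (a1 q) (a2 q) (a3 q) (a4 q))"
    by (simp only:)
  also have "\<dots> = (\<Prod>q\<in>{0..n}. \<Sum>a<bond_dim n bd q. \<Sum>b<bond_dim n bd q. \<Sum>c<bond_dim n bd q. \<Sum>x<bond_dim n bd q. ?f q a b c x)"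
    by (rule sum_bonds4)
  also have "\<dots> = (\<Prod>q\<in>{1..<n}. if \<tau> q = \<tau> (Suc q) then 1 else 1 / real bd)"
  proof (rule prod.mono_neutral_cong_right)
    show "\<forall>q\<in>{0..n} - {1..<n}. (\<Sum>a<bond_dim n bd q. \<Sum>b<bond_dim n bd q. \<Sum>c<bond_dim n bd q. \<Sum>x<bond_dim n bd q. ?f q a b c x) = 1"
    proof
      fix q assume "q \<in> {0..n} - {1..<n}"
      then have "q = 0 \<or> q = n" by auto
      then show "(\<Sum>a<bond_dim n bd q. \<Sum>b<bond_dim n bd q. \<Sum>c<bond_dim n bd q. \<Sum>x<bond_dim n bd q. ?f q a b c x) = 1"
        using n_ge by (auto simp: bond_dim_def bond_scale_def paired_def)
    qed
    fix q assume q: "q \<in> {1..<n}"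
    then have lt: "\<tau> (Suc q) < 3" "\<tau> q < 3" using tau by (auto simp: pairings_def PiE_iff)
    have "(\<Sum>a<bond_dim n bd q. \<Sum>b<bond_dim n bd q. \<Sum>c<bond_dim n bd q. \<Sum>x<bond_dim n bd q. ?f q a b c x) =
       (\<Sum>a<bd. \<Sum>b<bd. \<Sum>c<bd. \<Sum>x<bd. (1 / (real bd)\<^sup>2) * (of_bool (paired (\<tau> (Suc q)) a b c x) * of_bool (paired (\<tau> q) a b c x)))"
    proof -
      have bs: "(bond_scale q)\<^sup>2 = 1 / real bd" using q by (simp add: bond_scale_square)
      have "?f q a b c x = (1 / (real bd)\<^sup>2) * (of_bool (paired (\<tau> (Suc q)) a b c x) * of_bool (paired (\<tau> q) a b c x))" for a b c x
        using q unfolding bs by (simp add: power2_eq_square)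
      then show ?thesis using q by (simp add: bond_dim_def)
    qed
    also have "\<dots> = (1 / (real bd)\<^sup>2) * (if \<tau> (Suc q) = \<tau> q then (real bd)\<^sup>2 else real bd)"
      unfolding sum_distrib_left[symmetric] count_paired[OF lt] ..
    also have "\<dots> = (if \<tau> q = \<tau> (Suc q) then 1 else 1 / real bd)"
      using bd_pos by (simp add: power2_eq_square)
    finally show "(\<Sum>a<bond_dim n bd q. \<Sum>b<bond_dim n bd q. \<Sum>c<bond_dim n bd q. \<Sum>x<bond_dim n bd q. ?f q a b c x) =
       (if \<tau> q = \<tau> (Suc q) then 1 else 1 / real bd)" .
  qed auto
  finally show ?thesis .
qed

text \<open>
  Expanding the product over the sites of the sums of Wick's formula yields a sum over configurations
  of pairings; for each of them the bond indices are summed out.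
\<close>
lemma expectation_amp4:
  "has_bochner_integral (PiM I P) (\<lambda>G. amp G x1 * cnj (amp G x2) * amp G x3 * cnj (amp G x4))
    (complex_of_real (\<Sum>\<tau>\<in>pairings. pairing_weight \<tau> * of_bool (sites_paired \<tau> x1 x2 x3 x4)))"
proof -
  let ?s = "site_index d n"
  let ?L = "\<lambda>\<tau> a1 a2 a3 a4 p. of_bool (paired (\<tau> p) (a1 (p - 1)) (a2 (p - 1)) (a3 (p - 1)) (a4 (p - 1))) * of_bool (paired (\<tau> p) (a1 p) (a2 p) (a3 p) (a4 (p::nat))) :: real"
  let ?S = "\<lambda>\<tau> p. of_bool (paired (\<tau> p) (?s x1 p) (?s x2 p) (?s x3 p) (?s x4 p)) :: real"
  have "(\<Prod>p\<in>{1..n}. (core_variance n bd p)\<^sup>2 *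
       (\<Sum>t<3. pairing_coeff \<kappa> t * of_bool (paired t (factor_index a1 x1 p) (factor_index a2 x2 p) (factor_index a3 x3 p) (factor_index a4 x4 p)))) =
     (\<Sum>\<tau>\<in>pairings. ((\<Prod>p\<in>{1..n}. pairing_coeff \<kappa> (\<tau> p)) * of_bool (sites_paired \<tau> x1 x2 x3 x4)) * (\<Prod>p\<in>{1..n}. (core_variance n bd p)\<^sup>2 * ?L \<tau> a1 a2 a3 a4 p))" for a1 a2 a3 a4
  proof -
    have "(\<Prod>p\<in>{1..n}. (core_variance n bd p)\<^sup>2 *
       (\<Sum>t<3. pairing_coeff \<kappa> t * of_bool (paired t (factor_index a1 x1 p) (factor_index a2 x2 p) (factor_index a3 x3 p) (factor_index a4 x4 p)))) =
       (\<Sum>\<tau>\<in>pairings. \<Prod>p\<in>{1..n}. (core_variance n bd p)\<^sup>2 * (pairing_coeff \<kappa> (\<tau> p) * of_bool (paired (\<tau> p) (factor_index a1 x1 p) (factor_index a2 x2 p) (factor_index a3 x3 p) (factor_index a4 x4 p))))"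
      unfolding sum_distrib_left pairings_def by (subst prod_sum_PiE) auto
    also have "\<dots> = (\<Sum>\<tau>\<in>pairings. \<Prod>p\<in>{1..n}. (pairing_coeff \<kappa> (\<tau> p) * ?S \<tau> p) * ((core_variance n bd p)\<^sup>2 * ?L \<tau> a1 a2 a3 a4 p))"
      by (intro sum.cong prod.cong refl) (simp add: factor_index_def paired_tuple of_bool_conj)
    also have "\<dots> = (\<Sum>\<tau>\<in>pairings. ((\<Prod>p\<in>{1..n}. pairing_coeff \<kappa> (\<tau> p)) * of_bool (sites_paired \<tau> x1 x2 x3 x4)) * (\<Prod>p\<in>{1..n}. (core_variance n bd p)\<^sup>2 * ?L \<tau> a1 a2 a3 a4 p))"
      by (intro sum.cong refl) (simp only: prod.distrib sites_paired_def prod_of_bool finite_atLeastAtMost)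
    finally show ?thesis .
  qed
  then have "(\<Sum>a1\<in>bonds. \<Sum>a2\<in>bonds. \<Sum>a3\<in>bonds. \<Sum>a4\<in>bonds. \<Prod>p\<in>{1..n}. (core_variance n bd p)\<^sup>2 *
       (\<Sum>t<3. pairing_coeff \<kappa> t * of_bool (paired t (factor_index a1 x1 p) (factor_index a2 x2 p) (factor_index a3 x3 p) (factor_index a4 x4 p)))) =
     (\<Sum>a1\<in>bonds. \<Sum>a2\<in>bonds. \<Sum>a3\<in>bonds. \<Sum>a4\<in>bonds. \<Sum>\<tau>\<in>pairings. ((\<Prod>p\<in>{1..n}. pairing_coeff \<kappa> (\<tau> p)) * of_bool (sites_paired \<tau> x1 x2 x3 x4)) * (\<Prod>p\<in>{1..n}. (core_variance n bd p)\<^sup>2 * ?L \<tau> a1 a2 a3 a4 p))"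
    by (simp only:)
  also have "\<dots> = (\<Sum>\<tau>\<in>pairings. \<Sum>a1\<in>bonds. \<Sum>a2\<in>bonds. \<Sum>a3\<in>bonds. \<Sum>a4\<in>bonds. ((\<Prod>p\<in>{1..n}. pairing_coeff \<kappa> (\<tau> p)) * of_bool (sites_paired \<tau> x1 x2 x3 x4)) * (\<Prod>p\<in>{1..n}. (core_variance n bd p)\<^sup>2 * ?L \<tau> a1 a2 a3 a4 p))"
    by (simp only: sum.swap[of _ pairings bonds])
  also have "\<dots> = (\<Sum>\<tau>\<in>pairings. pairing_weight \<tau> * of_bool (sites_paired \<tau> x1 x2 x3 x4))"
  proof (intro sum.cong refl)
    fix \<tau> assume tau: "\<tau> \<in> pairings"
    show "(\<Sum>a1\<in>bonds. \<Sum>a2\<in>bonds. \<Sum>a3\<in>bonds. \<Sum>a4\<in>bonds. ((\<Prod>p\<in>{1..n}. pairing_coeff \<kappa> (\<tau> p)) * of_bool (sites_paired \<tau> x1 x2 x3 x4)) * (\<Prod>p\<in>{1..n}. (core_variance n bd p)\<^sup>2 * ?L \<tau> a1 a2 a3 a4 p)) =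
      pairing_weight \<tau> * of_bool (sites_paired \<tau> x1 x2 x3 x4)"
      unfolding sum_distrib_left[symmetric] bond_sum_eq[OF tau] pairing_weight_def by simp
  qed
  finally show ?thesis using expectation_amp4_raw[of x1 x2 x3 x4] by (simp only:)
qed

end

section \<open>Contractions along pairings and their weights\<close>

text \<open>
  Each pairing splits the sum into a product of two inner products.
\<close>
lemma paired_sum_bound:
  fixes f1 f2 f3 f4 :: "nat \<Rightarrow> real"
  assumes t: "t < 3" and nn: "\<And>i. f1 i \<ge> 0" "\<And>i. f2 i \<ge> 0" "\<And>i. f3 i \<ge> 0" "\<And>i. f4 i \<ge> 0"
  shows "(\<Sum>a<d. \<Sum>b<d. \<Sum>c<d. \<Sum>x<d. of_bool (paired t a b c x) * (f1 a * f2 b * f3 c * f4 x))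
    \<le> L2_set f1 {..<d} * L2_set f2 {..<d} * L2_set f3 {..<d} * L2_set f4 {..<d}"
proof -
  have cs: "(\<Sum>i<d. f i * g i) \<le> L2_set f {..<d} * L2_set g {..<d}" if "\<And>i. f i \<ge> 0" "\<And>i. g i \<ge> 0" for f g :: "nat \<Rightarrow> real"
    using L2_set_mult_ineq[where A = "{..<d}" and f = f and g = g] that by simp
  have two: "(\<Sum>i<d. f i * g i) * (\<Sum>i<d. h i * k i) \<le> (L2_set f {..<d} * L2_set g {..<d}) * (L2_set h {..<d} * L2_set k {..<d})"
    if "\<And>i. f i \<ge> 0" "\<And>i. g i \<ge> 0" "\<And>i. h i \<ge> 0" "\<And>i. k i \<ge> 0" for f g h k :: "nat \<Rightarrow> real"
    using that by (intro mult_mono cs) (auto intro!: sum_nonneg mult_nonneg_nonneg)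
  consider "t = 0" | "t = 1" | "t = 2" using t by linarith
  then show ?thesis
  proof cases
    case 1
    have "(\<Sum>a<d. \<Sum>b<d. \<Sum>c<d. \<Sum>x<d. of_bool (paired t a b c x) * (f1 a * f2 b * f3 c * f4 x)) =
      (\<Sum>a<d. \<Sum>b<d. of_bool (a = b) * (\<Sum>c<d. \<Sum>x<d. of_bool (c = x) * (f1 a * f2 b * f3 c * f4 x)))"
      unfolding 1 paired_simps by (simp only: of_bool_conj sum_distrib_left mult.assoc)
    also have "\<dots> = (\<Sum>a<d. \<Sum>b<d. of_bool (a = b) * (\<Sum>c<d. f1 a * f2 b * f3 c * f4 c))"
      by (intro sum.cong refl arg_cong[of _ _ "\<lambda>x. _ * x"] sum_of_bool_mult) auto
    also have "\<dots> = (\<Sum>a<d. \<Sum>c<d. f1 a * f2 a * f3 c * f4 c)"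
      by (intro sum.cong refl sum_of_bool_mult(2)) auto
    also have "\<dots> = (\<Sum>i<d. f1 i * f2 i) * (\<Sum>i<d. f3 i * f4 i)" by (simp add: sum_product mult_ac)
    also have "\<dots> \<le> (L2_set f1 {..<d} * L2_set f2 {..<d}) * (L2_set f3 {..<d} * L2_set f4 {..<d})" by (rule two) (use nn in auto)
    finally show ?thesis by (simp add: mult_ac)
  next
    case 2
    have "(\<Sum>a<d. \<Sum>b<d. \<Sum>c<d. \<Sum>x<d. of_bool (paired t a b c x) * (f1 a * f2 b * f3 c * f4 x)) =
      (\<Sum>a<d. \<Sum>b<d. \<Sum>c<d. of_bool (c = b) * (\<Sum>x<d. of_bool (a = x) * (f1 a * f2 b * f3 c * f4 x)))"
      unfolding 2 paired_simps by (simp only: of_bool_conj sum_distrib_left mult.assoc mult.left_commute)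
    also have "\<dots> = (\<Sum>a<d. \<Sum>b<d. \<Sum>c<d. of_bool (c = b) * (f1 a * f2 b * f3 c * f4 a))"
      by (intro sum.cong refl arg_cong[of _ _ "\<lambda>x. _ * x"] sum_of_bool_mult) auto
    also have "\<dots> = (\<Sum>a<d. \<Sum>b<d. f1 a * f2 b * f3 b * f4 a)"
      by (intro sum.cong refl sum_of_bool_mult(1)) auto
    also have "\<dots> = (\<Sum>i<d. f1 i * f4 i) * (\<Sum>i<d. f2 i * f3 i)" by (simp add: sum_product mult_ac)
    also have "\<dots> \<le> (L2_set f1 {..<d} * L2_set f4 {..<d}) * (L2_set f2 {..<d} * L2_set f3 {..<d})" by (rule two) (use nn in auto)
    finally show ?thesis by (simp add: mult_ac)
  next
    case 3
    have "(\<Sum>a<d. \<Sum>b<d. \<Sum>c<d. \<Sum>x<d. of_bool (paired t a b c x) * (f1 a * f2 b * f3 c * f4 x)) =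
      (\<Sum>a<d. \<Sum>b<d. \<Sum>c<d. of_bool (a = c) * (\<Sum>x<d. of_bool (b = x) * (f1 a * f2 b * f3 c * f4 x)))"
      unfolding 3 paired_simps by (simp only: of_bool_conj sum_distrib_left mult.assoc)
    also have "\<dots> = (\<Sum>a<d. \<Sum>b<d. \<Sum>c<d. of_bool (a = c) * (f1 a * f2 b * f3 c * f4 b))"
      by (intro sum.cong refl arg_cong[of _ _ "\<lambda>x. _ * x"] sum_of_bool_mult) auto
    also have "\<dots> = (\<Sum>a<d. \<Sum>b<d. f1 a * f2 b * f3 a * f4 b)"
      by (intro sum.cong refl sum_of_bool_mult(2)) auto
    also have "\<dots> = (\<Sum>i<d. f1 i * f3 i) * (\<Sum>i<d. f2 i * f4 i)" by (simp add: sum_product mult_ac)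
    also have "\<dots> \<le> (L2_set f1 {..<d} * L2_set f3 {..<d}) * (L2_set f2 {..<d} * L2_set f4 {..<d})" by (rule two) (use nn in auto)
    finally show ?thesis by (simp add: mult_ac)
  qed
qed

lemma sum_digits:
  fixes F :: "nat \<Rightarrow> 'b::comm_monoid_add"
  shows "(\<Sum>x<m * d. F x) = (\<Sum>y<m. \<Sum>i<d. F (y * d + i))"
proof -
  have "(\<Sum>x<m * d. F x) = (\<Sum>y<m. sum F {y * d..<y * d + d})" by (rule sum.nat_group[symmetric])
  also have "\<dots> = (\<Sum>y<m. \<Sum>i<d. F (y * d + i))"
  proof (rule sum.cong[OF refl])
    fix y
    show "sum F {y * d..<y * d + d} = (\<Sum>i<d. F (y * d + i))"
      using sum.shift_bounds_nat_ivl[of F 0 "y * d" d] by (simp add: atLeast0LessThan add.commute)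
  qed
  finally show ?thesis .
qed

text \<open>
  Induction on the number of sites: the induction hypothesis is applied to all digits but the last,
  with the last digits fixed, and leaves the single-site bound for the norms of the slices.
\<close>
lemma sites_paired_sum_bound:
  fixes f1 f2 f3 f4 :: "nat \<Rightarrow> real"
  assumes "\<forall>p\<in>{1..n}. \<tau> p < 3" and "\<And>i. f1 i \<ge> 0" "\<And>i. f2 i \<ge> 0" "\<And>i. f3 i \<ge> 0" "\<And>i. f4 i \<ge> 0" and d: "d > 0"
  shows "(\<Sum>a<d ^ n. \<Sum>b<d ^ n. \<Sum>c<d ^ n. \<Sum>x<d ^ n.
      of_bool (\<forall>p\<in>{1..n}. paired (\<tau> p) (site_index d n a p) (site_index d n b p) (site_index d n c p) (site_index d n x p)) *
       (f1 a * f2 b * f3 c * f4 x))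
    \<le> L2_set f1 {..<d ^ n} * L2_set f2 {..<d ^ n} * L2_set f3 {..<d ^ n} * L2_set f4 {..<d ^ n}"
  using assms
proof (induction n arbitrary: f1 f2 f3 f4)
  case 0
  then show ?case by (simp add: lessThan_Suc L2_set_def)
next
  case (Suc n)
  let ?s = "site_index d n"
  define S where "S a b c x = (of_bool (\<forall>p\<in>{1..n}. paired (\<tau> p) (?s a p) (?s b p) (?s c p) (?s x p)) :: real)" for a b c x
  define S' where "S' a b c x = (of_bool (\<forall>p\<in>{1..Suc n}. paired (\<tau> p) (site_index d (Suc n) a p) (site_index d (Suc n) b p) (site_index d (Suc n) c p) (site_index d (Suc n) x p)) :: real)" for a b c x
  define N where "N f i = L2_set (\<lambda>y. f (y * d + i)) {..<d ^ n}" for f and i :: nat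
  have N0: "N f i \<ge> 0" for f i by (simp add: N_def)
  have NL: "L2_set (N f) {..<d} = L2_set f {..<d ^ Suc n}" for f
  proof -
    have "(\<Sum>i<d. (N f i)\<^sup>2) = (\<Sum>i<d. \<Sum>y<d ^ n. (f (y * d + i))\<^sup>2)"
      unfolding N_def L2_set_def by (simp add: sum_nonneg)
    also have "\<dots> = (\<Sum>x<d ^ n * d. (f x)\<^sup>2)" unfolding sum_digits by (rule sum.swap)
    finally show ?thesis by (simp add: L2_set_def mult.commute)
  qed
  have S': "S' (y1 * d + i1) (y2 * d + i2) (y3 * d + i3) (y4 * d + i4) = of_bool (paired (\<tau> (Suc n)) i1 i2 i3 i4) * S y1 y2 y3 y4"
    if "i1 < d" "i2 < d" "i3 < d" "i4 < d" for y1 i1 y2 i2 y3 i3 y4 i4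
  proof -
    have si: "site_index d (Suc n) (y * d + i) p = ?s y p" if "p \<le> n" "i < d" for y i p
      using that by (simp add: site_index_Suc)
    have sl: "site_index d (Suc n) (y * d + i) (Suc n) = i" if "i < d" for y i
      using that by (simp add: site_index_Suc_last)
    have "{1..Suc n} = insert (Suc n) {1..n}" by auto
    then have split: "(\<forall>p\<in>{1..Suc n}. Q p) \<longleftrightarrow> Q (Suc n) \<and> (\<forall>p\<in>{1..n}. Q p)" for Q by simp
    have "(\<forall>p\<in>{1..n}. paired (\<tau> p) (site_index d (Suc n) (y1 * d + i1) p) (site_index d (Suc n) (y2 * d + i2) p)
        (site_index d (Suc n) (y3 * d + i3) p) (site_index d (Suc n) (y4 * d + i4) p)) \<longleftrightarrow>
      (\<forall>p\<in>{1..n}. paired (\<tau> p) (?s y1 p) (?s y2 p) (?s y3 p) (?s y4 p))"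
    proof (intro ball_cong refl)
      fix p assume "p \<in> {1..n}"
      then have "p \<le> n" by simp
      from si[OF this] that
      show "paired (\<tau> p) (site_index d (Suc n) (y1 * d + i1) p) (site_index d (Suc n) (y2 * d + i2) p)
        (site_index d (Suc n) (y3 * d + i3) p) (site_index d (Suc n) (y4 * d + i4) p) \<longleftrightarrow> paired (\<tau> p) (?s y1 p) (?s y2 p) (?s y3 p) (?s y4 p)"
        by (simp only:)
    qed
    then show ?thesis unfolding S'_def S_def of_bool_conj[symmetric] split by (simp only: sl that)
  qed
  have m: "d ^ Suc n = d ^ n * d" by simp
  have "(\<Sum>a<d ^ Suc n. \<Sum>b<d ^ Suc n. \<Sum>c<d ^ Suc n. \<Sum>x<d ^ Suc n. S' a b c x * (f1 a * f2 b * f3 c * f4 x)) =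
    (\<Sum>i1<d. \<Sum>i2<d. \<Sum>i3<d. \<Sum>i4<d. \<Sum>y1<d ^ n. \<Sum>y2<d ^ n. \<Sum>y3<d ^ n. \<Sum>y4<d ^ n.
      S' (y1 * d + i1) (y2 * d + i2) (y3 * d + i3) (y4 * d + i4) * (f1 (y1 * d + i1) * f2 (y2 * d + i2) * f3 (y3 * d + i3) * f4 (y4 * d + i4)))"
    unfolding m sum_digits by (simp only: sum.swap[of _ "{..<d}" "{..<d ^ n}"])
  also have "\<dots> = (\<Sum>i1<d. \<Sum>i2<d. \<Sum>i3<d. \<Sum>i4<d. of_bool (paired (\<tau> (Suc n)) i1 i2 i3 i4) * (\<Sum>y1<d ^ n. \<Sum>y2<d ^ n. \<Sum>y3<d ^ n. \<Sum>y4<d ^ n.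
      S y1 y2 y3 y4 * (f1 (y1 * d + i1) * f2 (y2 * d + i2) * f3 (y3 * d + i3) * f4 (y4 * d + i4))))"
    unfolding sum_distrib_left by (intro sum.cong refl) (simp add: S' mult.assoc)
  also have "\<dots> \<le> (\<Sum>i1<d. \<Sum>i2<d. \<Sum>i3<d. \<Sum>i4<d. of_bool (paired (\<tau> (Suc n)) i1 i2 i3 i4) * (N f1 i1 * N f2 i2 * N f3 i3 * N f4 i4))"
    unfolding S_def N_def
    by (intro sum_mono mult_left_mono Suc.IH) (use Suc.prems in auto)
  also have "\<dots> \<le> L2_set (N f1) {..<d} * L2_set (N f2) {..<d} * L2_set (N f3) {..<d} * L2_set (N f4) {..<d}"
    by (rule paired_sum_bound) (use Suc.prems(1) N0 in auto)
  finally show ?case unfolding NL S'_def .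
qed

text \<open>
  A transfer matrix computation: from a given pairing at site n, the next site continues with the same
  pairing with weight 1 or with one of the two others with weight c.
\<close>
lemma pairing_weight_sum:
  fixes c :: real
  assumes "n \<ge> 1"
  shows "(\<Sum>\<tau>\<in>PiE {1..n} (\<lambda>_. {..<3::nat}). \<Prod>q\<in>{1..<n}. if \<tau> q = \<tau> (Suc q) then 1 else c) = 3 * (1 + 2 * c) ^ (n - 1)"
  using assms
proof (induction n rule: nat_induct_at_least)
  case base
  have "real (card (PiE {1..1::nat} (\<lambda>_. {..<3::nat}))) = 3" by (simp add: card_PiE)
  then show ?case by simp
next
  case (Suc n)
  let ?w = "\<lambda>n \<tau>. \<Prod>q\<in>{1..<n}. if \<tau> q = (\<tau> (Suc q) :: nat) then 1 else c"
  have ins: "{1..Suc n} = insert (Suc n) {1..n}" by auto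
  have "(\<Sum>\<tau>\<in>PiE {1..Suc n} (\<lambda>_. {..<3}). ?w (Suc n) \<tau>) =
     (\<Sum>(t, g)\<in>{..<3} \<times> PiE {1..n} (\<lambda>_. {..<3}). ?w (Suc n) (g(Suc n := t)))"
    unfolding ins PiE_insert_eq
    by (subst sum.reindex[OF inj_combinator]) (simp_all only: o_def case_prod_beta' atLeastAtMost_iff, simp)
  also have "\<dots> = (\<Sum>g\<in>PiE {1..n} (\<lambda>_. {..<3}). \<Sum>t<3. ?w (Suc n) (g(Suc n := t)))"
    by (subst sum.swap) (simp add: sum.cartesian_product)
  also have "\<dots> = (\<Sum>g\<in>PiE {1..n} (\<lambda>_. {..<3}). ?w n g * (1 + 2 * c))"
  proof (intro sum.cong refl)
    fix g assume g: "g \<in> PiE {1..n} (\<lambda>_. {..<3::nat})"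
    have "?w (Suc n) (g(Suc n := t)) = ?w n g * (if g n = t then 1 else c)" for t
    proof -
      have "{1..<Suc n} = insert n {1..<n}" using Suc.hyps by auto
      then have "?w (Suc n) (g(Suc n := t)) = (if g n = t then 1 else c) * (\<Prod>q\<in>{1..<n}. if (g(Suc n := t)) q = (g(Suc n := t)) (Suc q) then 1 else c)"
        by simp
      also have "(\<Prod>q\<in>{1..<n}. if (g(Suc n := t)) q = (g(Suc n := t)) (Suc q) then 1 else c) = ?w n g"
        by (intro prod.cong) auto
      finally show ?thesis by simp
    qed
    moreover have "g n \<in> {0, 1, 2}"
    proof -
      have "g n < 3" using g Suc.hyps by (auto simp: PiE_iff)
      then show ?thesis by auto
    qed
    ultimately show "(\<Sum>t<3. ?w (Suc n) (g(Suc n := t))) = ?w n g * (1 + 2 * c)"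
      by (auto simp: sum_three algebra_simps)
  qed
  also have "\<dots> = 3 * (1 + 2 * c) ^ (Suc n - 1)"
    unfolding sum_distrib_right[symmetric] Suc.IH using Suc.hyps by (cases n) auto
  finally show ?case .
qed

context gaussian_cores
begin

definition const_pairing :: "nat \<Rightarrow> nat \<Rightarrow> nat" where
  "const_pairing t = (\<lambda>p\<in>{1..n}. t)"

lemma const_pairing_in: "t < 3 \<Longrightarrow> const_pairing t \<in> pairings"
  by (auto simp: const_pairing_def pairings_def)

lemma const_pairing_inj: "const_pairing t = const_pairing s \<longleftrightarrow> t = s"
proof
  assume "const_pairing t = const_pairing s"
  then have "const_pairing t 1 = const_pairing s 1" by simp
  then show "t = s" using n_ge by (simp add: const_pairing_def)
qed simp

lemma sites_paired_const:
  assumes "a < d ^ n" "b < d ^ n" "c < d ^ n" "x < d ^ n" "t < 3"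
  shows "sites_paired (const_pairing t) a b c x \<longleftrightarrow> paired t a b c x"
proof
  let ?s = "site_index d n"
  assume "sites_paired (const_pairing t) a b c x"
  then have h: "\<forall>p\<in>{1..n}. paired t (?s a p) (?s b p) (?s c p) (?s x p)"
    by (simp add: sites_paired_def const_pairing_def)
  have inj: "y = z" if "y < d ^ n" "z < d ^ n" "\<forall>p\<in>{1..n}. ?s y p = ?s z p" for y z
    using site_index_inj that by blast
  consider "t = 0" | "t = 1" | "t = 2" using assms by linarith
  then show "paired t a b c x"
  proof cases
    case 1
    have "a = b" "c = x" by (rule inj; use h assms in \<open>simp add: 1 paired_simps\<close>)+
    then show ?thesis by (simp add: 1 paired_simps)
  next
    case 2
    have h2: "\<forall>p\<in>{1..n}. ?s a p = ?s x p \<and> ?s c p = ?s b p" using h unfolding 2 paired_simps .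
    have "a = x" "c = b" by (rule inj; use h2 assms in simp)+
    then show ?thesis unfolding 2 paired_simps by simp
  next
    case 3
    have "a = c" "b = x" by (rule inj; use h assms in \<open>simp add: 3 paired_simps\<close>)+
    then show ?thesis by (simp add: 3 paired_simps)
  qed
next
  assume "paired t a b c x"
  then show "sites_paired (const_pairing t) a b c x"
    by (auto simp: sites_paired_def const_pairing_def paired_def split: if_splits)
qed

lemma prod_const_pairing: "(\<Prod>q\<in>{1..<n}. if const_pairing t q = const_pairing t (Suc q) then 1 else c) = (1::real)"
  by (rule prod.neutral) (auto simp: const_pairing_def)

lemma pairing_weight_le:
  "0 \<le> pairing_weight \<tau>" "pairing_weight \<tau> \<le> (\<Prod>q\<in>{1..<n}. if \<tau> q = \<tau> (Suc q) then 1 else 1 / real bd)"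
proof -
  have p: "0 \<le> pairing_coeff \<kappa> t" "pairing_coeff \<kappa> t \<le> 1" for t using kap by (auto simp: pairing_coeff_def)
  have nn: "0 \<le> (\<Prod>q\<in>{1..<n}. if \<tau> q = \<tau> (Suc q) then 1 else 1 / real bd)" by (intro prod_nonneg) auto
  have a: "0 \<le> (\<Prod>p\<in>{1..n}. pairing_coeff \<kappa> (\<tau> p))" by (intro prod_nonneg) (use p in auto)
  have b: "(\<Prod>p\<in>{1..n}. pairing_coeff \<kappa> (\<tau> p)) \<le> 1" by (intro prod_le_1) (use p in auto)
  show "0 \<le> pairing_weight \<tau>" unfolding pairing_weight_def by (intro mult_nonneg_nonneg a nn)
  show "pairing_weight \<tau> \<le> (\<Prod>q\<in>{1..<n}. if \<tau> q = \<tau> (Suc q) then 1 else 1 / real bd)"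
    unfolding pairing_weight_def using mult_right_mono[OF b nn] by simp
qed

lemma pairing_weight_const: "pairing_weight (const_pairing t) \<le> 1" "t < 2 \<Longrightarrow> pairing_weight (const_pairing t) = 1"
  using pairing_weight_le(2)[of "const_pairing t"] unfolding prod_const_pairing
  by (auto simp: pairing_weight_def prod_const_pairing) (auto simp: const_pairing_def pairing_coeff_def)

text \<open>
  The total weight of the nonconstant configurations when all three pairings count; in general it is
  an upper bound.
\<close>
definition excess :: real where "excess = 3 * ((1 + 2 / real bd) ^ (n - 1) - 1)"

lemma finite_pairings: "finite pairings" unfolding pairings_def by (intro finite_PiE) auto

lemma sum_nonconst_weights:
  "(\<Sum>\<tau>\<in>pairings - const_pairing ` {..<3}. pairing_weight \<tau>) \<le> excess"
proof -
  let ?w = "\<lambda>\<tau>. \<Prod>q\<in>{1..<n}. if \<tau> q = \<tau> (Suc q) then 1 else 1 / real bd"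
  have "(\<Sum>\<tau>\<in>pairings - const_pairing ` {..<3}. pairing_weight \<tau>) \<le> (\<Sum>\<tau>\<in>pairings - const_pairing ` {..<3}. ?w \<tau>)"
    by (intro sum_mono pairing_weight_le)
  also have "\<dots> = (\<Sum>\<tau>\<in>pairings. ?w \<tau>) - (\<Sum>\<tau>\<in>const_pairing ` {..<3}. ?w \<tau>)"
    using finite_pairings const_pairing_in by (intro sum_diff) auto
  also have "(\<Sum>\<tau>\<in>const_pairing ` {..<3}. ?w \<tau>) = (\<Sum>t<3. ?w (const_pairing t))"
    by (subst sum.reindex) (auto simp: inj_on_def const_pairing_inj)
  also have "\<dots> = 3" unfolding prod_const_pairing by simp
  also have "(\<Sum>\<tau>\<in>pairings. ?w \<tau>) = 3 * (1 + 2 * (1 / real bd)) ^ (n - 1)"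
    unfolding pairings_def by (rule pairing_weight_sum) (use n_ge in simp)
  finally show ?thesis by (simp add: excess_def algebra_simps)
qed

end

section \<open>The variance of a quadratic form in an rMPS\<close>

context gaussian_cores
begin

definition qform :: "(nat \<Rightarrow> nat \<Rightarrow> complex) \<Rightarrow> (nat \<times> nat \<times> nat \<times> nat \<Rightarrow> 'a) \<Rightarrow> complex" where
  "qform R G = (\<Sum>x<d ^ n. \<Sum>y<d ^ n. cnj (amp G x) * R x y * amp G y)"

definition contraction :: "(nat \<Rightarrow> nat) \<Rightarrow> (nat \<Rightarrow> nat \<Rightarrow> complex) \<Rightarrow> complex" where
  "contraction \<tau> R = (\<Sum>x<d ^ n. \<Sum>y<d ^ n. \<Sum>x'<d ^ n. \<Sum>y'<d ^ n. R x y * cnj (R x' y') * of_bool (sites_paired \<tau> y x x' y'))"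

lemma expectation_qform: "has_bochner_integral (PiM I P) (qform R) (\<Sum>x<d ^ n. R x x)"
proof -
  have "has_bochner_integral (PiM I P) (\<lambda>G. \<Sum>x<d ^ n. \<Sum>y<d ^ n. R x y * (amp G y * cnj (amp G x))) (\<Sum>x<d ^ n. \<Sum>y<d ^ n. R x y * of_bool (y = x))"
    by (intro has_bochner_integral_sum has_bochner_integral_mult_right expectation_amp2) auto
  moreover have "(\<Sum>x<d ^ n. \<Sum>y<d ^ n. R x y * of_bool (y = x)) = (\<Sum>x<d ^ n. R x x)"
    by (intro sum.cong refl) (subst mult.commute, simp add: sum_of_bool_mult)
  moreover have "qform R = (\<lambda>G. \<Sum>x<d ^ n. \<Sum>y<d ^ n. R x y * (amp G y * cnj (amp G x)))"
    by (simp add: qform_def fun_eq_iff mult_ac)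
  ultimately show ?thesis by simp
qed

lemma expectation_qform_square:
  "has_bochner_integral (PiM I P) (\<lambda>G. qform R G * cnj (qform R G)) (\<Sum>\<tau>\<in>pairings. complex_of_real (pairing_weight \<tau>) * contraction \<tau> R)"
proof -
  have "qform R G * cnj (qform R G) = (\<Sum>x<d ^ n. \<Sum>y<d ^ n. \<Sum>x'<d ^ n. \<Sum>y'<d ^ n.
      (R x y * cnj (R x' y')) * (amp G y * cnj (amp G x) * amp G x' * cnj (amp G y')))" for G
  proof -
    have "(\<Sum>x<d ^ n. \<Sum>y<d ^ n. \<Sum>x'<d ^ n. \<Sum>y'<d ^ n. (R x y * cnj (R x' y')) * (amp G y * cnj (amp G x) * amp G x' * cnj (amp G y')))
      = (\<Sum>x<d ^ n. \<Sum>y<d ^ n. \<Sum>x'<d ^ n. \<Sum>y'<d ^ n. (cnj (amp G x) * R x y * amp G y) * cnj (cnj (amp G x') * R x' y' * amp G y'))"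
      by (intro sum.cong refl) (simp add: mult_ac)
    also have "\<dots> = qform R G * cnj (qform R G)"
      unfolding qform_def cnj_sum by (simp only: sum_distrib_left[symmetric] sum_distrib_right[symmetric])
    finally show ?thesis by simp
  qed
  moreover have "has_bochner_integral (PiM I P) (\<lambda>G. \<Sum>x<d ^ n. \<Sum>y<d ^ n. \<Sum>x'<d ^ n. \<Sum>y'<d ^ n.
      (R x y * cnj (R x' y')) * (amp G y * cnj (amp G x) * amp G x' * cnj (amp G y')))
    (\<Sum>x<d ^ n. \<Sum>y<d ^ n. \<Sum>x'<d ^ n. \<Sum>y'<d ^ n. (R x y * cnj (R x' y')) *
       complex_of_real (\<Sum>\<tau>\<in>pairings. pairing_weight \<tau> * of_bool (sites_paired \<tau> y x x' y')))"
    by (intro has_bochner_integral_sum has_bochner_integral_mult_right expectation_amp4)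
  moreover have "(\<Sum>x<d ^ n. \<Sum>y<d ^ n. \<Sum>x'<d ^ n. \<Sum>y'<d ^ n. (R x y * cnj (R x' y')) *
       complex_of_real (\<Sum>\<tau>\<in>pairings. pairing_weight \<tau> * of_bool (sites_paired \<tau> y x x' y')))
     = (\<Sum>\<tau>\<in>pairings. complex_of_real (pairing_weight \<tau>) * contraction \<tau> R)"
  proof -
    have "(\<Sum>x<d ^ n. \<Sum>y<d ^ n. \<Sum>x'<d ^ n. \<Sum>y'<d ^ n. (R x y * cnj (R x' y')) *
       complex_of_real (\<Sum>\<tau>\<in>pairings. pairing_weight \<tau> * of_bool (sites_paired \<tau> y x x' y')))
      = (\<Sum>x<d ^ n. \<Sum>y<d ^ n. \<Sum>x'<d ^ n. \<Sum>y'<d ^ n. \<Sum>\<tau>\<in>pairings. complex_of_real (pairing_weight \<tau>) * (R x y * cnj (R x' y') * of_bool (sites_paired \<tau> y x x' y')))"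
      unfolding of_real_sum sum_distrib_left by (intro sum.cong refl) (simp add: mult_ac)
    also have "\<dots> = (\<Sum>\<tau>\<in>pairings. \<Sum>x<d ^ n. \<Sum>y<d ^ n. \<Sum>x'<d ^ n. \<Sum>y'<d ^ n. complex_of_real (pairing_weight \<tau>) * (R x y * cnj (R x' y') * of_bool (sites_paired \<tau> y x x' y')))"
      by (simp only: sum.swap[of _ pairings "{..<d ^ n}"])
    finally show ?thesis unfolding contraction_def sum_distrib_left .
  qed
  ultimately show ?thesis by (simp only:)
qed

definition gram :: "nat \<Rightarrow> (nat \<Rightarrow> nat \<Rightarrow> complex) \<Rightarrow> nat \<Rightarrow> nat \<Rightarrow> complex" where
  "gram J g x y = (\<Sum>j<J. g j x * cnj (g j y))"

definition gtrace :: "nat \<Rightarrow> (nat \<Rightarrow> nat \<Rightarrow> complex) \<Rightarrow> real" where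
  "gtrace J g = (\<Sum>j<J. \<Sum>x<d ^ n. (cmod (g j x))\<^sup>2)"

lemma gram_trace: "(\<Sum>x<d ^ n. gram J g x x) = complex_of_real (gtrace J g)"
  unfolding gram_def gtrace_def by (subst sum.swap) (simp add: complex_norm_square del: of_real_power)

text \<open>
  Expand both copies of R = sum_j g_j g_j^* and apply the Cauchy--Schwarz bound over the sites to each
  of the terms, which leaves the sum of all |g_j|^2 |g_j'|^2, that is (tr R)^2.
\<close>
lemma cmod_contraction_gram_le:
  assumes "\<tau> \<in> pairings"
  shows "cmod (contraction \<tau> (gram J g)) \<le> (gtrace J g)\<^sup>2"
proof -
  let ?m = "{..<d ^ n}"
  let ?b = "\<lambda>a b c x. of_bool (sites_paired \<tau> a b c x) :: real"
  have t: "\<forall>p\<in>{1..n}. \<tau> p < 3" using assms by (auto simp: pairings_def PiE_iff)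
  have "cmod (contraction \<tau> (gram J g)) \<le> (\<Sum>x\<in>?m. \<Sum>y\<in>?m. \<Sum>x'\<in>?m. \<Sum>y'\<in>?m. (\<Sum>j<J. cmod (g j x) * cmod (g j y)) * (\<Sum>j<J. cmod (g j x') * cmod (g j y')) * ?b y x x' y')"
    unfolding contraction_def gram_def
  proof (intro sum_norm_le)
    fix x y x' y'
    show "cmod ((\<Sum>j<J. g j x * cnj (g j y)) * cnj (\<Sum>j<J. g j x' * cnj (g j y')) * of_bool (sites_paired \<tau> y x x' y')) \<le> (\<Sum>j<J. cmod (g j x) * cmod (g j y)) * (\<Sum>j<J. cmod (g j x') * cmod (g j y')) * ?b y x x' y'"
      unfolding norm_mult complex_mod_cnj
      by (intro mult_mono order_trans[OF norm_sum] sum_mono mult_nonneg_nonneg sum_nonneg) (auto simp: norm_mult)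
  qed
  also have "\<dots> = (\<Sum>x\<in>?m. \<Sum>y\<in>?m. \<Sum>x'\<in>?m. \<Sum>y'\<in>?m. \<Sum>j<J. \<Sum>j'<J. ?b y x x' y' * (cmod (g j y) * cmod (g j x) * cmod (g j' x') * cmod (g j' y')))"
  proof (intro sum.cong refl)
    fix x y x' y'
    have "(\<Sum>j<J. cmod (g j x) * cmod (g j y)) * (\<Sum>j<J. cmod (g j x') * cmod (g j y')) * ?b y x x' y'
      = ?b y x x' y' * ((\<Sum>j<J. cmod (g j x) * cmod (g j y)) * (\<Sum>j<J. cmod (g j x') * cmod (g j y')))"
      by (rule mult.commute)
    also have "\<dots> = (\<Sum>j<J. \<Sum>j'<J. ?b y x x' y' * ((cmod (g j x) * cmod (g j y)) * (cmod (g j' x') * cmod (g j' y'))))"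
      by (subst sum_product) (simp only: sum_distrib_left)
    also have "\<dots> = (\<Sum>j<J. \<Sum>j'<J. ?b y x x' y' * (cmod (g j y) * cmod (g j x) * cmod (g j' x') * cmod (g j' y')))"
      by (intro sum.cong refl) (simp only: mult_ac)
    finally show "(\<Sum>j<J. cmod (g j x) * cmod (g j y)) * (\<Sum>j<J. cmod (g j x') * cmod (g j y')) * ?b y x x' y' =
       (\<Sum>j<J. \<Sum>j'<J. ?b y x x' y' * (cmod (g j y) * cmod (g j x) * cmod (g j' x') * cmod (g j' y')))" .
  qed
  also have "\<dots> = (\<Sum>j<J. \<Sum>j'<J. \<Sum>x\<in>?m. \<Sum>y\<in>?m. \<Sum>x'\<in>?m. \<Sum>y'\<in>?m. ?b y x x' y' * (cmod (g j y) * cmod (g j x) * cmod (g j' x') * cmod (g j' y')))"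
    by (simp only: sum.swap[of _ "{..<J}" ?m])
  also have "\<dots> = (\<Sum>j<J. \<Sum>j'<J. \<Sum>y\<in>?m. \<Sum>x\<in>?m. \<Sum>x'\<in>?m. \<Sum>y'\<in>?m. ?b y x x' y' * (cmod (g j y) * cmod (g j x) * cmod (g j' x') * cmod (g j' y')))"
    by (intro sum.cong refl sum.swap)
  also have "\<dots> \<le> (\<Sum>j<J. \<Sum>j'<J. L2_set (\<lambda>x. cmod (g j x)) ?m * L2_set (\<lambda>x. cmod (g j x)) ?m * L2_set (\<lambda>x. cmod (g j' x)) ?m * L2_set (\<lambda>x. cmod (g j' x)) ?m)"
    unfolding sites_paired_def by (intro sum_mono sites_paired_sum_bound t d_pos) auto
  also have "\<dots> = (\<Sum>j<J. \<Sum>j'<J. (\<Sum>x\<in>?m. (cmod (g j x))\<^sup>2) * (\<Sum>x\<in>?m. (cmod (g j' x))\<^sup>2))"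
  proof -
    have "L2_set f ?m * L2_set f ?m = (\<Sum>x\<in>?m. (f x)\<^sup>2)" for f unfolding L2_set_def by (simp add: sum_nonneg)
    then show ?thesis by (simp add: mult.assoc)
  qed
  also have "\<dots> = (gtrace J g)\<^sup>2" by (simp add: gtrace_def power2_eq_square sum_product)
  finally show ?thesis .
qed

text \<open>
  Constant configurations are the three pairings of a Gaussian vector without tensor structure.
\<close>
lemma contraction_const:
  "contraction (const_pairing 0) R = (\<Sum>x<d ^ n. R x x) * cnj (\<Sum>x<d ^ n. R x x)"
  "contraction (const_pairing 1) R = complex_of_real (\<Sum>x<d ^ n. \<Sum>y<d ^ n. (cmod (R x y))\<^sup>2)"
  "contraction (const_pairing 2) R = (\<Sum>x<d ^ n. \<Sum>y<d ^ n. R x y * cnj (R y x))"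
proof -
  let ?m = "{..<d ^ n}"
  have e: "contraction (const_pairing t) R = (\<Sum>x\<in>?m. \<Sum>y\<in>?m. \<Sum>x'\<in>?m. \<Sum>y'\<in>?m. R x y * cnj (R x' y') * of_bool (paired t y x x' y'))" if "t < 3" for t
    unfolding contraction_def by (intro sum.cong refl) (simp add: sites_paired_const that)
  have lt3: "(0::nat) < 3" "(1::nat) < 3" "(2::nat) < 3" by simp_all
  have "contraction (const_pairing 0) R = (\<Sum>x\<in>?m. \<Sum>y\<in>?m. of_bool (y = x) * (\<Sum>x'\<in>?m. \<Sum>y'\<in>?m. of_bool (x' = y') * (R x y * cnj (R x' y'))))"
    unfolding e[OF lt3(1)] paired_simps sum_distrib_left by (simp only: of_bool_conj mult_ac)
  also have "\<dots> = (\<Sum>x\<in>?m. \<Sum>y\<in>?m. of_bool (y = x) * (\<Sum>x'\<in>?m. R x y * cnj (R x' x')))"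
    by (intro sum.cong refl arg_cong[of _ _ "\<lambda>x. _ * x"] sum_of_bool_mult(2)) auto
  also have "\<dots> = (\<Sum>x\<in>?m. \<Sum>x'\<in>?m. R x x * cnj (R x' x'))" by (intro sum.cong refl sum_of_bool_mult(1)) auto
  finally show "contraction (const_pairing 0) R = (\<Sum>x<d ^ n. R x x) * cnj (\<Sum>x<d ^ n. R x x)"
    by (simp add: sum_product)
  have "contraction (const_pairing 1) R = (\<Sum>x\<in>?m. \<Sum>y\<in>?m. \<Sum>x'\<in>?m. of_bool (x' = x) * (\<Sum>y'\<in>?m. of_bool (y = y') * (R x y * cnj (R x' y'))))"
    unfolding e[OF lt3(2)] paired_simps sum_distrib_left by (simp only: of_bool_conj mult_ac)
  also have "\<dots> = (\<Sum>x\<in>?m. \<Sum>y\<in>?m. \<Sum>x'\<in>?m. of_bool (x' = x) * (R x y * cnj (R x' y)))"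
    by (intro sum.cong refl arg_cong[of _ _ "\<lambda>x. _ * x"] sum_of_bool_mult(2)) auto
  also have "\<dots> = (\<Sum>x\<in>?m. \<Sum>y\<in>?m. R x y * cnj (R x y))" by (intro sum.cong refl sum_of_bool_mult(1)) auto
  finally show "contraction (const_pairing 1) R = complex_of_real (\<Sum>x<d ^ n. \<Sum>y<d ^ n. (cmod (R x y))\<^sup>2)"
    by (simp add: complex_norm_square del: of_real_power)
  have "contraction (const_pairing 2) R = (\<Sum>x\<in>?m. \<Sum>y\<in>?m. \<Sum>x'\<in>?m. of_bool (y = x') * (\<Sum>y'\<in>?m. of_bool (x = y') * (R x y * cnj (R x' y'))))"
    unfolding e[OF lt3(3)] paired_simps sum_distrib_left by (simp only: of_bool_conj mult_ac)
  also have "\<dots> = (\<Sum>x\<in>?m. \<Sum>y\<in>?m. \<Sum>x'\<in>?m. of_bool (y = x') * (R x y * cnj (R x' x)))"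
    by (intro sum.cong refl arg_cong[of _ _ "\<lambda>x. _ * x"] sum_of_bool_mult(2)) auto
  also have "\<dots> = (\<Sum>x\<in>?m. \<Sum>y\<in>?m. R x y * cnj (R y x))" by (intro sum.cong refl sum_of_bool_mult(2)) auto
  finally show "contraction (const_pairing 2) R = (\<Sum>x<d ^ n. \<Sum>y<d ^ n. R x y * cnj (R y x))" .
qed

lemma Re_contraction_transpose_le:
  "Re (\<Sum>x<d ^ n. \<Sum>y<d ^ n. R x y * cnj (R y x)) \<le> (\<Sum>x<d ^ n. \<Sum>y<d ^ n. (cmod (R x y))\<^sup>2)"
proof -
  let ?m = "{..<d ^ n}"
  have "Re (\<Sum>x\<in>?m. \<Sum>y\<in>?m. R x y * cnj (R y x)) \<le> (\<Sum>x\<in>?m. \<Sum>y\<in>?m. ((cmod (R x y))\<^sup>2 + (cmod (R y x))\<^sup>2) / 2)"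
    unfolding Re_sum
  proof (intro sum_mono)
    fix x y
    have "Re (R x y * cnj (R y x)) \<le> cmod (R x y * cnj (R y x))" by (rule complex_Re_le_cmod)
    also have "\<dots> = cmod (R x y) * cmod (R y x)" by (simp add: norm_mult)
    also have "\<dots> \<le> ((cmod (R x y))\<^sup>2 + (cmod (R y x))\<^sup>2) / 2"
      using sum_squares_bound[of "cmod (R x y)" "cmod (R y x)"] by simp
    finally show "Re (R x y * cnj (R y x)) \<le> ((cmod (R x y))\<^sup>2 + (cmod (R y x))\<^sup>2) / 2" .
  qed
  also have "\<dots> = ((\<Sum>x\<in>?m. \<Sum>y\<in>?m. (cmod (R x y))\<^sup>2) + (\<Sum>x\<in>?m. \<Sum>y\<in>?m. (cmod (R y x))\<^sup>2)) / 2"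
    by (simp only: sum.distrib sum_divide_distrib[symmetric])
  also have "(\<Sum>x\<in>?m. \<Sum>y\<in>?m. (cmod (R y x))\<^sup>2) = (\<Sum>x\<in>?m. \<Sum>y\<in>?m. (cmod (R x y))\<^sup>2)" by (rule sum.swap)
  finally show ?thesis by simp
qed

text \<open>
  In the fourth moment, the constant configurations contribute (tr R)^2, which is the squared mean,
  |R|_F^2 and a third term of at most |R|_F^2. The nonconstant ones have total weight at most
  \<^const>\<open>excess\<close>, and each contributes at most (tr R)^2.
\<close>
lemma qform_variance:
  defines "F \<equiv> \<lambda>J g. (\<Sum>x<d ^ n. \<Sum>y<d ^ n. (cmod (gram J g x y))\<^sup>2)"
  shows "integrable (PiM I P) (\<lambda>G. (cmod (qform (gram J g) G - complex_of_real (gtrace J g)))\<^sup>2)"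
    and "(\<integral>G. (cmod (qform (gram J g) G - complex_of_real (gtrace J g)))\<^sup>2 \<partial>PiM I P) \<le> 2 * F J g + excess * (gtrace J g)\<^sup>2"
proof -
  let ?R = "gram J g" and ?T = "gtrace J g"
  let ?q = "\<lambda>G. qform ?R G"
  define Z where "Z = (\<Sum>\<tau>\<in>pairings. complex_of_real (pairing_weight \<tau>) * contraction \<tau> ?R)"
  have q1: "has_bochner_integral (PiM I P) ?q (complex_of_real ?T)" using expectation_qform[of ?R] unfolding gram_trace .
  have q2: "has_bochner_integral (PiM I P) (\<lambda>G. ?q G * cnj (?q G)) Z" unfolding Z_def by (rule expectation_qform_square)
  have q3: "has_bochner_integral (PiM I P) (\<lambda>G. cnj (?q G)) (complex_of_real ?T)"
    using has_bochner_integral_bounded_linear[OF bounded_linear_cnj q1] by simp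
  have one: "has_bochner_integral (PiM I P) (\<lambda>G. complex_of_real ?T * complex_of_real ?T) (complex_of_real ?T * complex_of_real ?T)"
    using PI.P.prob_space by (simp add: has_bochner_integral_iff)
  have "has_bochner_integral (PiM I P) (\<lambda>G. ?q G * cnj (?q G) - complex_of_real ?T * ?q G - complex_of_real ?T * cnj (?q G) + complex_of_real ?T * complex_of_real ?T)
     (Z - complex_of_real ?T * complex_of_real ?T - complex_of_real ?T * complex_of_real ?T + complex_of_real ?T * complex_of_real ?T)"
    by (intro has_bochner_integral_add has_bochner_integral_diff has_bochner_integral_mult_right q1 q2 q3 one)
  from has_bochner_integral_bounded_linear[OF bounded_linear_Re this]
  have "has_bochner_integral (PiM I P) (\<lambda>G. Re (?q G * cnj (?q G) - complex_of_real ?T * ?q G - complex_of_real ?T * cnj (?q G) + complex_of_real ?T * complex_of_real ?T)) (Re Z - ?T\<^sup>2)"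
    by (simp add: power2_eq_square)
  moreover have "Re (z * cnj z - complex_of_real t * z - complex_of_real t * cnj z + complex_of_real t * complex_of_real t) = (cmod (z - complex_of_real t))\<^sup>2" for z t
    unfolding cmod_power2 by (simp add: power2_eq_square algebra_simps)
  ultimately have V: "has_bochner_integral (PiM I P) (\<lambda>G. (cmod (?q G - complex_of_real ?T))\<^sup>2) (Re Z - ?T\<^sup>2)" by (simp only:)
  then show "integrable (PiM I P) (\<lambda>G. (cmod (?q G - complex_of_real ?T))\<^sup>2)" by (simp add: has_bochner_integral_iff)
  have "Re Z = (\<Sum>\<tau>\<in>pairings. pairing_weight \<tau> * Re (contraction \<tau> ?R))" by (simp add: Z_def)
  also have "\<dots> = (\<Sum>\<tau>\<in>const_pairing ` {..<3}. pairing_weight \<tau> * Re (contraction \<tau> ?R)) + (\<Sum>\<tau>\<in>pairings - const_pairing ` {..<3}. pairing_weight \<tau> * Re (contraction \<tau> ?R))"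
    using finite_pairings const_pairing_in by (subst add.commute, intro sum.subset_diff) auto
  also have "(\<Sum>\<tau>\<in>const_pairing ` {..<3}. pairing_weight \<tau> * Re (contraction \<tau> ?R)) = (\<Sum>t<3. pairing_weight (const_pairing t) * Re (contraction (const_pairing t) ?R))"
    by (subst sum.reindex) (auto simp: inj_on_def const_pairing_inj)
  also have "\<dots> = ?T\<^sup>2 + F J g + pairing_weight (const_pairing 2) * Re (contraction (const_pairing 2) ?R)"
    unfolding sum_three contraction_const gram_trace F_def
    using pairing_weight_const(2)[of 0] pairing_weight_const(2)[of 1] by (simp add: power2_eq_square)
  also have "pairing_weight (const_pairing 2) * Re (contraction (const_pairing 2) ?R) \<le> F J g"
  proof -
    have "pairing_weight (const_pairing 2) * Re (contraction (const_pairing 2) ?R) \<le> pairing_weight (const_pairing 2) * F J g"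
      unfolding contraction_const F_def by (intro mult_left_mono Re_contraction_transpose_le pairing_weight_le)
    also have "\<dots> \<le> 1 * F J g" unfolding F_def by (intro mult_right_mono pairing_weight_const sum_nonneg) auto
    finally show ?thesis by simp
  qed
  also have "(\<Sum>\<tau>\<in>pairings - const_pairing ` {..<3}. pairing_weight \<tau> * Re (contraction \<tau> ?R)) \<le> (\<Sum>\<tau>\<in>pairings - const_pairing ` {..<3}. pairing_weight \<tau> * ?T\<^sup>2)"
    by (intro sum_mono mult_left_mono pairing_weight_le order_trans[OF complex_Re_le_cmod cmod_contraction_gram_le]) auto
  also have "\<dots> \<le> excess * ?T\<^sup>2"
    unfolding sum_distrib_right[symmetric] by (intro mult_right_mono sum_nonconst_weights) auto
  finally have "Re Z \<le> ?T\<^sup>2 + F J g + F J g + excess * ?T\<^sup>2" by simp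
  then show "(\<integral>G. (cmod (?q G - complex_of_real ?T))\<^sup>2 \<partial>PiM I P) \<le> 2 * F J g + excess * ?T\<^sup>2"
    using V by (simp add: has_bochner_integral_iff)
qed

text \<open>
  Here the choice of the bond dimension enters: (1 + 2 / bd)^(n - 1) is at most
  \<open>exp (2 / \<gamma>) \<le> 1 + 4 / \<gamma>\<close>.
\<close>
lemma excess_bounds:
  assumes g: "\<gamma> > 2" and bd: "real bd = \<gamma> * real n"
  shows "0 \<le> excess" "excess \<le> 12 / \<gamma>"
proof -
  show "0 \<le> excess" unfolding excess_def by simp
  have b: "real bd > 0" using bd_pos by simp
  have "(1 + 2 / real bd) ^ (n - 1) \<le> exp (2 / real bd) ^ (n - 1)"
    using exp_ge_add_one_self[of "2 / real bd"] b by (intro power_mono) auto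
  also have "\<dots> = exp (real (n - 1) * (2 / real bd))" by (rule exp_of_nat_mult[symmetric])
  also have "\<dots> \<le> exp (2 / \<gamma>)"
  proof -
    have "real (n - 1) * (2 / real bd) \<le> real n * (2 / real bd)" using b by (intro mult_right_mono) auto
    also have "\<dots> = 2 / \<gamma>" using n_ge g by (simp add: bd field_simps)
    finally show ?thesis by simp
  qed
  also have "\<dots> \<le> 1 + 2 / \<gamma> + (2 / \<gamma>)\<^sup>2" using g by (intro exp_bound) auto
  also have "(2 / \<gamma>)\<^sup>2 \<le> 2 / \<gamma> * 1" unfolding power2_eq_square using g by (intro mult_left_mono) auto
  finally show "excess \<le> 12 / \<gamma>" unfolding excess_def by simp
qed

section \<open>The law of an rMPS\<close>

lemma rmps_law_alt: "rmps_law N d n bd = distr (PiM I P) (PiM {..<d ^ n} (\<lambda>_. borel)) (\<lambda>G. \<lambda>x\<in>{..<d ^ n}. mps_entry d n bd G x)"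
  unfolding rmps_law_def P_alt I_def ..

lemma mps_entry_measurable: "(\<lambda>G. mps_entry d n bd G x) \<in> borel_measurable (PiM I P)"
proof -
  have c: "(\<lambda>G. G (factor_index \<alpha> x p)) \<in> borel_measurable (PiM I P)" if "\<alpha> \<in> bonds" "p \<in> {1..n}" for \<alpha> p
  proof -
    have "factor_index \<alpha> x p \<in> I" using factor_index_sel[OF that(1), of x] that(2) by (auto simp: site_sel_def)
    then have "(\<lambda>G. G (factor_index \<alpha> x p)) \<in> measurable (PiM I P) (P (factor_index \<alpha> x p))" by (rule measurable_component_singleton)
    also have "measurable (PiM I P) (P (factor_index \<alpha> x p)) = borel_measurable (PiM I P)"
      by (rule measurable_cong_sets) (simp_all add: P_def N_sets)
    finally show ?thesis .
  qed
  have eq: "mps_entry d n bd G x = (\<Sum>\<alpha>\<in>bonds. \<Prod>p\<in>{1..n}. G (factor_index \<alpha> x p))" for G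
    by (simp add: mps_entry_def bonds_def factor_index_def)
  show ?thesis unfolding eq by (intro borel_measurable_sum borel_measurable_prod c)
qed

lemma law_measurable: "(\<lambda>G. \<lambda>x\<in>{..<d ^ n}. mps_entry d n bd G x) \<in> measurable (PiM I P) (PiM {..<d ^ n} (\<lambda>_. borel))"
  by (intro measurable_restrict mps_entry_measurable)

lemma prob_space_rmps_law: "prob_space (rmps_law N d n bd)"
  unfolding rmps_law_alt by (rule PI.P.prob_space_distr[OF law_measurable])

lemma law_coordinate_measurable:
  assumes "x < d ^ n"
  shows "(\<lambda>v. e (v x)) \<in> borel_measurable (rmps_law N d n bd)"
proof -
  have "x \<in> {..<d ^ n}" using assms by simp
  then have "(\<lambda>v. v x) \<in> borel_measurable (PiM {..<d ^ n} (\<lambda>_. borel))" by (rule measurable_component_singleton)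
  from measurable_compose[OF this e_meas] show ?thesis unfolding rmps_law_alt measurable_distr_eq1 .
qed

text \<open>
  Transfer from the law of the vector to the joint law of the cores. The vector is a function that is
  undefined beyond \<open>d ^ n\<close>, hence the requirement that f does not look there.
\<close>
lemma law_expectation:
  fixes f :: "(nat \<Rightarrow> complex) \<Rightarrow> 'c::{banach, second_countable_topology}"
  assumes f: "(\<lambda>v. f (\<lambda>x. e (v x))) \<in> borel_measurable (PiM {..<d ^ n} (\<lambda>_. borel))"
    and loc: "\<And>u v. (\<And>x. x < d ^ n \<Longrightarrow> u x = v x) \<Longrightarrow> f u = f v"
  shows "has_bochner_integral (rmps_law N d n bd) (\<lambda>v. f (\<lambda>x. e (v x))) c \<longleftrightarrow> has_bochner_integral (PiM I P) (\<lambda>G. f (amp G)) c"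
proof -
  have "f (\<lambda>x. e ((\<lambda>x\<in>{..<d ^ n}. mps_entry d n bd G x) x)) = f (amp G)" for G
    by (rule loc) (simp add: e_mps_entry)
  then show ?thesis unfolding rmps_law_alt has_bochner_integral_iff
    by (simp add: integrable_distr_eq[OF law_measurable f] integral_distr[OF law_measurable f])
qed

end

section \<open>Moments of real and complex Gaussians\<close>

text \<open>
  The moments of order at most 4 of the centred normal distribution of variance v.
\<close>
definition std_moment :: "real \<Rightarrow> nat \<Rightarrow> real" where
  "std_moment v k = (if k = 0 then 1 else if k = 2 then v else if k = 4 then 3 * v\<^sup>2 else 0)"

lemma sets_real_normal: "sets (real_normal v) = sets borel"
  by (simp add: real_normal_def)

lemma prob_space_real_normal: "v > 0 \<Longrightarrow> prob_space (real_normal v)"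
  unfolding real_normal_def by (rule prob_space_normal_density) simp

lemma real_normal_moment:
  assumes v: "v > 0" and k: "k \<le> 4"
  shows "has_bochner_integral (real_normal v) (\<lambda>g. g ^ k) (std_moment v k)"
proof -
  have s: "sqrt v > 0" using v by simp
  have "has_bochner_integral lborel (\<lambda>x. normal_density 0 (sqrt v) x *\<^sub>R x ^ k) (std_moment v k)"
  proof (cases "even k")
    case True
    then obtain j where j: "k = 2 * j" by blast
    then have "j = 0 \<or> j = 1 \<or> j = 2" using k by auto
    then have "fact (2 * j) / ((2 / (sqrt v)\<^sup>2) ^ j * fact j) = std_moment v k"
      using v by (auto simp: j std_moment_def fact_numeral field_simps power2_eq_square)
    then show ?thesis using normal_moment_even[OF s, of 0 j] by (simp add: j)
  next
    case False
    then obtain j where j: "k = 2 * j + 1" using oddE by blast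
    have "std_moment v k = 0" using False odd_pos[OF False] by (auto simp: std_moment_def)
    then show ?thesis using normal_moment_odd[OF s, of 0 j] by (simp add: j)
  qed
  then show ?thesis unfolding real_normal_def
    by (intro has_bochner_integral_density) auto
qed

lemma gaussian_cores_real:
  assumes "bd > 0" "n \<ge> 2" "d > 0"
  shows "gaussian_cores real_normal complex_of_real 1 d n bd"
proof (rule gaussian_cores.intro)
  fix v :: real and a b :: nat assume v: "v > 0" and ab: "a \<le> 2" "b \<le> 2"
  have "has_bochner_integral (real_normal v) (\<lambda>g. complex_of_real (g ^ (a + b))) (complex_of_real (std_moment v (a + b)))"
    using ab by (intro has_bochner_integral_of_real real_normal_moment v) auto
  moreover have "std_moment v (a + b) = gauss_moment 1 v a b"
  proof -
    have "a = 0 \<or> a = 1 \<or> a = 2" "b = 0 \<or> b = 1 \<or> b = 2" using ab by auto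
    then show ?thesis by (auto simp: std_moment_def numeral_eq_Suc)
  qed
  ultimately show "has_bochner_integral (real_normal v) (\<lambda>g. complex_of_real g ^ a * cnj (complex_of_real g) ^ b) (complex_of_real (gauss_moment 1 v a b))"
    by (simp add: power_add)
qed (insert assms, simp_all add: prob_space_real_normal sets_real_normal)

lemma has_bochner_integral_pair_mult:
  fixes f :: "'a \<Rightarrow> real" and g :: "'b \<Rightarrow> real"
  assumes "prob_space M" "prob_space N" and f: "has_bochner_integral M f a" and g: "has_bochner_integral N g b"
  shows "has_bochner_integral (M \<Otimes>\<^sub>M N) (\<lambda>p. f (fst p) * g (snd p)) (a * b)"
proof -
  interpret M: prob_space M by fact
  interpret N: prob_space N by fact
  interpret pair_sigma_finite M N by unfold_locales
  have i: "integrable M f" "integrable N g" using f g by (auto simp: has_bochner_integral_iff)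
  have [measurable]: "f \<in> borel_measurable M" "g \<in> borel_measurable N" using i by auto
  have int: "integrable (M \<Otimes>\<^sub>M N) (\<lambda>p. f (fst p) * g (snd p))"
  proof (rule Fubini_integrable)
    show "integrable M (\<lambda>x. \<integral>y. norm (f (fst (x, y)) * g (snd (x, y))) \<partial>N)" using i by (simp add: abs_mult)
    show "AE x in M. integrable N (\<lambda>y. f (fst (x, y)) * g (snd (x, y)))" using i by simp
  qed measurable
  have "(\<integral>p. f (fst p) * g (snd p) \<partial>(M \<Otimes>\<^sub>M N)) = (\<integral>x. \<integral>y. f x * g y \<partial>N \<partial>M)"
    using integral_fst'[OF int] by simp
  then show ?thesis using int f g by (simp add: has_bochner_integral_iff)
qed

lemma sets_complex_normal: "sets (complex_normal v) = sets borel"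
  by (simp add: complex_normal_def)

lemma Complex_measurable: "(\<lambda>(x, y). Complex x y) \<in> measurable (real_normal v \<Otimes>\<^sub>M real_normal w) borel"
proof -
  have s: "sets (real_normal v \<Otimes>\<^sub>M real_normal w) = sets (borel \<Otimes>\<^sub>M borel)"
    by (intro sets_pair_measure_cong sets_real_normal)
  have "(\<lambda>p::real \<times> real. Complex (fst p) (snd p)) \<in> measurable (borel \<Otimes>\<^sub>M borel) borel"
    unfolding Complex_eq by measurable
  then show ?thesis unfolding measurable_cong_sets[OF s refl] case_prod_beta' .
qed

lemma prob_space_complex_normal:
  assumes "v > 0" shows "prob_space (complex_normal v)"
proof -
  interpret A: prob_space "real_normal (v / 2)" by (rule prob_space_real_normal) (use assms in simp)
  interpret pair_prob_space "real_normal (v / 2)" "real_normal (v / 2)" by unfold_locales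
  show ?thesis unfolding complex_normal_def by (rule prob_space_distr[OF Complex_measurable])
qed

text \<open>
  In each of the nine cases, expanding the powers of x + i y leaves at most four products of moments
  of the independent real and imaginary parts.
\<close>
lemma complex_normal_moment:
  assumes v: "v > 0" and ab: "a \<le> 2" "b \<le> 2"
  shows "has_bochner_integral (complex_normal v) (\<lambda>z. z ^ a * cnj z ^ b) (complex_of_real (gauss_moment 0 v a b))"
proof -
  let ?N = "real_normal (v / 2)"
  let ?NN = "?N \<Otimes>\<^sub>M ?N"
  define f where "f i j p = complex_of_real (fst p ^ i * snd p ^ j)" for i j :: nat and p :: "real \<times> real"
  define mo where "mo = std_moment (v / 2)"
  have mixed: "has_bochner_integral ?NN (f i j) (complex_of_real (mo i * mo j))" if "i \<le> 4" "j \<le> 4" for i j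
    unfolding f_def mo_def
    by (intro has_bochner_integral_of_real has_bochner_integral_pair_mult prob_space_real_normal real_normal_moment) (use v that in auto)
  have comb: "has_bochner_integral ?NN (\<lambda>p. c1 * f i1 j1 p + c2 * f i2 j2 p + c3 * f i3 j3 p + c4 * f i4 j4 p)
     (c1 * complex_of_real (mo i1 * mo j1) + c2 * complex_of_real (mo i2 * mo j2) + c3 * complex_of_real (mo i3 * mo j3) + c4 * complex_of_real (mo i4 * mo j4))"
    if "i1 \<le> 4" "j1 \<le> 4" "i2 \<le> 4" "j2 \<le> 4" "i3 \<le> 4" "j3 \<le> 4" "i4 \<le> 4" "j4 \<le> 4" for c1 c2 c3 c4 i1 j1 i2 j2 i3 j3 i4 j4
    by (intro has_bochner_integral_add has_bochner_integral_mult_right mixed that)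
  have mos: "mo 0 = 1" "mo (Suc 0) = 0" "mo 2 = v / 2" "mo 3 = 0" "mo 4 = 3 * (v / 2)\<^sup>2"
    by (simp_all add: mo_def std_moment_def)
  have key: "has_bochner_integral ?NN (\<lambda>p. Complex (fst p) (snd p) ^ a * cnj (Complex (fst p) (snd p)) ^ b) (complex_of_real (gauss_moment 0 v a b))"
  proof -
    have "a = 0 \<or> a = 1 \<or> a = 2" "b = 0 \<or> b = 1 \<or> b = 2" using ab by auto
    then consider "a = 0" "b = 0" | "a = 1" "b = 0" | "a = 0" "b = 1" | "a = 1" "b = 1" | "a = 2" "b = 0" | "a = 0" "b = 2"
      | "a = 2" "b = 1" | "a = 1" "b = 2" | "a = 2" "b = 2" by blast
    then show ?thesis
    proof cases
      case 1
      have "(\<lambda>p. Complex (fst p) (snd p) ^ a * cnj (Complex (fst p) (snd p)) ^ b) = (\<lambda>p. 1 * f 0 0 p + 0 * f 0 0 p + 0 * f 0 0 p + 0 * f 0 0 p)"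
        by (simp add: 1 f_def)
      then show ?thesis using comb[of 0 0 0 0 0 0 0 0 1 0 0 0] by (simp add: mos 1)
    next
      case 2
      have "(\<lambda>p. Complex (fst p) (snd p) ^ a * cnj (Complex (fst p) (snd p)) ^ b) = (\<lambda>p. 1 * f 1 0 p + \<i> * f 0 1 p + 0 * f 0 0 p + 0 * f 0 0 p)"
        by (simp add: 2 f_def complex_eq_iff fun_eq_iff)
      then show ?thesis using comb[of 1 0 0 1 0 0 0 0 1 \<i> 0 0] by (simp add: mos 2)
    next
      case 3
      have "(\<lambda>p. Complex (fst p) (snd p) ^ a * cnj (Complex (fst p) (snd p)) ^ b) = (\<lambda>p. 1 * f 1 0 p + (- \<i>) * f 0 1 p + 0 * f 0 0 p + 0 * f 0 0 p)"
        by (simp add: 3 f_def complex_eq_iff fun_eq_iff)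
      then show ?thesis using comb[of 1 0 0 1 0 0 0 0 1 "- \<i>" 0 0] by (simp add: mos 3)
    next
      case 4
      have "(\<lambda>p. Complex (fst p) (snd p) ^ a * cnj (Complex (fst p) (snd p)) ^ b) = (\<lambda>p. 1 * f 2 0 p + 1 * f 0 2 p + 0 * f 0 0 p + 0 * f 0 0 p)"
        by (simp add: 4 f_def complex_eq_iff fun_eq_iff power2_eq_square)
      then show ?thesis using comb[of 2 0 0 2 0 0 0 0 1 1 0 0] by (simp add: mos 4)
    next
      case 5
      have "(\<lambda>p. Complex (fst p) (snd p) ^ a * cnj (Complex (fst p) (snd p)) ^ b) = (\<lambda>p. 1 * f 2 0 p + (- 1) * f 0 2 p + (2 * \<i>) * f 1 1 p + 0 * f 0 0 p)"
        by (simp add: 5 f_def complex_eq_iff fun_eq_iff power2_eq_square)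
      then show ?thesis using comb[of 2 0 0 2 1 1 0 0 1 "- 1" "2 * \<i>" 0] by (simp add: mos 5)
    next
      case 6
      have "(\<lambda>p. Complex (fst p) (snd p) ^ a * cnj (Complex (fst p) (snd p)) ^ b) = (\<lambda>p. 1 * f 2 0 p + (- 1) * f 0 2 p + (- 2 * \<i>) * f 1 1 p + 0 * f 0 0 p)"
        by (simp add: 6 f_def complex_eq_iff fun_eq_iff power2_eq_square)
      then show ?thesis using comb[of 2 0 0 2 1 1 0 0 1 "- 1" "- 2 * \<i>" 0] by (simp add: mos 6)
    next
      case 7
      have "(\<lambda>p. Complex (fst p) (snd p) ^ a * cnj (Complex (fst p) (snd p)) ^ b) = (\<lambda>p. 1 * f 3 0 p + 1 * f 1 2 p + \<i> * f 2 1 p + \<i> * f 0 3 p)"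
        by (simp add: 7 f_def complex_eq_iff fun_eq_iff power2_eq_square power3_eq_cube algebra_simps)
      then show ?thesis using comb[of 3 0 1 2 2 1 0 3 1 1 \<i> \<i>] by (simp add: mos 7)
    next
      case 8
      have "(\<lambda>p. Complex (fst p) (snd p) ^ a * cnj (Complex (fst p) (snd p)) ^ b) = (\<lambda>p. 1 * f 3 0 p + 1 * f 1 2 p + (- \<i>) * f 2 1 p + (- \<i>) * f 0 3 p)"
        by (simp add: 8 f_def complex_eq_iff fun_eq_iff power2_eq_square power3_eq_cube algebra_simps)
      then show ?thesis using comb[of 3 0 1 2 2 1 0 3 1 1 "- \<i>" "- \<i>"] by (simp add: mos 8)
    next
      case 9
      have "(\<lambda>p. Complex (fst p) (snd p) ^ a * cnj (Complex (fst p) (snd p)) ^ b) = (\<lambda>p. 1 * f 4 0 p + 2 * f 2 2 p + 1 * f 0 4 p + 0 * f 0 0 p)"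
        by (simp add: 9 f_def complex_eq_iff fun_eq_iff power2_eq_square power4_eq_xxxx algebra_simps)
      then show ?thesis using comb[of 4 0 2 2 0 4 0 0 1 2 1 0] by (simp add: mos 9 power2_eq_square)
    qed
  qed
  have "cnj \<in> borel_measurable borel" by (intro borel_measurable_continuous_onI continuous_intros)
  then have m: "(\<lambda>z. z ^ a * cnj z ^ b) \<in> borel_measurable borel" by measurable
  have eq: "(case p of (x, y) \<Rightarrow> Complex x y) = Complex (fst p) (snd p)" for p :: "real \<times> real"
    by (simp add: case_prod_beta')
  show ?thesis using key unfolding complex_normal_def has_bochner_integral_iff
    unfolding integrable_distr_eq[OF Complex_measurable m] integral_distr[OF Complex_measurable m] eq .
qed

lemma gaussian_cores_complex:
  assumes "bd > 0" "n \<ge> 2" "d > 0"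
  shows "gaussian_cores complex_normal (\<lambda>z. z) 0 d n bd"
proof (rule gaussian_cores.intro)
  fix v :: real and a b :: nat assume "v > 0" "a \<le> 2" "b \<le> 2"
  then show "has_bochner_integral (complex_normal v) (\<lambda>g. g ^ a * cnj g ^ b) (complex_of_real (gauss_moment 0 v a b))"
    by (rule complex_normal_moment)
qed (insert assms, simp_all add: prob_space_complex_normal sets_complex_normal)

section \<open>Isotropic test vectors\<close>

lemma cmod_mult_le_squares: "cmod (a * b) \<le> ((cmod a)\<^sup>2 + (cmod b)\<^sup>2) / 2"
  using sum_squares_bound[of "cmod a" "cmod b"] by (simp add: norm_mult)

text \<open>
  Markov's inequality for the strict event, which makes it correct for \<open>\<mu> = 0\<close> as well. That case
  does occur, for instance if the matrix to be approximated has rank at most r.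
\<close>
lemma (in prob_space) markov_strict:
  assumes f: "integrable M f" and nn: "\<And>x. x \<in> space M \<Longrightarrow> 0 \<le> (f x :: real)" and mu: "(\<integral>x. f x \<partial>M) \<le> \<mu>" and K: "K > 0"
  shows "prob {x \<in> space M. f x > K * \<mu>} \<le> 1 / K"
proof -
  have [measurable]: "f \<in> borel_measurable M" using f by auto
  have mu0: "\<mu> \<ge> 0" using mu Bochner_Integration.integral_nonneg[of M f] nn by (meson order_trans)
  show ?thesis
  proof (cases "\<mu> = 0")
    case True
    then have "(\<integral>x. f x \<partial>M) = 0" using mu Bochner_Integration.integral_nonneg[of M f] nn by (meson order_antisym)
    then have "AE x in M. f x = 0" using integral_nonneg_eq_0_iff_AE[OF f] nn by (auto intro: AE_I2)
    then have "AE x in M. \<not> f x > K * \<mu>" by eventually_elim (simp add: True)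
    then have "prob {x \<in> space M. f x > K * \<mu>} = 0"
      by (subst prob_eq_0) auto
    then show ?thesis using K by simp
  next
    case False
    with mu0 have pos: "K * \<mu> > 0" using K by simp
    have "prob {x \<in> space M. f x > K * \<mu>} \<le> prob {x \<in> space M. f x \<ge> K * \<mu>}"
      by (intro finite_measure_mono) auto
    also have "\<dots> \<le> (\<integral>x. f x \<partial>M) / (K * \<mu>)"
      by (rule integral_Markov_inequality_measure[OF f, where A = "{}"]) (use nn pos in auto)
    also have "\<dots> \<le> \<mu> / (K * \<mu>)" using mu pos by (intro divide_right_mono) auto
    also have "\<dots> = 1 / K" using False by simp
    finally show ?thesis .
  qed
qed

text \<open>
  The properties of a random test vector X on which the analysis of Nystrom++ rests: isotropy, and a
  bound on the variance of X^* R X for psd matrices R = sum_j g_j g_j^*. For a standard real Gaussian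
  vector the latter holds with \<open>\<beta> = 0\<close>; the bound on \<open>\<beta>\<close> makes the fourth moments of linear forms
  universally bounded.
\<close>
locale isotropic_sketch = prob_space M for M :: "'b measure" +
  fixes X :: "'b \<Rightarrow> nat \<Rightarrow> complex" and m :: nat and \<beta> :: real
  assumes X_meas: "\<And>x. x < m \<Longrightarrow> (\<lambda>w. X w x) \<in> borel_measurable M"
    and X_int4: "\<And>x. x < m \<Longrightarrow> integrable M (\<lambda>w. (cmod (X w x)) ^ 4)"
    and X_iso: "\<And>x y. x < m \<Longrightarrow> y < m \<Longrightarrow> (\<integral>w. X w x * cnj (X w y) \<partial>M) = of_bool (x = y)"
    and X_var: "\<And>J g. (\<integral>w. (cmod ((\<Sum>x<m. \<Sum>y<m. cnj (X w x) * (\<Sum>j<J. g j x * cnj (g j y)) * X w y)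
        - complex_of_real (\<Sum>j<J. \<Sum>x<m. (cmod (g j x))\<^sup>2)))\<^sup>2 \<partial>M)
      \<le> 2 * (\<Sum>x<m. \<Sum>y<m. (cmod (\<Sum>j<(J::nat). g j x * cnj (g j y)))\<^sup>2) + \<beta> * (\<Sum>j<J. \<Sum>x<m. (cmod (g j x))\<^sup>2)\<^sup>2"
    and beta: "0 \<le> \<beta>" "\<beta> \<le> 6"
begin

definition lin :: "(nat \<Rightarrow> complex) \<Rightarrow> 'b \<Rightarrow> complex" where
  "lin u w = (\<Sum>x<m. cnj (u x) * X w x)"

definition sqn :: "(nat \<Rightarrow> complex) \<Rightarrow> real" where
  "sqn u = (\<Sum>x<m. (cmod (u x))\<^sup>2)"

lemma sqn_nonneg [simp]: "sqn u \<ge> 0" by (auto simp: sqn_def intro: sum_nonneg)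

lemma lin_measurable [measurable]: "lin u \<in> borel_measurable M"
  unfolding lin_def using X_meas by (intro borel_measurable_sum borel_measurable_times) auto

lemma measurable_cnj [measurable]: "cnj \<in> borel_measurable borel"
  by (intro borel_measurable_continuous_onI continuous_intros)

text \<open>
  This crude bound depends on m; it only serves to show integrability.
\<close>
lemma lin_bound4: "(cmod (lin u w)) ^ 4 \<le> (sqn u)\<^sup>2 * (real m * (\<Sum>x<m. (cmod (X w x)) ^ 4))"
proof -
  have "(cmod (lin u w))\<^sup>2 \<le> (\<Sum>x<m. (cmod (X w x))\<^sup>2) * sqn u"
    using complex_cauchy_schwarz[of "\<lambda>x. X w x" "u" "{..<m}"] by (simp add: lin_def sqn_def mult.commute)
  then have "((cmod (lin u w))\<^sup>2)\<^sup>2 \<le> ((\<Sum>x<m. (cmod (X w x))\<^sup>2) * sqn u)\<^sup>2" by (intro power_mono) auto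
  also have "\<dots> = (sqn u)\<^sup>2 * (\<Sum>x<m. (cmod (X w x))\<^sup>2)\<^sup>2" by (simp add: power_mult_distrib mult.commute)
  also have "(\<Sum>x<m. (cmod (X w x))\<^sup>2)\<^sup>2 \<le> real m * (\<Sum>x<m. ((cmod (X w x))\<^sup>2)\<^sup>2)"
    using Cauchy_Schwarz_ineq_sum[of "\<lambda>_. 1" "\<lambda>x. (cmod (X w x))\<^sup>2" "{..<m}"] by simp
  finally show ?thesis by (simp add: mult_left_mono power_mult[symmetric])
qed

lemma integrable_lin4: "integrable M (\<lambda>w. (cmod (lin u w)) ^ 4)"
proof (rule Bochner_Integration.integrable_bound)
  show "integrable M (\<lambda>w. (sqn u)\<^sup>2 * (real m * (\<Sum>x<m. (cmod (X w x)) ^ 4)))"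
    using X_int4 by (intro integrable_mult_right Bochner_Integration.integrable_sum) auto
  show "AE w in M. norm ((cmod (lin u w)) ^ 4) \<le> norm ((sqn u)\<^sup>2 * (real m * (\<Sum>x<m. (cmod (X w x)) ^ 4)))"
    using lin_bound4[of u] by (intro AE_I2) (simp add: sum_nonneg)
qed measurable

lemma integrable_bound_one_plus_fourth:
  assumes f: "f \<in> borel_measurable M" and b: "\<And>w. w \<in> space M \<Longrightarrow> cmod (f w) \<le> c * (1 + (\<Sum>i\<in>A. (cmod (lin (u i) w)) ^ 4))"
  shows "integrable M f"
proof (rule Bochner_Integration.integrable_bound[OF _ f])
  show "integrable M (\<lambda>w. c * (1 + (\<Sum>i\<in>A. (cmod (lin (u i) w)) ^ 4)))"
    by (intro integrable_mult_right Bochner_Integration.integrable_add Bochner_Integration.integrable_sum integrable_lin4) auto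
  show "AE w in M. norm (f w) \<le> norm (c * (1 + (\<Sum>i\<in>A. (cmod (lin (u i) w)) ^ 4)))"
  proof (intro AE_I2)
    fix w assume "w \<in> space M"
    then have "cmod (f w) \<le> c * (1 + (\<Sum>i\<in>A. (cmod (lin (u i) w)) ^ 4))" by (rule b)
    also have "\<dots> \<le> \<bar>c * (1 + (\<Sum>i\<in>A. (cmod (lin (u i) w)) ^ 4))\<bar>" by (rule abs_ge_self)
    finally show "norm (f w) \<le> norm (c * (1 + (\<Sum>i\<in>A. (cmod (lin (u i) w)) ^ 4)))" by (simp only: real_norm_def)
  qed
qed

lemma square_le_one_plus_fourth: "(x::real)\<^sup>2 \<le> 1 + x ^ 4"
proof -
  have "2 * x\<^sup>2 \<le> x ^ 4 + 1" using sum_squares_bound[of "x\<^sup>2" 1] by (simp add: power_mult[symmetric])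
  then show ?thesis using zero_le_power2[of x] by linarith
qed

lemma integrable_lin_prod: "integrable M (\<lambda>w. lin u w * cnj (lin v w))"
proof (rule integrable_bound_one_plus_fourth[where A = "{0, 1::nat}" and u = "\<lambda>i. if i = 0 then u else v" and c = 2])
  fix w
  have "cmod (lin u w * cnj (lin v w)) \<le> ((cmod (lin u w))\<^sup>2 + (cmod (lin v w))\<^sup>2) / 2"
    using cmod_mult_le_squares[of "lin u w" "cnj (lin v w)"] by simp
  then show "cmod (lin u w * cnj (lin v w)) \<le> 2 * (1 + (\<Sum>i\<in>{0, 1::nat}. (cmod (lin (if i = 0 then u else v) w)) ^ 4))"
  proof -
    assume *: "cmod (lin u w * cnj (lin v w)) \<le> ((cmod (lin u w))\<^sup>2 + (cmod (lin v w))\<^sup>2) / 2"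
    have e: "(\<Sum>i\<in>{0, 1::nat}. (cmod (lin (if i = 0 then u else v) w)) ^ 4) = (cmod (lin u w)) ^ 4 + (cmod (lin v w)) ^ 4" by simp
    define P Q where "P = (cmod (lin u w)) ^ 4" and "Q = (cmod (lin v w)) ^ 4"
    have "P \<ge> 0" "Q \<ge> 0" by (simp_all add: P_def Q_def)
    moreover have "(cmod (lin u w))\<^sup>2 \<le> 1 + P" "(cmod (lin v w))\<^sup>2 \<le> 1 + Q"
      unfolding P_def Q_def by (rule square_le_one_plus_fourth)+
    ultimately show ?thesis unfolding e P_def[symmetric] Q_def[symmetric] using * by argo
  qed
qed measurable

lemma X_eq_lin: "x < m \<Longrightarrow> X w x = lin (\<lambda>y. of_bool (y = x)) w"
  by (simp add: lin_def of_bool_def if_distrib[of cnj] if_distrib[of "\<lambda>x. x * _"] sum.delta cong: if_cong)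

lemma integrable_X_prod: "x < m \<Longrightarrow> y < m \<Longrightarrow> integrable M (\<lambda>w. X w x * cnj (X w y))"
  by (simp only: X_eq_lin integrable_lin_prod)

lemma expectation_form:
  "has_bochner_integral M (\<lambda>w. \<Sum>x<m. \<Sum>y<m. cnj (X w x) * R x y * X w y) (\<Sum>x<m. R x x)"
proof -
  have "has_bochner_integral M (\<lambda>w. \<Sum>x<m. \<Sum>y<m. R x y * (X w y * cnj (X w x))) (\<Sum>x<m. \<Sum>y<m. R x y * of_bool (y = x))"
    by (intro has_bochner_integral_sum has_bochner_integral_mult_right)
       (auto simp: has_bochner_integral_iff integrable_X_prod X_iso)
  moreover have "(\<Sum>x<m. \<Sum>y<m. R x y * of_bool (y = x)) = (\<Sum>x<m. R x x)"
    by (intro sum.cong refl) (subst mult.commute, simp add: sum_of_bool_mult)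
  moreover have "(\<lambda>w. \<Sum>x<m. \<Sum>y<m. R x y * (X w y * cnj (X w x))) = (\<lambda>w. \<Sum>x<m. \<Sum>y<m. cnj (X w x) * R x y * X w y)"
    by (simp add: mult_ac)
  ultimately show ?thesis by simp
qed

lemma rank_one_form: "(\<Sum>x<m. \<Sum>y<m. cnj (X w x) * (u x * cnj (v y)) * X w y) = cnj (lin u w) * lin v w"
  unfolding lin_def cnj_sum sum_product by (intro sum.cong refl) (simp add: mult_ac)

lemma expectation_lin2: "has_bochner_integral M (\<lambda>w. (cmod (lin u w))\<^sup>2) (sqn u)"
proof -
  have "has_bochner_integral M (\<lambda>w. cnj (lin u w) * lin u w) (complex_of_real (sqn u))"
    using expectation_form[of "\<lambda>x y. u x * cnj (u y)"] unfolding rank_one_form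
    by (simp add: sqn_def complex_norm_square del: of_real_power)
  from has_bochner_integral_bounded_linear[OF bounded_linear_Re this]
  have "has_bochner_integral M (\<lambda>w. Re (cnj (lin u w) * lin u w)) (sqn u)" by simp
  moreover have "Re (cnj z * z) = (cmod z)\<^sup>2" for z unfolding cmod_power2 by (simp add: power2_eq_square)
  ultimately show ?thesis by simp
qed

text \<open>
  For the rank-one matrix u u^* the variance bound says that the variance of |(u, X)|^2 is at most
  \<open>(2 + \<beta>) |u|^4\<close>, and the squared mean is |u|^4.
\<close>
lemma expectation_lin4_le: "(\<integral>w. (cmod (lin u w)) ^ 4 \<partial>M) \<le> 9 * (sqn u)\<^sup>2"
proof -
  have "(\<integral>w. ((cmod (lin u w))\<^sup>2 - sqn u)\<^sup>2 \<partial>M) \<le> 2 * (sqn u)\<^sup>2 + \<beta> * (sqn u)\<^sup>2"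
  proof -
    have a: "(\<Sum>x<m. \<Sum>y<m. cnj (X w x) * (\<Sum>j<Suc 0. u x * cnj (u y)) * X w y) - complex_of_real (\<Sum>j<Suc 0. \<Sum>x<m. (cmod (u x))\<^sup>2)
       = complex_of_real ((cmod (lin u w))\<^sup>2 - sqn u)" for w
      using rank_one_form[of w u u] by (simp add: sqn_def complex_norm_square mult.commute del: of_real_power)
    have b: "(\<Sum>x<m. \<Sum>y<m. (cmod (\<Sum>j<Suc 0. u x * cnj (u y)))\<^sup>2) = (sqn u)\<^sup>2"
      by (simp add: norm_mult power_mult_distrib sqn_def sum_product power2_eq_square[of "sum _ _"])
    have c: "(\<Sum>j<Suc 0. \<Sum>x<m. (cmod (u x))\<^sup>2) = sqn u" by (simp add: sqn_def)
    show ?thesis using X_var[where J = "Suc 0" and g = "\<lambda>_. u"] unfolding a unfolding b c norm_of_real power2_abs .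
  qed
  also have "\<dots> \<le> 2 * (sqn u)\<^sup>2 + 6 * (sqn u)\<^sup>2" using beta by (intro add_left_mono mult_right_mono) auto
  finally have v: "(\<integral>w. ((cmod (lin u w))\<^sup>2 - sqn u)\<^sup>2 \<partial>M) \<le> 8 * (sqn u)\<^sup>2" by simp
  have e: "((cmod (lin u w))\<^sup>2 - sqn u)\<^sup>2 = (cmod (lin u w)) ^ 4 - 2 * sqn u * (cmod (lin u w))\<^sup>2 + (sqn u)\<^sup>2" for w
    by (simp add: power2_diff power_mult[symmetric])
  have i2: "integrable M (\<lambda>w. (cmod (lin u w))\<^sup>2)" "(\<integral>w. (cmod (lin u w))\<^sup>2 \<partial>M) = sqn u"
    using expectation_lin2[of u] by (auto simp: has_bochner_integral_iff)
  have "(\<integral>w. ((cmod (lin u w))\<^sup>2 - sqn u)\<^sup>2 \<partial>M) = (\<integral>w. (cmod (lin u w)) ^ 4 \<partial>M) - 2 * sqn u * sqn u + (sqn u)\<^sup>2"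
    unfolding e using i2 integrable_lin4[of u] by (simp add: prob_space)
  then show ?thesis using v by (simp add: power2_eq_square)
qed

text \<open>
  X^* E X is the sum of the s_j (X, u_j) (v_j, X). By Cauchy--Schwarz with weights s_j, its second
  moment is at most (sum_j s_j)^2 times a bound for the fourth moments of linear forms.
\<close>
lemma bilinear_bound:
  assumes s: "\<And>j. j < J \<Longrightarrow> s j \<ge> 0 \<and> sqn (u j) \<le> 1 \<and> sqn (v j) \<le> 1"
    and E: "\<And>x y. x < m \<Longrightarrow> y < m \<Longrightarrow> E x y = (\<Sum>j<(J::nat). complex_of_real (s j) * u j x * cnj (v j y))"
  shows "integrable M (\<lambda>w. (cmod (\<Sum>x<m. \<Sum>y<m. cnj (X w x) * E x y * X w y))\<^sup>2)"
    and "(\<integral>w. (cmod (\<Sum>x<m. \<Sum>y<m. cnj (X w x) * E x y * X w y))\<^sup>2 \<partial>M) \<le> 9 * (\<Sum>j<J. s j)\<^sup>2"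
proof -
  let ?N = "\<Sum>j<J. s j"
  \<comment> \<open>The square is dominated pointwise by weighted fourth powers of linear forms.\<close>
  let ?B = "\<lambda>w. ?N * (\<Sum>j<J. s j * (((cmod (lin (u j) w)) ^ 4 + (cmod (lin (v j) w)) ^ 4) / 2))"
  have form: "(\<Sum>x<m. \<Sum>y<m. cnj (X w x) * E x y * X w y) = (\<Sum>j<J. complex_of_real (s j) * (cnj (lin (u j) w) * lin (v j) w))" for w
  proof -
    have "(\<Sum>x<m. \<Sum>y<m. cnj (X w x) * E x y * X w y) = (\<Sum>x<m. \<Sum>y<m. \<Sum>j<J. complex_of_real (s j) * (cnj (X w x) * (u j x * cnj (v j y)) * X w y))"
      by (intro sum.cong refl) (simp add: E sum_distrib_left sum_distrib_right mult_ac)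
    also have "\<dots> = (\<Sum>j<J. \<Sum>x<m. \<Sum>y<m. complex_of_real (s j) * (cnj (X w x) * (u j x * cnj (v j y)) * X w y))"
      by (simp only: sum.swap[of _ "{..<J}" "{..<m}"])
    also have "\<dots> = (\<Sum>j<J. complex_of_real (s j) * (cnj (lin (u j) w) * lin (v j) w))"
      by (simp only: sum_distrib_left[symmetric] rank_one_form)
    finally show ?thesis .
  qed
  have bound: "(cmod (\<Sum>x<m. \<Sum>y<m. cnj (X w x) * E x y * X w y))\<^sup>2 \<le> ?B w" for w
  proof -
    have "(cmod (\<Sum>j<J. complex_of_real (s j) * (cnj (lin (u j) w) * lin (v j) w)))\<^sup>2
       = (cmod (\<Sum>j<J. complex_of_real (sqrt (s j)) * cnj (complex_of_real (sqrt (s j)) * (lin (u j) w * cnj (lin (v j) w)))))\<^sup>2"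
      using s by (intro arg_cong[of _ _ "\<lambda>z. (cmod z)\<^sup>2"] sum.cong refl) (simp add: mult.assoc[symmetric] of_real_mult[symmetric] del: of_real_mult)
    also have "\<dots> \<le> (\<Sum>j<J. (cmod (complex_of_real (sqrt (s j))))\<^sup>2) * (\<Sum>j<J. (cmod (complex_of_real (sqrt (s j)) * (lin (u j) w * cnj (lin (v j) w))))\<^sup>2)"
      by (rule complex_cauchy_schwarz)
    also have "\<dots> = ?N * (\<Sum>j<J. s j * ((cmod (lin (u j) w))\<^sup>2 * (cmod (lin (v j) w))\<^sup>2))"
    proof -
      have "(\<Sum>j<J. (cmod (complex_of_real (sqrt (s j))))\<^sup>2) = ?N"
        by (intro sum.cong refl) (use s in auto)
      moreover have "(\<Sum>j<J. (cmod (complex_of_real (sqrt (s j)) * (lin (u j) w * cnj (lin (v j) w))))\<^sup>2) = (\<Sum>j<J. s j * ((cmod (lin (u j) w))\<^sup>2 * (cmod (lin (v j) w))\<^sup>2))"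
        by (intro sum.cong refl) (use s in \<open>auto simp: norm_mult power_mult_distrib\<close>)
      ultimately show ?thesis by simp
    qed
    also have "\<dots> \<le> ?B w"
    proof (intro mult_left_mono sum_mono)
      fix j
      show "(cmod (lin (u j) w))\<^sup>2 * (cmod (lin (v j) w))\<^sup>2 \<le> ((cmod (lin (u j) w)) ^ 4 + (cmod (lin (v j) w)) ^ 4) / 2"
        using sum_squares_bound[of "(cmod (lin (u j) w))\<^sup>2" "(cmod (lin (v j) w))\<^sup>2"] by (simp add: power_mult[symmetric])
    qed (use s in \<open>auto intro: sum_nonneg\<close>)
    finally show ?thesis unfolding form .
  qed
  have iB: "integrable M ?B"
    by (intro integrable_mult_right Bochner_Integration.integrable_sum integrable_divide Bochner_Integration.integrable_add integrable_lin4)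
  have N0: "?N \<ge> 0" using s by (intro sum_nonneg) auto
  show int: "integrable M (\<lambda>w. (cmod (\<Sum>x<m. \<Sum>y<m. cnj (X w x) * E x y * X w y))\<^sup>2)"
  proof (rule Bochner_Integration.integrable_bound[OF iB])
    show "(\<lambda>w. (cmod (\<Sum>x<m. \<Sum>y<m. cnj (X w x) * E x y * X w y))\<^sup>2) \<in> borel_measurable M" unfolding form by measurable
    show "AE w in M. norm ((cmod (\<Sum>x<m. \<Sum>y<m. cnj (X w x) * E x y * X w y))\<^sup>2) \<le> norm (?B w)"
    proof (intro AE_I2)
      fix w
      have "(cmod (\<Sum>x<m. \<Sum>y<m. cnj (X w x) * E x y * X w y))\<^sup>2 \<le> ?B w" by (rule bound)
      also have "\<dots> \<le> \<bar>?B w\<bar>" by (rule abs_ge_self)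
      finally show "norm ((cmod (\<Sum>x<m. \<Sum>y<m. cnj (X w x) * E x y * X w y))\<^sup>2) \<le> norm (?B w)" by (simp only: real_norm_def abs_power2)
    qed
  qed
  have "(\<integral>w. (cmod (\<Sum>x<m. \<Sum>y<m. cnj (X w x) * E x y * X w y))\<^sup>2 \<partial>M) \<le> (\<integral>w. ?B w \<partial>M)"
    by (rule integral_mono[OF int iB bound])
  also have "\<dots> = ?N * (\<Sum>j<J. s j * (((\<integral>w. (cmod (lin (u j) w)) ^ 4 \<partial>M) + (\<integral>w. (cmod (lin (v j) w)) ^ 4 \<partial>M)) / 2))"
    by (simp add: Bochner_Integration.integral_sum Bochner_Integration.integral_add integrable_lin4)
  also have "\<dots> \<le> ?N * (\<Sum>j<J. s j * 9)"
  proof (intro mult_left_mono sum_mono)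
    fix j assume "j \<in> {..<J}"
    then have j: "sqn (u j) \<le> 1" "sqn (v j) \<le> 1" using s by auto
    have "(sqn (u j))\<^sup>2 \<le> 1" "(sqn (v j))\<^sup>2 \<le> 1" using j by (auto intro!: power_le_one)
    then show "((\<integral>w. (cmod (lin (u j) w)) ^ 4 \<partial>M) + (\<integral>w. (cmod (lin (v j) w)) ^ 4 \<partial>M)) / 2 \<le> 9"
      using expectation_lin4_le[of "u j"] expectation_lin4_le[of "v j"] by simp
  qed (use s N0 in auto)
  finally show "(\<integral>w. (cmod (\<Sum>x<m. \<Sum>y<m. cnj (X w x) * E x y * X w y))\<^sup>2 \<partial>M) \<le> 9 * ?N\<^sup>2"
    by (simp add: sum_distrib_right[symmetric] power2_eq_square mult_ac)
qed

text \<open>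
  The difference of the two sides vanishes at 0 and has the nonnegative derivative exp (-t) - (1 - t).
\<close>
lemma exp_neg_le: "x \<ge> 0 \<Longrightarrow> exp (- x) \<le> 1 - x + x\<^sup>2 / (2::real)"
proof -
  assume x: "x \<ge> 0"
  let ?g = "\<lambda>t::real. 1 - t + t\<^sup>2 / 2 - exp (- t)"
  have "?g 0 \<le> ?g x"
  proof (rule DERIV_nonneg_imp_nondecreasing[OF x])
    fix t :: real
    have "(?g has_real_derivative (- 1 + t + exp (- t))) (at t)"
      by (auto intro!: derivative_eq_intros)
    moreover have "- 1 + t + exp (- t) \<ge> 0" using exp_ge_add_one_self[of "- t"] by simp
    ultimately show "\<exists>y. (?g has_real_derivative y) (at t) \<and> 0 \<le> y" by blast
  qed
  then show ?thesis by simp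
qed

text \<open>
  The exponential moment of a nonpositive variable is controlled by two moments, because exp (-x) is
  at most 1 - x + x^2 / 2 for nonnegative x. The scale 18 |u|^2 makes the linear term 1 / 18 and the
  quadratic term at most 9 / 648 = 1 / 72, which leaves 1 - 1 / 24.
\<close>
lemma expectation_exp_lin:
  assumes u: "sqn u > 0"
  shows "integrable M (\<lambda>w. exp (- ((cmod (lin u w))\<^sup>2 / (18 * sqn u))))"
    and "(\<integral>w. exp (- ((cmod (lin u w))\<^sup>2 / (18 * sqn u))) \<partial>M) \<le> exp (- 1 / 24)"
proof -
  let ?f = "\<lambda>w. exp (- ((cmod (lin u w))\<^sup>2 / (18 * sqn u)))"
  let ?h = "\<lambda>w. 1 - (cmod (lin u w))\<^sup>2 / (18 * sqn u) + (cmod (lin u w)) ^ 4 / (648 * (sqn u)\<^sup>2)"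
  show i: "integrable M ?f"
    by (rule integrable_const_bound[of _ 1]) (use u in auto)
  have i2: "integrable M (\<lambda>w. (cmod (lin u w))\<^sup>2)" "(\<integral>w. (cmod (lin u w))\<^sup>2 \<partial>M) = sqn u"
    using expectation_lin2[of u] by (auto simp: has_bochner_integral_iff)
  have ih: "integrable M ?h" using i2 integrable_lin4[of u] by simp
  have "(\<integral>w. ?f w \<partial>M) \<le> (\<integral>w. ?h w \<partial>M)"
  proof (rule integral_mono[OF i ih])
    fix w
    have "?f w \<le> 1 - (cmod (lin u w))\<^sup>2 / (18 * sqn u) + ((cmod (lin u w))\<^sup>2 / (18 * sqn u))\<^sup>2 / 2"
      by (rule exp_neg_le) (use u in simp)
    also have "\<dots> = ?h w" by (simp add: power_divide power_mult_distrib power_mult[symmetric])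
    finally show "?f w \<le> ?h w" .
  qed
  also have "\<dots> = 1 - sqn u / (18 * sqn u) + (\<integral>w. (cmod (lin u w)) ^ 4 \<partial>M) / (648 * (sqn u)\<^sup>2)"
    using i2 integrable_lin4[of u] by (simp add: prob_space)
  also have "\<dots> \<le> 1 - 1 / 18 + 9 * (sqn u)\<^sup>2 / (648 * (sqn u)\<^sup>2)"
    using u expectation_lin4_le[of u] by (intro add_mono divide_right_mono) auto
  also have "\<dots> = 1 + (- 1 / 24)" using u by simp
  also have "\<dots> \<le> exp (- 1 / 24)" by (rule exp_ge_add_one_self)
  finally show "(\<integral>w. ?f w \<partial>M) \<le> exp (- 1 / 24)" .
qed

end

section \<open>Lower bounds from a net\<close>

text \<open>
  The mesh and the squared radius of the net, the latter in units of the squared mesh. If the Gram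
  matrix of b has trace at most 1000 p, rounding a unit vector to this mesh moves it by at most 1 / 20000
  and its image by at most 1 / 20, both in squared norm, and the rounded vector has squared norm at
  most 3 = 120000 p / (40000 p).
\<close>
definition net_mesh :: "nat \<Rightarrow> real" where "net_mesh p = 1 / (200 * sqrt (real p))"

definition net_radius :: "nat \<Rightarrow> nat" where "net_radius p = 120000 * p"

lemma net_mesh_square: "p > 0 \<Longrightarrow> (net_mesh p)\<^sup>2 = 1 / (40000 * real p)"
  by (simp add: net_mesh_def power_divide power_mult_distrib)

lemma cmod_add_square_le: "(cmod (a + b))\<^sup>2 \<le> 2 * (cmod a)\<^sup>2 + 2 * (cmod b)\<^sup>2"
  using cmod_diff_square_le[of a "- b"] by simp

text \<open>
  The unit vector t is close to a net point v of squared norm at least 1 / 2 - 1 / 20000. The image of v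
  has squared norm at least |v|^2 / 2, hence that of t is at least |v|^2 / 4 - 1 / 20, which exceeds
  1 / 16.
\<close>
lemma lattice_lower_bound_unit:
  fixes b :: "nat \<Rightarrow> nat \<Rightarrow> complex"
  assumes p: "p > 0" and HS: "(\<Sum>q<p. \<Sum>i<k. (cmod (b q i))\<^sup>2) \<le> 1000 * real p"
    and net: "\<And>z. z \<in> lattice_net p (net_radius p) \<Longrightarrow>
      (\<Sum>q<p. (cmod (lattice_pt (net_mesh p) z q))\<^sup>2) / 2 \<le> (\<Sum>i<k. (cmod (\<Sum>q<p. lattice_pt (net_mesh p) z q * b q i))\<^sup>2)"
    and t: "(\<Sum>q<p. (cmod (t q))\<^sup>2) = 1"
  shows "1 \<le> 16 * (\<Sum>i<k. (cmod (\<Sum>q<p. t q * b q i))\<^sup>2)"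
proof -
  define \<eta> where "\<eta> = net_mesh p"
  have eta: "\<eta> > 0" "\<eta>\<^sup>2 = 1 / (40000 * real p)" using p net_mesh_square by (auto simp: \<eta>_def net_mesh_def)
  obtain z0 where z0: "\<forall>q<p. (cmod (t q - lattice_pt \<eta> z0 q))\<^sup>2 \<le> 2 * \<eta>\<^sup>2"
    and z0': "(\<Sum>i<k. (cmod (\<Sum>q<p. (t q - lattice_pt \<eta> z0 q) * b q i))\<^sup>2) \<le> 2 * \<eta>\<^sup>2 * (\<Sum>q<p. \<Sum>i<k. (cmod (b q i))\<^sup>2)"
    using lattice_rounding[OF eta(1), where v = t and b = b and p = p and N = k] by blast
  \<comment> \<open>Points of the net are extensional functions, so that they can be counted.\<close>
  define z where "z = (\<lambda>q\<in>{..<p}. z0 q)"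
  define v where "v q = lattice_pt \<eta> z q" for q
  have zv: "lattice_pt \<eta> z0 q = v q" if "q < p" for q using that by (simp add: v_def z_def lattice_pt_def)
  have d: "(\<Sum>q<p. (cmod (t q - v q))\<^sup>2) \<le> 1 / 20000"
  proof -
    have "(\<Sum>q<p. (cmod (t q - v q))\<^sup>2) \<le> (\<Sum>q<p. 2 * \<eta>\<^sup>2)" using z0 zv by (intro sum_mono) auto
    also have "\<dots> = 1 / 20000" using p by (simp add: eta)
    finally show ?thesis .
  qed
  have r: "(\<Sum>i<k. (cmod (\<Sum>q<p. (t q - v q) * b q i))\<^sup>2) \<le> 1 / 20"
  proof -
    have "(\<Sum>i<k. (cmod (\<Sum>q<p. (t q - v q) * b q i))\<^sup>2) = (\<Sum>i<k. (cmod (\<Sum>q<p. (t q - lattice_pt \<eta> z0 q) * b q i))\<^sup>2)"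
      by (intro sum.cong refl arg_cong[of _ _ "\<lambda>x. (cmod x)\<^sup>2"]) (simp add: zv)
    also have "\<dots> \<le> 2 * \<eta>\<^sup>2 * (1000 * real p)" using z0' HS by (elim order_trans) (intro mult_left_mono, auto)
    also have "\<dots> = 1 / 20" using p by (simp add: eta)
    finally show ?thesis .
  qed
  have up: "(\<Sum>q<p. (cmod (v q))\<^sup>2) \<le> 3"
  proof -
    have "(\<Sum>q<p. (cmod (v q))\<^sup>2) \<le> (\<Sum>q<p. 2 * (cmod (t q))\<^sup>2 + 2 * (cmod (t q - v q))\<^sup>2)"
    proof (intro sum_mono)
      fix q show "(cmod (v q))\<^sup>2 \<le> 2 * (cmod (t q))\<^sup>2 + 2 * (cmod (t q - v q))\<^sup>2"
        using cmod_diff_square_le[of "t q" "t q - v q"] by simp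
    qed
    also have "\<dots> = 2 * (\<Sum>q<p. (cmod (t q))\<^sup>2) + 2 * (\<Sum>q<p. (cmod (t q - v q))\<^sup>2)" by (simp add: sum.distrib sum_distrib_left)
    finally show ?thesis using t d by simp
  qed
  have lo: "1 / 2 - 1 / 20000 \<le> (\<Sum>q<p. (cmod (v q))\<^sup>2)"
  proof -
    have "(\<Sum>q<p. (cmod (t q))\<^sup>2) \<le> (\<Sum>q<p. 2 * (cmod (v q))\<^sup>2 + 2 * (cmod (t q - v q))\<^sup>2)"
    proof (intro sum_mono)
      fix q show "(cmod (t q))\<^sup>2 \<le> 2 * (cmod (v q))\<^sup>2 + 2 * (cmod (t q - v q))\<^sup>2"
        using cmod_add_square_le[of "v q" "t q - v q"] by simp
    qed
    also have "\<dots> = 2 * (\<Sum>q<p. (cmod (v q))\<^sup>2) + 2 * (\<Sum>q<p. (cmod (t q - v q))\<^sup>2)" by (simp add: sum.distrib sum_distrib_left)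
    finally show ?thesis using t d by simp
  qed
  have "z \<in> lattice_net p (net_radius p)"
  proof -
    have "real_of_int (\<Sum>q<p. (fst (z q))\<^sup>2 + (snd (z q))\<^sup>2) * \<eta>\<^sup>2 = (\<Sum>q<p. (cmod (v q))\<^sup>2)"
      unfolding of_int_sum sum_distrib_right
      by (intro sum.cong refl) (simp add: v_def lattice_pt_def cmod_power2 power_mult_distrib algebra_simps)
    then have "real_of_int (\<Sum>q<p. (fst (z q))\<^sup>2 + (snd (z q))\<^sup>2) * \<eta>\<^sup>2 \<le> 3" using up by simp
    then have "real_of_int (\<Sum>q<p. (fst (z q))\<^sup>2 + (snd (z q))\<^sup>2) \<le> real_of_int (int (net_radius p))"
      using p by (simp add: eta net_radius_def field_simps)
    then have "(\<Sum>q<p. (fst (z q))\<^sup>2 + (snd (z q))\<^sup>2) \<le> int (net_radius p)" by (simp only: of_int_le_iff)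
    then show ?thesis by (simp add: lattice_net_def z_def)
  qed
  from net[OF this] have n: "(\<Sum>q<p. (cmod (v q))\<^sup>2) / 2 \<le> (\<Sum>i<k. (cmod (\<Sum>q<p. v q * b q i))\<^sup>2)"
    by (simp add: v_def \<eta>_def)
  have "(\<Sum>i<k. (cmod (\<Sum>q<p. v q * b q i))\<^sup>2) \<le> (\<Sum>i<k. 2 * (cmod (\<Sum>q<p. t q * b q i))\<^sup>2 + 2 * (cmod (\<Sum>q<p. (t q - v q) * b q i))\<^sup>2)"
  proof (intro sum_mono)
    fix i
    have "(\<Sum>q<p. v q * b q i) = (\<Sum>q<p. t q * b q i) - (\<Sum>q<p. (t q - v q) * b q i)"
      by (simp add: sum_subtractf[symmetric] algebra_simps)
    then show "(cmod (\<Sum>q<p. v q * b q i))\<^sup>2 \<le> 2 * (cmod (\<Sum>q<p. t q * b q i))\<^sup>2 + 2 * (cmod (\<Sum>q<p. (t q - v q) * b q i))\<^sup>2"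
      by (simp only: cmod_diff_square_le)
  qed
  also have "\<dots> = 2 * (\<Sum>i<k. (cmod (\<Sum>q<p. t q * b q i))\<^sup>2) + 2 * (\<Sum>i<k. (cmod (\<Sum>q<p. (t q - v q) * b q i))\<^sup>2)"
    by (simp add: sum.distrib sum_distrib_left)
  finally show ?thesis using n lo r by simp
qed

lemma lattice_lower_bound:
  fixes b :: "nat \<Rightarrow> nat \<Rightarrow> complex"
  assumes HS: "(\<Sum>q<p. \<Sum>i<k. (cmod (b q i))\<^sup>2) \<le> 1000 * real p"
    and net: "\<And>z. z \<in> lattice_net p (net_radius p) \<Longrightarrow>
      (\<Sum>q<p. (cmod (lattice_pt (net_mesh p) z q))\<^sup>2) / 2 \<le> (\<Sum>i<k. (cmod (\<Sum>q<p. lattice_pt (net_mesh p) z q * b q i))\<^sup>2)"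
  shows "(\<Sum>q<p. (cmod (t q))\<^sup>2) \<le> 16 * (\<Sum>i<k. (cmod (\<Sum>q<p. t q * b q i))\<^sup>2)"
proof (cases "(\<Sum>q<p. (cmod (t q))\<^sup>2) = 0")
  case True
  then show ?thesis by (simp add: sum_nonneg)
next
  case False
  define s where "s = (\<Sum>q<p. (cmod (t q))\<^sup>2)"
  have s: "s > 0" using False unfolding s_def by (metis less_eq_real_def sum_nonneg zero_le_power2)
  have p: "p > 0" using False by (cases p) auto
  define t' where "t' q = t q / sqrt s" for q
  have sc: "(cmod (z / complex_of_real (sqrt s)))\<^sup>2 = (cmod z)\<^sup>2 / s" for z using s by (simp add: norm_divide power_divide)
  have "(\<Sum>q<p. (cmod (t' q))\<^sup>2) = 1"
    using s by (simp add: t'_def sc sum_divide_distrib[symmetric] s_def[symmetric])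
  from lattice_lower_bound_unit[OF p HS net this]
  have "1 \<le> 16 * (\<Sum>i<k. (cmod (\<Sum>q<p. t' q * b q i))\<^sup>2)" by blast
  also have "(\<Sum>i<k. (cmod (\<Sum>q<p. t' q * b q i))\<^sup>2) = (\<Sum>i<k. (cmod (\<Sum>q<p. t q * b q i))\<^sup>2) / s"
    by (simp add: t'_def sum_divide_distrib[symmetric] sc)
  finally show ?thesis using s unfolding s_def[symmetric] by (simp add: field_simps)
qed

context isotropic_sketch
begin

definition MK :: "nat \<Rightarrow> (nat \<Rightarrow> 'b) measure" where "MK k = PiM {..<k} (\<lambda>_. M)"

lemma product_prob_space_M: "product_prob_space (\<lambda>_::nat. M)"
  by (simp add: product_prob_space_def product_prob_space_axioms_def product_sigma_finite_def prob_space_axioms prob_space_imp_sigma_finite)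

lemma prob_space_MK: "prob_space (MK k)"
  unfolding MK_def by (intro prob_space_PiM prob_space_axioms)

lemma expectation_prod:
  fixes f :: "nat \<Rightarrow> 'b \<Rightarrow> 'c::{real_normed_field, banach, second_countable_topology}"
  assumes "\<And>i. i < k \<Longrightarrow> integrable M (f i)"
  shows "has_bochner_integral (MK k) (\<lambda>\<omega>. \<Prod>i<k. f i (\<omega> i)) (\<Prod>i<k. \<integral>w. f i w \<partial>M)"
proof -
  interpret PM: product_prob_space "\<lambda>_::nat. M" by (rule product_prob_space_M)
  have "integrable (PiM {..<k} (\<lambda>_. M)) (\<lambda>\<omega>. \<Prod>i\<in>{..<k}. f i (\<omega> i))"
    by (rule PM.product_integrable_prod) (use assms in auto)
  moreover have "(\<integral>\<omega>. (\<Prod>i\<in>{..<k}. f i (\<omega> i)) \<partial>PiM {..<k} (\<lambda>_. M)) = (\<Prod>i\<in>{..<k}. \<integral>w. f i w \<partial>M)"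
    by (rule PM.product_integral_prod) (use assms in auto)
  ultimately show ?thesis by (simp add: has_bochner_integral_iff MK_def)
qed

lemma expectation_component:
  fixes f :: "'b \<Rightarrow> 'c::{real_normed_field, banach, second_countable_topology}"
  assumes "i < k" "has_bochner_integral M f c"
  shows "has_bochner_integral (MK k) (\<lambda>\<omega>. f (\<omega> i)) c"
proof -
  have fi: "integrable M f" "(\<integral>w. f w \<partial>M) = c" using assms by (auto simp: has_bochner_integral_iff)
  have "has_bochner_integral (MK k) (\<lambda>\<omega>. \<Prod>l<k. (if l = i then f else (\<lambda>_. 1)) (\<omega> l)) (\<Prod>l<k. \<integral>w. (if l = i then f else (\<lambda>_. 1)) w \<partial>M)"
    by (rule expectation_prod) (use fi in auto)
  moreover have "(\<Prod>l<k. (if l = i then f else (\<lambda>_. 1)) (\<omega> l)) = f (\<omega> i)" for \<omega>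
  proof -
    have "(\<Prod>l<k. (if l = i then f else (\<lambda>_. 1)) (\<omega> l)) = (\<Prod>l<k. if l = i then f (\<omega> l) else 1)" by (intro prod.cong) auto
    then show ?thesis using assms(1) by (simp add: prod.delta)
  qed
  moreover have "(\<Prod>l<k. \<integral>w. (if l = i then f else (\<lambda>_. 1)) w \<partial>M) = c"
  proof -
    have "(\<Prod>l<k. \<integral>w. (if l = i then f else (\<lambda>_. 1)) w \<partial>M) = (\<Prod>l<k. if l = i then c else 1)"
      using fi by (intro prod.cong) (auto simp: prob_space)
    then show ?thesis using assms(1) by (simp add: prod.delta)
  qed
  ultimately show ?thesis by simp
qed

lemma expectation_two_components:
  fixes f g :: "'b \<Rightarrow> 'c::{real_normed_field, banach, second_countable_topology}"
  assumes ij: "i < k" "j < k" "i \<noteq> j" and f: "has_bochner_integral M f c" and g: "has_bochner_integral M g d"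
  shows "has_bochner_integral (MK k) (\<lambda>\<omega>. f (\<omega> i) * g (\<omega> j)) (c * d)"
proof -
  have fi: "integrable M f" "(\<integral>w. f w \<partial>M) = c" "integrable M g" "(\<integral>w. g w \<partial>M) = d" using f g by (auto simp: has_bochner_integral_iff)
  let ?h = "\<lambda>l. if l = i then f else if l = j then g else (\<lambda>_. 1)"
  have "has_bochner_integral (MK k) (\<lambda>\<omega>. \<Prod>l<k. ?h l (\<omega> l)) (\<Prod>l<k. \<integral>w. ?h l w \<partial>M)"
    by (rule expectation_prod) (use fi in auto)
  moreover have two: "(\<Prod>l<k. if l = i then a else if l = j then b else 1) = a * b" for a b :: 'c
  proof -
    have "(\<Prod>l<k. if l = i then a else if l = j then b else 1) = (\<Prod>l<k. (if l = i then a else 1) * (if l = j then b else 1))"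
      using ij(3) by (intro prod.cong) auto
    then show ?thesis using ij by (simp add: prod.distrib prod.delta)
  qed
  moreover have "(\<Prod>l<k. ?h l (\<omega> l)) = f (\<omega> i) * g (\<omega> j)" for \<omega>
  proof -
    have "(\<Prod>l<k. ?h l (\<omega> l)) = (\<Prod>l<k. if l = i then f (\<omega> i) else if l = j then g (\<omega> j) else 1)" by (intro prod.cong) auto
    then show ?thesis unfolding two .
  qed
  moreover have "(\<Prod>l<k. \<integral>w. ?h l w \<partial>M) = c * d"
  proof -
    have "(\<Prod>l<k. \<integral>w. ?h l w \<partial>M) = (\<Prod>l<k. if l = i then c else if l = j then d else 1)"
      using fi by (intro prod.cong) (auto simp: prob_space)
    then show ?thesis unfolding two .
  qed
  ultimately show ?thesis by simp
qed

text \<open>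
  Up to normalization, the squared norm of \<open>\<Omega>\<close>^* u for the sketch \<open>\<Omega>\<close> with columns \<open>X (\<omega> i)\<close>.
\<close>
definition energy :: "nat \<Rightarrow> (nat \<Rightarrow> complex) \<Rightarrow> (nat \<Rightarrow> 'b) \<Rightarrow> real" where
  "energy k u \<omega> = (\<Sum>i<k. (cmod (lin u (\<omega> i)))\<^sup>2)"

lemma energy_nonneg [simp]: "energy k u \<omega> \<ge> 0" by (auto simp: energy_def intro: sum_nonneg)

lemma lin_component_measurable: "i < k \<Longrightarrow> (\<lambda>\<omega>. lin u (\<omega> i)) \<in> borel_measurable (MK k)"
proof -
  assume "i < k"
  then have "(\<lambda>\<omega>. \<omega> i) \<in> measurable (MK k) M" unfolding MK_def by (intro measurable_component_singleton) simp
  then show ?thesis by (rule measurable_compose) (rule lin_measurable)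
qed

lemma energy_measurable [measurable]: "energy k u \<in> borel_measurable (MK k)"
  unfolding energy_def using lin_component_measurable by (intro borel_measurable_sum borel_measurable_power borel_measurable_norm) auto

lemma expectation_energy: "has_bochner_integral (MK k) (energy k u) (real k * sqn u)"
proof -
  have "has_bochner_integral (MK k) (\<lambda>\<omega>. \<Sum>i<k. (cmod (lin u (\<omega> i)))\<^sup>2) (\<Sum>i<k. sqn u)"
    by (intro has_bochner_integral_sum expectation_component expectation_lin2) auto
  then show ?thesis by (simp add: energy_def[abs_def])
qed

lemma energy_markov:
  assumes c: "\<And>t. t \<in> T \<Longrightarrow> c t \<ge> 0" and K: "K > 0" and mu: "(\<Sum>t\<in>T. c t * (real k * sqn (u t))) \<le> \<mu>"
  shows "measure (MK k) {\<omega> \<in> space (MK k). (\<Sum>t\<in>T. c t * energy k (u t) \<omega>) > K * \<mu>} \<le> 1 / K"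
proof -
  interpret K: prob_space "MK k" by (rule prob_space_MK)
  have h: "has_bochner_integral (MK k) (\<lambda>\<omega>. \<Sum>t\<in>T. c t * energy k (u t) \<omega>) (\<Sum>t\<in>T. c t * (real k * sqn (u t)))"
    by (intro has_bochner_integral_sum has_bochner_integral_mult_right expectation_energy)
  show ?thesis
    by (rule K.markov_strict) (use h mu K c in \<open>auto simp: has_bochner_integral_iff intro!: sum_nonneg\<close>)
qed

text \<open>
  For independent vectors, isotropy can be applied to each of the two arguments in turn.
\<close>
lemma cross_form_second_moment:
  assumes ij: "i < k" "j < k" "i \<noteq> j"
  shows "has_bochner_integral (MK k) (\<lambda>\<omega>. (cmod (\<Sum>x<m. \<Sum>y<m. cnj (X (\<omega> i) x) * E x y * X (\<omega> j) y))\<^sup>2) (\<Sum>x<m. \<Sum>y<m. (cmod (E x y))\<^sup>2)"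
proof -
  let ?f = "\<lambda>\<omega>. \<Sum>x<m. \<Sum>y<m. cnj (X (\<omega> i) x) * E x y * X (\<omega> j) y"
  let ?g = "\<lambda>\<omega>. \<Sum>x<m. \<Sum>y<m. \<Sum>x'<m. \<Sum>y'<m. (E x y * cnj (E x' y')) * ((X (\<omega> i) x' * cnj (X (\<omega> i) x)) * (X (\<omega> j) y * cnj (X (\<omega> j) y')))"
  have eq: "?f \<omega> * cnj (?f \<omega>) = ?g \<omega>" for \<omega>
  proof -
    have "?g \<omega> = (\<Sum>x<m. \<Sum>y<m. \<Sum>x'<m. \<Sum>y'<m. (cnj (X (\<omega> i) x) * E x y * X (\<omega> j) y) * cnj (cnj (X (\<omega> i) x') * E x' y' * X (\<omega> j) y'))"
      by (intro sum.cong refl) (simp add: mult_ac)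
    also have "\<dots> = ?f \<omega> * cnj (?f \<omega>)"
      unfolding cnj_sum by (simp only: sum_distrib_left[symmetric] sum_distrib_right[symmetric])
    finally show ?thesis by simp
  qed
  have "has_bochner_integral (MK k) ?g (\<Sum>x<m. \<Sum>y<m. \<Sum>x'<m. \<Sum>y'<m. (E x y * cnj (E x' y')) * (of_bool (x' = x) * of_bool (y = y')))"
  proof (intro has_bochner_integral_sum has_bochner_integral_mult_right)
    fix x y x' y' assume xy: "x \<in> {..<m}" "y \<in> {..<m}" "x' \<in> {..<m}" "y' \<in> {..<m}"
    have a: "has_bochner_integral M (\<lambda>w. X w x' * cnj (X w x)) (of_bool (x' = x))"
      using xy by (auto simp: has_bochner_integral_iff integrable_X_prod X_iso)
    have b: "has_bochner_integral M (\<lambda>w. X w y * cnj (X w y')) (of_bool (y = y'))"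
      using xy by (auto simp: has_bochner_integral_iff integrable_X_prod X_iso)
    show "has_bochner_integral (MK k) (\<lambda>\<omega>. (X (\<omega> i) x' * cnj (X (\<omega> i) x)) * (X (\<omega> j) y * cnj (X (\<omega> j) y'))) (of_bool (x' = x) * of_bool (y = y'))"
      by (rule expectation_two_components[OF ij a b])
  qed
  moreover have "(\<Sum>x<m. \<Sum>y<m. \<Sum>x'<m. \<Sum>y'<m. (E x y * cnj (E x' y')) * (of_bool (x' = x) * of_bool (y = y'))) = complex_of_real (\<Sum>x<m. \<Sum>y<m. (cmod (E x y))\<^sup>2)"
  proof -
    have "(\<Sum>x<m. \<Sum>y<m. \<Sum>x'<m. \<Sum>y'<m. (E x y * cnj (E x' y')) * (of_bool (x' = x) * of_bool (y = y'))) =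
        (\<Sum>x<m. \<Sum>y<m. \<Sum>x'<m. of_bool (x' = x) * (\<Sum>y'<m. of_bool (y = y') * (E x y * cnj (E x' y'))))"
      unfolding sum_distrib_left by (intro sum.cong refl) (simp only: mult_ac)
    also have "\<dots> = (\<Sum>x<m. \<Sum>y<m. \<Sum>x'<m. of_bool (x' = x) * (E x y * cnj (E x' y)))"
      by (intro sum.cong refl arg_cong[of _ _ "\<lambda>x. _ * x"] sum_of_bool_mult(2)) auto
    also have "\<dots> = (\<Sum>x<m. \<Sum>y<m. E x y * cnj (E x y))" by (intro sum.cong refl sum_of_bool_mult(1)) auto
    finally show ?thesis by (simp add: complex_norm_square del: of_real_power)
  qed
  ultimately have "has_bochner_integral (MK k) (\<lambda>\<omega>. ?f \<omega> * cnj (?f \<omega>)) (complex_of_real (\<Sum>x<m. \<Sum>y<m. (cmod (E x y))\<^sup>2))"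
    unfolding eq by simp
  from has_bochner_integral_bounded_linear[OF bounded_linear_Re this]
  have "has_bochner_integral (MK k) (\<lambda>\<omega>. Re (?f \<omega> * cnj (?f \<omega>))) (\<Sum>x<m. \<Sum>y<m. (cmod (E x y))\<^sup>2)" by (simp only: Re_complex_of_real)
  moreover have "Re (z * cnj z) = (cmod z)\<^sup>2" for z unfolding cmod_power2 by (simp add: power2_eq_square)
  ultimately show ?thesis by (simp only:)
qed

text \<open>
  Up to normalization, the squared Frobenius norm of \<open>\<Omega>\<close>^* E \<open>\<Omega>\<close>.
\<close>
definition gram_energy :: "nat \<Rightarrow> (nat \<Rightarrow> nat \<Rightarrow> complex) \<Rightarrow> (nat \<Rightarrow> 'b) \<Rightarrow> real" where
  "gram_energy k E \<omega> = (\<Sum>i<k. \<Sum>j<k. (cmod (\<Sum>x<m. \<Sum>y<m. cnj (X (\<omega> i) x) * E x y * X (\<omega> j) y))\<^sup>2)"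

lemma gram_energy_nonneg: "gram_energy k E \<omega> \<ge> 0"
  unfolding gram_energy_def by (intro sum_nonneg) auto

text \<open>
  The off-diagonal entries of \<open>\<Omega>\<close>^* E \<open>\<Omega>\<close> have second moment |E|_F^2. The k diagonal entries are only
  bounded in terms of the nuclear norm, but being so few they contribute at relative order 1 / k.
\<close>
lemma gram_energy_markov:
  assumes s: "\<And>j. j < J \<Longrightarrow> s j \<ge> 0 \<and> sqn (u j) \<le> 1 \<and> sqn (v j) \<le> 1"
    and E: "\<And>x y. x < m \<Longrightarrow> y < m \<Longrightarrow> E x y = (\<Sum>j<(J::nat). complex_of_real (s j) * u j x * cnj (v j y))"
    and K: "K > 0"
  shows "integrable (MK k) (gram_energy k E)"
    and "measure (MK k) {\<omega> \<in> space (MK k). gram_energy k E \<omega> > K * ((real k)\<^sup>2 * (\<Sum>x<m. \<Sum>y<m. (cmod (E x y))\<^sup>2) + 9 * real k * (\<Sum>j<J. s j)\<^sup>2)} \<le> 1 / K"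
proof -
  interpret K: prob_space "MK k" by (rule prob_space_MK)
  let ?F = "\<Sum>x<m. \<Sum>y<m. (cmod (E x y))\<^sup>2" and ?N = "\<Sum>j<J. s j"
  let ?q = "\<lambda>w. (cmod (\<Sum>x<m. \<Sum>y<m. cnj (X w x) * E x y * X w y))\<^sup>2"
  have dg: "has_bochner_integral M ?q (\<integral>w. ?q w \<partial>M)" "(\<integral>w. ?q w \<partial>M) \<le> 9 * ?N\<^sup>2"
    using bilinear_bound[of J s u v E, OF s E] by (auto simp: has_bochner_integral_iff)
  have F0: "?F \<ge> 0" by (intro sum_nonneg) auto
  have h: "has_bochner_integral (MK k) (gram_energy k E) (\<Sum>i<k. \<Sum>j<k. if i = j then (\<integral>w. ?q w \<partial>M) else ?F)"
    unfolding gram_energy_def[abs_def]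
  proof (intro has_bochner_integral_sum)
    fix i j assume ij: "i \<in> {..<k}" "j \<in> {..<k}"
    show "has_bochner_integral (MK k) (\<lambda>\<omega>. (cmod (\<Sum>x<m. \<Sum>y<m. cnj (X (\<omega> i) x) * E x y * X (\<omega> j) y))\<^sup>2) (if i = j then (\<integral>w. ?q w \<partial>M) else ?F)"
    proof (cases "i = j")
      case True
      then show ?thesis using expectation_component[OF _ dg(1), of i k] ij by simp
    next
      case False
      then show ?thesis using cross_form_second_moment[of i k j E] ij by simp
    qed
  qed
  then show "integrable (MK k) (gram_energy k E)" by (simp add: has_bochner_integral_iff)
  have "(\<Sum>i<k. \<Sum>j<k. if i = j then (\<integral>w. ?q w \<partial>M) else ?F) \<le> (\<Sum>i<k. \<Sum>j<k. ?F + (if i = j then 9 * ?N\<^sup>2 else 0))"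
    using dg(2) F0 by (intro sum_mono) auto
  also have "\<dots> = (real k)\<^sup>2 * ?F + 9 * real k * ?N\<^sup>2" by (simp add: sum.distrib power2_eq_square distrib_left mult_ac)
  finally have mu: "(\<Sum>i<k. \<Sum>j<k. if i = j then (\<integral>w. ?q w \<partial>M) else ?F) \<le> (real k)\<^sup>2 * ?F + 9 * real k * ?N\<^sup>2" .
  show "measure (MK k) {\<omega> \<in> space (MK k). gram_energy k E \<omega> > K * ((real k)\<^sup>2 * ?F + 9 * real k * ?N\<^sup>2)} \<le> 1 / K"
    by (rule K.markov_strict) (use h mu K in \<open>auto simp: has_bochner_integral_iff gram_energy_nonneg\<close>)
qed

text \<open>
  Chernoff's method: the k independent factors give exp (- k / 24), and the threshold costs exp (k / 36).
\<close>
lemma energy_lower_tail: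
  "measure (MK k) {\<omega> \<in> space (MK k). energy k u \<omega> < real k / 2 * sqn u} \<le> exp (- real k / 72)"
proof (cases "sqn u = 0")
  case True
  have "{\<omega> \<in> space (MK k). energy k u \<omega> < real k / 2 * sqn u} = {}"
    using energy_nonneg[of k u] by (auto simp: True not_less)
  then show ?thesis by (simp only: measure_empty) simp
next
  case False
  then have u: "sqn u > 0" using sqn_nonneg[of u] by linarith
  interpret K: prob_space "MK k" by (rule prob_space_MK)
  let ?f = "\<lambda>w. exp (- ((cmod (lin u w))\<^sup>2 / (18 * sqn u)))"
  have h: "has_bochner_integral (MK k) (\<lambda>\<omega>. \<Prod>i<k. ?f (\<omega> i)) (\<Prod>i<k. \<integral>w. ?f w \<partial>M)"
    by (rule expectation_prod) (use expectation_exp_lin(1)[OF u] in auto)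
  have pe: "(\<Prod>i<k. ?f (\<omega> i)) = exp (- (energy k u \<omega> / (18 * sqn u)))" for \<omega>
    by (simp add: exp_sum[symmetric] energy_def sum_negf sum_divide_distrib)
  have le: "(\<Prod>i<k. \<integral>w. ?f w \<partial>M) \<le> exp (- real k / 24)"
  proof -
    have "(\<Prod>i<k. \<integral>w. ?f w \<partial>M) \<le> (\<Prod>i<k. exp (- 1 / 24))"
      by (intro prod_mono conjI expectation_exp_lin(2)[OF u] Bochner_Integration.integral_nonneg) auto
    also have "\<dots> = exp (real k * (- 1 / 24))" by (simp only: prod_constant card_lessThan exp_of_nat_mult)
    finally show ?thesis by simp
  qed
  have "measure (MK k) {\<omega> \<in> space (MK k). energy k u \<omega> < real k / 2 * sqn u} \<le>
     measure (MK k) {\<omega> \<in> space (MK k). (\<Prod>i<k. ?f (\<omega> i)) \<ge> exp (- real k / 36)}"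
  proof (rule K.finite_measure_mono)
    show "{\<omega> \<in> space (MK k). energy k u \<omega> < real k / 2 * sqn u} \<subseteq> {\<omega> \<in> space (MK k). (\<Prod>i<k. ?f (\<omega> i)) \<ge> exp (- real k / 36)}"
      unfolding pe using u by (auto simp: field_simps)
    show "{\<omega> \<in> space (MK k). (\<Prod>i<k. ?f (\<omega> i)) \<ge> exp (- real k / 36)} \<in> sets (MK k)" unfolding pe by measurable
  qed
  also have "\<dots> \<le> (\<integral>\<omega>. (\<Prod>i<k. ?f (\<omega> i)) \<partial>MK k) / exp (- real k / 36)"
    by (rule integral_Markov_inequality_measure[where A = "{}"]) (use h in \<open>auto simp: has_bochner_integral_iff intro!: prod_nonneg\<close>)
  also have "\<dots> \<le> exp (- real k / 24) / exp (- real k / 36)"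
    using h le by (intro divide_right_mono) (auto simp: has_bochner_integral_iff)
  also have "\<dots> = exp (- real k / 72)" by (simp add: exp_diff[symmetric])
  finally show ?thesis .
qed

end

section \<open>Measurability of the estimator\<close>

definition mat_measurable :: "'w measure \<Rightarrow> nat \<Rightarrow> nat \<Rightarrow> ('w \<Rightarrow> complex mat) \<Rightarrow> bool" where
  "mat_measurable N p q F \<longleftrightarrow> (\<forall>w. F w \<in> carrier_mat p q) \<and> (\<forall>i<p. \<forall>j<q. (\<lambda>w. F w $$ (i, j)) \<in> borel_measurable N)"

lemma mat_measurableD: "mat_measurable N p q F \<Longrightarrow> F w \<in> carrier_mat p q"
  "mat_measurable N p q F \<Longrightarrow> i < p \<Longrightarrow> j < q \<Longrightarrow> (\<lambda>w. F w $$ (i, j)) \<in> borel_measurable N"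
  by (auto simp: mat_measurable_def)

lemma mat_measurable_const: "A \<in> carrier_mat p q \<Longrightarrow> mat_measurable N p q (\<lambda>_. A)"
  by (simp add: mat_measurable_def)

lemma mat_measurable_mult:
  assumes F: "mat_measurable N p q F" and G: "mat_measurable N q r G"
  shows "mat_measurable N p r (\<lambda>w. F w * G w)"
proof -
  have c: "F w \<in> carrier_mat p q" "G w \<in> carrier_mat q r" for w using F G by (auto simp: mat_measurable_def)
  have "(F w * G w) $$ (i, j) = (\<Sum>l<q. F w $$ (i, l) * G w $$ (l, j))" if "i < p" "j < r" for w i j
    using c[of w] that by (subst mult_mat_index) auto
  moreover have "(\<lambda>w. \<Sum>l<q. F w $$ (i, l) * G w $$ (l, j)) \<in> borel_measurable N" if "i < p" "j < r" for i j
    using that F G by (intro borel_measurable_sum borel_measurable_times mat_measurableD(2)) auto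
  ultimately show ?thesis using c unfolding mat_measurable_def by (auto simp del: index_mult_mat(1) intro: mult_carrier_mat[OF c])
qed

lemma mat_measurable_minus:
  assumes F: "mat_measurable N p q F" and G: "mat_measurable N p q G"
  shows "mat_measurable N p q (\<lambda>w. F w - G w)"
proof -
  have c: "F w \<in> carrier_mat p q" "G w \<in> carrier_mat p q" for w using F G by (auto simp: mat_measurable_def)
  have "(F w - G w) $$ (i, j) = F w $$ (i, j) - G w $$ (i, j)" if "i < p" "j < q" for w i j using c[of w] that by auto
  then show ?thesis using F G c unfolding mat_measurable_def by (auto intro!: borel_measurable_diff minus_carrier_mat)
qed

lemma mat_measurable_add:
  assumes F: "mat_measurable N p q F" and G: "mat_measurable N p q G"
  shows "mat_measurable N p q (\<lambda>w. F w + G w)"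
proof -
  have c: "F w \<in> carrier_mat p q" "G w \<in> carrier_mat p q" for w using F G by (auto simp: mat_measurable_def)
  have "(F w + G w) $$ (i, j) = F w $$ (i, j) + G w $$ (i, j)" if "i < p" "j < q" for w i j using c[of w] that by auto
  then show ?thesis using F G c unfolding mat_measurable_def by (auto intro!: borel_measurable_add add_carrier_mat)
qed

lemma mat_measurable_smult:
  assumes F: "mat_measurable N p q F" and c: "c \<in> borel_measurable N"
  shows "mat_measurable N p q (\<lambda>w. c w \<cdot>\<^sub>m F w)"
proof -
  have d: "F w \<in> carrier_mat p q" for w using F by (auto simp: mat_measurable_def)
  have "(c w \<cdot>\<^sub>m F w) $$ (i, j) = c w * F w $$ (i, j)" if "i < p" "j < q" for w i j using d[of w] that by auto
  then show ?thesis using F d c unfolding mat_measurable_def by (auto intro!: borel_measurable_times)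
qed

lemma borel_measurable_cnj: "f \<in> borel_measurable N \<Longrightarrow> (\<lambda>w. cnj (f w)) \<in> borel_measurable N"
  by (rule borel_measurable_continuous_on[OF _ _]) (auto intro!: continuous_intros)

lemma mat_measurable_adjoint:
  assumes F: "mat_measurable N p q F"
  shows "mat_measurable N q p (\<lambda>w. mat_adjoint (F w))"
proof -
  have d: "F w \<in> carrier_mat p q" for w using F by (auto simp: mat_measurable_def)
  have "mat_adjoint (F w) $$ (i, j) = cnj (F w $$ (j, i))" if "i < q" "j < p" for w i j using d[of w] that by auto
  then show ?thesis using F d unfolding mat_measurable_def by (auto intro!: borel_measurable_cnj mat_adjoint_carrier)
qed

lemma frobenius_norm_measurable:
  assumes F: "mat_measurable N p q F"
  shows "(\<lambda>w. (frobenius_norm (F w))\<^sup>2) \<in> borel_measurable N"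
proof -
  have d: "F w \<in> carrier_mat p q" for w using F by (auto simp: mat_measurable_def)
  have "(frobenius_norm (F w))\<^sup>2 = (\<Sum>i<p. \<Sum>j<q. (cmod (F w $$ (i, j)))\<^sup>2)" for w
    unfolding frobenius_norm_square using d[of w] by simp
  then show ?thesis using F by (auto intro!: borel_measurable_sum borel_measurable_power measurable_compose[OF mat_measurableD(2)[OF F] borel_measurable_norm])
qed

text \<open>
  The pseudoinverse is a pointwise limit of the Landweber iterates.
\<close>
lemma mat_measurable_pinv:
  assumes F: "mat_measurable N p p F" and h: "\<And>w. mat_adjoint (F w) = F w"
  shows "mat_measurable N p p (\<lambda>w. pinv (F w))"
proof -
  have d: "F w \<in> carrier_mat p p" for w using F by (auto simp: mat_measurable_def)
  then have dr: "dim_row (F w) = p" for w by auto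
  have it: "mat_measurable N p p (\<lambda>w. pinv_iter (F w) t)" for t
  proof (induction t)
    case 0
    then show ?case by (simp add: dr mat_measurable_const)
  next
    case (Suc t)
    have c: "(\<lambda>w. complex_of_real (inverse (1 + (frobenius_norm (F w))\<^sup>2))) \<in> borel_measurable N"
      using frobenius_norm_measurable[OF F] by measurable
    have X: "mat_measurable N p p (\<lambda>w. 1\<^sub>m p - F w * pinv_iter (F w) t)"
      by (rule mat_measurable_minus[OF mat_measurable_const[OF one_carrier_mat] mat_measurable_mult[OF F Suc.IH]])
    show ?case unfolding pinv_iter.simps dr
      by (rule mat_measurable_add[OF Suc.IH mat_measurable_smult[OF mat_measurable_mult[OF F X] c]])
  qed
  have "(\<lambda>w. pinv (F w) $$ (i, j)) \<in> borel_measurable N" if ij: "i < p" "j < p" for i j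
    by (rule borel_measurable_LIMSEQ_metric[where f = "\<lambda>t w. pinv_iter (F w) t $$ (i, j)"])
      (use ij in \<open>auto intro: mat_measurableD(2)[OF it] pinv_iter_tendsto[OF d h]\<close>)
  then show ?thesis using hermitian_pinv(2)[OF d h] by (auto simp: mat_measurable_def)
qed

lemma nystrom_pp_measurable:
  fixes A :: "complex mat"
  assumes A: "A \<in> carrier_mat m m" "mat_adjoint A = A"
    and w: "\<And>j x. j < k \<Longrightarrow> x < m \<Longrightarrow> (\<lambda>w. \<omega> w j x) \<in> borel_measurable N"
    and p: "\<And>j x. j < l \<Longrightarrow> x < m \<Longrightarrow> (\<lambda>w. \<psi> w j x) \<in> borel_measurable N"
  shows "(\<lambda>w. nystrom_pp A k l (\<omega> w) (\<psi> w)) \<in> borel_measurable N"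
proof -
  let ?S = "\<lambda>w. sketch_mat m k (\<omega> w)"
  have S: "mat_measurable N m k ?S"
    unfolding mat_measurable_def sketch_mat_def using w by auto
  have Am: "mat_measurable N m m (\<lambda>_. A)" by (rule mat_measurable_const[OF A(1)])
  note Sa = mat_measurable_adjoint[OF S]
  have Md: "mat_measurable N k k (\<lambda>w. mat_adjoint (?S w) * A * ?S w)" by (rule mat_measurable_mult[OF mat_measurable_mult[OF Sa Am] S])
  have "mat_adjoint (mat_adjoint (?S w) * A * ?S w) = mat_adjoint (?S w) * A * ?S w" for w
    using A mat_measurableD(1)[OF S, of w] by (simp add: mat_adjoint_mult mat_mult_assoc)
  then have P: "mat_measurable N k k (\<lambda>w. pinv (mat_adjoint (?S w) * A * ?S w))" by (intro mat_measurable_pinv Md)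
  have L: "mat_measurable N m m (\<lambda>w. nystrom A (?S w))"
    unfolding nystrom_def
    by (rule mat_measurable_mult[OF mat_measurable_mult[OF mat_measurable_mult[OF mat_measurable_mult[OF Am S] P] Sa] Am])
  have R: "mat_measurable N m m (\<lambda>w. A - nystrom A (?S w))" by (rule mat_measurable_minus[OF Am L])
  have dA: "dim_row A = m" using A by simp
  have tr: "mat_trace (nystrom A (?S w)) = (\<Sum>i<m. nystrom A (?S w) $$ (i, i))" for w
    using mat_measurableD(1)[OF L, of w] by (simp add: mat_trace_def)
  have q: "((A - nystrom A (?S w)) *\<^sub>v Matrix.vec m (\<psi> w j)) \<bullet>c Matrix.vec m (\<psi> w j) =
      (\<Sum>x<m. (\<Sum>y<m. (A - nystrom A (?S w)) $$ (x, y) * \<psi> w j y) * cnj (\<psi> w j x))" for w j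
    using mat_measurableD(1)[OF R, of w] mat_measurableD(1)[OF L, of w] A(1) by (simp add: scalar_prod_def atLeast0LessThan)
  show ?thesis unfolding nystrom_pp_def Let_def dA tr q
    by (intro borel_measurable_add borel_measurable_divide borel_measurable_sum borel_measurable_times borel_measurable_cnj
      mat_measurableD(2)[OF L] mat_measurableD(2)[OF R] p borel_measurable_const) auto
qed

section \<open>Good sketches\<close>

text \<open>
  This determines the constant 10 ^ 7: the union bound over the net requires that k / 72 is at least
  120004 p + 10.
\<close>
lemma net_size_bound:
  assumes "p \<le> r" "r \<ge> 1" "real k \<ge> 10 ^ 7 * real r"
  shows "2 ^ net_radius p * 9 ^ p * exp (- real k / 72) \<le> 1 / 1000"
proof -
  have e1: "(2::real) \<le> exp 1" using exp_ge_add_one_self[of 1] by simp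
  have e2: "(2::real) ^ n \<le> exp (real n)" for n
    using power_mono[OF e1, of n] by (simp add: exp_of_nat_mult[symmetric])
  have "(9::real) ^ p \<le> (2 ^ 4) ^ p" by (intro power_mono) auto
  also have "\<dots> = 2 ^ (4 * p)" by (simp add: power_mult)
  also have "\<dots> \<le> exp (real (4 * p))" by (rule e2)
  finally have a: "(9::real) ^ p \<le> exp (4 * real p)" by simp
  have b: "(1000::real) \<le> exp 10" using e2[of 10] by simp
  have c: "(2::real) ^ net_radius p \<le> exp (120000 * real p)" using e2[of "net_radius p"] by (simp add: net_radius_def)
  have "(2::real) ^ net_radius p * 9 ^ p * 1000 \<le> exp (120000 * real p) * exp (4 * real p) * exp 10"
    by (intro mult_mono a b c) auto
  also have "\<dots> = exp (120004 * real p + 10)" by (simp add: exp_add[symmetric])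
  also have "\<dots> \<le> exp (real k / 72)"
  proof -
    have "real p \<le> real r" "real r \<ge> 1" using assms by auto
    then have "120004 * real p + 10 \<le> real k / 72" using assms(3) by simp
    then show ?thesis by simp
  qed
  finally have "(2::real) ^ net_radius p * 9 ^ p * 1000 \<le> exp (real k / 72)" .
  then have "(2::real) ^ net_radius p * 9 ^ p * 1000 * exp (- real k / 72) \<le> exp (real k / 72) * exp (- real k / 72)"
    by (intro mult_right_mono) auto
  then show ?thesis by (simp add: exp_add[symmetric])
qed

context isotropic_sketch
begin

text \<open>
  The event on which the Nystrom residual is controlled: Markov bounds for the sketched norms of the
  residual matrix E, of its singular vectors u and v and of an orthonormal system q, and a lower bound
  for the image of each point of the net in the span of q.
\<close>
definition good_sketch :: "nat \<Rightarrow> nat \<Rightarrow> (nat \<Rightarrow> nat \<Rightarrow> complex) \<Rightarrow> (nat \<Rightarrow> nat \<Rightarrow> complex) \<Rightarrow>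
    (nat \<Rightarrow> real) \<Rightarrow> (nat \<Rightarrow> nat \<Rightarrow> complex) \<Rightarrow> (nat \<Rightarrow> nat \<Rightarrow> complex) \<Rightarrow> (nat \<Rightarrow> 'b) \<Rightarrow> bool" where
  "good_sketch k p q E s u v \<omega> \<longleftrightarrow>
     (\<Sum>y<m. energy k (\<lambda>x. E x y) \<omega>) \<le> 1000 * (real k * (\<Sum>x<m. \<Sum>y<m. (cmod (E x y))\<^sup>2)) \<and>
     (\<Sum>x<m. energy k (\<lambda>y. cnj (E x y)) \<omega>) \<le> 1000 * (real k * (\<Sum>x<m. \<Sum>y<m. (cmod (E x y))\<^sup>2)) \<and>
     gram_energy k E \<omega> \<le> 1000 * ((real k)\<^sup>2 * (\<Sum>x<m. \<Sum>y<m. (cmod (E x y))\<^sup>2) + 9 * real k * (\<Sum>j<m. s j)\<^sup>2) \<and>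
     (\<Sum>j<m. s j * energy k (u j) \<omega>) \<le> 1000 * (real k * (\<Sum>j<m. s j)) \<and>
     (\<Sum>j<m. s j * energy k (v j) \<omega>) \<le> 1000 * (real k * (\<Sum>j<m. s j)) \<and>
     (\<Sum>i<p. energy k (q i) \<omega>) \<le> 1000 * (real k * real p) \<and>
     (\<forall>z\<in>lattice_net p (net_radius p). real k / 2 * sqn (\<lambda>x. \<Sum>i<p. lattice_pt (net_mesh p) z i * q i x)
        \<le> energy k (\<lambda>x. \<Sum>i<p. lattice_pt (net_mesh p) z i * q i x) \<omega>)"

text \<open>
  Each of the six Markov bounds, and the union bound over the net, fails with probability at most
  1 / 1000.
\<close>
lemma good_sketch_prob:
  assumes s: "\<And>j. j < m \<Longrightarrow> s j \<ge> 0 \<and> sqn (u j) \<le> 1 \<and> sqn (v j) \<le> 1"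
    and E: "\<And>x y. x < m \<Longrightarrow> y < m \<Longrightarrow> E x y = (\<Sum>j<m. complex_of_real (s j) * u j x * cnj (v j y))"
    and q: "\<And>i. i < p \<Longrightarrow> sqn (q i) = 1"
    and k: "p \<le> r" "r \<ge> 1" "real k \<ge> 10 ^ 7 * real r"
  shows "{\<omega> \<in> space (MK k). good_sketch k p q E s u v \<omega>} \<in> sets (MK k)"
    and "measure (MK k) {\<omega> \<in> space (MK k). good_sketch k p q E s u v \<omega>} \<ge> 993 / 1000"
proof -
  interpret K: prob_space "MK k" by (rule prob_space_MK)
  let ?F = "\<Sum>x<m. \<Sum>y<m. (cmod (E x y))\<^sup>2" and ?N = "\<Sum>j<m. s j"
  let ?w = "\<lambda>z x. \<Sum>i<p. lattice_pt (net_mesh p) z i * q i x"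
  have [measurable]: "gram_energy k E \<in> borel_measurable (MK k)"
    using gram_energy_markov(1)[of m s u v E 1 k, OF s E] by auto
  define B1 where "B1 = {\<omega> \<in> space (MK k). (\<Sum>y\<in>{..<m}. 1 * energy k (\<lambda>x. E x y) \<omega>) > 1000 * (real k * ?F)}"
  define B2 where "B2 = {\<omega> \<in> space (MK k). (\<Sum>x\<in>{..<m}. 1 * energy k (\<lambda>y. cnj (E x y)) \<omega>) > 1000 * (real k * ?F)}"
  define B3 where "B3 = {\<omega> \<in> space (MK k). gram_energy k E \<omega> > 1000 * ((real k)\<^sup>2 * ?F + 9 * real k * ?N\<^sup>2)}"
  define B4 where "B4 = {\<omega> \<in> space (MK k). (\<Sum>j\<in>{..<m}. s j * energy k (u j) \<omega>) > 1000 * (real k * ?N)}"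
  define B5 where "B5 = {\<omega> \<in> space (MK k). (\<Sum>j\<in>{..<m}. s j * energy k (v j) \<omega>) > 1000 * (real k * ?N)}"
  define B6 where "B6 = {\<omega> \<in> space (MK k). (\<Sum>i\<in>{..<p}. 1 * energy k (q i) \<omega>) > 1000 * (real k * real p)}"
  define Bz where "Bz z = {\<omega> \<in> space (MK k). energy k (?w z) \<omega> < real k / 2 * sqn (?w z)}" for z
  define B7 where "B7 = (\<Union>z\<in>lattice_net p (net_radius p). Bz z)"
  have fin: "finite (lattice_net p (net_radius p))" by (rule lattice_net_card)
  have sB: "B1 \<in> sets (MK k)" "B2 \<in> sets (MK k)" "B3 \<in> sets (MK k)" "B4 \<in> sets (MK k)" "B5 \<in> sets (MK k)" "B6 \<in> sets (MK k)"
    unfolding B1_def B2_def B3_def B4_def B5_def B6_def by measurable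
  have sBz: "Bz z \<in> sets (MK k)" for z unfolding Bz_def by measurable
  then have sB7: "B7 \<in> sets (MK k)" unfolding B7_def using fin by (intro sets.finite_UN) auto
  have m1: "measure (MK k) B1 \<le> 1 / 1000" unfolding B1_def
  proof (rule energy_markov)
    show "(\<Sum>t\<in>{..<m}. 1 * (real k * sqn (\<lambda>x. E x t))) \<le> real k * ?F"
    proof -
      have "(\<Sum>t\<in>{..<m}. 1 * (real k * sqn (\<lambda>x. E x t))) = real k * (\<Sum>t<m. \<Sum>x<m. (cmod (E x t))\<^sup>2)"
        by (simp add: sqn_def sum_distrib_left)
      also have "(\<Sum>t<m. \<Sum>x<m. (cmod (E x t))\<^sup>2) = ?F" by (rule sum.swap)
      finally show ?thesis by simp
    qed
  qed auto
  have m2: "measure (MK k) B2 \<le> 1 / 1000" unfolding B2_def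
    by (rule energy_markov) (auto simp: sqn_def sum_distrib_left)
  have m3: "measure (MK k) B3 \<le> 1 / 1000" unfolding B3_def
    by (rule gram_energy_markov(2)[of m s u v E 1000 k, OF s E]) auto
  have le1: "(\<Sum>t\<in>{..<m}. s t * (real k * sqn (f t))) \<le> real k * ?N" if "\<And>j. j < m \<Longrightarrow> sqn (f j) \<le> 1" for f
  proof -
    have "(\<Sum>t\<in>{..<m}. s t * (real k * sqn (f t))) \<le> (\<Sum>t\<in>{..<m}. s t * (real k * 1))"
      using s that by (intro sum_mono mult_left_mono) auto
    then show ?thesis by (simp add: sum_distrib_left mult.commute)
  qed
  have m4: "measure (MK k) B4 \<le> 1 / 1000" unfolding B4_def
    by (rule energy_markov) (use s le1[of u] in auto)
  have m5: "measure (MK k) B5 \<le> 1 / 1000" unfolding B5_def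
    by (rule energy_markov) (use s le1[of v] in auto)
  have m6: "measure (MK k) B6 \<le> 1 / 1000" unfolding B6_def
    by (rule energy_markov) (auto simp: q)
  have m7: "measure (MK k) B7 \<le> 1 / 1000"
  proof -
    have "measure (MK k) B7 \<le> (\<Sum>z\<in>lattice_net p (net_radius p). measure (MK k) (Bz z))"
      unfolding B7_def by (rule K.finite_measure_subadditive_finite) (use fin sBz in auto)
    also have "\<dots> \<le> (\<Sum>z\<in>lattice_net p (net_radius p). exp (- real k / 72))"
      unfolding Bz_def by (intro sum_mono energy_lower_tail)
    also have "\<dots> = real (card (lattice_net p (net_radius p))) * exp (- real k / 72)" by simp
    also have "\<dots> \<le> 2 ^ net_radius p * 9 ^ p * exp (- real k / 72)"
      by (intro mult_right_mono lattice_net_card) auto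
    also have "\<dots> \<le> 1 / 1000" by (rule net_size_bound[OF k])
    finally show ?thesis .
  qed
  let ?B = "B1 \<union> (B2 \<union> (B3 \<union> (B4 \<union> (B5 \<union> (B6 \<union> B7)))))"
  have sU: "?B \<in> sets (MK k)" using sB sB7 by auto
  have eq: "{\<omega> \<in> space (MK k). good_sketch k p q E s u v \<omega>} = space (MK k) - ?B"
    unfolding good_sketch_def B1_def B2_def B3_def B4_def B5_def B6_def B7_def Bz_def by (auto simp: not_less)
  then show "{\<omega> \<in> space (MK k). good_sketch k p q E s u v \<omega>} \<in> sets (MK k)" using sU by auto
  have un: "measure (MK k) (P \<union> Q) \<le> measure (MK k) P + measure (MK k) Q" if "P \<in> sets (MK k)" "Q \<in> sets (MK k)" for P Q
    using that by (rule measure_Un_le)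
  have "measure (MK k) ?B \<le> measure (MK k) B1 + (measure (MK k) B2 + (measure (MK k) B3 + (measure (MK k) B4 + (measure (MK k) B5 + (measure (MK k) B6 + measure (MK k) B7)))))"
    using sB sB7 by (intro order_trans[OF un] add_left_mono order_refl) auto
  also have "\<dots> \<le> 7 / 1000" using m1 m2 m3 m4 m5 m6 m7 by linarith
  finally show "measure (MK k) {\<omega> \<in> space (MK k). good_sketch k p q E s u v \<omega>} \<ge> 993 / 1000"
    unfolding eq using K.prob_compl[OF sU] by simp
qed

end

section \<open>The trace estimator and the residual of a good sketch\<close>

lemma square_sum4_le: "(a + b + c + d)\<^sup>2 \<le> 4 * (a\<^sup>2 + b\<^sup>2 + c\<^sup>2 + (d::real)\<^sup>2)"
proof -
  have "0 \<le> (a - b)\<^sup>2 + (a - c)\<^sup>2 + (a - d)\<^sup>2 + (b - c)\<^sup>2 + (b - d)\<^sup>2 + (c - d)\<^sup>2" by simp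
  then show ?thesis by (simp add: power2_eq_square algebra_simps)
qed

context isotropic_sketch
begin

text \<open>
  For R = sum_j g_j g_j^* these are the quadratic form X^* R X, the squared Frobenius norm of R and its
  trace.
\<close>
definition gram_form :: "nat \<Rightarrow> (nat \<Rightarrow> nat \<Rightarrow> complex) \<Rightarrow> 'b \<Rightarrow> real" where
  "gram_form J g w = (\<Sum>j<J. (cmod (lin (g j) w))\<^sup>2)"

definition gram_frob2 :: "nat \<Rightarrow> (nat \<Rightarrow> nat \<Rightarrow> complex) \<Rightarrow> real" where
  "gram_frob2 J g = (\<Sum>x<m. \<Sum>y<m. (cmod (\<Sum>j<J. g j x * cnj (g j y)))\<^sup>2)"

definition gram_tr :: "nat \<Rightarrow> (nat \<Rightarrow> nat \<Rightarrow> complex) \<Rightarrow> real" where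
  "gram_tr J g = (\<Sum>j<J. sqn (g j))"

lemma gram_form_eq: "(\<Sum>x<m. \<Sum>y<m. cnj (X w x) * (\<Sum>j<J. g j x * cnj (g j y)) * X w y) = complex_of_real (gram_form J g w)"
proof -
  have "(\<Sum>x<m. \<Sum>y<m. cnj (X w x) * (\<Sum>j<J. g j x * cnj (g j y)) * X w y) = (\<Sum>x<m. \<Sum>y<m. \<Sum>j<J. cnj (X w x) * (g j x * cnj (g j y)) * X w y)"
    by (simp only: sum_distrib_left sum_distrib_right)
  also have "\<dots> = (\<Sum>j<J. \<Sum>x<m. \<Sum>y<m. cnj (X w x) * (g j x * cnj (g j y)) * X w y)"
    by (simp only: sum.swap[of _ "{..<J}" "{..<m}"])
  also have "\<dots> = (\<Sum>j<J. cnj (lin (g j) w) * lin (g j) w)" unfolding rank_one_form ..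
  finally show ?thesis by (simp add: gram_form_def complex_norm_square mult.commute del: of_real_power)
qed

lemma gram_form_mean: "has_bochner_integral M (gram_form J g) (gram_tr J g)"
  unfolding gram_form_def[abs_def] gram_tr_def by (intro has_bochner_integral_sum expectation_lin2)

lemma gram_form_variance:
  "integrable M (\<lambda>w. (gram_form J g w - gram_tr J g)\<^sup>2)"
  "(\<integral>w. (gram_form J g w - gram_tr J g)\<^sup>2 \<partial>M) \<le> 2 * gram_frob2 J g + \<beta> * (gram_tr J g)\<^sup>2"
proof -
  have gm: "gram_form J g \<in> borel_measurable M" unfolding gram_form_def[abs_def] by measurable
  have i2: "integrable M (\<lambda>w. (gram_form J g w)\<^sup>2)"
  proof (rule Bochner_Integration.integrable_bound)
    show "integrable M (\<lambda>w. real J * (\<Sum>j<J. (cmod (lin (g j) w)) ^ 4))"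
      by (intro integrable_mult_right Bochner_Integration.integrable_sum integrable_lin4)
    show "AE w in M. norm ((gram_form J g w)\<^sup>2) \<le> norm (real J * (\<Sum>j<J. (cmod (lin (g j) w)) ^ 4))"
    proof (intro AE_I2)
      fix w
      have "(gram_form J g w)\<^sup>2 \<le> real J * (\<Sum>j<J. ((cmod (lin (g j) w))\<^sup>2)\<^sup>2)"
        using Cauchy_Schwarz_ineq_sum[of "\<lambda>_. 1" "\<lambda>j. (cmod (lin (g j) w))\<^sup>2" "{..<J}"] by (simp add: gram_form_def)
      also have "\<dots> = real J * (\<Sum>j<J. (cmod (lin (g j) w)) ^ 4)" by (simp add: power_mult[symmetric])
      finally show "norm ((gram_form J g w)\<^sup>2) \<le> norm (real J * (\<Sum>j<J. (cmod (lin (g j) w)) ^ 4))"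
        by (simp add: sum_nonneg)
    qed
  qed (use gm in measurable)
  have i1: "integrable M (gram_form J g)" using gram_form_mean by (auto simp: has_bochner_integral_iff)
  show "integrable M (\<lambda>w. (gram_form J g w - gram_tr J g)\<^sup>2)"
    unfolding power2_diff using i1 i2 by simp
  have T: "(\<Sum>j<J. \<Sum>x<m. (cmod (g j x))\<^sup>2) = gram_tr J g" by (simp add: gram_tr_def sqn_def)
  have "(cmod (complex_of_real (gram_form J g w) - complex_of_real (gram_tr J g)))\<^sup>2 = (gram_form J g w - gram_tr J g)\<^sup>2" for w
    unfolding of_real_diff[symmetric] norm_of_real by simp
  then show "(\<integral>w. (gram_form J g w - gram_tr J g)\<^sup>2 \<partial>M) \<le> 2 * gram_frob2 J g + \<beta> * (gram_tr J g)\<^sup>2"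
    using X_var[where J = J and g = g] unfolding gram_form_eq T gram_frob2_def by simp
qed

text \<open>
  Chebyshev's inequality: the summands are independent with mean tr R, so the variance of their average
  is the variance of one of them divided by l.
\<close>
lemma trace_estimator_markov:
  assumes l: "l \<ge> 1"
  shows "measure (MK l) {\<psi> \<in> space (MK l). ((\<Sum>i<l. gram_form J g (\<psi> i)) / real l - gram_tr J g)\<^sup>2
     > 1000 * ((2 * gram_frob2 J g + \<beta> * (gram_tr J g)\<^sup>2) / real l)} \<le> 1 / 1000"
    and "(\<lambda>\<psi>. ((\<Sum>i<l. gram_form J g (\<psi> i)) / real l - gram_tr J g)\<^sup>2) \<in> borel_measurable (MK l)"
proof -
  interpret K: prob_space "MK l" by (rule prob_space_MK)
  let ?T = "gram_tr J g"
  let ?y = "\<lambda>w. gram_form J g w - ?T"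
  define V where "V = (\<integral>w. (?y w)\<^sup>2 \<partial>M)"
  have hV: "has_bochner_integral M (\<lambda>w. ?y w * ?y w) V"
    using gram_form_variance(1)[of J g] by (simp add: has_bochner_integral_iff V_def power2_eq_square)
  have h0: "has_bochner_integral M ?y 0"
  proof -
    have "has_bochner_integral M (\<lambda>w. ?T) ?T" by (simp add: has_bochner_integral_iff prob_space)
    from has_bochner_integral_diff[OF gram_form_mean[of J g] this] show ?thesis by simp
  qed
  have "has_bochner_integral (MK l) (\<lambda>\<psi>. \<Sum>i<l. \<Sum>j<l. ?y (\<psi> i) * ?y (\<psi> j)) (\<Sum>i<l. \<Sum>j<l. if i = j then V else 0)"
  proof (intro has_bochner_integral_sum)
    fix i j assume ij: "i \<in> {..<l}" "j \<in> {..<l}"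
    show "has_bochner_integral (MK l) (\<lambda>\<psi>. ?y (\<psi> i) * ?y (\<psi> j)) (if i = j then V else 0)"
    proof (cases "i = j")
      case True
      then show ?thesis using expectation_component[OF _ hV, of i l] ij by simp
    next
      case False
      then show ?thesis using expectation_two_components[OF _ _ False h0 h0, of l] ij by simp
    qed
  qed
  then have h: "has_bochner_integral (MK l) (\<lambda>\<psi>. (\<Sum>i<l. \<Sum>j<l. ?y (\<psi> i) * ?y (\<psi> j)) / (real l)\<^sup>2) (real l * V / (real l)\<^sup>2)"
    by (intro has_bochner_integral_divide_zero) simp
  have eq: "((\<Sum>i<l. gram_form J g (\<psi> i)) / real l - ?T)\<^sup>2 = (\<Sum>i<l. \<Sum>j<l. ?y (\<psi> i) * ?y (\<psi> j)) / (real l)\<^sup>2" for \<psi>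
  proof -
    have "(\<Sum>i<l. gram_form J g (\<psi> i)) / real l - ?T = (\<Sum>i<l. ?y (\<psi> i)) / real l"
      using l by (simp add: sum_subtractf field_simps)
    then show ?thesis by (simp only: power_divide power2_eq_square[of "sum _ _"] sum_product)
  qed
  show "(\<lambda>\<psi>. ((\<Sum>i<l. gram_form J g (\<psi> i)) / real l - gram_tr J g)\<^sup>2) \<in> borel_measurable (MK l)"
    unfolding eq using h by (auto simp: has_bochner_integral_iff)
  have "real l * V / (real l)\<^sup>2 = V / real l" using l by (simp add: power2_eq_square)
  also have "\<dots> \<le> (2 * gram_frob2 J g + \<beta> * ?T\<^sup>2) / real l"
    using gram_form_variance(2)[of J g] by (intro divide_right_mono) (auto simp: V_def)
  finally have le: "real l * V / (real l)\<^sup>2 \<le> (2 * gram_frob2 J g + \<beta> * ?T\<^sup>2) / real l" .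
  show "measure (MK l) {\<psi> \<in> space (MK l). ((\<Sum>i<l. gram_form J g (\<psi> i)) / real l - gram_tr J g)\<^sup>2
     > 1000 * ((2 * gram_frob2 J g + \<beta> * (gram_tr J g)\<^sup>2) / real l)} \<le> 1 / 1000"
    by (rule K.markov_strict) (use h le in \<open>auto simp: eq has_bochner_integral_iff\<close>, simp add: eq[symmetric])
qed

text \<open>
  All quantities in the bounds on the Nystrom residual are energies of the sketch.
\<close>
lemma sketch_energy:
  fixes \<omega> :: "nat \<Rightarrow> 'b" and k :: nat
  defines "S \<equiv> sketch_mat m k (\<lambda>j. X (\<omega> j))"
  assumes k: "k \<ge> 1"
  shows "S \<in> carrier_mat m k"
    and "E \<in> carrier_mat m c \<Longrightarrow> i < k \<Longrightarrow> y < c \<Longrightarrow> (mat_adjoint S * E) $$ (i, y) = cnj (lin (\<lambda>x. E $$ (x, y)) (\<omega> i)) / sqrt (real k)"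
    and "E \<in> carrier_mat m m \<Longrightarrow> (frobenius_norm (mat_adjoint S * E))\<^sup>2 = (\<Sum>y<m. energy k (\<lambda>x. E $$ (x, y)) \<omega>) / real k"
    and "E \<in> carrier_mat m m \<Longrightarrow> (frobenius_norm (E * S))\<^sup>2 = (\<Sum>x<m. energy k (\<lambda>y. cnj (E $$ (x, y))) \<omega>) / real k"
    and "E \<in> carrier_mat m m \<Longrightarrow> (frobenius_norm (mat_adjoint S * E * S))\<^sup>2 = gram_energy k (\<lambda>x y. E $$ (x, y)) \<omega> / (real k)\<^sup>2"
    and "vnorm2 (mat_adjoint S *\<^sub>v Matrix.vec m f) = energy k f \<omega> / real k"
proof -
  have sq: "complex_of_real (1 / sqrt (real k)) = 1 / complex_of_real (sqrt (real k))" by simp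
  have nk: "(cmod (z / complex_of_real (sqrt (real k))))\<^sup>2 = (cmod z)\<^sup>2 / real k" for z
    by (simp add: norm_divide power_divide)
  show S: "S \<in> carrier_mat m k" by (simp add: S_def sketch_mat_def)
  have Si: "S $$ (x, i) = X (\<omega> i) x / complex_of_real (sqrt (real k))" if "x < m" "i < k" for x i
    using that by (simp add: S_def sketch_mat_def)
  show SE: "(mat_adjoint S * E) $$ (i, y) = cnj (lin (\<lambda>x. E $$ (x, y)) (\<omega> i)) / sqrt (real k)"
    if "E \<in> carrier_mat m c" "i < k" "y < c" for E c i y
  proof -
    have "(mat_adjoint S * E) $$ (i, y) = (\<Sum>x<m. cnj (X (\<omega> i) x) * E $$ (x, y) / sqrt (real k))"
      using that S by (subst mult_mat_index) (auto simp: Si intro!: sum.cong)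
    then show ?thesis by (simp add: lin_def sum_divide_distrib mult.commute)
  qed
  show "(frobenius_norm (mat_adjoint S * E))\<^sup>2 = (\<Sum>y<m. energy k (\<lambda>x. E $$ (x, y)) \<omega>) / real k" if E: "E \<in> carrier_mat m m"
  proof -
    have "(frobenius_norm (mat_adjoint S * E))\<^sup>2 = (\<Sum>i<k. \<Sum>y<m. (cmod (lin (\<lambda>x. E $$ (x, y)) (\<omega> i)))\<^sup>2 / real k)"
      unfolding frobenius_norm_square using E S by (intro sum.cong) (auto simp: SE[OF E] nk simp del: index_mult_mat(1))
    also have "\<dots> = (\<Sum>y<m. \<Sum>i<k. (cmod (lin (\<lambda>x. E $$ (x, y)) (\<omega> i)))\<^sup>2 / real k)" by (rule sum.swap)
    finally show ?thesis by (simp add: energy_def sum_divide_distrib)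
  qed
  have ES: "(E * S) $$ (x, i) = lin (\<lambda>y. cnj (E $$ (x, y))) (\<omega> i) / sqrt (real k)"
    if "E \<in> carrier_mat c m" "i < k" "x < c" for E c i x
  proof -
    have "(E * S) $$ (x, i) = (\<Sum>y<m. E $$ (x, y) * X (\<omega> i) y / sqrt (real k))"
      using that S by (subst mult_mat_index) (auto simp: Si intro!: sum.cong)
    then show ?thesis by (simp add: lin_def sum_divide_distrib)
  qed
  show "(frobenius_norm (E * S))\<^sup>2 = (\<Sum>x<m. energy k (\<lambda>y. cnj (E $$ (x, y))) \<omega>) / real k" if E: "E \<in> carrier_mat m m"
  proof -
    have "(frobenius_norm (E * S))\<^sup>2 = (\<Sum>x<m. \<Sum>i<k. (cmod (lin (\<lambda>y. cnj (E $$ (x, y))) (\<omega> i)))\<^sup>2 / real k)"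
      unfolding frobenius_norm_square using E S by (intro sum.cong) (auto simp: ES[OF E] nk simp del: index_mult_mat(1))
    then show ?thesis by (simp add: energy_def sum_divide_distrib)
  qed
  show "(frobenius_norm (mat_adjoint S * E * S))\<^sup>2 = gram_energy k (\<lambda>x y. E $$ (x, y)) \<omega> / (real k)\<^sup>2" if E: "E \<in> carrier_mat m m"
  proof -
    have c: "mat_adjoint S * E \<in> carrier_mat k m" using S E by (intro carrier_matI) auto
    have "(mat_adjoint S * E * S) $$ (i, j) = (\<Sum>x<m. \<Sum>y<m. cnj (X (\<omega> i) x) * E $$ (x, y) * X (\<omega> j) y) / real k" if ij: "i < k" "j < k" for i j
    proof -
      have sk: "complex_of_real (sqrt (real k)) * complex_of_real (sqrt (real k)) = complex_of_real (real k)"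
        by (simp only: of_real_mult[symmetric] real_sqrt_mult_self abs_of_nat)
      have "(mat_adjoint S * E * S) $$ (i, j) = (\<Sum>y<m. (mat_adjoint S * E) $$ (i, y) * X (\<omega> j) y) / sqrt (real k)"
        unfolding ES[OF c ij(2) ij(1)] lin_def by simp
      also have "(\<Sum>y<m. (mat_adjoint S * E) $$ (i, y) * X (\<omega> j) y) = (\<Sum>y<m. (\<Sum>x<m. cnj (X (\<omega> i) x) * E $$ (x, y) * X (\<omega> j) y) / sqrt (real k))"
      proof (rule sum.cong[OF refl])
        fix y assume y: "y \<in> {..<m}"
        have "cnj (lin (\<lambda>x. E $$ (x, y)) (\<omega> i)) * X (\<omega> j) y = (\<Sum>x<m. cnj (X (\<omega> i) x) * E $$ (x, y) * X (\<omega> j) y)"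
          by (simp add: lin_def sum_distrib_left mult_ac)
        then show "(mat_adjoint S * E) $$ (i, y) * X (\<omega> j) y = (\<Sum>x<m. cnj (X (\<omega> i) x) * E $$ (x, y) * X (\<omega> j) y) / sqrt (real k)"
          using SE[OF E ij(1), of y] y by (simp del: index_mult_mat(1))
      qed
      also have "\<dots> = (\<Sum>x<m. \<Sum>y<m. cnj (X (\<omega> i) x) * E $$ (x, y) * X (\<omega> j) y) / sqrt (real k)"
        unfolding sum_divide_distrib[symmetric] by (rule arg_cong[of _ _ "\<lambda>z. z / _"]) (rule sum.swap)
      finally show ?thesis by (simp add: sk)
    qed
    then have "(frobenius_norm (mat_adjoint S * E * S))\<^sup>2 = (\<Sum>i<k. \<Sum>j<k. (cmod (\<Sum>x<m. \<Sum>y<m. cnj (X (\<omega> i) x) * E $$ (x, y) * X (\<omega> j) y))\<^sup>2 / (real k)\<^sup>2)"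
      unfolding frobenius_norm_square using c S
      by (intro sum.cong) (auto simp: norm_divide power_divide simp del: index_mult_mat(1))
    then show ?thesis by (simp add: gram_energy_def sum_divide_distrib)
  qed
  show "vnorm2 (mat_adjoint S *\<^sub>v Matrix.vec m f) = energy k f \<omega> / real k"
  proof -
    have "(mat_adjoint S *\<^sub>v Matrix.vec m f) $ i = cnj (lin f (\<omega> i)) / sqrt (real k)" if "i < k" for i
      using that S by (simp add: scalar_prod_def atLeast0LessThan lin_def Si sum_divide_distrib mult.commute)
    then show ?thesis using S by (simp add: vnorm2_def energy_def nk sum_divide_distrib)
  qed
qed

text \<open>
  The net makes S^* Q bounded below with constant 1 / 4, so the deterministic bounds on the residual
  hold with \<open>\<kappa> = 4\<close>, and the Markov bounds of the good event estimate their right-hand sides.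
\<close>
lemma good_sketch_residual:
  fixes A E Q C :: "complex mat"
  assumes A: "A \<in> carrier_mat m m" and psd: "psd A" and E: "E \<in> carrier_mat m m"
    and AE: "A - E = Q * C" and Q: "Q \<in> carrier_mat m p" and QQ: "mat_adjoint Q * Q = 1\<^sub>m p" and C: "C \<in> carrier_mat p m"
    and s: "\<And>j. j < m \<Longrightarrow> s j \<ge> 0 \<and> sqn (u j) \<le> 1 \<and> sqn (v j) \<le> 1"
    and Es: "\<And>x y. x < m \<Longrightarrow> y < m \<Longrightarrow> E $$ (x, y) = (\<Sum>j<m. complex_of_real (s j) * u j x * cnj (v j y))"
    and good: "good_sketch k p (\<lambda>i x. Q $$ (x, i)) (\<lambda>x y. E $$ (x, y)) s u v \<omega>" and k: "k \<ge> 1"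
  defines "R \<equiv> A - nystrom A (sketch_mat m k (\<lambda>j. X (\<omega> j)))"
  shows "(frobenius_norm R)\<^sup>2 \<le> 1152004 * (frobenius_norm E)\<^sup>2 + 9216000 * ((\<Sum>j<m. s j)\<^sup>2 / real k)"
    and "Re (mat_trace R) \<le> 32002 * (\<Sum>j<m. s j)"
proof -
  let ?S = "sketch_mat m k (\<lambda>j. X (\<omega> j))"
  let ?N = "\<Sum>j<m. s j"
  let ?F = "(frobenius_norm E)\<^sup>2"
  note SK = sketch_energy[OF k, where \<omega> = \<omega>]
  note S = SK(1)
  have F: "(\<Sum>x<m. \<Sum>y<m. (cmod (E $$ (x, y)))\<^sup>2) = ?F" using E by (simp add: frobenius_norm_square)
  have kp: "real k > 0" using k by simp
  have g: "(\<Sum>y<m. energy k (\<lambda>x. E $$ (x, y)) \<omega>) \<le> 1000 * (real k * ?F)"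
    "(\<Sum>x<m. energy k (\<lambda>y. cnj (E $$ (x, y))) \<omega>) \<le> 1000 * (real k * ?F)"
    "gram_energy k (\<lambda>x y. E $$ (x, y)) \<omega> \<le> 1000 * ((real k)\<^sup>2 * ?F + 9 * real k * ?N\<^sup>2)"
    "(\<Sum>j<m. s j * energy k (u j) \<omega>) \<le> 1000 * (real k * ?N)"
    "(\<Sum>j<m. s j * energy k (v j) \<omega>) \<le> 1000 * (real k * ?N)"
    "(\<Sum>i<p. energy k (\<lambda>x. Q $$ (x, i)) \<omega>) \<le> 1000 * (real k * real p)"
    and gn: "\<And>z. z \<in> lattice_net p (net_radius p) \<Longrightarrow> real k / 2 * sqn (\<lambda>x. \<Sum>i<p. lattice_pt (net_mesh p) z i * Q $$ (x, i))
        \<le> energy k (\<lambda>x. \<Sum>i<p. lattice_pt (net_mesh p) z i * Q $$ (x, i)) \<omega>"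
    using good unfolding good_sketch_def F by auto
  define b where "b q i = cnj (lin (\<lambda>x. Q $$ (x, q)) (\<omega> i)) / sqrt (real k)" for q i
  have comb: "(\<Sum>i<k. (cmod (\<Sum>q<p. t q * b q i))\<^sup>2) = energy k (\<lambda>x. \<Sum>i<p. t i * Q $$ (x, i)) \<omega> / real k" for t
  proof -
    have "(\<Sum>q<p. t q * b q i) = cnj (lin (\<lambda>x. \<Sum>i<p. t i * Q $$ (x, i)) (\<omega> i)) / sqrt (real k)" for i
    proof -
      have "cnj (lin (\<lambda>x. \<Sum>i<p. t i * Q $$ (x, i)) (\<omega> i)) = (\<Sum>x<m. \<Sum>q<p. t q * (Q $$ (x, q) * cnj (X (\<omega> i) x)))"
        by (simp add: lin_def sum_distrib_left mult_ac)
      also have "\<dots> = (\<Sum>q<p. \<Sum>x<m. t q * (Q $$ (x, q) * cnj (X (\<omega> i) x)))" by (rule sum.swap)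
      also have "\<dots> = (\<Sum>q<p. t q * cnj (lin (\<lambda>x. Q $$ (x, q)) (\<omega> i)))" by (simp add: lin_def sum_distrib_left)
      finally show ?thesis by (simp add: b_def sum_divide_distrib)
    qed
    then show ?thesis by (simp add: energy_def norm_divide power_divide sum_divide_distrib)
  qed
  have iso: "sqn (\<lambda>x. \<Sum>i<p. t i * Q $$ (x, i)) = (\<Sum>i<p. (cmod (t i))\<^sup>2)" for t
  proof -
    have "vnorm2 (Q *\<^sub>v Matrix.vec p t) = vnorm2 (Matrix.vec p t)" by (rule vnorm2_isometry[OF Q QQ]) simp
    then show ?thesis using Q by (simp add: vnorm2_def sqn_def scalar_prod_def atLeast0LessThan mult.commute)
  qed
  have low: "vnorm2 t \<le> 4\<^sup>2 * vnorm2 ((mat_adjoint ?S * Q) *\<^sub>v t)" if t: "t \<in> carrier_vec p" for t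
  proof -
    have "(\<Sum>q<p. (cmod (t $ q))\<^sup>2) \<le> 16 * (\<Sum>i<k. (cmod (\<Sum>q<p. t $ q * b q i))\<^sup>2)"
    proof (rule lattice_lower_bound)
      have "(\<Sum>q<p. \<Sum>i<k. (cmod (b q i))\<^sup>2) = (\<Sum>i<p. energy k (\<lambda>x. Q $$ (x, i)) \<omega>) / real k"
        by (simp add: b_def energy_def norm_divide power_divide sum_divide_distrib)
      also have "\<dots> \<le> 1000 * (real k * real p) / real k" using g(6) by (intro divide_right_mono) auto
      finally show "(\<Sum>q<p. \<Sum>i<k. (cmod (b q i))\<^sup>2) \<le> 1000 * real p" using kp by simp
      fix z assume "z \<in> lattice_net p (net_radius p)"
      from gn[OF this] show "(\<Sum>q<p. (cmod (lattice_pt (net_mesh p) z q))\<^sup>2) / 2 \<le> (\<Sum>i<k. (cmod (\<Sum>q<p. lattice_pt (net_mesh p) z q * b q i))\<^sup>2)"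
        unfolding comb iso using kp by (simp add: field_simps)
    qed
    moreover have "((mat_adjoint ?S * Q) *\<^sub>v t) $ i = (\<Sum>q<p. t $ q * b q i)" if "i < k" for i
    proof -
      have "((mat_adjoint ?S * Q) *\<^sub>v t) $ i = (\<Sum>q<p. (mat_adjoint ?S * Q) $$ (i, q) * t $ q)"
        using t Q S that by (simp add: scalar_prod_def atLeast0LessThan del: index_mult_mat(1))
      then show ?thesis using SK(2)[OF Q that] by (simp add: b_def mult.commute del: index_mult_mat(1))
    qed
    ultimately show ?thesis using t S by (simp add: vnorm2_def)
  qed
  define a1 where "a1 = frobenius_norm (mat_adjoint ?S * E)"
  define a2 where "a2 = frobenius_norm (E * ?S)"
  define a3 where "a3 = frobenius_norm (mat_adjoint ?S * E * ?S)"
  have "frobenius_norm R \<le> frobenius_norm E + 4 * a1 + 4 * a2 + 4\<^sup>2 * a3"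
    unfolding R_def a1_def a2_def a3_def by (rule nystrom_residual_bounds(1)[OF A psd E AE Q QQ C S _ low]) auto
  then have "(frobenius_norm R)\<^sup>2 \<le> (frobenius_norm E + 4 * a1 + 4 * a2 + 4\<^sup>2 * a3)\<^sup>2" by (intro power_mono) auto
  also have "\<dots> \<le> 4 * (?F + (4 * a1)\<^sup>2 + (4 * a2)\<^sup>2 + (4\<^sup>2 * a3)\<^sup>2)" by (rule square_sum4_le)
  also have "\<dots> = 4 * (?F + 16 * a1\<^sup>2 + 16 * a2\<^sup>2 + 256 * a3\<^sup>2)" by (simp add: power_mult_distrib)
  also have "\<dots> \<le> 4 * (?F + 16 * (1000 * ?F) + 16 * (1000 * ?F) + 256 * (1000 * (?F + 9 * (?N\<^sup>2 / real k))))"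
  proof (intro mult_left_mono add_mono order_refl)
    show "a1\<^sup>2 \<le> 1000 * ?F" unfolding a1_def SK(3)[OF E] using g(1) kp by (simp add: field_simps)
    show "a2\<^sup>2 \<le> 1000 * ?F" unfolding a2_def SK(4)[OF E] using g(2) kp by (simp add: field_simps)
    have "a3\<^sup>2 \<le> 1000 * ((real k)\<^sup>2 * ?F + 9 * real k * ?N\<^sup>2) / (real k)\<^sup>2"
      unfolding a3_def SK(5)[OF E] using g(3) by (intro divide_right_mono) auto
    also have "\<dots> = 1000 * (?F + 9 * (?N\<^sup>2 / real k))" using kp by (simp add: field_simps power2_eq_square)
    finally show "a3\<^sup>2 \<le> 1000 * (?F + 9 * (?N\<^sup>2 / real k))" .
  qed auto
  also have "\<dots> = 1152004 * ?F + 9216000 * (?N\<^sup>2 / real k)" by simp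
  finally show "(frobenius_norm R)\<^sup>2 \<le> 1152004 * ?F + 9216000 * (?N\<^sup>2 / real k)" .
  have "Re (mat_trace R) \<le> (\<Sum>j<m. s j * (2 + 4\<^sup>2 * (vnorm2 (mat_adjoint ?S *\<^sub>v Matrix.vec m (u j)) + vnorm2 (mat_adjoint ?S *\<^sub>v Matrix.vec m (v j)))))"
    unfolding R_def
    by (rule nystrom_residual_bounds(2)[OF A psd E AE Q QQ C S _ low]) (use s Es in \<open>auto simp: sqn_def\<close>)
  also have "\<dots> = 2 * ?N + 16 / real k * ((\<Sum>j<m. s j * energy k (u j) \<omega>) + (\<Sum>j<m. s j * energy k (v j) \<omega>))"
    unfolding SK(6) sum.distrib[symmetric] sum_distrib_left by (intro sum.cong refl) (simp add: algebra_simps add_divide_distrib)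
  also have "\<dots> \<le> 2 * ?N + 16 / real k * (1000 * (real k * ?N) + 1000 * (real k * ?N))"
    using g(4,5) by (intro add_left_mono mult_left_mono add_mono) auto
  also have "\<dots> = 32002 * ?N" using kp by simp
  finally show "Re (mat_trace R) \<le> 32002 * ?N" .
qed

end

section \<open>The error of Nystrom++ for isotropic test vectors\<close>

text \<open>
  The inequality of Chebyshev is applied with the factor 1000; the resulting bound is divided by l,
  which produces the factor 1 / r in front of each of the terms F, N^2 / r and \<open>N^2 / \<gamma>\<close>.
\<close>
lemma final_constants:
  fixes F N R2 T \<beta> \<gamma> :: real
  assumes R2: "R2 \<le> 1152004 * F + 9216000 * (N\<^sup>2 / real k)" and T: "0 \<le> T" "T \<le> 32002 * N"
    and F: "0 \<le> F" and b: "0 \<le> \<beta>" "\<beta> \<le> 12 / \<gamma>" and g: "\<gamma> > 0" and r: "r \<ge> 1" and k: "real k \<ge> real r" and l: "real l \<ge> real r"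
  shows "1000 * ((2 * R2 + \<beta> * T\<^sup>2) / real l) \<le> 10 ^ 14 * (1 / real r * F + (1 / (real r)\<^sup>2 + 1 / (\<gamma> * real r)) * N\<^sup>2)"
proof -
  have r0: "real r > 0" using r by simp
  have l0: "real l > 0" using r0 l by linarith
  have a: "N\<^sup>2 / real k \<le> N\<^sup>2 / real r" using k r0 by (intro divide_left_mono) auto
  have "T\<^sup>2 \<le> (32002 * N)\<^sup>2" using T by (intro power_mono) auto
  then have "\<beta> * T\<^sup>2 \<le> 12 / \<gamma> * (32002 * N)\<^sup>2" using b g by (intro mult_mono) auto
  also have "\<dots> = 12289536048 * (N\<^sup>2 / \<gamma>)" by (simp add: power_mult_distrib)
  finally have c: "\<beta> * T\<^sup>2 \<le> 12289536048 * (N\<^sup>2 / \<gamma>)" .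
  have q: "0 \<le> N\<^sup>2 / real r" "0 \<le> N\<^sup>2 / \<gamma>" using r0 g by auto
  have arith: "2 * R2 + S \<le> 10 ^ 11 * (F + P + Q)"
    if "R2 \<le> 1152004 * F + 9216000 * P'" "P' \<le> P" "S \<le> 12289536048 * Q" "0 \<le> P" "0 \<le> Q" for P P' Q S :: real
    using that F by simp
  have "2 * R2 + \<beta> * T\<^sup>2 \<le> 10 ^ 11 * (F + N\<^sup>2 / real r + N\<^sup>2 / \<gamma>)" by (rule arith[OF R2 a c q])
  then have "(2 * R2 + \<beta> * T\<^sup>2) / real l \<le> 10 ^ 11 * (F + N\<^sup>2 / real r + N\<^sup>2 / \<gamma>) / real l"
    using l0 by (intro divide_right_mono) auto
  also have "\<dots> \<le> 10 ^ 11 * (F + N\<^sup>2 / real r + N\<^sup>2 / \<gamma>) / real r"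
    using l r0 l0 F q by (intro divide_left_mono mult_nonneg_nonneg mult_pos_pos) auto
  finally have "(2 * R2 + \<beta> * T\<^sup>2) / real l \<le> 10 ^ 11 * (F + N\<^sup>2 / real r + N\<^sup>2 / \<gamma>) / real r" .
  from mult_left_mono[OF this, of 1000]
  have "1000 * ((2 * R2 + \<beta> * T\<^sup>2) / real l) \<le> 10 ^ 14 * ((F + N\<^sup>2 / real r + N\<^sup>2 / \<gamma>) / real r)"
    by (rule ord_le_eq_trans) simp_all
  also have "(F + N\<^sup>2 / real r + N\<^sup>2 / \<gamma>) / real r = 1 / real r * F + (1 / (real r)\<^sup>2 + 1 / (\<gamma> * real r)) * N\<^sup>2"
    using r0 g by (simp add: field_simps power2_eq_square)
  finally show ?thesis .
qed

lemma gram_matrix_index: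
  fixes G :: "complex mat"
  assumes G: "G \<in> carrier_mat m m" and xy: "x < m" "y < m"
  shows "(mat_adjoint G * G) $$ (x, y) = (\<Sum>j<m. cnj (G $$ (j, x)) * cnj (cnj (G $$ (j, y))))"
  using assms by (subst mult_mat_index) auto

context isotropic_sketch
begin

text \<open>
  The trace of the Nystrom approximation cancels: what remains is the error of the trace estimator for
  the residual G^* G, the Gram matrix built from the conjugated rows of G.
\<close>
lemma nystrom_pp_error_eq:
  fixes A G :: "complex mat"
  assumes A: "A \<in> carrier_mat m m" and L: "nystrom A (sketch_mat m k \<omega>) \<in> carrier_mat m m"
    and G: "G \<in> carrier_mat m m" and R: "A - nystrom A (sketch_mat m k \<omega>) = mat_adjoint G * G"
  defines "g \<equiv> \<lambda>j x. cnj (G $$ (j, x))"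
  shows "nystrom_pp A k l \<omega> (\<lambda>j. X (\<psi> j)) - mat_trace A = complex_of_real ((\<Sum>i<l. gram_form m g (\<psi> i)) / real l - gram_tr m g)"
    and "(frobenius_norm (mat_adjoint G * G))\<^sup>2 = gram_frob2 m g"
    and "mat_trace (mat_adjoint G * G) = complex_of_real (gram_tr m g)"
proof -
  let ?L = "nystrom A (sketch_mat m k \<omega>)" and ?R = "mat_adjoint G * G"
  have Rc: "?R \<in> carrier_mat m m" using G by (intro carrier_matI) auto
  have Ri: "?R $$ (x, y) = (\<Sum>j<m. g j x * cnj (g j y))" if "x < m" "y < m" for x y
    unfolding g_def using gram_matrix_index[OF G that] .
  show tr: "mat_trace ?R = complex_of_real (gram_tr m g)"
  proof -
    have "mat_trace ?R = (\<Sum>x<m. \<Sum>j<m. g j x * cnj (g j x))"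
      unfolding mat_trace_def using Rc by (intro sum.cong) (auto simp: Ri simp del: index_mult_mat(1))
    also have "\<dots> = (\<Sum>j<m. \<Sum>x<m. g j x * cnj (g j x))" by (rule sum.swap)
    finally show ?thesis by (simp add: gram_tr_def sqn_def complex_norm_square del: of_real_power)
  qed
  show "(frobenius_norm ?R)\<^sup>2 = gram_frob2 m g"
    unfolding frobenius_norm_square gram_frob2_def using Rc by (intro sum.cong) (auto simp: Ri simp del: index_mult_mat(1))
  have q: "(?R *\<^sub>v Matrix.vec m (X w)) \<bullet>c Matrix.vec m (X w) = complex_of_real (gram_form m g w)" for w
  proof -
    have "(?R *\<^sub>v Matrix.vec m (X w)) \<bullet>c Matrix.vec m (X w) = (\<Sum>x<m. (\<Sum>y<m. ?R $$ (x, y) * X w y) * cnj (X w x))"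
      using Rc by (simp add: scalar_prod_def[of _ "conjugate _"] atLeast0LessThan del: index_mult_mat(1))
        (auto simp: scalar_prod_def atLeast0LessThan simp del: index_mult_mat(1) intro!: sum.cong)
    also have "\<dots> = (\<Sum>x<m. \<Sum>y<m. cnj (X w x) * (\<Sum>j<m. g j x * cnj (g j y)) * X w y)"
      unfolding sum_distrib_right by (intro sum.cong refl) (simp add: Ri mult_ac sum_distrib_left del: index_mult_mat(1))
    finally show ?thesis unfolding gram_form_eq .
  qed
  have "mat_trace A = mat_trace ?L + mat_trace ?R"
    unfolding R[symmetric] using A L by (simp add: mat_trace_def sum.distrib[symmetric])
  moreover have "nystrom_pp A k l \<omega> (\<lambda>j. X (\<psi> j)) = mat_trace ?L + complex_of_real ((\<Sum>i<l. gram_form m g (\<psi> i)) / real l)"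
    using A unfolding nystrom_pp_def Let_def by (simp add: R q)
  ultimately show "nystrom_pp A k l \<omega> (\<lambda>j. X (\<psi> j)) - mat_trace A = complex_of_real ((\<Sum>i<l. gram_form m g (\<psi> i)) / real l - gram_tr m g)"
    by (simp add: tr)
qed

text \<open>
  For a good sketch, the trace estimator for the residual is analysed with \<open>\<omega>\<close> fixed, which is
  possible because \<open>\<psi>\<close> is independent of it. Fubini's theorem then combines the two probabilities:
  0.993 times 0.999 exceeds 0.98.
\<close>
theorem nystrom_pp_bound:
  fixes A E :: "complex mat"
  assumes A: "A \<in> carrier_mat m m" and psd: "psd A" and E: "E \<in> carrier_mat m m"
    and low_rank: "\<forall>x<m. \<forall>y<m. (A - E) $$ (x, y) = (\<Sum>i<r. Y i x * z i y)"
    and r: "r \<ge> 1" and k: "real k \<ge> 10 ^ 7 * real r" and l: "real l \<ge> 10 ^ 7 * real r"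
    and g: "\<gamma> > 0" "\<beta> \<le> 12 / \<gamma>"
  defines "D \<equiv> {p \<in> space (MK k \<Otimes>\<^sub>M MK l).
     (cmod (nystrom_pp A k l (\<lambda>j. X (fst p j)) (\<lambda>j. X (snd p j)) - mat_trace A))\<^sup>2
       \<le> 10 ^ 14 * (1 / real r * (frobenius_norm E)\<^sup>2 + (1 / (real r)\<^sup>2 + 1 / (\<gamma> * real r)) * (nuclear_norm E)\<^sup>2)}"
  shows "measure (MK k \<Otimes>\<^sub>M MK l) D \<ge> 98 / 100"
proof -
  interpret K: prob_space "MK k" by (rule prob_space_MK)
  interpret L: prob_space "MK l" by (rule prob_space_MK)
  interpret pair_prob_space "MK k" "MK l" by unfold_locales
  let ?bound = "10 ^ 14 * (1 / real r * (frobenius_norm E)\<^sup>2 + (1 / (real r)\<^sup>2 + 1 / (\<gamma> * real r)) * (nuclear_norm E)\<^sup>2)"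
  have Ah: "mat_adjoint A = A" using psd by (simp add: psd_def)
  have k1: "real k \<ge> real r" "k \<ge> 1" and l1: "real l \<ge> real r" "l \<ge> 1"
  proof -
    have "real r \<ge> 1" using r by simp
    then have "real k \<ge> real r \<and> real k \<ge> 1" "real l \<ge> real r \<and> real l \<ge> 1" using k l by auto
    then show "real k \<ge> real r" "k \<ge> 1" "real l \<ge> real r" "l \<ge> 1" by auto
  qed
  have AEc: "A - E \<in> carrier_mat m m" using A E by auto
  obtain p Q C where p: "p \<le> r" and Q: "Q \<in> carrier_mat m p" and QQ: "mat_adjoint Q * Q = 1\<^sub>m p" and C: "C \<in> carrier_mat p m" and AE: "A - E = Q * C"
    using orthonormal_factorization[OF AEc low_rank] by blast
  obtain s u v where suv: "\<forall>j<m. s j \<ge> 0 \<and> (\<Sum>x<m. (cmod (u j x))\<^sup>2) \<le> 1 \<and> (\<Sum>x<m. (cmod (v j x))\<^sup>2) \<le> 1"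
    and nuc: "(\<Sum>j<m. s j) = nuclear_norm E"
    and Es: "\<forall>x<m. \<forall>y<m. E $$ (x, y) = (\<Sum>j<m. complex_of_real (s j) * u j x * cnj (v j y))"
    using nuclear_norm_decomposition[OF E] by blast
  have s: "s j \<ge> 0 \<and> sqn (u j) \<le> 1 \<and> sqn (v j) \<le> 1" if "j < m" for j using suv that by (simp add: sqn_def)
  have Q1: "sqn (\<lambda>x. Q $$ (x, i)) = 1" if i: "i < p" for i
  proof -
    have "complex_of_real (sqn (\<lambda>x. Q $$ (x, i))) = (mat_adjoint Q * Q) $$ (i, i)"
      using Q i by (subst mult_mat_index) (auto simp: sqn_def complex_norm_square mult.commute simp del: of_real_power intro!: sum.cong)
    then have "complex_of_real (sqn (\<lambda>x. Q $$ (x, i))) = 1" using i by (simp add: QQ)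
    then show ?thesis by (simp only: of_real_eq_1_iff)
  qed
  define Good where "Good = {\<omega> \<in> space (MK k). good_sketch k p (\<lambda>i x. Q $$ (x, i)) (\<lambda>x y. E $$ (x, y)) s u v \<omega>}"
  have Good: "Good \<in> sets (MK k)" "measure (MK k) Good \<ge> 993 / 1000"
    unfolding Good_def using good_sketch_prob[of s u v "\<lambda>x y. E $$ (x, y)" p "\<lambda>i x. Q $$ (x, i)" r k] s Es Q1 p r k by auto
  have Xk: "(\<lambda>q. X (fst q j) x) \<in> borel_measurable (MK k \<Otimes>\<^sub>M MK l)" if "j < k" "x < m" for j x
  proof -
    have "(\<lambda>\<omega>. \<omega> j) \<in> measurable (MK k) M" unfolding MK_def by (intro measurable_component_singleton) (use that in simp)
    from measurable_compose[OF measurable_compose[OF measurable_fst this] X_meas[OF that(2)]] show ?thesis .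
  qed
  have Xl: "(\<lambda>q. X (snd q j) x) \<in> borel_measurable (MK k \<Otimes>\<^sub>M MK l)" if "j < l" "x < m" for j x
  proof -
    have "(\<lambda>\<omega>. \<omega> j) \<in> measurable (MK l) M" unfolding MK_def by (intro measurable_component_singleton) (use that in simp)
    from measurable_compose[OF measurable_compose[OF measurable_snd this] X_meas[OF that(2)]] show ?thesis .
  qed
  have [measurable]: "(\<lambda>q. nystrom_pp A k l (\<lambda>j. X (fst q j)) (\<lambda>j. X (snd q j))) \<in> borel_measurable (MK k \<Otimes>\<^sub>M MK l)"
    by (rule nystrom_pp_measurable[OF A Ah]) (use Xk Xl in auto)
  have D: "D \<in> sets (MK k \<Otimes>\<^sub>M MK l)" unfolding D_def by measurable
  have slice: "measure (MK l) (Pair \<omega> -` D) \<ge> 999 / 1000" if w: "\<omega> \<in> Good" for \<omega>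
  proof -
    have ws: "\<omega> \<in> space (MK k)" and gs: "good_sketch k p (\<lambda>i x. Q $$ (x, i)) (\<lambda>x y. E $$ (x, y)) s u v \<omega>"
      using w by (auto simp: Good_def)
    let ?S = "sketch_mat m k (\<lambda>j. X (\<omega> j))"
    have S: "?S \<in> carrier_mat m k" by (simp add: sketch_mat_def)
    have Lc: "nystrom A ?S \<in> carrier_mat m m" by (rule nystrom_residual(1)[OF A psd S])
    obtain G where G: "G \<in> carrier_mat m m" and RG: "A - nystrom A ?S = mat_adjoint G * G" using nystrom_residual(2)[OF A psd S] by blast
    define h where "h = (\<lambda>j x. cnj (G $$ (j, x)))"
    note er = nystrom_pp_error_eq[OF A Lc G RG, folded h_def]
    have fr: "gram_frob2 m h \<le> 1152004 * (frobenius_norm E)\<^sup>2 + 9216000 * ((nuclear_norm E)\<^sup>2 / real k)"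
      using good_sketch_residual(1)[OF A psd E AE Q QQ C s _ gs k1(2)] Es unfolding RG er(2) nuc by blast
    have tr: "gram_tr m h \<le> 32002 * nuclear_norm E"
      using good_sketch_residual(2)[OF A psd E AE Q QQ C s _ gs k1(2)] Es unfolding RG er(3) nuc by simp
    have t0: "0 \<le> gram_tr m h" by (auto simp: gram_tr_def intro: sum_nonneg)
    have fc: "1000 * ((2 * gram_frob2 m h + \<beta> * (gram_tr m h)\<^sup>2) / real l) \<le> ?bound"
      by (rule final_constants[OF fr t0 tr _ beta(1) g(2,1) r k1(1) l1(1)]) simp
    let ?Z = "\<lambda>\<psi>. ((\<Sum>i<l. gram_form m h (\<psi> i)) / real l - gram_tr m h)\<^sup>2"
    let ?B = "{\<psi> \<in> space (MK l). ?Z \<psi> > 1000 * ((2 * gram_frob2 m h + \<beta> * (gram_tr m h)\<^sup>2) / real l)}"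
    note tm = trace_estimator_markov[OF l1(2), of m h]
    have Bs: "?B \<in> sets (MK l)" using tm(2) by measurable
    have sub: "space (MK l) - ?B \<subseteq> Pair \<omega> -` D"
    proof
      fix \<psi> assume \<psi>: "\<psi> \<in> space (MK l) - ?B"
      have "cmod (nystrom_pp A k l (\<lambda>j. X (\<omega> j)) (\<lambda>j. X (\<psi> j)) - mat_trace A) = \<bar>(\<Sum>i<l. gram_form m h (\<psi> i)) / real l - gram_tr m h\<bar>"
        unfolding er(1) norm_of_real ..
      then have "(cmod (nystrom_pp A k l (\<lambda>j. X (\<omega> j)) (\<lambda>j. X (\<psi> j)) - mat_trace A))\<^sup>2 = ?Z \<psi>" by simp
      also have "\<dots> \<le> ?bound" using \<psi> fc by (auto simp: not_less)
      finally show "\<psi> \<in> Pair \<omega> -` D" using ws \<psi> by (auto simp: D_def space_pair_measure)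
    qed
    have "999 / 1000 \<le> measure (MK l) (space (MK l) - ?B)" using L.prob_compl[OF Bs] tm(1) by simp
    also have "\<dots> \<le> measure (MK l) (Pair \<omega> -` D)"
      by (rule L.finite_measure_mono[OF sub sets_Pair1[OF D]])
    finally show ?thesis .
  qed
  have "ennreal (999 / 1000) * emeasure (MK k) Good = (\<integral>\<^sup>+ \<omega>. ennreal (999 / 1000) * indicator Good \<omega> \<partial>MK k)"
    using Good(1) by (simp add: nn_integral_cmult_indicator)
  also have "\<dots> \<le> (\<integral>\<^sup>+ \<omega>. emeasure (MK l) (Pair \<omega> -` D) \<partial>MK k)"
  proof (intro nn_integral_mono)
    fix \<omega>
    show "ennreal (999 / 1000) * indicator Good \<omega> \<le> emeasure (MK l) (Pair \<omega> -` D)"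
    proof (cases "\<omega> \<in> Good")
      case True
      then show ?thesis using slice[OF True] by (simp add: L.emeasure_eq_measure ennreal_leI)
    qed simp
  qed
  also have "\<dots> = emeasure (MK k \<Otimes>\<^sub>M MK l) D" by (rule L.emeasure_pair_measure_alt[OF D, symmetric])
  finally have "ennreal (999 / 1000) * ennreal (measure (MK k) Good) \<le> ennreal (measure (MK k \<Otimes>\<^sub>M MK l) D)"
    unfolding K.emeasure_eq_measure P.emeasure_eq_measure .
  then have "ennreal (999 / 1000 * measure (MK k) Good) \<le> ennreal (measure (MK k \<Otimes>\<^sub>M MK l) D)"
    using ennreal_mult'[of "999 / 1000" "measure (MK k) Good"] by (metis divide_nonneg_nonneg zero_le_numeral)
  then have "999 / 1000 * measure (MK k) Good \<le> measure (MK k \<Otimes>\<^sub>M MK l) D" using ennreal_le_iff[OF measure_nonneg] by blast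
  then show ?thesis using Good(2) by simp
qed

end

section \<open>Nystrom++ with random matrix product states\<close>

text \<open>
  The fourth moments of the entries are finite by Wick's formula, and the variance bound is the one for
  quadratic forms in an rMPS, with the total weight of the nonconstant pairings as \<open>\<beta>\<close>.
\<close>
lemma (in gaussian_cores) rmps_isotropic_sketch:
  assumes g: "\<gamma> > 2" and bd: "real bd = \<gamma> * real n"
  shows "isotropic_sketch (rmps_law N d n bd) (\<lambda>v x. e (v x)) (d ^ n) excess"
proof (rule isotropic_sketch.intro)
  show "prob_space (rmps_law N d n bd)" by (rule prob_space_rmps_law)
  have e: "(\<lambda>v. e (v x)) \<in> borel_measurable (PiM {..<d ^ n} (\<lambda>_. borel))" if "x < d ^ n" for x
  proof -
    have "x \<in> {..<d ^ n}" using that by simp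
    then have "(\<lambda>v. v x) \<in> borel_measurable (PiM {..<d ^ n} (\<lambda>_. borel))" by (rule measurable_component_singleton)
    then show ?thesis by (rule measurable_compose[OF _ e_meas])
  qed
  have cnj: "cnj \<in> borel_measurable borel"
    by (intro borel_measurable_continuous_onI continuous_intros)
  have ec: "(\<lambda>v. cnj (e (v x))) \<in> borel_measurable (PiM {..<d ^ n} (\<lambda>_. borel))" if "x < d ^ n" for x
    by (rule measurable_compose[OF e[OF that] cnj])
  show "isotropic_sketch_axioms (rmps_law N d n bd) (\<lambda>v x. e (v x)) (d ^ n) excess"
  proof
    fix x assume x: "x < d ^ n"
    show "(\<lambda>w. e (w x)) \<in> borel_measurable (rmps_law N d n bd)" by (rule law_coordinate_measurable[OF x])
    have "integrable (PiM I P) (\<lambda>G. cmod (amp G x * cnj (amp G x) * amp G x * cnj (amp G x)))"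
      using expectation_amp4[of x x x x] by (auto simp: has_bochner_integral_iff)
    then have "integrable (PiM I P) (\<lambda>G. (cmod (amp G x)) ^ 4)" by (simp add: norm_mult power4_eq_xxxx)
    then obtain c where "has_bochner_integral (PiM I P) (\<lambda>G. (cmod (amp G x)) ^ 4) c" by (auto simp: has_bochner_integral_iff)
    then have "has_bochner_integral (rmps_law N d n bd) (\<lambda>v. (cmod (e (v x))) ^ 4) c"
      using law_expectation[of "\<lambda>u. (cmod (u x)) ^ 4" c] e[OF x] x by simp
    then show "integrable (rmps_law N d n bd) (\<lambda>w. (cmod (e (w x))) ^ 4)" by (simp add: has_bochner_integral_iff)
  next
    fix x y assume x: "x < d ^ n" and y: "y < d ^ n"
    have "has_bochner_integral (rmps_law N d n bd) (\<lambda>v. e (v x) * cnj (e (v y))) (of_bool (x = y))"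
      using law_expectation[of "\<lambda>u. u x * cnj (u y)" "of_bool (x = y)"] borel_measurable_times[OF e[OF x] ec[OF y]] x y
        expectation_amp2[OF x y] by simp
    then show "(\<integral>w. e (w x) * cnj (e (w y)) \<partial>rmps_law N d n bd) = of_bool (x = y)" by (simp add: has_bochner_integral_iff)
  next
    fix J and g :: "nat \<Rightarrow> nat \<Rightarrow> complex"
    define f where "f = (\<lambda>u. (cmod ((\<Sum>x<d ^ n. \<Sum>y<d ^ n. cnj (u x) * (\<Sum>j<J. g j x * cnj (g j y)) * u y)
        - complex_of_real (\<Sum>j<J. \<Sum>x<d ^ n. (cmod (g j x))\<^sup>2)))\<^sup>2)"
    have fa: "f (amp G) = (cmod (qform (gram J g) G - complex_of_real (gtrace J g)))\<^sup>2" for G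
      unfolding f_def qform_def gram_def gtrace_def ..
    have hb: "has_bochner_integral (PiM I P) (\<lambda>G. f (amp G)) (\<integral>G. f (amp G) \<partial>PiM I P)"
      unfolding has_bochner_integral_iff fa using qform_variance(1) by blast
    have meas: "(\<lambda>v. f (\<lambda>x. e (v x))) \<in> borel_measurable (PiM {..<d ^ n} (\<lambda>_. borel))"
    proof -
      have "(\<lambda>v. (cmod (h v - c))\<^sup>2) \<in> borel_measurable K"
        if [measurable]: "h \<in> borel_measurable K" for h c and K :: "(nat \<Rightarrow> 'a) measure" by measurable
      note square = this
      show ?thesis unfolding f_def
        by (rule square) (intro borel_measurable_sum borel_measurable_times borel_measurable_const e ec; simp)
    qed
    have loc: "f u = f v" if "\<And>x. x < d ^ n \<Longrightarrow> u x = v x" for u v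
      unfolding f_def using that by simp
    have "(\<integral>w. f (\<lambda>x. e (w x)) \<partial>rmps_law N d n bd) = (\<integral>G. f (amp G) \<partial>PiM I P)"
      using law_expectation[OF meas loc, THEN iffD2, OF _ hb] by (simp add: has_bochner_integral_iff)
    also have "\<dots> \<le> 2 * (\<Sum>x<d ^ n. \<Sum>y<d ^ n. (cmod (gram J g x y))\<^sup>2) + excess * (gtrace J g)\<^sup>2"
      unfolding fa by (rule qform_variance(2))
    finally show "(\<integral>w. (cmod ((\<Sum>x<d ^ n. \<Sum>y<d ^ n. cnj (e (w x)) * (\<Sum>j<J. g j x * cnj (g j y)) * e (w y))
        - complex_of_real (\<Sum>j<J. \<Sum>x<d ^ n. (cmod (g j x))\<^sup>2)))\<^sup>2 \<partial>rmps_law N d n bd)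
      \<le> 2 * (\<Sum>x<d ^ n. \<Sum>y<d ^ n. (cmod (\<Sum>j<J. g j x * cnj (g j y)))\<^sup>2) + excess * (\<Sum>j<J. \<Sum>x<d ^ n. (cmod (g j x))\<^sup>2)\<^sup>2"
      unfolding f_def gram_def gtrace_def .
  next
    show "0 \<le> excess" by (rule excess_bounds(1)[OF g bd])
    have "12 / \<gamma> \<le> 6" using g by (simp add: field_simps)
    with excess_bounds(2)[OF g bd] show "excess \<le> 6" by linarith
  qed
qed

lemma (in gaussian_cores) rmps_nystrom_pp_bound:
  fixes A B :: "complex mat"
  assumes g: "\<gamma> > 2" and bd: "real bd = \<gamma> * real n"
    and A: "A \<in> carrier_mat (d ^ n) (d ^ n)" and psd: "psd A" and B: "B \<in> carrier_mat (d ^ n) (d ^ n)"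
    and low_rank: "\<forall>x<d ^ n. \<forall>y<d ^ n. B $$ (x, y) = (\<Sum>i<r. Y i x * z i y)"
    and r: "r \<ge> 1" and k: "real k \<ge> 10 ^ 7 * real r" and l: "real l \<ge> 10 ^ 7 * real r"
  shows "\<P>((\<omega>, \<psi>) in iid_rmps N d n bd k \<Otimes>\<^sub>M iid_rmps N d n bd l.
      (cmod (nystrom_pp A k l (\<lambda>j x. e (\<omega> j x)) (\<lambda>j x. e (\<psi> j x)) - mat_trace A))\<^sup>2
        \<le> 10 ^ 14 * (1 / real r * (frobenius_norm (A - B))\<^sup>2
            + (1 / (real r)\<^sup>2 + 1 / (\<gamma> * real r)) * (nuclear_norm (A - B))\<^sup>2)) \<ge> 0.98"
proof -
  interpret S: isotropic_sketch "rmps_law N d n bd" "\<lambda>v x. e (v x)" "d ^ n" excess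
    by (rule rmps_isotropic_sketch[OF g bd])
  have MK: "S.MK j = iid_rmps N d n bd j" for j by (simp add: S.MK_def iid_rmps_def)
  have E: "A - B \<in> carrier_mat (d ^ n) (d ^ n)" using A B by auto
  have "\<forall>x<d ^ n. \<forall>y<d ^ n. (A - (A - B)) $$ (x, y) = (\<Sum>i<r. Y i x * z i y)"
    using A B low_rank by auto
  from S.nystrom_pp_bound[OF A psd E this r k l _ excess_bounds(2)[OF g bd]] g
  show ?thesis unfolding MK by (simp add: case_prod_beta')
qed

theorem theorem3p3:
  shows "\<exists>C0 C1 :: real. C0 > 0 \<and> C1 > 0 \<and>
    (\<forall>(d::nat) (n::nat) (bd::nat) (A::real mat) (B::real mat) (r::nat) (\<gamma>::real) (k::nat) (l::nat).
       d \<ge> 1 \<longrightarrow> n \<ge> 2 \<longrightarrow>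
       A \<in> carrier_mat (d ^ n) (d ^ n) \<longrightarrow> psd A \<longrightarrow>
       r \<ge> 1 \<longrightarrow> best_rank_approx r A B \<longrightarrow>
       \<gamma> > 2 \<longrightarrow> real bd = \<gamma> * real n \<longrightarrow>
       real k \<ge> C0 * real r \<longrightarrow> real l \<ge> C0 * real r \<longrightarrow>
       \<P>((\<omega>, \<psi>) in iid_rmps real_normal d n bd k \<Otimes>\<^sub>M iid_rmps real_normal d n bd l.
          \<bar>nystrom_pp A k l \<omega> \<psi> - mat_trace A\<bar>\<^sup>2
            \<le> C1 * (1 / real r * (frobenius_norm (A - B))\<^sup>2
                + (1 / (real r)\<^sup>2 + 1 / (\<gamma> * real r)) * (nuclear_norm (A - B))\<^sup>2))
        \<ge> 0.98) \<and>
    (\<forall>(d::nat) (n::nat) (bd::nat) (A::complex mat) (B::complex mat) (r::nat) (\<gamma>::real) (k::nat) (l::nat).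
       d \<ge> 1 \<longrightarrow> n \<ge> 2 \<longrightarrow>
       A \<in> carrier_mat (d ^ n) (d ^ n) \<longrightarrow> psd A \<longrightarrow>
       r \<ge> 1 \<longrightarrow> best_rank_approx r A B \<longrightarrow>
       \<gamma> > 2 \<longrightarrow> real bd = \<gamma> * real n \<longrightarrow>
       real k \<ge> C0 * real r \<longrightarrow> real l \<ge> C0 * real r \<longrightarrow>
       \<P>((\<omega>, \<psi>) in iid_rmps complex_normal d n bd k \<Otimes>\<^sub>M iid_rmps complex_normal d n bd l.
          (cmod (nystrom_pp A k l \<omega> \<psi> - mat_trace A))\<^sup>2
            \<le> C1 * (1 / real r * (frobenius_norm (A - B))\<^sup>2
                + (1 / (real r)\<^sup>2 + 1 / (\<gamma> * real r)) * (nuclear_norm (A - B))\<^sup>2))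
        \<ge> 0.98)"
proof (rule exI[of _ "10 ^ 7"], rule exI[of _ "10 ^ 14"], intro conjI allI impI)
  fix d n bd r k l :: nat and A B :: "real mat" and \<gamma> :: real
  assume dn: "d \<ge> 1" "n \<ge> 2" and A: "A \<in> carrier_mat (d ^ n) (d ^ n)" and psd: "psd A" and r: "r \<ge> 1"
    and best: "best_rank_approx r A B" and g: "\<gamma> > 2" and bd: "real bd = \<gamma> * real n"
    and kl: "real k \<ge> 10 ^ 7 * real r" "real l \<ge> 10 ^ 7 * real r"
  have "real bd > 0" using g dn by (simp add: bd)
  then interpret gaussian_cores real_normal complex_of_real 1 d n bd
    using dn by (intro gaussian_cores_real) auto
  have Ah: "mat_adjoint A = A" using psd by (simp add: psd_def)
  have B: "B \<in> carrier_mat (d ^ n) (d ^ n)" and rank: "vec_space.rank (d ^ n) B \<le> r"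
    using best A by (auto simp: best_rank_approx_def)
  obtain Y z where YZ: "\<forall>x<d ^ n. \<forall>y<d ^ n. B $$ (x, y) = (\<Sum>i<r. Y i x * z i y)"
    using vec_space.rank_factorization[OF B rank] by blast
  have Yc: "\<forall>x<d ^ n. \<forall>y<d ^ n. cmat B $$ (x, y) = (\<Sum>i<r. complex_of_real (Y i x) * complex_of_real (z i y))"
    using B YZ by auto
  have E: "cmat A - cmat B = cmat (A - B)" using A B by (simp add: cmat_minus)
  have nuc: "nuclear_norm (cmat (A - B)) = nuclear_norm (A - B)"
    by (rule cmat_nuclear_norm[of _ "d ^ n"]) (use A B in auto)
  have tr: "mat_trace (cmat A) = complex_of_real (mat_trace A)" using A by (intro cmat_trace) auto
  have "(cmod (nystrom_pp (cmat A) k l (\<lambda>j x. complex_of_real (\<omega> j x)) (\<lambda>j x. complex_of_real (\<psi> j x)) - mat_trace (cmat A)))\<^sup>2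
      = \<bar>nystrom_pp A k l \<omega> \<psi> - mat_trace A\<bar>\<^sup>2" for \<omega> \<psi>
    unfolding tr cmat_nystrom_pp[OF A Ah, symmetric] of_real_diff[symmetric] norm_of_real ..
  note transfer = this E nuc cmat_frobenius_norm
  show "\<P>((\<omega>, \<psi>) in iid_rmps real_normal d n bd k \<Otimes>\<^sub>M iid_rmps real_normal d n bd l.
          \<bar>nystrom_pp A k l \<omega> \<psi> - mat_trace A\<bar>\<^sup>2
            \<le> 10 ^ 14 * (1 / real r * (frobenius_norm (A - B))\<^sup>2
                + (1 / (real r)\<^sup>2 + 1 / (\<gamma> * real r)) * (nuclear_norm (A - B))\<^sup>2)) \<ge> 0.98"
    using rmps_nystrom_pp_bound[OF g bd _ cmat_psd[OF A psd] _ Yc r kl] A B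
    unfolding transfer by simp
next
  fix d n bd r k l :: nat and A B :: "complex mat" and \<gamma> :: real
  assume dn: "d \<ge> 1" "n \<ge> 2" and A: "A \<in> carrier_mat (d ^ n) (d ^ n)" and psd: "psd A" and r: "r \<ge> 1"
    and best: "best_rank_approx r A B" and g: "\<gamma> > 2" and bd: "real bd = \<gamma> * real n"
    and kl: "real k \<ge> 10 ^ 7 * real r" "real l \<ge> 10 ^ 7 * real r"
  have "real bd > 0" using g dn by (simp add: bd)
  then interpret gaussian_cores complex_normal "\<lambda>z. z" 0 d n bd
    using dn by (intro gaussian_cores_complex) auto
  have B: "B \<in> carrier_mat (d ^ n) (d ^ n)" and rank: "vec_space.rank (d ^ n) B \<le> r"
    using best A by (auto simp: best_rank_approx_def)
  obtain Y z where YZ: "\<forall>x<d ^ n. \<forall>y<d ^ n. B $$ (x, y) = (\<Sum>i<r. Y i x * z i y)"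
    using vec_space.rank_factorization[OF B rank] by blast
  show "\<P>((\<omega>, \<psi>) in iid_rmps complex_normal d n bd k \<Otimes>\<^sub>M iid_rmps complex_normal d n bd l.
          (cmod (nystrom_pp A k l \<omega> \<psi> - mat_trace A))\<^sup>2
            \<le> 10 ^ 14 * (1 / real r * (frobenius_norm (A - B))\<^sup>2
                + (1 / (real r)\<^sup>2 + 1 / (\<gamma> * real r)) * (nuclear_norm (A - B))\<^sup>2)) \<ge> 0.98"
    by (rule rmps_nystrom_pp_bound[OF g bd A psd B YZ r kl])
qed simp_all

end
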